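(* In the setting described in the context (linear drift, $\sigma_\infty\ne0$), let $\theta\in(0,\frac\pi2)$ and $$T_\theta^N=\inf\left\{t\ge0:\left|\frac{X^N_{t-,2}}{X^N_{t-,1}}\right|\le|\tan\theta|\ \text{ and }\ \left|\frac{X^N_{t,2}}{X^N_{t,1}}\right|\ge|\tan\theta|\right\},$$ $$t_N=\frac1{2(\lambda+\mu)}\log N,\qquad c_\theta=\frac1{\lambda+\mu}\log\left|\frac{x_{0,1}\tan\theta}{Z_\infty}\right| .$$ Then, as $N\to\infty$, $$T_\theta^N-t_N\Rightarrow c_\theta$$ and $$N^{\mu/(2(\lambda+\mu))}\,|X^N_{T_\theta^N}|\Rightarrow|\sec\theta|\,|\tan\theta|^{-\mu/(\lambda+\mu)}\,|x_0|^{\lambda/(\lambda+\mu)}\,|Z_\infty|^{\mu/(\lambda+\mu)},$$ where $\Rightarrow$ denotes convergence in distribution.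
   Context: For each $N\in\mathbb N$, $(X_t^N)_{t\ge0}$ is a pure jump Markov process with $X_0^N=x_0$, taking values in $I^N\subset\mathbb R^2$, with Lévy kernel $K^N(x,dy)$ (jumps from $x$ to $x+y$ occur at rate $K^N(x,dy)$). $S\subset\mathbb R^2$ is open, $x_0\in S$, $S^N=I^N\cap S$, and $m^N(x,\theta)=\int_{\mathbb R^2}e^{\langle\theta,y\rangle}K^N(x,dy)$ for $x\in S^N$, $\theta\in(\mathbb R^2)^*$. There is a limit kernel $K(x,dy)$, $x\in S$, with Laplace transform $m(x,\theta)=\int e^{\langle\theta,y\rangle}K(x,dy)$, such that, with $'$ denoting differentiation in $\theta$: (a) for some $\eta_0>0$, $m(x,\theta)$ is uniformly bounded for $x\in S$, $|\theta|\le\eta_0$; (b) $\sup_{x\in S^N}\sup_{|\theta|\le\eta_0}|m^N(x,N\theta)/N-m(x,\theta)|\to0$; (c) with $b(x)=m'(x,0)$ and $b^N(x)=(m^N)'(x,0)$, $\sup_{x\in S^N}N^{1/2}|b^N(x)-b(x)|\to0$; (d) $a(x)=m''(x,0)$ is Lipschitz on $S$. (The $\theta$ in the Laplace transforms is unrelated to the angle $\theta$.) Linear case: $b(x)=Bx$ on $S$, $B=\begin{pmatrix}-\mu&0\\0&\lambda\end{pmatrix}$, $\lambda,\mu>0$; $x_0=(x_{0,1},0)$ with $x_{0,1}\ne0$; $x_t=e^{Bt}x_0=e^{-\mu t}x_0$. $S$ contains an $\epsilon$-neighbourhood (some $\epsilon>0$) of the path $\{x_t:t\ge0\}$; the process is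 stopped at the first time it leaves $S$. $\sigma_\infty^2=\int_0^\infty e^{-2\lambda s}a(x_s)_{2,2}\,ds$ and $Z_\infty\sim N(0,\sigma_\infty^2)$. $T_\theta^N$ is the first time that $X^N$ intersects one of the straight lines through $0$ at angles $\pm\theta$; second subscripts $1,2$ denote coordinates, $X^N_{t-}$ is the left limit ($X^N_{0-}=X^N_0$), a ratio with zero denominator is read as $\infty$ in absolute value, and $\inf\emptyset=\infty$. *)

theory Defs
  imports "HOL-Probability.Probability"
begin

section \<open>Kernels, Laplace transforms and their derivatives\<close>

definition finite_kernel :: "(real^2) set \<Rightarrow> (real^2 \<Rightarrow> (real^2) measure) \<Rightarrow> bool" where
  "finite_kernel I K \<longleftrightarrow>
     (\<forall>x\<in>I. sets (K x) = sets borel \<and> finite_measure (K x)) \<and>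
     (\<forall>A\<in>sets borel. (\<lambda>x. emeasure (K x) A) \<in> borel_measurable (restrict_space borel I))"

text \<open>Total mass is finite because the kernel holds the jump rates of a pure jump process; as for a
  Levy measure, the origin (a jump of size zero) carries no mass.\<close>

definition levy_kernel :: "(real^2) set \<Rightarrow> (real^2 \<Rightarrow> (real^2) measure) \<Rightarrow> bool" where
  "levy_kernel I K \<longleftrightarrow> finite_kernel I K \<and> (\<forall>x\<in>I. emeasure (K x) {0} = 0)"

text \<open>The Laplace transform is \<open>ennreal\<close>-valued, so that divergence is \<open>\<infinity>\<close> and not \<open>0\<close>. The dual
  space is identified with \<open>real^2\<close> through the inner product.\<close>

definition laplace :: "(real^2 \<Rightarrow> (real^2) measure) \<Rightarrow> real^2 \<Rightarrow> real^2 \<Rightarrow> ennreal" where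
  "laplace K x \<theta> = (\<integral>\<^sup>+ y. ennreal (exp (\<theta> \<bullet> y)) \<partial>K x)"

definition grad :: "(real^2 \<Rightarrow> real) \<Rightarrow> real^2 \<Rightarrow> real^2" where
  "grad f \<theta> = (THE D. GDERIV f \<theta> :> D)"

text \<open>First and second derivative of the Laplace transform in \<open>\<theta>\<close>, at \<open>\<theta> = 0\<close>.\<close>

definition drift :: "(real^2 \<Rightarrow> (real^2) measure) \<Rightarrow> real^2 \<Rightarrow> real^2" where
  "drift K x = grad (\<lambda>\<theta>. enn2real (laplace K x \<theta>)) 0"

definition covar :: "(real^2 \<Rightarrow> (real^2) measure) \<Rightarrow> real^2 \<Rightarrow> real^2^2" where
  "covar K x = jacobian (grad (\<lambda>\<theta>. enn2real (laplace K x \<theta>))) (at 0)"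

section \<open>Pure jump Markov processes\<close>

text \<open>\<open>X\<close> is the step process with jump times \<open>J 1 < J 2 < \<dots>\<close> (equal to \<open>\<infinity>\<close> once there are no
  further jumps) and with value \<open>Y n\<close> on \<open>[J n, J (n+1))\<close>. Conditionally on the history
  \<open>J 0, Y 0, \<dots>, J n, Y n\<close> and on \<open>J n < \<infinity>\<close>, with \<open>q = K(Y n, \<real>\<^sup>2)\<close> the total rate: the holding
  time \<open>J (n+1) - J n\<close> is exponential of rate \<open>q\<close>, and the jump \<open>Y (n+1) - Y n\<close> is independent
  of it with law \<open>K(Y n, \<cdot>) / q\<close>. If \<open>q = 0\<close> then the right-hand side below is \<open>0\<close> (since
  \<open>x / 0 = 0\<close>), which says that \<open>J (n+1) = \<infinity>\<close>: the state is absorbing. The process is defined for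
  all times, hence does not explode.\<close>

definition history ::
  "'w measure \<Rightarrow> (nat \<Rightarrow> 'w \<Rightarrow> ereal) \<Rightarrow> (nat \<Rightarrow> 'w \<Rightarrow> real^2) \<Rightarrow> nat \<Rightarrow> 'w measure" where
  "history M J Y n =
     vimage_algebra (space M) (\<lambda>\<omega>. \<lambda>i\<in>{..n}. (J i \<omega>, Y i \<omega>)) (\<Pi>\<^sub>M i\<in>{..n}. borel \<Otimes>\<^sub>M borel)"

definition pure_jump_markov ::
  "'w measure \<Rightarrow> (real \<Rightarrow> 'w \<Rightarrow> real^2) \<Rightarrow> (real^2) set \<Rightarrow> (real^2 \<Rightarrow> (real^2) measure) \<Rightarrow> real^2 \<Rightarrow> bool"
where
  "pure_jump_markov M X I K x0 \<longleftrightarrow>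
     prob_space M \<and> levy_kernel I K \<and>
     (\<exists>J Y.
        (\<forall>n. J n \<in> borel_measurable M \<and> Y n \<in> borel_measurable M) \<and>
        (\<forall>\<omega>\<in>space M.
           J 0 \<omega> = 0 \<and> Y 0 \<omega> = x0 \<and>
           (\<forall>n. Y n \<omega> \<in> I) \<and>
           (\<forall>n. J n \<omega> \<le> J (Suc n) \<omega>) \<and>
           (\<forall>n. J n \<omega> < \<infinity> \<longrightarrow> J n \<omega> < J (Suc n) \<omega>) \<and>
           (\<lambda>n. J n \<omega>) \<longlonglongrightarrow> \<infinity> \<and>
           (\<forall>n. \<forall>t\<ge>0. J n \<omega> \<le> ereal t \<and> ereal t < J (Suc n) \<omega> \<longrightarrow> X t \<omega> = Y n \<omega>)) \<and>
        (\<forall>n. \<forall>E\<in>sets (history M J Y n). \<forall>A\<in>sets borel. \<forall>t\<ge>0.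
           measure M {\<omega>\<in>E. J n \<omega> + ereal t < J (Suc n) \<omega> \<and> J (Suc n) \<omega> < \<infinity> \<and>
                            Y (Suc n) \<omega> - Y n \<omega> \<in> A} =
           (LINT \<omega>:{\<omega>\<in>E. J n \<omega> < \<infinity>}|M.
              exp (- measure (K (Y n \<omega>)) UNIV * t) *
                (measure (K (Y n \<omega>)) A / measure (K (Y n \<omega>)) UNIV))))"

section \<open>Path functionals\<close>

definition exit_time :: "(real^2) set \<Rightarrow> (real \<Rightarrow> real^2) \<Rightarrow> ereal" where
  "exit_time S x = (INF t\<in>{t. 0 \<le> t \<and> x t \<notin> S}. ereal t)"

definition stopped :: "(real^2) set \<Rightarrow> (real \<Rightarrow> real^2) \<Rightarrow> real \<Rightarrow> real^2" where
  "stopped S x t = x (real_of_ereal (min (ereal t) (exit_time S x)))"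

definition left_limit :: "(real \<Rightarrow> real^2) \<Rightarrow> real \<Rightarrow> real^2" where
  "left_limit x t = (if t = 0 then x 0 else Lim (at_left t) x)"

definition abs_slope :: "real^2 \<Rightarrow> ereal" where
  "abs_slope v = (if v $ 1 = 0 then \<infinity> else ereal \<bar>v $ 2 / v $ 1\<bar>)"

definition hit_time :: "real \<Rightarrow> (real \<Rightarrow> real^2) \<Rightarrow> ereal" where
  "hit_time \<theta> x =
     (INF t\<in>{t. 0 \<le> t \<and> abs_slope (left_limit x t) \<le> ereal \<bar>tan \<theta>\<bar> \<and>
                 abs_slope (x t) \<ge> ereal \<bar>tan \<theta>\<bar>}. ereal t)"

text \<open>The value at an infinite time is set to \<open>0\<close> by convention.\<close>

definition value_at :: "(real \<Rightarrow> real^2) \<Rightarrow> ereal \<Rightarrow> real^2" where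
  "value_at x T = (if T = \<infinity> then 0 else x (real_of_ereal T))"

section \<open>Convergence in distribution\<close>

text \<open>The random variables may live on different probability spaces. General target spaces are
  needed because hitting times are \<open>ereal\<close>-valued.\<close>

definition converges_in_distribution ::
  "(nat \<Rightarrow> 'w measure) \<Rightarrow> (nat \<Rightarrow> 'w \<Rightarrow> 'b::topological_space) \<Rightarrow> 'v measure \<Rightarrow> ('v \<Rightarrow> 'b) \<Rightarrow> bool"
where
  "converges_in_distribution M V P W \<longleftrightarrow>
     (\<forall>n. V n \<in> borel_measurable (M n)) \<and> W \<in> borel_measurable P \<and>
     (\<forall>f :: 'b \<Rightarrow> real. continuous_on UNIV f \<and> bounded (range f) \<longrightarrow>
        (\<lambda>n. \<integral>\<omega>. f (V n \<omega>) \<partial>M n) \<longlonglongrightarrow> (\<integral>\<omega>. f (W \<omega>) \<partial>P))"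

text \<open>For real random variables this is weak convergence of the laws in the library's sense.\<close>

lemma converges_in_distribution_real_iff:
  fixes V :: "nat \<Rightarrow> 'w \<Rightarrow> real" and W :: "'v \<Rightarrow> real"
  assumes "\<And>n. prob_space (M n)" "prob_space P"
    and V: "\<And>n. V n \<in> borel_measurable (M n)" and W: "W \<in> borel_measurable P"
  shows "converges_in_distribution M V P W \<longleftrightarrow>
           weak_conv_m (\<lambda>n. distr (M n) borel (V n)) (distr P borel W)"
proof -
  have rd: "real_distribution (distr (M n) borel (V n))" for n
    using assms(1) V
    by (simp add: real_distribution_def real_distribution_axioms_def prob_space.prob_space_distr)
  have rd': "real_distribution (distr P borel W)"
    using assms(2) W
    by (simp add: real_distribution_def real_distribution_axioms_def prob_space.prob_space_distr)
  have eq: "(LINT x|distr (M n) borel (V n). f x) = (\<integral>\<omega>. f (V n \<omega>) \<partial>M n)"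
    and eq': "(LINT x|distr P borel W. f x) = (\<integral>\<omega>. f (W \<omega>) \<partial>P)"
    if "continuous_on UNIV f" for n and f :: "real \<Rightarrow> real"
    using V W borel_measurable_continuous_onI[OF that] by (simp_all add: integral_distr)
  show ?thesis
  proof
    assume c: "converges_in_distribution M V P W"
    show "weak_conv_m (\<lambda>n. distr (M n) borel (V n)) (distr P borel W)"
    proof (rule integral_bdd_continuous_conv_imp_weak_conv[OF rd rd'])
      fix f :: "real \<Rightarrow> real" and B
      assume f: "\<And>x. isCont f x" "\<And>x. \<bar>f x\<bar> \<le> B"
      have "continuous_on UNIV f" "bounded (range f)"
        using f by (auto simp: continuous_on_eq_continuous_at bounded_iff)
      then show "(\<lambda>n. LINT x|distr (M n) borel (V n). f x) \<longlonglongrightarrow> (LINT x|distr P borel W. f x)"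
        using c by (simp add: eq eq' converges_in_distribution_def)
    qed
  next
    assume w: "weak_conv_m (\<lambda>n. distr (M n) borel (V n)) (distr P borel W)"
    have "(\<lambda>n. \<integral>\<omega>. f (V n \<omega>) \<partial>M n) \<longlonglongrightarrow> (\<integral>\<omega>. f (W \<omega>) \<partial>P)"
      if f: "continuous_on UNIV f" "bounded (range f)" for f :: "real \<Rightarrow> real"
    proof -
      obtain B where "\<And>x. \<bar>f x\<bar> \<le> B"
        using f(2) by (auto simp: bounded_iff)
      then have "(\<lambda>n. LINT x|distr (M n) borel (V n). f x) \<longlonglongrightarrow> (LINT x|distr P borel W. f x)"
        using weak_conv_imp_integral_bdd_continuous_conv[OF rd rd' w, of f B] f(1)
        by (auto simp: continuous_on_eq_continuous_at)
      then show ?thesis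
        using f(1) by (simp add: eq eq')
    qed
    then show "converges_in_distribution M V P W"
      using V W by (auto simp: converges_in_distribution_def)
  qed
qed

end

theory Submission
  imports Defs
begin

text \<open>Put \<open>D = lam + \<mu>\<close>, so that \<open>sqrt N = exp (D * tN)\<close>. In the variables \<open>p = exp (\<mu> * t) * X\<^sub>1\<close> and
  \<open>u = sqrt N * exp (- lam * t) * X\<^sub>2\<close> the linear drift disappears: each is its initial value plus a
  compensated sum over the jumps, up to the small difference between the drift of the process and the
  linear drift. The sum for \<open>p\<close> has variance of order \<open>exp (2 * \<mu> * t) / N\<close>, which is still small
  at times \<open>tN + O(1)\<close>, so \<open>p\<close> stays near \<open>x0 $ 1\<close>. The sum for \<open>u\<close> has variance close to the integral of
  \<open>exp (- 2 * lam * s) * a (x s)\<close> with \<open>a\<close> the second moment of the jumps across the stable line. This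
  variance is collected at times of order one, and the sum converges in law to \<open>Z\<close>. Writing \<open>U\<close> for its
  value at time \<open>tN\<close>, the process is close to
  \<open>(exp (- \<mu> * t) * x0 $ 1, exp (lam * t) * U / sqrt N)\<close>. The slope of this curve equals \<open>tan \<theta>\<close> in
  absolute value when \<open>exp (D * (t - tN)) * \<bar>U\<bar> = \<bar>x0 $ 1\<bar> * tan \<theta>\<close>, that is at the time
  \<open>t = tN + ln (\<bar>x0 $ 1\<bar> * tan \<theta> / \<bar>U\<bar>) / D\<close>, and the norm of the curve at that time is the asserted
  radius (\<open>limit_radius\<close>).

  The probabilistic input is the compensation formula: the expected value of a function of the next
  jump is the expected integral of that function against the kernel over the holding interval
  (\<open>compensation_formula\<close>). It yields an Ito inequality for bounded functions of a compensated sum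
  (\<open>ito_total\<close>). The function \<open>u\<^sup>2 / (b\<^sup>2 + u\<^sup>2)\<close> turns it into a Chebyshev inequality
  (\<open>chebyshev_total\<close>); \<open>cos (\<kappa> * u)\<close> and \<open>sin (\<kappa> * u)\<close>, multiplied by \<open>exp (\<kappa>\<^sup>2 / 2 * V s)\<close> with \<open>V\<close> the
  limiting variance, turn it into an estimate of the characteristic function
  (\<open>clt_estimate_real\<close>, \<open>char_U_tendsto\<close>), from which Levy's continuity theorem gives the law of \<open>Z\<close>.

  For the crossing, estimates at finitely many deterministic times suffice. From above: if the slope is already
  steep at a grid time \<open>tN + g\<close>, then the lines have been crossed by then (\<open>hit_before\<close>). From below: the
  compensated sum that stops collecting jumps at the crossing has, at a deterministic later time, the
  value that it had at the crossing; so an estimate at a deterministic time describes the state at the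
  random hitting time (\<open>at_hit\<close>). Together they locate the hitting time and place as continuous functions of \<open>U\<close>,
  uniformly for \<open>1 / R \<le> \<bar>U\<bar> \<le> R\<close> and outside an event of small probability (\<open>hit_asymptotics\<close>), and
  convergence in law of \<open>U\<close> carries over because \<open>Z\<close> has no atom at \<open>0\<close> (\<open>converging_together\<close>).\<close>

section \<open>Moments and derivatives of the Laplace transform\<close>

lemma exp_taylor_bound:
  fixes x :: real
  shows "\<bar>exp x - (\<Sum>m<n. x ^ m / fact m)\<bar> \<le> \<bar>x\<bar> ^ n / fact n * exp \<bar>x\<bar>"
proof -
  obtain t where t: "\<bar>t\<bar> \<le> \<bar>x\<bar>" "exp x = (\<Sum>m<n. (x ^ m) / fact m) + (exp t / fact n) * x ^ n"
    using Maclaurin_exp_le by blast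
  have "\<bar>exp x - (\<Sum>m<n. x ^ m / fact m)\<bar> = exp t / fact n * \<bar>x\<bar> ^ n"
    using t(2) by (simp add: abs_mult power_abs)
  also have "\<dots> \<le> exp \<bar>x\<bar> / fact n * \<bar>x\<bar> ^ n"
    using t(1) by (intro mult_right_mono divide_right_mono) auto
  finally show ?thesis by (simp add: field_simps)
qed

lemma power_le_exp:
  fixes z :: real
  assumes "z \<ge> 0"
  shows "z ^ p \<le> fact p * exp z"
proof -
  have "z ^ p / fact p \<le> exp z"
  proof -
    have "(\<Sum>m<Suc p. z ^ m / fact m) \<le> exp z"
    proof -
      obtain t where "exp z = (\<Sum>m<Suc p. (z ^ m) / fact m) + (exp t / fact (Suc p)) * z ^ Suc p"
        using Maclaurin_exp_le by blast
      moreover have "(exp t / fact (Suc p)) * z ^ Suc p \<ge> 0"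
        using assms by (intro mult_nonneg_nonneg divide_nonneg_nonneg zero_le_power) auto
      ultimately show ?thesis by linarith
    qed
    moreover have "(\<Sum>m<p. z ^ m / fact m) \<ge> 0"
      using assms by (intro sum_nonneg) auto
    ultimately show ?thesis by simp
  qed
  then show ?thesis by (simp add: field_simps)
qed

text \<open>Half of an exponential weight pays for a polynomial factor; the other half stays available.\<close>

lemma power_exp_absorb:
  fixes z r :: real
  assumes "z \<ge> 0" "r > 0"
  shows "z ^ p * exp (r / 2 * z) \<le> fact p * (2 / r) ^ p * exp (r * z)"
proof -
  have "(r / 2 * z) ^ p \<le> fact p * exp (r / 2 * z)"
    using assms by (intro power_le_exp) auto
  then have "(2 / r) ^ p * ((r / 2 * z) ^ p) \<le> (2 / r) ^ p * (fact p * exp (r / 2 * z))"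
    using assms by (intro mult_left_mono) auto
  moreover have "(2 / r) ^ p * ((r / 2 * z) ^ p) = z ^ p"
    using assms by (simp add: power_mult_distrib[symmetric])
  ultimately have "z ^ p * exp (r / 2 * z) \<le> (2 / r) ^ p * (fact p * exp (r / 2 * z)) * exp (r / 2 * z)"
    by (intro mult_right_mono) auto
  also have "\<dots> = fact p * (2 / r) ^ p * exp (r * z)"
    by (simp add: mult_exp_exp)
  finally show ?thesis .
qed

text \<open>Gradient and Hessian of the Laplace transform both come from this criterion: the remainder of the
  integrand is quadratic in \<open>h\<close>, with a coefficient that is integrable.\<close>

lemma has_derivative_at_of_quadratic_remainder:
  fixes f :: "'a::real_normed_vector \<Rightarrow> 'b::real_normed_vector"
  assumes D: "bounded_linear D" and r: "r > 0"
    and rem: "\<And>h. norm h \<le> r \<Longrightarrow> norm (f (x + h) - f x - D h) \<le> C * (norm h)\<^sup>2"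
  shows "(f has_derivative D) (at x)"
proof -
  have "((\<lambda>h. norm (f (x + h) - f x - D h) / norm h) \<longlongrightarrow> 0) (at 0)"
  proof (rule Lim_null_comparison)
    show "((\<lambda>h::'a. C * norm h) \<longlongrightarrow> 0) (at 0)"
      by (auto intro!: tendsto_eq_intros)
    have "eventually (\<lambda>h::'a. norm h \<le> r) (at 0)"
      unfolding eventually_at using r by (intro exI[of _ r]) (auto simp: dist_norm)
    then show "\<forall>\<^sub>F h in at 0. norm (norm (f (x + h) - f x - D h) / norm h) \<le> C * norm h"
    proof eventually_elim
      case (elim h)
      then show ?case using rem[OF elim]
        by (cases "h = 0") (auto simp: field_simps power2_eq_square)
    qed
  qed
  then show ?thesis using D by (simp add: has_derivative_at)
qed

text \<open>An exponential moment bounds all polynomial moments, with constants explicit in \<open>r\<close> and \<open>Q\<close>. This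
  matters because both grow linearly with \<open>N\<close> for the kernels of the scaled process, which makes the
  moment of order \<open>p\<close> of size \<open>N\<close> to the power \<open>1 - p\<close>.\<close>

locale exp_moments =
  fixes k :: "(real^2) measure" and r Q :: real
  assumes sets_k [measurable_cong]: "sets k = sets borel" and fin: "finite_measure k"
    and r_pos: "r > 0" and Q_nonneg: "Q \<ge> 0"
    and exp_norm: "(\<integral>\<^sup>+ y. ennreal (exp (r * norm y)) \<partial>k) \<le> ennreal Q"
begin

lemma integrable_exp_norm: "integrable k (\<lambda>y. exp (r * norm y))"
  using exp_norm by (intro integrableI_bounded) (auto simp: top_unique less_top[symmetric])

lemma integral_exp_norm_le: "(\<integral>y. exp (r * norm y) \<partial>k) \<le> Q"
proof -
  have "ennreal (\<integral>y. exp (r * norm y) \<partial>k) = (\<integral>\<^sup>+ y. ennreal (exp (r * norm y)) \<partial>k)"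
    using integrable_exp_norm by (intro nn_integral_eq_integral[symmetric]) auto
  then have "ennreal (\<integral>y. exp (r * norm y) \<partial>k) \<le> ennreal Q" using exp_norm by simp
  then show ?thesis using Q_nonneg by simp
qed

text \<open>The exponential factor allowed in the bound on \<open>h\<close> is what differentiation under the integral produces.\<close>

lemma moment_bounds:
  fixes h :: "real^2 \<Rightarrow> 'b::{banach, second_countable_topology}"
  assumes h [measurable]: "h \<in> borel_measurable borel" and c: "c \<ge> 0"
    and le: "\<And>y. norm (h y) \<le> c * (norm y ^ p * exp (r / 2 * norm y))"
  shows "integrable k h" and "(\<integral>y. norm (h y) \<partial>k) \<le> c * (fact p * (2 / r) ^ p * Q)"
    and "norm (\<integral>y. h y \<partial>k) \<le> c * (fact p * (2 / r) ^ p * Q)"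
proof -
  have le': "norm (h y) \<le> c * (fact p * (2 / r) ^ p) * exp (r * norm y)" for y
    using le[of y] mult_left_mono[OF power_exp_absorb[of "norm y" r p] c] r_pos by (simp add: mult.assoc)
  show int: "integrable k h"
    by (rule Bochner_Integration.integrable_bound[OF integrable_mult_right[OF integrable_exp_norm,
          of "c * (fact p * (2 / r) ^ p)"]])
      (use le' r_pos c in \<open>auto simp: abs_mult\<close>)
  have "(\<integral>y. norm (h y) \<partial>k) \<le> (\<integral>y. c * (fact p * (2 / r) ^ p) * exp (r * norm y) \<partial>k)"
    using int integrable_exp_norm le' by (intro integral_mono) auto
  also have "\<dots> \<le> c * (fact p * (2 / r) ^ p) * Q"
    using integral_exp_norm_le c r_pos by (simp add: mult_left_mono)
  finally show *: "(\<integral>y. norm (h y) \<partial>k) \<le> c * (fact p * (2 / r) ^ p * Q)"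
    by (simp add: mult.assoc)
  then show "norm (\<integral>y. h y \<partial>k) \<le> c * (fact p * (2 / r) ^ p * Q)"
    using integral_norm_bound[of k h] by linarith
qed

lemma exp_inner_le:
  assumes "norm \<theta> \<le> s"
  shows "exp (\<theta> \<bullet> y) \<le> exp (s * norm (y::real^2))"
proof -
  have "\<theta> \<bullet> y \<le> norm \<theta> * norm y" by (rule norm_cauchy_schwarz)
  also have "\<dots> \<le> s * norm y" using assms by (intro mult_right_mono) auto
  finally show ?thesis by simp
qed

lemma laplace_eq_integral:
  assumes "norm \<theta> \<le> r / 2"
  shows "enn2real (laplace (\<lambda>_. k) x \<theta>) = (\<integral>y. exp (\<theta> \<bullet> y) \<partial>k)"
proof -
  have "integrable k (\<lambda>y. exp (\<theta> \<bullet> y))"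
    by (rule moment_bounds(1)[where c=1 and p=0]) (use exp_inner_le[OF assms] in simp_all)
  then show ?thesis unfolding laplace_def
    by (subst nn_integral_eq_integral) auto
qed

lemma quadratic_remainder_exp_inner:
  fixes y :: "real^2"
  assumes "norm \<theta> \<le> r / 4" "norm h \<le> r / 4"
  shows "\<bar>exp ((\<theta> + h) \<bullet> y) - exp (\<theta> \<bullet> y) - h \<bullet> (exp (\<theta> \<bullet> y) *\<^sub>R y)\<bar>
           \<le> (norm h)\<^sup>2 * (norm y ^ 2 * exp (r / 2 * norm y))"
proof -
  have "\<bar>exp (h \<bullet> y) - 1 - h \<bullet> y\<bar> \<le> \<bar>h \<bullet> y\<bar> ^ 2 / 2 * exp \<bar>h \<bullet> y\<bar>"
  proof -
    have "(\<Sum>m<2. (h \<bullet> y) ^ m / fact m) = 1 + h \<bullet> y" by (simp add: numeral_2_eq_2)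
    then show ?thesis using exp_taylor_bound[of "h \<bullet> y" 2] by (simp only: diff_diff_eq fact_2)
  qed
  also have "\<dots> \<le> \<bar>h \<bullet> y\<bar> ^ 2 * exp \<bar>h \<bullet> y\<bar>" by (intro mult_right_mono) auto
  also have "\<dots> \<le> (norm h * norm y) ^ 2 * exp (r / 4 * norm y)"
  proof (intro mult_mono power_mono)
    show "exp \<bar>h \<bullet> y\<bar> \<le> exp (r / 4 * norm y)"
      using Cauchy_Schwarz_ineq2[of h y] mult_right_mono[OF assms(2), of "norm y"] by simp
  qed (auto simp: Cauchy_Schwarz_ineq2)
  finally have 1: "\<bar>exp (h \<bullet> y) - 1 - h \<bullet> y\<bar> \<le> (norm h * norm y) ^ 2 * exp (r / 4 * norm y)" .
  have "exp ((\<theta> + h) \<bullet> y) - exp (\<theta> \<bullet> y) - h \<bullet> (exp (\<theta> \<bullet> y) *\<^sub>R y)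
      = exp (\<theta> \<bullet> y) * (exp (h \<bullet> y) - 1 - h \<bullet> y)"
    by (simp add: inner_left_distrib exp_add algebra_simps)
  then have "\<bar>exp ((\<theta> + h) \<bullet> y) - exp (\<theta> \<bullet> y) - h \<bullet> (exp (\<theta> \<bullet> y) *\<^sub>R y)\<bar>
      = exp (\<theta> \<bullet> y) * \<bar>exp (h \<bullet> y) - 1 - h \<bullet> y\<bar>"
    by (simp add: abs_mult)
  also have "\<dots> \<le> exp (r / 4 * norm y) * ((norm h * norm y) ^ 2 * exp (r / 4 * norm y))"
    using 1 exp_inner_le[OF assms(1), of y] by (intro mult_mono) auto
  also have "\<dots> = (norm h)\<^sup>2 * (norm y ^ 2 * (exp (r / 4 * norm y) * exp (r / 4 * norm y)))"
    by (simp add: power_mult_distrib algebra_simps)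
  also have "exp (r / 4 * norm y) * exp (r / 4 * norm y) = exp (r / 2 * norm y)"
    by (simp add: exp_add[symmetric])
  finally show ?thesis .
qed

lemma integrable_exp_inner_scaleR:
  assumes "norm \<theta> \<le> r / 2"
  shows "integrable k (\<lambda>y. exp (\<theta> \<bullet> y) *\<^sub>R y)"
  by (rule moment_bounds(1)[where c=1 and p=1])
    (use exp_inner_le[OF assms] in \<open>auto simp: mult.commute intro!: mult_left_mono\<close>)

lemma GDERIV_laplace:
  assumes "norm \<theta> \<le> r / 8"
  shows "GDERIV (\<lambda>\<theta>. enn2real (laplace (\<lambda>_. k) x \<theta>)) \<theta> :> (\<integral>y. exp (\<theta> \<bullet> y) *\<^sub>R y \<partial>k)"
  unfolding gderiv_def
proof (rule has_derivative_at_of_quadratic_remainder[where r="r/8" and C="1 * (fact 2 * (2 / r) ^ 2 * Q)"])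
  show "bounded_linear (\<lambda>h. h \<bullet> (\<integral>y. exp (\<theta> \<bullet> y) *\<^sub>R y \<partial>k))" by (rule bounded_linear_inner_left)
  show "r / 8 > 0" using r_pos by simp
  fix h :: "real^2" assume h: "norm h \<le> r / 8"
  have th: "norm (\<theta> + h) \<le> r / 2" "norm \<theta> \<le> r / 2" "norm \<theta> \<le> r / 4" "norm h \<le> r / 4"
    using norm_triangle_ineq[of \<theta> h] assms h r_pos by linarith+
  have i: "integrable k (\<lambda>y. exp (\<theta> \<bullet> y))" if "norm \<theta> \<le> r / 2" for \<theta>
    by (rule moment_bounds(1)[where c=1 and p=0]) (use exp_inner_le[OF that] in simp_all)
  have "(\<integral>y. exp ((\<theta> + h) \<bullet> y) \<partial>k) - (\<integral>y. exp (\<theta> \<bullet> y) \<partial>k) - h \<bullet> (\<integral>y. exp (\<theta> \<bullet> y) *\<^sub>R y \<partial>k)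
     = (\<integral>y. exp ((\<theta> + h) \<bullet> y) - exp (\<theta> \<bullet> y) - h \<bullet> (exp (\<theta> \<bullet> y) *\<^sub>R y) \<partial>k)"
    using i[OF th(1)] i[OF th(2)] integrable_exp_inner_scaleR[OF th(2)]
    by (simp only: Bochner_Integration.integral_diff Bochner_Integration.integrable_diff
        integral_inner_right integrable_inner_right)
  also have "norm \<dots> \<le> (norm h)\<^sup>2 * (fact 2 * (2 / r) ^ 2 * Q)"
    by (rule moment_bounds(3)) (use quadratic_remainder_exp_inner[OF th(3,4)] in auto)
  finally show "norm (enn2real (laplace (\<lambda>_. k) x (\<theta> + h)) - enn2real (laplace (\<lambda>_. k) x \<theta>)
      - h \<bullet> (\<integral>y. exp (\<theta> \<bullet> y) *\<^sub>R y \<partial>k)) \<le> 1 * (fact 2 * (2 / r) ^ 2 * Q) * (norm h)\<^sup>2"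
    by (simp add: laplace_eq_integral[OF th(1)] laplace_eq_integral[OF th(2)] mult.commute)
qed

lemma grad_laplace:
  assumes "norm \<theta> \<le> r / 8"
  shows "grad (\<lambda>\<theta>. enn2real (laplace (\<lambda>_. k) x \<theta>)) \<theta> = (\<integral>y. exp (\<theta> \<bullet> y) *\<^sub>R y \<partial>k)"
proof -
  have "D = D'" if "GDERIV f z :> D" "GDERIV f z :> D'" for f z and D D' :: "real^2"
  proof -
    have "(\<lambda>h. h \<bullet> D) = (\<lambda>h. h \<bullet> D')"
      using that unfolding gderiv_def by (rule has_derivative_unique)
    from fun_cong[OF this, of "D - D'"] have "(D - D') \<bullet> (D - D') = 0"
      by (simp add: inner_diff_right)
    then show ?thesis by simp
  qed
  then show ?thesis unfolding grad_def using GDERIV_laplace[OF assms] by (intro the_equality) blast+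
qed

lemma drift_eq: "drift (\<lambda>_. k) x = (\<integral>y. y \<partial>k)"
  unfolding drift_def using grad_laplace[of 0] r_pos by simp

text \<open>The gradient has derivative \<open>\<lambda>h. \<integral>y. (h \<bullet> y) *\<^sub>R y \<partial>k\<close> at the origin, since its remainder is again quadratic,
  now controlled by the third moment.\<close>

lemma covar_22_eq: "covar (\<lambda>_. k) x $ 2 $ 2 = (\<integral>y. (y $ 2)\<^sup>2 \<partial>k)"
proof -
  let ?g = "grad (\<lambda>\<theta>. enn2real (laplace (\<lambda>_. k) x \<theta>))"
  let ?D = "\<lambda>h. \<integral>y. (h \<bullet> y) *\<^sub>R y \<partial>k"
  have iD: "integrable k (\<lambda>y. (h \<bullet> y) *\<^sub>R y)" for h
  proof (rule moment_bounds(1)[where c="norm h" and p=2])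
    fix y :: "real^2"
    have "norm ((h \<bullet> y) *\<^sub>R y) \<le> norm h * norm y * norm y"
      using Cauchy_Schwarz_ineq2[of h y] by (simp add: mult_right_mono)
    also have "\<dots> \<le> norm h * norm y * norm y * exp (r / 2 * norm y)"
      using r_pos mult_left_mono[of 1 "exp (r / 2 * norm y)" "norm h * norm y * norm y"] by simp
    finally show "norm ((h \<bullet> y) *\<^sub>R y) \<le> norm h * (norm y ^ 2 * exp (r / 2 * norm y))"
      by (simp add: power2_eq_square mult.assoc)
  qed auto
  have lin: "linear ?D"
  proof (rule linearI)
    show "?D (a + b) = ?D a + ?D b" for a b
      using iD[of a] iD[of b] by (simp add: inner_left_distrib scaleR_add_left)
    show "?D (c *\<^sub>R a) = c *\<^sub>R ?D a" for c a
      unfolding inner_scaleR_left scaleR_scaleR[symmetric] by (rule integral_scaleR_right)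
  qed
  have "(?g has_derivative ?D) (at 0)"
  proof (rule has_derivative_at_of_quadratic_remainder[where r="r/8" and C="fact 3 * (2 / r) ^ 3 * Q"])
    show "bounded_linear ?D" using lin by (rule linear_conv_bounded_linear[THEN iffD1])
    show "r / 8 > 0" using r_pos by simp
    fix h :: "real^2" assume h: "norm h \<le> r / 8"
    then have h2: "norm h \<le> r / 2" "norm h \<le> r / 4" "norm (0::real^2) \<le> r / 4" "norm (0::real^2) \<le> r / 8"
      "norm (0::real^2) \<le> r / 2"
      using r_pos by auto
    have "?g (0 + h) - ?g 0 - ?D h = (\<integral>y. exp (h \<bullet> y) *\<^sub>R y - y - (h \<bullet> y) *\<^sub>R y \<partial>k)"
      using integrable_exp_inner_scaleR[OF h2(1)] integrable_exp_inner_scaleR[OF h2(5)] iD[of h] h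
      by (simp add: grad_laplace[OF h2(4)] grad_laplace[OF h])
    also have "norm \<dots> \<le> (norm h)\<^sup>2 * (fact 3 * (2 / r) ^ 3 * Q)"
    proof (rule moment_bounds(3))
      fix y :: "real^2"
      have "exp (h \<bullet> y) *\<^sub>R y - y - (h \<bullet> y) *\<^sub>R y = (exp (h \<bullet> y) - 1 - h \<bullet> y) *\<^sub>R y"
        by (simp add: algebra_simps)
      then have "norm (exp (h \<bullet> y) *\<^sub>R y - y - (h \<bullet> y) *\<^sub>R y) = \<bar>exp (h \<bullet> y) - 1 - h \<bullet> y\<bar> * norm y"
        by simp
      also have "\<dots> \<le> (norm h)\<^sup>2 * (norm y ^ 2 * exp (r / 2 * norm y)) * norm y"
        using quadratic_remainder_exp_inner[OF h2(3,2), of y] by (intro mult_right_mono) auto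
      finally show "norm (exp (h \<bullet> y) *\<^sub>R y - y - (h \<bullet> y) *\<^sub>R y)
          \<le> (norm h)\<^sup>2 * (norm y ^ 3 * exp (r / 2 * norm y))"
        by (simp add: power2_eq_square power3_eq_cube algebra_simps)
    qed auto
    finally show "norm (?g (0 + h) - ?g 0 - ?D h) \<le> fact 3 * (2 / r) ^ 3 * Q * (norm h)\<^sup>2"
      by (simp add: mult.commute)
  qed
  then have "frechet_derivative ?g (at 0) = ?D" by (rule frechet_derivative_at[symmetric])
  then have "covar (\<lambda>_. k) x $ 2 $ 2 = ?D (axis 2 1) $ 2"
    unfolding covar_def jacobian_def by (simp add: matrix_def)
  also have "\<dots> = ?D (axis 2 1) \<bullet> axis 2 1" by (simp add: inner_axis)
  also have "\<dots> = (\<integral>y. ((axis 2 1 \<bullet> y) *\<^sub>R y) \<bullet> axis 2 1 \<partial>k)"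
    using iD by (simp only: integral_inner_left)
  also have "\<dots> = (\<integral>y. (y $ 2)\<^sup>2 \<partial>k)"
    by (simp add: inner_axis inner_commute[of "axis 2 1"] power2_eq_square)
  finally show ?thesis .
qed

text \<open>The second moment is read off from three values of the Laplace transform. Hence uniform convergence of
  the transforms implies convergence of the second moments.\<close>

lemma second_difference_laplace:
  assumes "\<bar>s\<bar> \<le> r / 2"
  shows "\<bar>(\<integral>y. exp (s * y $ 2) \<partial>k) + (\<integral>y. exp (- s * y $ 2) \<partial>k) - 2 * (\<integral>y. 1 \<partial>k)
            - s\<^sup>2 * (\<integral>y. (y $ 2)\<^sup>2 \<partial>k)\<bar> \<le> 2 * s ^ 4 * ((2 / r) ^ 4 * Q)"
proof -
  have yb: "\<bar>y $ 2\<bar> \<le> norm y" for y :: "real^2" using component_le_norm_cart by auto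
  have sy: "\<bar>s * y $ 2\<bar> \<le> r / 2 * norm y" for y :: "real^2"
    unfolding abs_mult using assms yb[of y] r_pos by (intro mult_mono) auto
  have sy': "s * y $ 2 \<le> r / 2 * norm y" "- s * y $ 2 \<le> r / 2 * norm y" for y :: "real^2"
    using sy[of y] by (auto simp only: abs_le_iff mult_minus_left)
  have i1: "integrable k (\<lambda>y. exp (s * y $ 2))"
    by (rule moment_bounds(1)[where c=1 and p=0]) (use sy'(1) in simp_all)
  have i1': "integrable k (\<lambda>y. exp (- s * y $ 2))"
    by (rule moment_bounds(1)[where c=1 and p=0]) (use sy'(2) in simp_all)
  have i2: "integrable k (\<lambda>y. (y $ 2)\<^sup>2)"
  proof (rule moment_bounds(1)[where c=1 and p=2])
    fix y :: "real^2"
    have "(y $ 2)\<^sup>2 \<le> (norm y)\<^sup>2 * 1" using yb[of y] abs_le_square_iff by fastforce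
    also have "\<dots> \<le> (norm y)\<^sup>2 * exp (r / 2 * norm y)" using r_pos by (intro mult_left_mono) auto
    finally show "norm ((y $ 2)\<^sup>2) \<le> 1 * ((norm y)\<^sup>2 * exp (r / 2 * norm y))" by simp
  qed auto
  have i3: "integrable k (\<lambda>y. 1::real)" using fin by (simp add: finite_measure.integrable_const)
  have "(\<integral>y. exp (s * y $ 2) \<partial>k) + (\<integral>y. exp (- s * y $ 2) \<partial>k) - 2 * (\<integral>y. 1 \<partial>k)
            - s\<^sup>2 * (\<integral>y. (y $ 2)\<^sup>2 \<partial>k)
      = (\<integral>y. exp (s * y $ 2) + exp (- s * y $ 2) - 2 * 1 - s\<^sup>2 * (y $ 2)\<^sup>2 \<partial>k)"
    using i1 i1' i2 i3
    by (simp only: Bochner_Integration.integral_diff Bochner_Integration.integral_add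
        Bochner_Integration.integrable_diff Bochner_Integration.integrable_add
        integral_mult_right_zero integrable_mult_right)
  also have "norm \<dots> \<le> s ^ 4 / 12 * (fact 4 * (2 / r) ^ 4 * Q)"
  proof (rule moment_bounds(3))
    fix y :: "real^2"
    let ?z = "s * y $ 2"
    have b: "\<bar>exp z - (1 + z + z\<^sup>2 / 2 + z ^ 3 / 6)\<bar> \<le> z ^ 4 / 24 * exp \<bar>z\<bar>" for z :: real
    proof -
      have "(\<Sum>m<4. z ^ m / fact m) = 1 + z + z\<^sup>2 / 2 + z ^ 3 / 6"
        by (simp add: numeral_eq_Suc lessThan_Suc)
      moreover have "\<bar>z\<bar> ^ 4 = z ^ 4" by (simp add: power_even_abs)
      moreover have "fact 4 = (24::real)" by (simp add: fact_numeral)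
      ultimately show ?thesis using exp_taylor_bound[of z 4] by simp
    qed
    have "\<bar>exp z + exp (- z) - 2 - z\<^sup>2\<bar> \<le> z ^ 4 / 12 * exp \<bar>z\<bar>" for z :: real
    proof -
      have "\<bar>exp (- z) - (1 - z + z\<^sup>2 / 2 - z ^ 3 / 6)\<bar> \<le> z ^ 4 / 24 * exp \<bar>z\<bar>"
        using b[of "- z"] by simp
      with b[of z] show ?thesis unfolding abs_le_iff by linarith
    qed
    then have "\<bar>exp ?z + exp (- ?z) - 2 - ?z\<^sup>2\<bar> \<le> ?z ^ 4 / 12 * exp \<bar>?z\<bar>" .
    also have "\<dots> \<le> (s ^ 4 * norm y ^ 4) / 12 * exp (r / 2 * norm y)"
    proof (intro mult_mono divide_right_mono)
      have "(y $ 2) ^ 4 \<le> norm y ^ 4" using power_mono[OF yb[of y], of 4] by simp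
      then show "?z ^ 4 \<le> s ^ 4 * norm y ^ 4" by (simp add: power_mult_distrib mult_left_mono)
    qed (use sy[of y] in auto)
    finally show "norm (exp (s * y $ 2) + exp (- s * y $ 2) - 2 * 1 - s\<^sup>2 * (y $ 2)\<^sup>2)
      \<le> s ^ 4 / 12 * (norm y ^ 4 * exp (r / 2 * norm y))"
      by (simp add: power_mult_distrib)
  qed auto
  finally show ?thesis by (simp add: fact_numeral ac_simps)
qed

lemma abs_moment_bound:
  shows "integrable k (\<lambda>y. \<bar>y $ i\<bar> ^ p)" and "(\<integral>y. \<bar>y $ i\<bar> ^ p \<partial>k) \<le> fact p * (2 / r) ^ p * Q"
proof -
  have b: "norm (\<bar>y $ i\<bar> ^ p) \<le> 1 * (norm y ^ p * exp (r / 2 * norm y))" for y :: "real^2"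
  proof -
    have "\<bar>y $ i\<bar> ^ p * 1 \<le> norm y ^ p * exp (r / 2 * norm y)"
      using component_le_norm_cart[of y i] r_pos by (intro mult_mono power_mono) auto
    then show ?thesis by simp
  qed
  show "integrable k (\<lambda>y. \<bar>y $ i\<bar> ^ p)"
    by (rule moment_bounds(1)[OF _ _ b]) auto
  have "norm (\<integral>y. \<bar>y $ i\<bar> ^ p \<partial>k) \<le> 1 * (fact p * (2 / r) ^ p * Q)"
    by (rule moment_bounds(3)[OF _ _ b]) auto
  then show "(\<integral>y. \<bar>y $ i\<bar> ^ p \<partial>k) \<le> fact p * (2 / r) ^ p * Q" by simp
qed

lemma integrable_id: "integrable k (\<lambda>y. y)"
  using integrable_exp_inner_scaleR[of 0] r_pos by simp

lemma integral_component: "(\<integral>y. y \<partial>k) $ i = (\<integral>y. y $ i \<partial>k)"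
proof -
  have "(\<integral>y. y \<partial>k) $ i = (\<integral>y. y \<partial>k) \<bullet> axis i 1" by (simp add: inner_axis)
  also have "\<dots> = (\<integral>y. y \<bullet> axis i 1 \<partial>k)"
    by (rule integral_inner_left[symmetric]) (rule integrable_id)
  finally show ?thesis by (simp add: inner_axis)
qed

lemma integrable_component: "integrable k (\<lambda>y. y $ i)"
proof -
  have "integrable k (\<lambda>y. y \<bullet> axis i (1::real))" by (rule integrable_inner_left) (rule integrable_id)
  then show ?thesis by (simp add: inner_axis)
qed

lemma mass_le: "measure k UNIV \<le> Q"
  using abs_moment_bound(2)[of 1 0] sets_eq_imp_space_eq[OF sets_k] by simp

end

text \<open>As \<open>norm y\<close> is at most twice the largest coordinate, \<open>exp (\<eta> / 2 * norm y)\<close> is at most the sum of the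
  four exponentials in the directions of the coordinate axes.\<close>

lemma exp_moments_of_laplace:
  assumes "sets (K x) = sets borel" "finite_measure (K x)" "\<eta> > 0" "C \<ge> 0"
    and le: "\<And>\<theta>. norm \<theta> \<le> \<eta> \<Longrightarrow> laplace K x \<theta> \<le> ennreal C"
  shows "exp_moments (K x) (\<eta> / 2) (4 * C)"
proof (rule exp_moments.intro)
  have [measurable_cong]: "sets (K x) = sets borel" by fact
  let ?e = "\<lambda>i s y. ennreal (exp ((axis i s :: real^2) \<bullet> y))"
  have pt: "ennreal (exp (\<eta> / 2 * norm y)) \<le> ?e 1 \<eta> y + ?e 1 (-\<eta>) y + ?e 2 \<eta> y + ?e 2 (-\<eta>) y" for y :: "real^2"
  proof -
    have "norm y \<le> \<bar>y $ 1\<bar> + \<bar>y $ 2\<bar>"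
      using norm_le_l1_cart[of y] by (simp add: sum_2)
    then have "\<eta> / 2 * norm y \<le> \<eta> / 2 * (\<bar>y $ 1\<bar> + \<bar>y $ 2\<bar>)"
      using assms(3) by (intro mult_left_mono) auto
    then have "\<eta> / 2 * norm y \<le> \<eta> * \<bar>y $ 1\<bar> \<or> \<eta> / 2 * norm y \<le> \<eta> * \<bar>y $ 2\<bar>"
      by (auto simp: algebra_simps)
    then have "\<eta> / 2 * norm y \<le> \<eta> * y $ 1 \<or> \<eta> / 2 * norm y \<le> - \<eta> * y $ 1
       \<or> \<eta> / 2 * norm y \<le> \<eta> * y $ 2 \<or> \<eta> / 2 * norm y \<le> - \<eta> * y $ 2"
      by (auto simp: abs_if split: if_splits)
    then have "exp (\<eta> / 2 * norm y) \<le> exp (\<eta> * y $ 1) \<or> exp (\<eta> / 2 * norm y) \<le> exp (- \<eta> * y $ 1)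
       \<or> exp (\<eta> / 2 * norm y) \<le> exp (\<eta> * y $ 2) \<or> exp (\<eta> / 2 * norm y) \<le> exp (- \<eta> * y $ 2)"
      by simp
    then have "exp (\<eta> / 2 * norm y) \<le> exp (\<eta> * y $ 1) + exp (- \<eta> * y $ 1) + exp (\<eta> * y $ 2) + exp (- \<eta> * y $ 2)"
      using exp_gt_zero[of "\<eta> * y $ 1"] exp_gt_zero[of "- \<eta> * y $ 1"]
        exp_gt_zero[of "\<eta> * y $ 2"] exp_gt_zero[of "- \<eta> * y $ 2"] by linarith
    then show ?thesis by (simp add: inner_axis' ennreal_plus[symmetric] del: ennreal_plus)
  qed
  have "(\<integral>\<^sup>+ y. ennreal (exp (\<eta> / 2 * norm y)) \<partial>K x)
      \<le> (\<integral>\<^sup>+ y. ?e 1 \<eta> y + ?e 1 (-\<eta>) y + ?e 2 \<eta> y + ?e 2 (-\<eta>) y \<partial>K x)"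
    by (intro nn_integral_mono pt)
  also have "\<dots> = laplace K x (axis 1 \<eta>) + laplace K x (axis 1 (-\<eta>)) + laplace K x (axis 2 \<eta>) + laplace K x (axis 2 (-\<eta>))"
    unfolding laplace_def by (simp add: nn_integral_add)
  also have "\<dots> \<le> ennreal C + ennreal C + ennreal C + ennreal C"
    using assms(3) by (intro add_mono le) (auto simp: norm_eq_sqrt_inner inner_axis_axis)
  also have "\<dots> = ennreal (4 * C)" using assms(4) by (simp add: ennreal_plus[symmetric] del: ennreal_plus)
  finally show "(\<integral>\<^sup>+ y. ennreal (exp (\<eta> / 2 * norm y)) \<partial>K x) \<le> ennreal (4 * C)" .
qed (use assms(1-4) in simp_all)

lemma drift_cong_kernel: "drift K x = drift (\<lambda>_. K x) x"
  by (simp add: drift_def laplace_def)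

lemma covar_cong_kernel: "covar K x = covar (\<lambda>_. K x) x"
  by (simp add: covar_def laplace_def)

section \<open>The compensation formula\<close>

lemma nn_integral_zero_mass:
  assumes "emeasure k (space k) = 0"
  shows "(\<integral>\<^sup>+ y. f y \<partial>k) = 0"
proof -
  have "AE y in k. f y = 0" using assms by (intro AE_I[of _ _ "space k"]) auto
  then have "(\<integral>\<^sup>+ y. f y \<partial>k) = (\<integral>\<^sup>+ y. 0 \<partial>k)" by (rule nn_integral_cong_AE)
  then show ?thesis by simp
qed

text \<open>Division by one plus the mass makes the kernel a subprobability kernel, for which integrals depend
  measurably on the state.\<close>

lemma measurable_nn_integral_finite_kernel:
  assumes K: "finite_kernel I K" and Y: "Y \<in> N \<rightarrow>\<^sub>M restrict_space borel I"
    and f: "(\<lambda>(x, y). f x y) \<in> borel_measurable (N \<Otimes>\<^sub>M borel)"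
  shows "(\<lambda>x. \<integral>\<^sup>+ y. f x y \<partial>K (Y x)) \<in> borel_measurable N"
proof -
  let ?q = "\<lambda>x. 1 + emeasure (K x) UNIV"
  let ?Q = "\<lambda>x. scale_measure (1 / ?q x) (K x)"
  have sp: "space (K x) = UNIV" if "x \<in> I" for x
    using K that sets_eq_imp_space_eq[of "K x" borel] by (auto simp: finite_kernel_def)
  have q: "?q x \<noteq> \<infinity>" "?q x \<noteq> 0" if "x \<in> I" for x
    using K that finite_measure.emeasure_finite[of "K x"] by (auto simp: finite_kernel_def)
  have em [measurable]: "(\<lambda>x. emeasure (K x) A) \<in> borel_measurable (restrict_space borel I)"
    if "A \<in> sets borel" for A
    using K that by (auto simp: finite_kernel_def)
  have Q: "?Q \<in> restrict_space borel I \<rightarrow>\<^sub>M subprob_algebra borel"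
  proof (rule measurable_subprob_algebra)
    fix x :: "real^2" assume "x \<in> space (restrict_space borel I)"
    then have x: "x \<in> I" by (simp add: space_restrict_space)
    have "1 / ?q x * emeasure (K x) UNIV \<le> 1"
    proof -
      have "emeasure (K x) UNIV / ?q x \<le> 1"
        using q[OF x] by (intro divide_le_posI_ennreal) (auto simp: zero_less_iff_neq_zero)
      then show ?thesis by (simp add: ennreal_times_divide mult.commute)
    qed
    then show "subprob_space (?Q x)"
      by (intro subprob_spaceI) (simp_all add: sp[OF x] space_scale_measure)
    show "sets (?Q x) = sets borel" using K x by (simp add: finite_kernel_def)
  next
    fix A :: "(real^2) set" assume "A \<in> sets borel"
    then show "(\<lambda>x. emeasure (?Q x) A) \<in> borel_measurable (restrict_space borel I)"
      by simp
  qed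
  have YI: "Y x \<in> I" if "x \<in> space N" for x
    using measurable_space[OF Y that] by (simp add: space_restrict_space)
  have "(\<lambda>x. \<integral>\<^sup>+ y. f x y \<partial>?Q (Y x)) \<in> borel_measurable N"
    by (rule nn_integral_measurable_subprob_algebra2[OF f measurable_compose[OF Y Q]])
  moreover have "(\<lambda>x. ?q (Y x)) \<in> borel_measurable N"
    using measurable_compose[OF Y em[of UNIV]] by simp
  ultimately have "(\<lambda>x. ?q (Y x) * (\<integral>\<^sup>+ y. f x y \<partial>?Q (Y x))) \<in> borel_measurable N"
    by (intro borel_measurable_times_ennreal)
  moreover have "?q (Y x) * (\<integral>\<^sup>+ y. f x y \<partial>?Q (Y x)) = (\<integral>\<^sup>+ y. f x y \<partial>K (Y x))" if x: "x \<in> space N" for x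
  proof -
    have m: "(\<lambda>y. f x y) \<in> borel_measurable (K (Y x))"
      using measurable_Pair2[OF f x] K YI[OF x] by (simp add: finite_kernel_def cong: measurable_cong_sets)
    have "?q (Y x) * (\<integral>\<^sup>+ y. f x y \<partial>?Q (Y x)) = ?q (Y x) * (1 / ?q (Y x)) * (\<integral>\<^sup>+ y. f x y \<partial>K (Y x))"
      using m by (simp add: nn_integral_scale_measure mult.assoc)
    also have "?q (Y x) * (1 / ?q (Y x)) = 1"
      using q[OF YI[OF x]] ennreal_divide_self[of "?q (Y x)"]
      by (simp add: ennreal_times_divide less_top zero_less_iff_neq_zero)
    finally show ?thesis by simp
  qed
  ultimately show ?thesis by (simp cong: measurable_cong)
qed

lemma nn_integral_exp_tail:
  assumes "q > 0"
  shows "(\<integral>\<^sup>+ s. ennreal (exp (- q * s)) * indicator {a..} s \<partial>lborel) = ennreal (exp (- q * a) / q)"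
proof -
  have "(\<integral>\<^sup>+ s. ennreal (exp (- q * s)) * indicator {a..} s \<partial>lborel)
      = ennreal (0 - (- exp (- q * a) / q))"
  proof (rule nn_integral_FTC_atLeast)
    show "((\<lambda>s. - exp (- q * s) / q) \<longlongrightarrow> 0) at_top"
    proof -
      have "filterlim (\<lambda>s. - q * s) at_bot at_top"
        using assms by (simp add: filterlim_uminus_at_bot filterlim_tendsto_pos_mult_at_top[OF tendsto_const _ filterlim_ident])
      then have "((\<lambda>s. exp (- q * s)) \<longlongrightarrow> 0) at_top"
        by (rule filterlim_compose[OF exp_at_bot])
      then have "((\<lambda>s. - exp (- q * s) / q) \<longlongrightarrow> - 0 / q) at_top"
        using assms by (intro tendsto_intros) auto
      then show ?thesis by simp
    qed
    show "DERIV (\<lambda>s. - exp (- q * s) / q) s :> exp (- q * s)" for s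
      using assms by (auto intro!: derivative_eq_intros)
  qed auto
  then show ?thesis by simp
qed

text \<open>The probabilistic estimates concern only the chain of jump times and states; the process itself enters
  later, through its paths.\<close>

locale jump_process = prob_space M
  for M :: "'w measure" +
  fixes J :: "nat \<Rightarrow> 'w \<Rightarrow> ereal" and Y :: "nat \<Rightarrow> 'w \<Rightarrow> real^2"
    and I :: "(real^2) set" and K :: "real^2 \<Rightarrow> (real^2) measure" and x0 :: "real^2"
  assumes kernel: "finite_kernel I K"
    and J_measurable [measurable]: "\<And>n. J n \<in> borel_measurable M"
    and Y_measurable [measurable]: "\<And>n. Y n \<in> borel_measurable M"
    and J_0: "\<And>\<omega>. \<omega> \<in> space M \<Longrightarrow> J 0 \<omega> = 0"
    and Y_0: "\<And>\<omega>. \<omega> \<in> space M \<Longrightarrow> Y 0 \<omega> = x0"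
    and Y_in: "\<And>\<omega> n. \<omega> \<in> space M \<Longrightarrow> Y n \<omega> \<in> I"
    and J_mono: "\<And>\<omega> n. \<omega> \<in> space M \<Longrightarrow> J n \<omega> \<le> J (Suc n) \<omega>"
    and J_strict: "\<And>\<omega> n. \<omega> \<in> space M \<Longrightarrow> J n \<omega> < \<infinity> \<Longrightarrow> J n \<omega> < J (Suc n) \<omega>"
    and J_lim: "\<And>\<omega>. \<omega> \<in> space M \<Longrightarrow> (\<lambda>n. J n \<omega>) \<longlonglongrightarrow> \<infinity>"
    and law: "\<And>n E A t. E \<in> sets (history M J Y n) \<Longrightarrow> A \<in> sets borel \<Longrightarrow> t \<ge> 0 \<Longrightarrow>
           measure M {\<omega>\<in>E. J n \<omega> + ereal t < J (Suc n) \<omega> \<and> J (Suc n) \<omega> < \<infinity> \<and>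
                            Y (Suc n) \<omega> - Y n \<omega> \<in> A} =
           (LINT \<omega>:{\<omega>\<in>E. J n \<omega> < \<infinity>}|M.
              exp (- measure (K (Y n \<omega>)) UNIV * t) *
                (measure (K (Y n \<omega>)) A / measure (K (Y n \<omega>)) UNIV))"
begin

abbreviation "F n \<equiv> history M J Y n"

abbreviation rate :: "nat \<Rightarrow> 'w \<Rightarrow> real" where
  "rate n \<omega> \<equiv> measure (K (Y n \<omega>)) UNIV"

abbreviation "jump n \<omega> \<equiv> Y (Suc n) \<omega> - Y n \<omega>"

lemma J_le: "\<omega> \<in> space M \<Longrightarrow> m \<le> n \<Longrightarrow> J m \<omega> \<le> J n \<omega>"
  by (rule lift_Suc_mono_le[of "\<lambda>n. J n \<omega>"]) (auto intro: J_mono)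

lemma J_nonneg: "\<omega> \<in> space M \<Longrightarrow> 0 \<le> J n \<omega>"
  using J_le[of \<omega> 0 n] by (simp add: J_0)

lemma kernel_sets: "x \<in> I \<Longrightarrow> sets (K x) = sets borel"
  using kernel by (simp add: finite_kernel_def)

lemma kernel_space: "x \<in> I \<Longrightarrow> space (K x) = UNIV"
  using sets_eq_imp_space_eq[OF kernel_sets] by simp

lemma kernel_finite: "x \<in> I \<Longrightarrow> finite_measure (K x)"
  using kernel by (simp add: finite_kernel_def)

lemma space_history [simp]: "space (F n) = space M"
  by (simp add: history_def)

lemma sets_history_subset: "sets (F n) \<subseteq> sets M"
  unfolding history_def
  by (rule sets_image_in_sets) (auto intro!: measurable_restrict)

lemma measurable_history_imp: "f \<in> F n \<rightarrow>\<^sub>M N \<Longrightarrow> f \<in> M \<rightarrow>\<^sub>M N"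
  using sets_history_subset[of n] by (auto simp: measurable_def)

lemma measurable_ident_history [measurable]: "(\<lambda>\<omega>. \<omega>) \<in> M \<rightarrow>\<^sub>M F n"
  by (rule measurable_history_imp[of _ n]) simp

lemma measurable_history:
  assumes "k \<le> n"
  shows "J k \<in> borel_measurable (F n)" and "Y k \<in> borel_measurable (F n)"
proof -
  let ?g = "\<lambda>\<omega>. \<lambda>i\<in>{..n}. (J i \<omega>, Y i \<omega>)"
  have g: "?g \<in> F n \<rightarrow>\<^sub>M (\<Pi>\<^sub>M i\<in>{..n}. borel \<Otimes>\<^sub>M borel)"
    unfolding history_def by (rule measurable_vimage_algebra1) (auto simp: space_PiM space_pair_measure)
  have "(\<lambda>\<omega>. ?g \<omega> k) \<in> F n \<rightarrow>\<^sub>M borel \<Otimes>\<^sub>M borel"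
    by (rule measurable_compose[OF g]) (use assms in \<open>auto intro!: measurable_component_singleton\<close>)
  then have *: "(\<lambda>\<omega>. (J k \<omega>, Y k \<omega>)) \<in> F n \<rightarrow>\<^sub>M borel \<Otimes>\<^sub>M borel"
    using assms by simp
  show "J k \<in> borel_measurable (F n)" "Y k \<in> borel_measurable (F n)"
    using measurable_compose[OF * measurable_fst] measurable_compose[OF * measurable_snd] by simp_all
qed

lemma measurable_history_state:
  "Y n \<in> F n \<rightarrow>\<^sub>M restrict_space borel I"
  by (rule measurable_restrict_space2) (auto intro: Y_in measurable_history)

lemma emeasure_kernel_measurable [measurable]:
  assumes "A \<in> sets borel"
  shows "(\<lambda>\<omega>. emeasure (K (Y n \<omega>)) A) \<in> borel_measurable (F n)"
proof -
  have "(\<lambda>x. emeasure (K x) A) \<in> borel_measurable (restrict_space borel I)"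
    using kernel assms unfolding finite_kernel_def by blast
  from measurable_compose[OF measurable_history_state this] show ?thesis .
qed

lemma measure_kernel_measurable [measurable]:
  assumes "A \<in> sets borel"
  shows "(\<lambda>\<omega>. measure (K (Y n \<omega>)) A) \<in> borel_measurable (F n)"
  unfolding measure_def using emeasure_kernel_measurable[OF assms] by measurable

lemma emeasure_kernel: "x \<in> I \<Longrightarrow> emeasure (K x) A = ennreal (measure (K x) A)"
  using finite_measure.emeasure_eq_measure[OF kernel_finite] by simp

lemma kernel_measure_le: "x \<in> I \<Longrightarrow> measure (K x) A \<le> measure (K x) UNIV"
  using finite_measure.bounded_measure[OF kernel_finite, of x A] by (simp add: kernel_space)

text \<open>The law prescribes the tails of the holding time on an event of the past and a set of jumps, and two finite
  measures on the line with equal tails agree.\<close>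

lemma law_rectangle:
  assumes E: "E \<in> sets (F n)" and A [measurable]: "A \<in> sets borel" and B: "B \<in> sets borel"
  defines "h \<equiv> \<lambda>\<omega>. real_of_ereal (J (Suc n) \<omega>) - real_of_ereal (J n \<omega>)"
  shows "emeasure M {\<omega>\<in>E. J (Suc n) \<omega> < \<infinity> \<and> h \<omega> \<in> B \<and> jump n \<omega> \<in> A} =
    (\<integral>\<^sup>+ \<omega>. indicator {\<omega>\<in>E. J n \<omega> < \<infinity>} \<omega> * (\<integral>\<^sup>+ s. ennreal (exp (- rate n \<omega> * s)) * indicator {0..} s * indicator B s \<partial>lborel)
       * emeasure (K (Y n \<omega>)) A \<partial>M)"
proof -
  have [measurable]: "E \<in> sets M" using E sets_history_subset by blast
  from sets.sets_into_space[OF this] have EM: "\<omega> \<in> E \<Longrightarrow> \<omega> \<in> space M" for \<omega> by auto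
  note [measurable] = measurable_history_imp[OF emeasure_kernel_measurable]
    measurable_history_imp[OF measure_kernel_measurable]
  have [measurable]: "h \<in> borel_measurable M" unfolding h_def by measurable
  let ?E1 = "{\<omega>\<in>E. J (Suc n) \<omega> < \<infinity> \<and> jump n \<omega> \<in> A}"
  let ?E0 = "{\<omega>\<in>E. J n \<omega> < \<infinity>}"
  have E0 [measurable]: "?E0 \<in> sets M" and E1 [measurable]: "?E1 \<in> sets M" by measurable
  let ?m1 = "distr (density M (indicator ?E1)) borel h"
  let ?w = "\<lambda>\<omega> s. indicator ?E0 \<omega> * (ennreal (exp (- rate n \<omega> * s)) * indicator {0..} s) * emeasure (K (Y n \<omega>)) A"
  let ?m2 = "density lborel (\<lambda>s. \<integral>\<^sup>+ \<omega>. ?w \<omega> s \<partial>M)"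
  interpret L: pair_sigma_finite M lborel by unfold_locales
  have w [measurable]: "case_prod ?w \<in> borel_measurable (M \<Otimes>\<^sub>M lborel)" by measurable
  have m1: "emeasure ?m1 X = emeasure M {\<omega>\<in>E. J (Suc n) \<omega> < \<infinity> \<and> h \<omega> \<in> X \<and> jump n \<omega> \<in> A}"
    if [measurable]: "X \<in> sets borel" for X
  proof -
    have "emeasure ?m1 X = (\<integral>\<^sup>+ \<omega>. indicator ?E1 \<omega> * indicator (h -` X \<inter> space M) \<omega> \<partial>M)"
      by (simp add: emeasure_distr emeasure_density)
    also have "\<dots> = (\<integral>\<^sup>+ \<omega>. indicator {\<omega>\<in>E. J (Suc n) \<omega> < \<infinity> \<and> h \<omega> \<in> X \<and> jump n \<omega> \<in> A} \<omega> \<partial>M)"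
      by (intro nn_integral_cong) (auto split: split_indicator)
    finally show ?thesis by simp
  qed
  have m2: "emeasure ?m2 X = (\<integral>\<^sup>+ \<omega>. indicator ?E0 \<omega> * (\<integral>\<^sup>+ s. ennreal (exp (- rate n \<omega> * s)) * indicator {0..} s * indicator X s \<partial>lborel)
       * emeasure (K (Y n \<omega>)) A \<partial>M)" if [measurable]: "X \<in> sets borel" for X
  proof -
    have "emeasure ?m2 X = (\<integral>\<^sup>+ s. (\<integral>\<^sup>+ \<omega>. ?w \<omega> s * indicator X s \<partial>M) \<partial>lborel)"
      by (simp add: emeasure_density nn_integral_multc)
    also have "\<dots> = (\<integral>\<^sup>+ \<omega>. (\<integral>\<^sup>+ s. ?w \<omega> s * indicator X s \<partial>lborel) \<partial>M)"
      by (rule L.Fubini') measurable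
    also have "\<dots> = (\<integral>\<^sup>+ \<omega>. indicator ?E0 \<omega> * (\<integral>\<^sup>+ s. ennreal (exp (- rate n \<omega> * s)) * indicator {0..} s * indicator X s \<partial>lborel)
       * emeasure (K (Y n \<omega>)) A \<partial>M)"
    proof (intro nn_integral_cong)
      fix \<omega> assume "\<omega> \<in> space M"
      have "(\<integral>\<^sup>+ s. ?w \<omega> s * indicator X s \<partial>lborel)
         = (\<integral>\<^sup>+ s. (indicator ?E0 \<omega> * emeasure (K (Y n \<omega>)) A) * (ennreal (exp (- rate n \<omega> * s)) * indicator {0..} s * indicator X s) \<partial>lborel)"
        by (intro nn_integral_cong) (simp add: ac_simps)
      also have "\<dots> = (indicator ?E0 \<omega> * emeasure (K (Y n \<omega>)) A) * (\<integral>\<^sup>+ s. ennreal (exp (- rate n \<omega> * s)) * indicator {0..} s * indicator X s \<partial>lborel)"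
        by (rule nn_integral_cmult) measurable
      finally show "(\<integral>\<^sup>+ s. ?w \<omega> s * indicator X s \<partial>lborel) = indicator ?E0 \<omega> * (\<integral>\<^sup>+ s. ennreal (exp (- rate n \<omega> * s)) * indicator {0..} s * indicator X s \<partial>lborel)
       * emeasure (K (Y n \<omega>)) A" by (simp add: ac_simps)
    qed
    finally show ?thesis .
  qed
  have "?m1 = ?m2"
  proof (rule measure_eqI_lessThan)
    show "sets ?m1 = sets borel" "sets ?m2 = sets borel" by simp_all
    fix r :: real
    have "emeasure ?m1 {r<..} \<le> 1"
      using m1[of "{r<..}"] by (simp add: emeasure_le_1)
    then show "emeasure ?m1 {r<..} < \<infinity>" by (rule le_less_trans) simp
    let ?t = "max r 0"
    have e1: "{\<omega>\<in>E. J (Suc n) \<omega> < \<infinity> \<and> h \<omega> \<in> {r<..} \<and> jump n \<omega> \<in> A} =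
        {\<omega>\<in>E. J n \<omega> + ereal ?t < J (Suc n) \<omega> \<and> J (Suc n) \<omega> < \<infinity> \<and> jump n \<omega> \<in> A}"
    proof -
      have "J n \<omega> + ereal ?t < J (Suc n) \<omega> \<longleftrightarrow> h \<omega> \<in> {r<..}" if wE: "\<omega> \<in> E" and fin: "J (Suc n) \<omega> < \<infinity>" for \<omega>
      proof -
        have w: "\<omega> \<in> space M" using wE EM by auto
        have "0 \<le> J n \<omega>" "J n \<omega> < J (Suc n) \<omega>"
          using J_nonneg[OF w] J_strict[OF w le_less_trans[OF J_mono[OF w] fin]] by auto
        then obtain a b where "J n \<omega> = ereal a" "J (Suc n) \<omega> = ereal b" "0 \<le> a" "a < b"
          using fin by (cases "J n \<omega>"; cases "J (Suc n) \<omega>") auto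
        then have "J n \<omega> + ereal ?t = ereal (a + ?t)" "J (Suc n) \<omega> = ereal b" "h \<omega> = b - a"
          by (simp_all add: h_def del: ereal_max)
        moreover have "a + ?t < b \<longleftrightarrow> r < b - a" using \<open>a < b\<close> by linarith
        ultimately show ?thesis by simp
      qed
      then show ?thesis by auto
    qed
    have q01: "0 \<le> measure (K (Y n \<omega>)) A / rate n \<omega>" "measure (K (Y n \<omega>)) A / rate n \<omega> \<le> 1" if "\<omega> \<in> space M" for \<omega>
    proof -
      show "0 \<le> measure (K (Y n \<omega>)) A / rate n \<omega>" by (intro divide_nonneg_nonneg measure_nonneg)
      show "measure (K (Y n \<omega>)) A / rate n \<omega> \<le> 1"
        using kernel_measure_le[OF Y_in[OF that], of n A] measure_nonneg[of "K (Y n \<omega>)" UNIV]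
        by (cases "rate n \<omega> = 0") (simp_all add: divide_le_eq_1_pos less_le)
    qed
    let ?g = "\<lambda>\<omega>. indicator ?E0 \<omega> * (exp (- rate n \<omega> * ?t) * (measure (K (Y n \<omega>)) A / rate n \<omega>))"
    have g01: "0 \<le> ?g \<omega>" "?g \<omega> \<le> 1" if "\<omega> \<in> space M" for \<omega>
    proof -
      have "exp (- rate n \<omega> * ?t) \<le> 1" by (simp add: measure_nonneg)
      then show "0 \<le> ?g \<omega>" "?g \<omega> \<le> 1" using q01[OF that] mult_mono[of "exp (- rate n \<omega> * ?t)" 1 "measure (K (Y n \<omega>)) A / rate n \<omega>" 1]
        by (auto simp: indicator_def)
    qed
    have "integrable M ?g"
      by (rule integrable_const_bound[where B=1]) (use g01 in auto)
    then have "ennreal (\<integral>\<omega>. ?g \<omega> \<partial>M) = (\<integral>\<^sup>+ \<omega>. ennreal (?g \<omega>) \<partial>M)"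
      using g01 by (intro nn_integral_eq_integral[symmetric]) auto
    moreover have "measure M {\<omega>\<in>E. J n \<omega> + ereal ?t < J (Suc n) \<omega> \<and> J (Suc n) \<omega> < \<infinity> \<and> jump n \<omega> \<in> A} = (\<integral>\<omega>. ?g \<omega> \<partial>M)"
      using law[OF E A, of ?t] by (simp add: set_lebesgue_integral_def)
    ultimately have l: "emeasure M {\<omega>\<in>E. J n \<omega> + ereal ?t < J (Suc n) \<omega> \<and> J (Suc n) \<omega> < \<infinity> \<and> jump n \<omega> \<in> A}
         = (\<integral>\<^sup>+ \<omega>. ennreal (?g \<omega>) \<partial>M)"
      by (simp add: emeasure_eq_measure)
    also have "\<dots> = (\<integral>\<^sup>+ \<omega>. indicator ?E0 \<omega> * (\<integral>\<^sup>+ s. ennreal (exp (- rate n \<omega> * s)) * indicator {0..} s * indicator {r<..} s \<partial>lborel)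
       * emeasure (K (Y n \<omega>)) A \<partial>M)"
    proof (intro nn_integral_cong)
      fix \<omega> assume w: "\<omega> \<in> space M"
      show "ennreal (?g \<omega>) = indicator ?E0 \<omega> * (\<integral>\<^sup>+ s. ennreal (exp (- rate n \<omega> * s)) * indicator {0..} s * indicator {r<..} s \<partial>lborel)
       * emeasure (K (Y n \<omega>)) A"
      proof (cases "rate n \<omega> = 0")
        case True
        then have "measure (K (Y n \<omega>)) A = 0"
          using kernel_measure_le[OF Y_in[OF w], of n A] measure_nonneg[of "K (Y n \<omega>)" A] by linarith
        then show ?thesis using emeasure_kernel[OF Y_in[OF w]] by simp
      next
        case False
        then have pos: "rate n \<omega> > 0" by (simp add: measure_nonneg zero_less_measure_iff less_le)
        have "(\<integral>\<^sup>+ s. ennreal (exp (- rate n \<omega> * s)) * indicator {0..} s * indicator {r<..} s \<partial>lborel)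
          = (\<integral>\<^sup>+ s. ennreal (exp (- rate n \<omega> * s)) * indicator {?t..} s \<partial>lborel)"
        proof (rule nn_integral_cong_AE)
          have "AE s in lborel. s \<noteq> r" by (rule AE_lborel_singleton)
          then show "AE s in lborel. ennreal (exp (- rate n \<omega> * s)) * indicator {0..} s * indicator {r<..} s
              = ennreal (exp (- rate n \<omega> * s)) * indicator {?t..} s"
            by eventually_elim (auto split: split_indicator)
        qed
        also have "\<dots> = ennreal (exp (- rate n \<omega> * ?t) / rate n \<omega>)"
          by (rule nn_integral_exp_tail[OF pos])
        finally show ?thesis
          using pos emeasure_kernel[OF Y_in[OF w]]
          by (auto simp: ennreal_mult[symmetric] measure_nonneg split: split_indicator)
      qed
    qed
    finally show "emeasure ?m1 {r<..} = emeasure ?m2 {r<..}"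
      using m1[of "{r<..}"] m2[of "{r<..}"] e1 by simp
  qed
  then show ?thesis using m1[OF B] m2[OF B] by simp
qed

text \<open>Rectangles generate the product of the history, the line and the plane, so the previous identity
  determines the joint law of history, holding time and jump; functions follow by monotone approximation.\<close>

lemma holding_and_jump_formula:
  fixes f :: "'w \<times> real \<times> (real^2) \<Rightarrow> ennreal"
  assumes f: "f \<in> borel_measurable (F n \<Otimes>\<^sub>M (borel \<Otimes>\<^sub>M borel))"
  defines "h \<equiv> \<lambda>\<omega>. real_of_ereal (J (Suc n) \<omega>) - real_of_ereal (J n \<omega>)"
  shows "(\<integral>\<^sup>+ \<omega>. indicator {\<omega>. J (Suc n) \<omega> < \<infinity>} \<omega> * f (\<omega>, h \<omega>, jump n \<omega>) \<partial>M) =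
    (\<integral>\<^sup>+ \<omega>. (\<integral>\<^sup>+ s. indicator {\<omega>. J n \<omega> < \<infinity>} \<omega> * (ennreal (exp (- rate n \<omega> * s)) * indicator {0..} s)
       * (\<integral>\<^sup>+ y. f (\<omega>, s, y) \<partial>K (Y n \<omega>)) \<partial>lborel) \<partial>M)"
proof -
  let ?P = "F n \<Otimes>\<^sub>M ((borel::real measure) \<Otimes>\<^sub>M (borel::(real^2) measure))"
  note [measurable] = measurable_history_imp[OF emeasure_kernel_measurable]
    measurable_history_imp[OF measure_kernel_measurable]
  have h [measurable]: "h \<in> borel_measurable M" unfolding h_def by measurable
  let ?w = "\<lambda>\<omega> s. indicator {\<omega>. J n \<omega> < \<infinity>} \<omega> * (ennreal (exp (- rate n \<omega> * s)) * indicator {0..} s)"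
  define R where "R = (\<lambda>g. \<integral>\<^sup>+ \<omega>. (\<integral>\<^sup>+ s. ?w \<omega> s * (\<integral>\<^sup>+ y. g (\<omega>, s, y) \<partial>K (Y n \<omega>)) \<partial>lborel) \<partial>M)"
  have inner [measurable]: "(\<lambda>(\<omega>, s). \<integral>\<^sup>+ y. g (\<omega>, s, y) \<partial>K (Y n \<omega>)) \<in> borel_measurable (M \<Otimes>\<^sub>M lborel)"
    if [measurable]: "g \<in> borel_measurable ?P" for g :: "'w \<times> real \<times> (real^2) \<Rightarrow> ennreal"
  proof -
    have "(\<lambda>z. \<integral>\<^sup>+ y. g (fst z, snd z, y) \<partial>K (Y n (fst z))) \<in> borel_measurable (M \<Otimes>\<^sub>M lborel)"
    proof (rule measurable_nn_integral_finite_kernel[OF kernel])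
      show "(\<lambda>z. Y n (fst z)) \<in> M \<Otimes>\<^sub>M lborel \<rightarrow>\<^sub>M restrict_space borel I"
        by (rule measurable_restrict_space2) (auto simp: space_pair_measure intro: Y_in)
      have id: "(\<lambda>z. fst (fst z)) \<in> (M \<Otimes>\<^sub>M lborel) \<Otimes>\<^sub>M borel \<rightarrow>\<^sub>M F n"
        by (rule measurable_compose[OF _ measurable_ident_history]) measurable
      show "(\<lambda>(z, y). g (fst z, snd z, y)) \<in> borel_measurable ((M \<Otimes>\<^sub>M lborel) \<Otimes>\<^sub>M borel)"
        unfolding case_prod_beta
        by (rule measurable_compose[OF _ that]) (intro measurable_Pair id; measurable)
    qed
    then show ?thesis by (simp add: case_prod_beta)
  qed
  have gK [measurable]: "(\<lambda>y. g (\<omega>, s, y)) \<in> borel_measurable (K (Y n \<omega>))"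
    if g: "g \<in> borel_measurable ?P" and w: "\<omega> \<in> space M" for g :: "'w \<times> real \<times> (real^2) \<Rightarrow> ennreal" and \<omega> s
  proof -
    have "(\<lambda>y. (\<omega>, s, y)) \<in> borel \<rightarrow>\<^sub>M ?P" using w by (intro measurable_Pair) auto
    from measurable_compose[OF this g] show ?thesis
      using kernel_sets[OF Y_in[OF w]] by (simp cong: measurable_cong_sets)
  qed
  have slice: "(\<lambda>s. \<integral>\<^sup>+ y. g (\<omega>, s, y) \<partial>K (Y n \<omega>)) \<in> borel_measurable lborel"
    if "g \<in> borel_measurable ?P" "\<omega> \<in> space M" for g :: "'w \<times> real \<times> (real^2) \<Rightarrow> ennreal" and \<omega>
    using measurable_Pair2[OF inner[OF that(1)] that(2)] by simp
  have wm [measurable]: "?w \<omega> \<in> borel_measurable lborel" for \<omega> by measurable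
  have outer: "(\<lambda>\<omega>. \<integral>\<^sup>+ s. ?w \<omega> s * (\<integral>\<^sup>+ y. g (\<omega>, s, y) \<partial>K (Y n \<omega>)) \<partial>lborel) \<in> borel_measurable M"
    if "g \<in> borel_measurable ?P" for g :: "'w \<times> real \<times> (real^2) \<Rightarrow> ennreal"
  proof -
    have "(\<lambda>(\<omega>, s). ?w \<omega> s * (\<integral>\<^sup>+ y. g (\<omega>, s, y) \<partial>K (Y n \<omega>))) \<in> borel_measurable (M \<Otimes>\<^sub>M lborel)"
      using inner[OF that] by (simp add: case_prod_beta)
    then show ?thesis by (intro lborel.borel_measurable_nn_integral) auto
  qed
  have R_suminf: "R (\<lambda>z. \<Sum>i. g i z) = (\<Sum>i. R (g i))" if g: "\<And>i. g i \<in> borel_measurable ?P"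
    for g :: "nat \<Rightarrow> 'w \<times> real \<times> (real^2) \<Rightarrow> ennreal"
  proof -
    have "R (\<lambda>z. \<Sum>i. g i z) = (\<integral>\<^sup>+ \<omega>. (\<integral>\<^sup>+ s. (\<Sum>i. ?w \<omega> s * (\<integral>\<^sup>+ y. g i (\<omega>, s, y) \<partial>K (Y n \<omega>))) \<partial>lborel) \<partial>M)"
      unfolding R_def by (intro nn_integral_cong) (simp add: nn_integral_suminf gK[OF g])
    also have "\<dots> = (\<integral>\<^sup>+ \<omega>. (\<Sum>i. \<integral>\<^sup>+ s. ?w \<omega> s * (\<integral>\<^sup>+ y. g i (\<omega>, s, y) \<partial>K (Y n \<omega>)) \<partial>lborel) \<partial>M)"
      by (intro nn_integral_cong nn_integral_suminf borel_measurable_times_ennreal wm slice g)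
    also have "\<dots> = (\<Sum>i. R (g i))"
      unfolding R_def by (intro nn_integral_suminf outer g)
    finally show ?thesis .
  qed
  have R_cmult: "R (\<lambda>z. c * g z) = c * R g" if g: "g \<in> borel_measurable ?P" for c g
  proof -
    have "R (\<lambda>z. c * g z) = (\<integral>\<^sup>+ \<omega>. (\<integral>\<^sup>+ s. c * (?w \<omega> s * (\<integral>\<^sup>+ y. g (\<omega>, s, y) \<partial>K (Y n \<omega>))) \<partial>lborel) \<partial>M)"
      unfolding R_def by (intro nn_integral_cong) (simp add: nn_integral_cmult gK[OF g] ac_simps)
    also have "\<dots> = (\<integral>\<^sup>+ \<omega>. c * (\<integral>\<^sup>+ s. ?w \<omega> s * (\<integral>\<^sup>+ y. g (\<omega>, s, y) \<partial>K (Y n \<omega>)) \<partial>lborel) \<partial>M)"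
      by (intro nn_integral_cong nn_integral_cmult borel_measurable_times_ennreal wm slice g)
    also have "\<dots> = c * R g"
      unfolding R_def by (intro nn_integral_cmult outer g)
    finally show ?thesis .
  qed
  let ?E1 = "{\<omega>\<in>space M. J (Suc n) \<omega> < \<infinity>}"
  let ?T = "\<lambda>\<omega>. (\<omega>, h \<omega>, jump n \<omega>)"
  let ?m1 = "distr (density M (indicator ?E1)) ?P ?T"
  have T [measurable]: "?T \<in> M \<rightarrow>\<^sub>M ?P" by measurable
  have L: "(\<integral>\<^sup>+ z. g z \<partial>?m1) = (\<integral>\<^sup>+ \<omega>. indicator {\<omega>. J (Suc n) \<omega> < \<infinity>} \<omega> * g (?T \<omega>) \<partial>M)"
    if [measurable]: "g \<in> borel_measurable ?P" for g
  proof -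
    have "(\<integral>\<^sup>+ z. g z \<partial>?m1) = (\<integral>\<^sup>+ \<omega>. indicator ?E1 \<omega> * g (?T \<omega>) \<partial>M)"
      by (simp add: nn_integral_distr nn_integral_density)
    also have "\<dots> = (\<integral>\<^sup>+ \<omega>. indicator {\<omega>. J (Suc n) \<omega> < \<infinity>} \<omega> * g (?T \<omega>) \<partial>M)"
      by (intro nn_integral_cong) (auto split: split_indicator)
    finally show ?thesis .
  qed
  let ?m2 = "measure_of (space ?P) (sets ?P) (\<lambda>X. R (indicator X))"
  have sets2: "sets ?m2 = sets ?P" by simp
  have m2: "emeasure ?m2 X = R (indicator X)" if "X \<in> sets ?P" for X
  proof (rule emeasure_measure_of[where \<Omega>="space ?P" and A="sets ?P"])
    show "?m2 = measure_of (space ?P) (sets ?P) (\<lambda>X. R (indicator X))" ..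
    show "sets ?P \<subseteq> Pow (space ?P)" by (rule sets.space_closed)
    show "X \<in> sets ?m2" using that by simp
    show "positive (sets ?m2) (\<lambda>X. R (indicator X))"
      by (simp add: positive_def R_def)
    show "countably_additive (sets ?m2) (\<lambda>X. R (indicator X))"
    proof (rule countably_additiveI)
      fix A :: "nat \<Rightarrow> ('w \<times> real \<times> (real^2)) set"
      assume A: "range A \<subseteq> sets ?m2" "disjoint_family A" "\<Union> (range A) \<in> sets ?m2"
      have "indicator (A i) \<in> borel_measurable ?P" for i using A(1) by auto
      from R_suminf[OF this] have "(\<Sum>i. R (indicator (A i))) = R (\<lambda>z. \<Sum>i. indicator (A i) z)" by simp
      also have "(\<lambda>z. \<Sum>i. indicator (A i) z :: ennreal) = indicator (\<Union> (range A))"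
        using A(2) by (intro ext suminf_indicator)
      finally show "(\<Sum>i. R (indicator (A i))) = R (indicator (\<Union> (range A)))" .
    qed
  qed
  have eq: "?m1 = ?m2"
  proof -
    let ?Eb = "{a \<times> b | a b. a \<in> sets (borel::real measure) \<and> b \<in> sets (borel::(real^2) measure)}"
    let ?G = "{a \<times> b | a b. a \<in> sets (F n) \<and> b \<in> ?Eb}"
    have FS: "a \<subseteq> space M" if "a \<in> sets (F n)" for a
      using sets.sets_into_space[OF that] by simp
    have sG: "sets ?P = sigma_sets (space ?P) ?G"
    proof -
      have "sets ?P = sets (sigma (space (F n) \<times> space (borel \<Otimes>\<^sub>M borel)) ?G)"
      proof (rule sets_pair_eq[where Ca="{space (F n)}" and Cb="{UNIV}"])
        show "sets (F n) \<subseteq> Pow (space (F n))" by (rule sets.space_closed)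
        show "sets (F n) = sigma_sets (space (F n)) (sets (F n))" by (rule sets.sigma_sets_eq[symmetric])
        show "?Eb \<subseteq> Pow (space (borel \<Otimes>\<^sub>M borel))" by (auto simp: space_pair_measure)
        show "sets ((borel::real measure) \<Otimes>\<^sub>M (borel::(real^2) measure)) = sigma_sets (space (borel \<Otimes>\<^sub>M borel)) ?Eb"
          by (simp add: sets_pair_measure space_pair_measure)
        have "(UNIV :: (real \<times> (real^2)) set) \<in> ?Eb"
          by (intro CollectI exI[of _ UNIV] conjI) simp_all
        then show "{UNIV} \<subseteq> ?Eb" by (rule insert_subsetI) simp
        show "{space (F n)} \<subseteq> sets (F n)" using sets.top[of "F n"] by simp
      qed (auto simp: space_pair_measure)
      also have "\<dots> = sigma_sets (space ?P) ?G"
        unfolding space_pair_measure[symmetric]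
        by (rule sets_measure_of) (auto simp: space_pair_measure dest!: FS)
      finally show ?thesis .
    qed
    have "Int_stable ?G"
    proof (rule Int_stableI)
      fix X Z assume "X \<in> ?G" "Z \<in> ?G"
      then obtain a p q c r s where X: "X = a \<times> (p \<times> q)" and Z: "Z = c \<times> (r \<times> s)"
        and s: "a \<in> sets (F n)" "c \<in> sets (F n)" "p \<in> sets borel" "r \<in> sets borel" "q \<in> sets borel" "s \<in> sets borel"
        by blast
      have "X \<inter> Z = (a \<inter> c) \<times> ((p \<inter> r) \<times> (q \<inter> s))" unfolding X Z by auto
      moreover have "(p \<inter> r) \<times> (q \<inter> s) \<in> ?Eb" using s by (intro CollectI exI[of _ "p \<inter> r"] exI[of _ "q \<inter> s"]) auto
      moreover have "a \<inter> c \<in> sets (F n)" using s by (intro sets.Int)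
      ultimately show "X \<inter> Z \<in> ?G" by blast
    qed
    moreover have "?G \<subseteq> Pow (space ?P)"
      by (auto simp: space_pair_measure dest!: FS)
    moreover have "emeasure ?m1 X = emeasure ?m2 X" if X: "X \<in> ?G" for X
    proof -
      obtain a p q where Xe: "X = a \<times> (p \<times> q)" and a [measurable]: "a \<in> sets (F n)"
        and [measurable]: "p \<in> sets borel" "q \<in> sets borel" using X by auto
      have aM: "a \<subseteq> space M" using sets.sets_into_space[OF a] by simp
      have XP [measurable]: "X \<in> sets ?P" unfolding Xe by measurable
      have "emeasure ?m1 X = (\<integral>\<^sup>+ z. indicator X z \<partial>?m1)" by simp
      also have "\<dots> = (\<integral>\<^sup>+ \<omega>. indicator {\<omega>. J (Suc n) \<omega> < \<infinity>} \<omega> * indicator X (?T \<omega>) \<partial>M)"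
        by (rule L) measurable
      also have "\<dots> = (\<integral>\<^sup>+ \<omega>. indicator {\<omega>\<in>a. J (Suc n) \<omega> < \<infinity> \<and> h \<omega> \<in> p \<and> jump n \<omega> \<in> q} \<omega> \<partial>M)"
        by (intro nn_integral_cong) (auto simp: Xe split: split_indicator)
      also have "\<dots> = emeasure M {\<omega>\<in>a. J (Suc n) \<omega> < \<infinity> \<and> h \<omega> \<in> p \<and> jump n \<omega> \<in> q}"
      proof -
        have [measurable]: "a \<in> sets M" using a sets_history_subset by blast
        show ?thesis by (rule nn_integral_indicator) measurable
      qed
      also have "\<dots> = (\<integral>\<^sup>+ \<omega>. indicator {\<omega>\<in>a. J n \<omega> < \<infinity>} \<omega> * (\<integral>\<^sup>+ s. ennreal (exp (- rate n \<omega> * s)) * indicator {0..} s * indicator p s \<partial>lborel)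
           * emeasure (K (Y n \<omega>)) q \<partial>M)"
        unfolding h_def by (rule law_rectangle) measurable
      also have "\<dots> = R (indicator X)"
        unfolding R_def
      proof (intro nn_integral_cong)
        fix \<omega> assume w: "\<omega> \<in> space M"
        have qK: "q \<in> sets (K (Y n \<omega>))" using kernel_sets[OF Y_in[OF w]] by simp
        have "(\<integral>\<^sup>+ s. ?w \<omega> s * (\<integral>\<^sup>+ y. indicator X (\<omega>, s, y) \<partial>K (Y n \<omega>)) \<partial>lborel)
          = (\<integral>\<^sup>+ s. ?w \<omega> s * (\<integral>\<^sup>+ y. (indicator a \<omega> * indicator p s) * indicator q y \<partial>K (Y n \<omega>)) \<partial>lborel)"
          by (intro nn_integral_cong arg_cong2[where f="(*)"] refl) (auto simp: Xe split: split_indicator)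
        also have "\<dots> = (\<integral>\<^sup>+ s. (indicator {\<omega>\<in>a. J n \<omega> < \<infinity>} \<omega> * emeasure (K (Y n \<omega>)) q) *
            (ennreal (exp (- rate n \<omega> * s)) * indicator {0..} s * indicator p s) \<partial>lborel)"
          using qK by (intro nn_integral_cong) (auto simp: nn_integral_cmult ac_simps split: split_indicator)
        also have "\<dots> = (indicator {\<omega>\<in>a. J n \<omega> < \<infinity>} \<omega> * emeasure (K (Y n \<omega>)) q) *
            (\<integral>\<^sup>+ s. ennreal (exp (- rate n \<omega> * s)) * indicator {0..} s * indicator p s \<partial>lborel)"
          by (rule nn_integral_cmult) measurable
        finally show "indicator {\<omega>\<in>a. J n \<omega> < \<infinity>} \<omega> * (\<integral>\<^sup>+ s. ennreal (exp (- rate n \<omega> * s)) * indicator {0..} s * indicator p s \<partial>lborel)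
           * emeasure (K (Y n \<omega>)) q = (\<integral>\<^sup>+ s. ?w \<omega> s * (\<integral>\<^sup>+ y. indicator X (\<omega>, s, y) \<partial>K (Y n \<omega>)) \<partial>lborel)"
          by (simp add: ac_simps)
      qed
      finally show ?thesis using m2[OF XP] by simp
    qed
    moreover have "emeasure ?m1 (space ?P) \<noteq> \<infinity>"
    proof -
      have "emeasure ?m1 (space ?P) = (\<integral>\<^sup>+ z. 1 \<partial>?m1)" by simp
      also have "\<dots> = (\<integral>\<^sup>+ \<omega>. indicator {\<omega>. J (Suc n) \<omega> < \<infinity>} \<omega> * 1 \<partial>M)" by (rule L) simp
      also have "\<dots> \<le> (\<integral>\<^sup>+ \<omega>. 1 \<partial>M)" by (intro nn_integral_mono) (auto split: split_indicator)
      finally show ?thesis by (auto simp: emeasure_space_1 top_unique)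
    qed
    moreover have "space ?P \<in> ?G"
    proof -
      have "space ?P = space (F n) \<times> (UNIV \<times> UNIV)" by (simp add: space_pair_measure)
      moreover have "(UNIV::real set) \<times> (UNIV::(real^2) set) \<in> ?Eb"
        by (intro CollectI exI[of _ UNIV] conjI) simp_all
      ultimately show ?thesis
        by (intro CollectI exI[of _ "space (F n)"] exI[of _ "UNIV \<times> UNIV"] conjI sets.top) simp_all
    qed
    ultimately show ?thesis
      using sG sets2
      by (intro measure_eqI_generator_eq[where E="?G" and \<Omega>="space ?P" and A="\<lambda>_. space ?P"]) auto
  qed
  have ind: "integral\<^sup>N ?m2 g = R g" if "g \<in> borel_measurable ?P" for g
    using that
  proof (induction g rule: borel_measurable_induct)
    case (cong g' g)
    have "g' (\<omega>, s, y) = g (\<omega>, s, y)" if "\<omega> \<in> space M" for \<omega> s y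
      using cong(3)[of "(\<omega>, s, y)"] that by (auto simp: space_pair_measure)
    then have "R g' = R g" unfolding R_def by (intro nn_integral_cong) simp
    moreover have "integral\<^sup>N ?m2 g' = integral\<^sup>N ?m2 g"
      by (intro nn_integral_cong cong(3)) simp
    ultimately show ?case using cong(4) by simp
  next
    case (set X)
    then show ?case using m2[OF set] by simp
  next
    case (mult g c)
    then show ?case by (simp add: nn_integral_cmult R_cmult cong: measurable_cong_sets)
  next
    case (add u v)
    let ?g = "\<lambda>i::nat. if i = 0 then u else if i = 1 then v else (\<lambda>_. 0)"
    have s2: "(\<Sum>i. (if i = 0 then a else if i = Suc 0 then b else 0)) = a + (b::ennreal)" for a b
      by (subst suminf_finite[of "{0, 1}"]) auto
    have R0: "R (\<lambda>_. 0) = 0" by (simp add: R_def)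
    have "R (\<lambda>z. \<Sum>i. ?g i z) = (\<Sum>i. R (?g i))"
      using add by (intro R_suminf) auto
    moreover have "(\<lambda>z. \<Sum>i. ?g i z) = (\<lambda>z. v z + u z)"
      by (simp add: if_distrib[of "\<lambda>f. f _"] s2 add.commute cong: if_cong)
    moreover have "(\<Sum>i. R (?g i)) = R u + R v"
      by (simp add: if_distrib[of R] R0 s2 cong: if_cong)
    ultimately show ?case using add by (simp add: nn_integral_add add.commute cong: measurable_cong_sets)
  next
    case (seq U)
    have U [measurable]: "\<And>i. U i \<in> borel_measurable ?P" by fact
    have inc: "incseq U" by fact
    have incp: "incseq (\<lambda>i. U i z)" for z
      using inc unfolding incseq_def le_fun_def by blast
    have "R (\<lambda>z. \<Squnion>i. U i z) = (\<integral>\<^sup>+ \<omega>. (\<integral>\<^sup>+ s. (\<Squnion>i. ?w \<omega> s * (\<integral>\<^sup>+ y. U i (\<omega>, s, y) \<partial>K (Y n \<omega>))) \<partial>lborel) \<partial>M)"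
      unfolding R_def
    proof (intro nn_integral_cong)
      fix \<omega> s assume w: "\<omega> \<in> space M"
      have "(\<integral>\<^sup>+ y. (\<Squnion>i. U i (\<omega>, s, y)) \<partial>K (Y n \<omega>)) = (\<Squnion>i. \<integral>\<^sup>+ y. U i (\<omega>, s, y) \<partial>K (Y n \<omega>))"
      proof (rule nn_integral_monotone_convergence_SUP)
        show "incseq (\<lambda>i y. U i (\<omega>, s, y))" using inc unfolding incseq_def le_fun_def by blast
        show "(\<lambda>y. U i (\<omega>, s, y)) \<in> borel_measurable (K (Y n \<omega>))" for i by (rule gK[OF U w])
      qed
      then show "?w \<omega> s * (\<integral>\<^sup>+ y. (\<Squnion>i. U i (\<omega>, s, y)) \<partial>K (Y n \<omega>)) = (\<Squnion>i. ?w \<omega> s * (\<integral>\<^sup>+ y. U i (\<omega>, s, y) \<partial>K (Y n \<omega>)))"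
        by (simp add: SUP_mult_left_ennreal)
    qed
    also have "\<dots> = (\<integral>\<^sup>+ \<omega>. (\<Squnion>i. \<integral>\<^sup>+ s. ?w \<omega> s * (\<integral>\<^sup>+ y. U i (\<omega>, s, y) \<partial>K (Y n \<omega>)) \<partial>lborel) \<partial>M)"
      using incp by (intro nn_integral_cong nn_integral_monotone_convergence_SUP borel_measurable_times_ennreal wm slice U)
        (auto simp: incseq_def le_fun_def intro!: mult_left_mono nn_integral_mono)
    also have "\<dots> = (\<Squnion>i. R (U i))"
      unfolding R_def using incp by (intro nn_integral_monotone_convergence_SUP outer U)
        (auto simp: incseq_def le_fun_def intro!: mult_left_mono nn_integral_mono)
    finally have RS: "R (\<Squnion>i. U i) = (\<Squnion>i. R (U i))"
      by (simp add: SUP_apply[abs_def] image_image cong: SUP_cong)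
    have IS: "integral\<^sup>N ?m2 (\<Squnion>i. U i) = (\<Squnion>i. integral\<^sup>N ?m2 (U i))"
    proof -
      have "(\<Squnion>i. U i) = (\<lambda>z. \<Squnion>i. U i z)" by (simp add: fun_eq_iff image_image)
      moreover have "(\<integral>\<^sup>+ z. (\<Squnion>i. U i z) \<partial>?m2) = (\<Squnion>i. integral\<^sup>N ?m2 (U i))"
        using inc U by (intro nn_integral_monotone_convergence_SUP) (simp_all cong: measurable_cong_sets)
      ultimately show ?thesis by simp
    qed
    have IH: "integral\<^sup>N ?m2 (U i) = R (U i)" for i using seq by blast
    show ?case by (simp only: IS IH RS)
  qed
  have "integral\<^sup>N ?m1 f = integral\<^sup>N ?m2 f" using eq by (rule arg_cong)
  also have "\<dots> = R f" by (rule ind[OF f])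
  finally show ?thesis unfolding L[OF f] unfolding R_def .
qed

lemma real_J_measurable [measurable]: "(\<lambda>\<omega>. real_of_ereal (J n \<omega>)) \<in> borel_measurable (F n)"
  by (intro borel_measurable_real_of_ereal measurable_history(1) order_refl)

text \<open>At \<open>t = 0\<close> and with all jumps allowed, the law gives a further jump conditional probability \<open>q / q = 1\<close>.\<close>

lemma AE_jump_if_rate_pos:
  "AE \<omega> in M. J n \<omega> < \<infinity> \<longrightarrow> rate n \<omega> > 0 \<longrightarrow> J (Suc n) \<omega> < \<infinity>"
proof -
  note [measurable] = measurable_history[of n n, OF order_refl]
  let ?E = "{\<omega>\<in>space (F n). J n \<omega> < \<infinity> \<and> rate n \<omega> > 0}"
  have E [measurable]: "?E \<in> sets (F n)" by measurable
  have EM [measurable]: "?E \<in> sets M" using E sets_history_subset by blast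
  have "measure M {\<omega>\<in>?E. J n \<omega> + ereal 0 < J (Suc n) \<omega> \<and> J (Suc n) \<omega> < \<infinity> \<and> jump n \<omega> \<in> UNIV}
     = (LINT \<omega>:{\<omega>\<in>?E. J n \<omega> < \<infinity>}|M. exp (- rate n \<omega> * 0) * (rate n \<omega> / rate n \<omega>))"
    by (rule law[OF E]) auto
  also have "\<dots> = (LINT \<omega>|M. indicator ?E \<omega>)"
    unfolding set_lebesgue_integral_def
    by (intro Bochner_Integration.integral_cong) (auto split: split_indicator)
  also have "\<dots> = measure M ?E" using EM sets.sets_into_space[OF EM] by (simp add: Int_absorb2)
  also have "{\<omega>\<in>?E. J n \<omega> + ereal 0 < J (Suc n) \<omega> \<and> J (Suc n) \<omega> < \<infinity> \<and> jump n \<omega> \<in> UNIV}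
     = {\<omega>\<in>?E. J (Suc n) \<omega> < \<infinity>}"
    using J_strict by auto
  finally have "measure M (?E - {\<omega>\<in>?E. J (Suc n) \<omega> < \<infinity>}) = 0"
    by (subst finite_measure_Diff) auto
  then have "AE \<omega> in M. \<omega> \<notin> ?E - {\<omega>\<in>?E. J (Suc n) \<omega> < \<infinity>}"
    by (intro AE_not_in) (auto simp: emeasure_eq_measure null_sets_def)
  then show ?thesis by (rule AE_mp) (auto intro!: AE_I2)
qed

text \<open>With \<open>q\<close> the rate, \<open>exp (- q * s)\<close> is the integral of \<open>q * exp (- q * r)\<close> over \<open>r \<ge> s\<close>: the probability
  density of a jump at \<open>s\<close> is the rate times the probability that the holding time exceeds \<open>s\<close>. So the law of holding
  time and jump, applied to \<open>f\<close> and then to the integral of \<open>f\<close> over the holding interval, gives the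
  same value.\<close>

lemma compensation_formula:
  fixes f :: "'w \<times> real \<times> (real^2) \<Rightarrow> ennreal"
  assumes f [measurable]: "f \<in> borel_measurable (F n \<Otimes>\<^sub>M (borel \<Otimes>\<^sub>M borel))"
  shows "(\<integral>\<^sup>+ \<omega>. indicator {\<omega>. J (Suc n) \<omega> < \<infinity>} \<omega> * f (\<omega>, real_of_ereal (J (Suc n) \<omega>), jump n \<omega>) \<partial>M) =
    (\<integral>\<^sup>+ \<omega>. (\<integral>\<^sup>+ s. indicator {s. J n \<omega> \<le> ereal s \<and> ereal s < J (Suc n) \<omega>} s
       * (\<integral>\<^sup>+ y. f (\<omega>, s, y) \<partial>K (Y n \<omega>)) \<partial>lborel) \<partial>M)"
proof -
  let ?P = "F n \<Otimes>\<^sub>M ((borel::real measure) \<Otimes>\<^sub>M (borel::(real^2) measure))"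
  define j where "j = (\<lambda>\<omega>. real_of_ereal (J n \<omega>))"
  define h where "h = (\<lambda>\<omega>. real_of_ereal (J (Suc n) \<omega>) - real_of_ereal (J n \<omega>))"
  have j [measurable]: "j \<in> borel_measurable (F n)" unfolding j_def by (rule real_J_measurable)
  define \<psi> where "\<psi> = (\<lambda>\<omega> s. \<integral>\<^sup>+ y. f (\<omega>, s + j \<omega>, y) \<partial>K (Y n \<omega>))"
  have psi [measurable]: "(\<lambda>z. \<psi> (fst z) (snd z)) \<in> borel_measurable (F n \<Otimes>\<^sub>M borel)"
    unfolding \<psi>_def
  proof (rule measurable_nn_integral_finite_kernel[OF kernel])
    show "(\<lambda>z. Y n (fst z)) \<in> F n \<Otimes>\<^sub>M borel \<rightarrow>\<^sub>M restrict_space borel I"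
      by (rule measurable_compose[OF measurable_fst measurable_history_state])
    show "(\<lambda>(z, y). f (fst z, snd z + j (fst z), y)) \<in> borel_measurable ((F n \<Otimes>\<^sub>M borel) \<Otimes>\<^sub>M borel)"
      unfolding case_prod_beta by measurable
  qed
  have psi_slice [measurable]: "\<psi> \<omega> \<in> borel_measurable borel" if "\<omega> \<in> space M" for \<omega>
    using measurable_compose[OF measurable_Pair1'[of \<omega> "F n" borel] psi] that by simp
  let ?f0 = "\<lambda>z. f (fst z, fst (snd z) + j (fst z), snd (snd z))"
  let ?g = "\<lambda>z. \<integral>\<^sup>+ s. indicator {s. 0 \<le> s \<and> s < fst (snd z)} s * \<psi> (fst z) s \<partial>lborel"
  have f0: "?f0 \<in> borel_measurable ?P" by measurable
  have g: "?g \<in> borel_measurable ?P"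
  proof (rule lborel.borel_measurable_nn_integral)
    have [measurable]: "(\<lambda>w::('w \<times> real \<times> (real^2)) \<times> real. \<psi> (fst (fst w)) (snd w)) \<in> borel_measurable (?P \<Otimes>\<^sub>M lborel)"
      by (rule measurable_compose[OF _ psi, of "\<lambda>w. (fst (fst w), snd w)", simplified]) measurable
    have "(\<lambda>w::('w \<times> real \<times> (real^2)) \<times> real. indicator {w. 0 \<le> snd w \<and> snd w < fst (snd (fst w))} w * \<psi> (fst (fst w)) (snd w))
        \<in> borel_measurable (?P \<Otimes>\<^sub>M lborel)"
      by measurable
    then show "(\<lambda>(z, s). indicator {s. 0 \<le> s \<and> s < fst (snd z)} s * \<psi> (fst z) s) \<in> borel_measurable (?P \<Otimes>\<^sub>M lborel)"
      by (simp add: case_prod_beta indicator_def)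
  qed
  have fin: "J n \<omega> < \<infinity>" "J n \<omega> = ereal (j \<omega>)" "J (Suc n) \<omega> = ereal (j \<omega> + h \<omega>)" "h \<omega> > 0" "j \<omega> \<ge> 0"
    if w: "\<omega> \<in> space M" and fin: "J (Suc n) \<omega> < \<infinity>" for \<omega>
  proof -
    have "0 \<le> J n \<omega>" "J n \<omega> < J (Suc n) \<omega>"
      using J_nonneg[OF w] J_strict[OF w le_less_trans[OF J_mono[OF w] fin]] by auto
    then obtain a b where "J n \<omega> = ereal a" "J (Suc n) \<omega> = ereal b" "0 \<le> a" "a < b"
      using fin by (cases "J n \<omega>"; cases "J (Suc n) \<omega>") auto
    then show "J n \<omega> < \<infinity>" "J n \<omega> = ereal (j \<omega>)" "J (Suc n) \<omega> = ereal (j \<omega> + h \<omega>)" "h \<omega> > 0" "j \<omega> \<ge> 0"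
      by (auto simp: j_def h_def)
  qed
  \<comment> \<open>An absorbing state has a kernel of mass zero, so both sides vanish there.\<close>
  have psi0: "\<psi> \<omega> s = 0" if "\<omega> \<in> space M" "rate n \<omega> = 0" for \<omega> s
    unfolding \<psi>_def using that
    by (intro nn_integral_zero_mass) (simp add: emeasure_kernel[OF Y_in] kernel_space[OF Y_in])
  have "(\<integral>\<^sup>+ \<omega>. indicator {\<omega>. J (Suc n) \<omega> < \<infinity>} \<omega> * f (\<omega>, real_of_ereal (J (Suc n) \<omega>), jump n \<omega>) \<partial>M)
      = (\<integral>\<^sup>+ \<omega>. indicator {\<omega>. J (Suc n) \<omega> < \<infinity>} \<omega> * ?f0 (\<omega>, h \<omega>, jump n \<omega>) \<partial>M)"
    by (intro nn_integral_cong) (auto simp: fin add.commute split: split_indicator)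
  also have "\<dots> = (\<integral>\<^sup>+ \<omega>. (\<integral>\<^sup>+ s. indicator {\<omega>. J n \<omega> < \<infinity>} \<omega> * (ennreal (exp (- rate n \<omega> * s)) * indicator {0..} s)
       * \<psi> \<omega> s \<partial>lborel) \<partial>M)"
    using holding_and_jump_formula[OF f0] by (simp add: h_def \<psi>_def)
  also have "\<dots> = (\<integral>\<^sup>+ \<omega>. (\<integral>\<^sup>+ r. indicator {\<omega>. J n \<omega> < \<infinity>} \<omega> * (ennreal (exp (- rate n \<omega> * r)) * indicator {0..} r)
       * (\<integral>\<^sup>+ y. ?g (\<omega>, r, y) \<partial>K (Y n \<omega>)) \<partial>lborel) \<partial>M)"
  proof (rule nn_integral_cong)
    fix \<omega> assume w: "\<omega> \<in> space M"
    let ?q = "rate n \<omega>" let ?i = "indicator {\<omega>. J n \<omega> < \<infinity>} \<omega> :: ennreal"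
    note [measurable] = psi_slice[OF w]
    show "(\<integral>\<^sup>+ s. ?i * (ennreal (exp (- ?q * s)) * indicator {0..} s) * \<psi> \<omega> s \<partial>lborel)
      = (\<integral>\<^sup>+ r. ?i * (ennreal (exp (- ?q * r)) * indicator {0..} r) * (\<integral>\<^sup>+ y. ?g (\<omega>, r, y) \<partial>K (Y n \<omega>)) \<partial>lborel)"
    proof (cases "?q = 0")
      case True
      then show ?thesis using psi0[OF w] by simp
    next
      case False
      then have q: "?q > 0" by (simp add: less_le measure_nonneg)
      have "(\<integral>\<^sup>+ r. ?i * (ennreal (exp (- ?q * r)) * indicator {0..} r) * (\<integral>\<^sup>+ y. ?g (\<omega>, r, y) \<partial>K (Y n \<omega>)) \<partial>lborel)
         = (\<integral>\<^sup>+ r. (\<integral>\<^sup>+ s. ?i * (ennreal (exp (- ?q * r)) * indicator {0..} r) * ennreal ?q * (indicator {s. 0 \<le> s \<and> s < r} s * \<psi> \<omega> s) \<partial>lborel) \<partial>lborel)"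
      proof (intro nn_integral_cong)
        fix r :: real
        let ?G = "\<integral>\<^sup>+ s. indicator {s. 0 \<le> s \<and> s < r} s * \<psi> \<omega> s \<partial>lborel"
        let ?c = "?i * (ennreal (exp (- ?q * r)) * indicator {0..} r)"
        have "(\<integral>\<^sup>+ y. ?g (\<omega>, r, y) \<partial>K (Y n \<omega>)) = ennreal ?q * ?G"
          by (simp add: kernel_space[OF Y_in[OF w]] emeasure_kernel[OF Y_in[OF w]] mult.commute)
        moreover have "(\<integral>\<^sup>+ s. ?c * ennreal ?q * (indicator {s. 0 \<le> s \<and> s < r} s * \<psi> \<omega> s) \<partial>lborel) = ?c * ennreal ?q * ?G"
          by (rule nn_integral_cmult) measurable
        ultimately show "?c * (\<integral>\<^sup>+ y. ?g (\<omega>, r, y) \<partial>K (Y n \<omega>))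
            = (\<integral>\<^sup>+ s. ?c * ennreal ?q * (indicator {s. 0 \<le> s \<and> s < r} s * \<psi> \<omega> s) \<partial>lborel)"
          by (simp only: mult.assoc)
      qed
      \<comment> \<open>The order of integration is exchanged so that the inner integral is the tail of the holding time.\<close>
      also have "\<dots> = (\<integral>\<^sup>+ s. (\<integral>\<^sup>+ r. ?i * (ennreal (exp (- ?q * r)) * indicator {0..} r) * ennreal ?q * (indicator {s. 0 \<le> s \<and> s < r} s * \<psi> \<omega> s) \<partial>lborel) \<partial>lborel)"
      proof (rule lborel_pair.Fubini')
        have "(\<lambda>p::real \<times> real. ?i * (ennreal (exp (- ?q * snd p)) * indicator {0..} (snd p)) * ennreal ?q * (indicator {p. 0 \<le> fst p \<and> fst p < snd p} p * \<psi> \<omega> (fst p)))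
           \<in> borel_measurable (lborel \<Otimes>\<^sub>M lborel)"
          by measurable
        then show "(\<lambda>(s, r). ?i * (ennreal (exp (- ?q * r)) * indicator {0..} r) * ennreal ?q * (indicator {s. 0 \<le> s \<and> s < r} s * \<psi> \<omega> s))
           \<in> borel_measurable (lborel \<Otimes>\<^sub>M lborel)"
          by (simp add: case_prod_beta indicator_def)
      qed
      also have "\<dots> = (\<integral>\<^sup>+ s. ?i * (ennreal (exp (- ?q * s)) * indicator {0..} s) * \<psi> \<omega> s \<partial>lborel)"
      proof (intro nn_integral_cong)
        fix s :: real
        have "(\<integral>\<^sup>+ r. ?i * (ennreal (exp (- ?q * r)) * indicator {0..} r) * ennreal ?q * (indicator {s. 0 \<le> s \<and> s < r} s * \<psi> \<omega> s) \<partial>lborel)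
          = (\<integral>\<^sup>+ r. (?i * ennreal ?q * indicator {0..} s * \<psi> \<omega> s) * (ennreal (exp (- ?q * r)) * indicator {s..} r) \<partial>lborel)"
        proof (rule nn_integral_cong_AE)
          have "AE r in lborel. r \<noteq> s" by (rule AE_lborel_singleton)
          then show "AE r in lborel. ?i * (ennreal (exp (- ?q * r)) * indicator {0..} r) * ennreal ?q * (indicator {s. 0 \<le> s \<and> s < r} s * \<psi> \<omega> s)
            = (?i * ennreal ?q * indicator {0..} s * \<psi> \<omega> s) * (ennreal (exp (- ?q * r)) * indicator {s..} r)"
            by eventually_elim (auto simp: ac_simps split: split_indicator)
        qed
        also have "\<dots> = (?i * ennreal ?q * indicator {0..} s * \<psi> \<omega> s) * ennreal (exp (- ?q * s) / ?q)"
          by (subst nn_integral_cmult) (simp_all only: nn_integral_exp_tail[OF q], measurable)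
        also have "\<dots> = ?i * indicator {0..} s * \<psi> \<omega> s * (ennreal ?q * ennreal (exp (- ?q * s) / ?q))"
          by (simp add: ac_simps)
        also have "ennreal ?q * ennreal (exp (- ?q * s) / ?q) = ennreal (exp (- ?q * s))"
          using q by (subst ennreal_mult[symmetric]) auto
        finally show "(\<integral>\<^sup>+ r. ?i * (ennreal (exp (- ?q * r)) * indicator {0..} r) * ennreal ?q * (indicator {s. 0 \<le> s \<and> s < r} s * \<psi> \<omega> s) \<partial>lborel)
          = ?i * (ennreal (exp (- ?q * s)) * indicator {0..} s) * \<psi> \<omega> s"
          by (simp add: ac_simps)
      qed
      finally show ?thesis by simp
    qed
  qed
  also have "\<dots> = (\<integral>\<^sup>+ \<omega>. indicator {\<omega>. J (Suc n) \<omega> < \<infinity>} \<omega> * ?g (\<omega>, h \<omega>, jump n \<omega>) \<partial>M)"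
    using holding_and_jump_formula[OF g] by (simp add: h_def)
  also have "\<dots> = (\<integral>\<^sup>+ \<omega>. (\<integral>\<^sup>+ s. indicator {s. J n \<omega> \<le> ereal s \<and> ereal s < J (Suc n) \<omega>} s
       * (\<integral>\<^sup>+ y. f (\<omega>, s, y) \<partial>K (Y n \<omega>)) \<partial>lborel) \<partial>M)"
  proof (rule nn_integral_cong_AE)
    show "AE \<omega> in M. indicator {\<omega>. J (Suc n) \<omega> < \<infinity>} \<omega> * ?g (\<omega>, h \<omega>, jump n \<omega>)
      = (\<integral>\<^sup>+ s. indicator {s. J n \<omega> \<le> ereal s \<and> ereal s < J (Suc n) \<omega>} s * (\<integral>\<^sup>+ y. f (\<omega>, s, y) \<partial>K (Y n \<omega>)) \<partial>lborel)"
      using AE_jump_if_rate_pos[of n] AE_space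
    proof eventually_elim
      case (elim \<omega>)
      then have w: "\<omega> \<in> space M" by simp
      let ?ff = "\<lambda>s. \<integral>\<^sup>+ y. f (\<omega>, s, y) \<partial>K (Y n \<omega>)"
      note [measurable] = psi_slice[OF w]
      show ?case
      proof (cases "J (Suc n) \<omega> < \<infinity>")
        case True
        have ffm [measurable]: "?ff \<in> borel_measurable borel"
        proof -
          have "(\<lambda>s. \<psi> \<omega> (s - j \<omega>)) \<in> borel_measurable borel" by measurable
          then show ?thesis by (simp add: \<psi>_def)
        qed
        have "(\<integral>\<^sup>+ s. indicator {s. J n \<omega> \<le> ereal s \<and> ereal s < J (Suc n) \<omega>} s * ?ff s \<partial>lborel)
          = (\<integral>\<^sup>+ s. indicator {j \<omega>..<j \<omega> + h \<omega>} s * ?ff s \<partial>lborel)"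
          by (intro nn_integral_cong) (auto simp: fin[OF w True] split: split_indicator)
        also have "\<dots> = (\<integral>\<^sup>+ s. indicator {j \<omega>..<j \<omega> + h \<omega>} (j \<omega> + 1 * s) * ?ff (j \<omega> + 1 * s) \<partial>lborel)"
          by (subst nn_integral_real_affine[where t="j \<omega>" and c=1]) auto
        also have "\<dots> = ?g (\<omega>, h \<omega>, jump n \<omega>)"
          by (intro nn_integral_cong) (auto simp: \<psi>_def add.commute split: split_indicator)
        finally show ?thesis using True by simp
      next
        case False
        have z: "indicator {s. J n \<omega> \<le> ereal s \<and> ereal s < J (Suc n) \<omega>} s * ?ff s = 0" for s
        proof (cases "J n \<omega> < \<infinity>")
          case True
          then have "rate n \<omega> = 0" using elim False by (auto simp: less_le measure_nonneg)
          then have "?ff s = 0"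
            by (intro nn_integral_zero_mass) (simp add: emeasure_kernel[OF Y_in[OF w]] kernel_space[OF Y_in[OF w]])
          then show ?thesis by simp
        qed auto
        then show ?thesis using False by (simp only: z nn_integral_const) simp
      qed
    qed
  qed
  finally show ?thesis .
qed

end

lemma borel_measurable_vec_nth [measurable (raw)]:
  fixes f :: "'a \<Rightarrow> real^'n"
  assumes "f \<in> borel_measurable N"
  shows "(\<lambda>x. f x $ i) \<in> borel_measurable N"
  by (rule measurable_compose[OF assms])
    (intro borel_measurable_continuous_onI continuous_intros)

text \<open>A jump time truncated to the window from \<open>t0\<close> to \<open>t\<close>. Holding intervals become bounded real intervals
  in this way, also if the next jump never happens.\<close>

definition clip :: "real \<Rightarrow> real \<Rightarrow> ereal \<Rightarrow> real" where
  "clip t0 t a = (if a \<le> ereal t0 then t0 else if ereal t \<le> a then t else real_of_ereal a)"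

lemma clip_measurable [measurable]: "clip t0 t \<in> borel_measurable borel"
  unfolding clip_def[abs_def] by measurable

lemma clip_bounds:
  assumes "t0 \<le> t"
  shows "t0 \<le> clip t0 t a" "clip t0 t a \<le> t"
  using assms by (cases a; auto simp: clip_def)+

lemma clip_mono:
  assumes "t0 \<le> t" "a \<le> b"
  shows "clip t0 t a \<le> clip t0 t b"
  using assms by (cases a; cases b) (auto simp: clip_def)

lemma clip_less_iff: "t0 < s \<Longrightarrow> s < t \<Longrightarrow> s < clip t0 t a \<longleftrightarrow> ereal s < a"
  by (cases a) (auto simp: clip_def)

lemma clip_le_iff: "t0 < s \<Longrightarrow> s < t \<Longrightarrow> clip t0 t a \<le> s \<longleftrightarrow> a \<le> ereal s"
  by (cases a) (auto simp: clip_def)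

lemma AE_clip_interval:
  assumes "t0 \<le> t"
  shows "AE s in lborel. s \<in> {clip t0 t a..clip t0 t b} \<longleftrightarrow> a \<le> ereal s \<and> ereal s < b \<and> t0 < s \<and> s \<le> t"
proof -
  have "AE s in lborel. s \<noteq> t0 \<and> s \<noteq> t \<and> s \<noteq> clip t0 t b"
    by (intro AE_conjI AE_lborel_singleton)
  then show ?thesis
  proof eventually_elim
    case (elim s)
    show ?case
    proof (cases "t0 < s \<and> s < t")
      case True
      then show ?thesis
        using elim clip_le_iff[of t0 s t a] clip_less_iff[of t0 s t b] by (auto simp: le_less)
    next
      case False
      then show ?thesis
        using elim clip_bounds[OF assms, of a] clip_bounds[OF assms, of b] by auto
    qed
  qed
qed

context jump_process
begin

lemma kernel_nn_integral_measurable: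
  fixes f :: "'w \<times> real \<times> (real^2) \<Rightarrow> ennreal"
  assumes [measurable]: "f \<in> borel_measurable (F n \<Otimes>\<^sub>M (borel \<Otimes>\<^sub>M borel))"
  shows "(\<lambda>z. \<integral>\<^sup>+ y. f (fst z, snd z, y) \<partial>K (Y n (fst z))) \<in> borel_measurable (F n \<Otimes>\<^sub>M borel)"
proof (rule measurable_nn_integral_finite_kernel[OF kernel])
  show "(\<lambda>z. Y n (fst z)) \<in> F n \<Otimes>\<^sub>M borel \<rightarrow>\<^sub>M restrict_space borel I"
    by (rule measurable_compose[OF measurable_fst measurable_history_state])
  show "(\<lambda>(z, y). f (fst z, snd z, y)) \<in> borel_measurable ((F n \<Otimes>\<^sub>M borel) \<Otimes>\<^sub>M borel)"
    unfolding case_prod_beta by measurable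
qed

lemma section_measurable:
  assumes "f \<in> F n \<Otimes>\<^sub>M (borel \<Otimes>\<^sub>M borel) \<rightarrow>\<^sub>M N" "\<omega> \<in> space M"
  shows "(\<lambda>y. f (\<omega>, s, y)) \<in> K (Y n \<omega>) \<rightarrow>\<^sub>M N"
proof -
  have "(\<lambda>y. (\<omega>, s, y)) \<in> borel \<rightarrow>\<^sub>M F n \<Otimes>\<^sub>M (borel \<Otimes>\<^sub>M borel)"
    using assms(2) by (intro measurable_Pair) auto
  from measurable_compose[OF this assms(1)] show ?thesis
    using kernel_sets[OF Y_in[OF assms(2)]] by (simp cong: measurable_cong_sets)
qed

text \<open>Positive and negative parts of a bounded integrand have finite compensators, because the rate
  is bounded on its support and the window has finite length.\<close>

lemma compensation_formula_bounded:
  fixes \<phi> :: "'w \<times> real \<times> (real^2) \<Rightarrow> real"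
  assumes phi [measurable]: "\<phi> \<in> borel_measurable (F n \<Otimes>\<^sub>M (borel \<Otimes>\<^sub>M borel))"
    and t: "t0 \<le> t" and q: "q \<ge> 0"
    and bd: "\<And>\<omega> s y. \<omega> \<in> space M \<Longrightarrow> \<bar>\<phi> (\<omega>, s, y)\<bar> \<le> c"
    and supp: "\<And>\<omega> s y. \<omega> \<in> space M \<Longrightarrow> \<phi> (\<omega>, s, y) \<noteq> 0 \<Longrightarrow> t0 < s \<and> s \<le> t \<and> rate n \<omega> \<le> q"
  defines "Nj \<equiv> \<lambda>\<omega>. indicator {\<omega>. J (Suc n) \<omega> < \<infinity>} \<omega> * \<phi> (\<omega>, real_of_ereal (J (Suc n) \<omega>), jump n \<omega>)"
    and "Cj \<equiv> \<lambda>\<omega>. LINT s:{clip t0 t (J n \<omega>)..clip t0 t (J (Suc n) \<omega>)}|lborel. (\<integral>y. \<phi> (\<omega>, s, y) \<partial>K (Y n \<omega>))"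
  shows "integrable M Nj" and "integrable M Cj" and "(\<integral>\<omega>. Nj \<omega> \<partial>M) = (\<integral>\<omega>. Cj \<omega> \<partial>M)"
    and "\<And>\<omega>. \<omega> \<in> space M \<Longrightarrow> set_integrable lborel {clip t0 t (J n \<omega>)..clip t0 t (J (Suc n) \<omega>)} (\<lambda>s. \<integral>y. \<phi> (\<omega>, s, y) \<partial>K (Y n \<omega>))"
proof -
  let ?P = "F n \<Otimes>\<^sub>M ((borel::real measure) \<Otimes>\<^sub>M (borel::(real^2) measure))"
  define e where "e = (\<lambda>(\<psi> :: 'w \<times> real \<times> (real^2) \<Rightarrow> real) \<omega> s. \<integral>\<^sup>+ y. ennreal (\<psi> (\<omega>, s, y)) \<partial>K (Y n \<omega>))"
  define G where "G = (\<lambda>\<psi> \<omega>. \<integral>\<^sup>+ s. indicator {s. J n \<omega> \<le> ereal s \<and> ereal s < J (Suc n) \<omega>} s * e \<psi> \<omega> s \<partial>lborel)"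
  let ?I = "\<lambda>\<omega>. {clip t0 t (J n \<omega>)..clip t0 t (J (Suc n) \<omega>)}"
  let ?good = "\<lambda>\<psi>. \<psi> \<in> borel_measurable ?P \<and> (\<forall>\<omega> s y. \<omega> \<in> space M \<longrightarrow> \<bar>\<psi> (\<omega>, s, y)\<bar> \<le> c
     \<and> (\<psi> (\<omega>, s, y) \<noteq> 0 \<longrightarrow> t0 < s \<and> s \<le> t \<and> rate n \<omega> \<le> q))"
  have c0: "c \<ge> 0"
  proof -
    obtain \<omega> where "\<omega> \<in> space M" using not_empty by auto
    from bd[OF this, of 0 0] show ?thesis by linarith
  qed
  have em [measurable]: "(\<lambda>z. e \<psi> (fst z) (snd z)) \<in> borel_measurable (F n \<Otimes>\<^sub>M borel)" if "?good \<psi>" for \<psi>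
  proof -
    have [measurable]: "\<psi> \<in> borel_measurable ?P" using that by blast
    show ?thesis unfolding e_def by (rule kernel_nn_integral_measurable) measurable
  qed
  have em1: "e \<psi> \<omega> \<in> borel_measurable lborel" if "?good \<psi>" "\<omega> \<in> space M" for \<psi> \<omega>
    using measurable_compose[OF measurable_Pair1'[of \<omega> "F n" borel] em[OF that(1)]] that(2) by simp
  have eb: "e \<psi> \<omega> s \<le> ennreal (c * q) * indicator {t0..t} s" if g: "?good \<psi>" and w: "\<omega> \<in> space M" for \<psi> \<omega> s
  proof (cases "t0 < s \<and> s \<le> t \<and> rate n \<omega> \<le> q")
    case True
    have "e \<psi> \<omega> s \<le> (\<integral>\<^sup>+ y. ennreal c \<partial>K (Y n \<omega>))"
      unfolding e_def
    proof (intro nn_integral_mono ennreal_leI)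
      show "\<psi> (\<omega>, s, y) \<le> c" for y using g w abs_le_D1 by blast
    qed
    also have "\<dots> = ennreal (c * rate n \<omega>)"
      using c0 by (simp add: kernel_space[OF Y_in[OF w]] emeasure_kernel[OF Y_in[OF w]] ennreal_mult measure_nonneg)
    also have "\<dots> \<le> ennreal (c * q)" using True c0 by (intro ennreal_leI mult_left_mono) auto
    finally show ?thesis using True by simp
  next
    case False
    have "\<psi> (\<omega>, s, y) = 0" for y using g w False by blast
    then show ?thesis by (simp add: e_def)
  qed
  have Gb: "G \<psi> \<omega> \<le> ennreal (c * q * (t - t0))" if g: "?good \<psi>" and w: "\<omega> \<in> space M" for \<psi> \<omega>
  proof -
    have "G \<psi> \<omega> \<le> (\<integral>\<^sup>+ s. ennreal (c * q) * indicator {t0..t} s \<partial>lborel)"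
      unfolding G_def
      by (intro nn_integral_mono order_trans[OF _ eb[OF g w]]) (auto split: split_indicator)
    also have "\<dots> = ennreal (c * q * (t - t0))"
      using t c0 q by (subst nn_integral_cmult_indicator) (auto simp: ennreal_mult)
    finally show ?thesis .
  qed
  have Gm: "G \<psi> \<in> borel_measurable M" if g: "?good \<psi>" for \<psi>
  proof -
    have [measurable]: "(\<lambda>z. e \<psi> (fst z) (snd z)) \<in> borel_measurable (M \<Otimes>\<^sub>M lborel)"
    proof -
      have id: "(\<lambda>z. (fst z, snd z)) \<in> M \<Otimes>\<^sub>M lborel \<rightarrow>\<^sub>M F n \<Otimes>\<^sub>M borel"
        by (intro measurable_Pair measurable_compose[OF measurable_fst measurable_ident_history]) measurable
      from measurable_compose[OF id em[OF g]] show ?thesis by simp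
    qed
    have "(\<lambda>z. indicator {z. J n (fst z) \<le> ereal (snd z) \<and> ereal (snd z) < J (Suc n) (fst z)} z * e \<psi> (fst z) (snd z)) \<in> borel_measurable (M \<Otimes>\<^sub>M lborel)"
      by measurable
    then have "(\<lambda>(\<omega>, s). indicator {s. J n \<omega> \<le> ereal s \<and> ereal s < J (Suc n) \<omega>} s * e \<psi> \<omega> s) \<in> borel_measurable (M \<Otimes>\<^sub>M lborel)"
      by (simp add: case_prod_beta indicator_def)
    then show ?thesis unfolding G_def by (rule lborel.borel_measurable_nn_integral)
  qed
  have GN: "(\<integral>\<^sup>+ \<omega>. ennreal (indicator {\<omega>. J (Suc n) \<omega> < \<infinity>} \<omega> * \<psi> (\<omega>, real_of_ereal (J (Suc n) \<omega>), jump n \<omega>)) \<partial>M) = (\<integral>\<^sup>+ \<omega>. G \<psi> \<omega> \<partial>M)"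
    if g: "?good \<psi>" for \<psi>
  proof -
    have [measurable]: "\<psi> \<in> borel_measurable ?P" using g by blast
    have m: "(\<lambda>z. ennreal (\<psi> z)) \<in> borel_measurable ?P" by measurable
    have "(\<integral>\<^sup>+ \<omega>. ennreal (indicator {\<omega>. J (Suc n) \<omega> < \<infinity>} \<omega> * \<psi> (\<omega>, real_of_ereal (J (Suc n) \<omega>), jump n \<omega>)) \<partial>M)
      = (\<integral>\<^sup>+ \<omega>. indicator {\<omega>. J (Suc n) \<omega> < \<infinity>} \<omega> * ennreal (\<psi> (\<omega>, real_of_ereal (J (Suc n) \<omega>), jump n \<omega>)) \<partial>M)"
      by (intro nn_integral_cong) (auto split: split_indicator)
    then show ?thesis using compensation_formula[OF m] by (simp add: G_def e_def)
  qed
  have GI: "set_integrable lborel (?I \<omega>) (\<lambda>s. enn2real (e \<psi> \<omega> s))"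
      "(LINT s:?I \<omega>|lborel. enn2real (e \<psi> \<omega> s)) = enn2real (G \<psi> \<omega>)" if g: "?good \<psi>" and w: "\<omega> \<in> space M" for \<psi> \<omega>
  proof -
    note [measurable] = em1[OF g w]
    have fin: "e \<psi> \<omega> s < top" for s
      by (rule le_less_trans[OF eb[OF g w]]) (auto simp: ennreal_mult_less_top split: split_indicator)
    have AE: "AE s in lborel. ennreal (indicator (?I \<omega>) s * enn2real (e \<psi> \<omega> s)) = indicator {s. J n \<omega> \<le> ereal s \<and> ereal s < J (Suc n) \<omega>} s * e \<psi> \<omega> s"
      using AE_clip_interval[OF t, of "J n \<omega>" "J (Suc n) \<omega>"]
    proof eventually_elim
      case (elim s)
      have "e \<psi> \<omega> s = 0" if "\<not> (t0 < s \<and> s \<le> t)"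
      proof -
        have "\<psi> (\<omega>, s, y) = 0" for y using g w that by blast
        then show ?thesis by (simp add: e_def)
      qed
      then show ?case using elim fin[of s] by (auto split: split_indicator)
    qed
    have nn: "(\<integral>\<^sup>+ s. ennreal (indicator (?I \<omega>) s * enn2real (e \<psi> \<omega> s)) \<partial>lborel) = G \<psi> \<omega>"
      unfolding G_def by (rule nn_integral_cong_AE[OF AE])
    show "set_integrable lborel (?I \<omega>) (\<lambda>s. enn2real (e \<psi> \<omega> s))"
      unfolding set_integrable_def
    proof (rule integrableI_nonneg)
      show "(\<integral>\<^sup>+ s. ennreal (indicator (?I \<omega>) s *\<^sub>R enn2real (e \<psi> \<omega> s)) \<partial>lborel) < \<infinity>"
        using nn le_less_trans[OF Gb[OF g w] ennreal_less_top] by simp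
    qed auto
    show "(LINT s:?I \<omega>|lborel. enn2real (e \<psi> \<omega> s)) = enn2real (G \<psi> \<omega>)"
      unfolding set_lebesgue_integral_def
      by (subst integral_eq_nn_integral) (auto simp: nn)
  qed
  let ?m = "\<lambda>z. - \<phi> z"
  have g1: "?good \<phi>" using phi bd supp by blast
  have g2: "?good ?m" using phi bd supp by simp
  have phiK: "(\<integral>y. \<phi> (\<omega>, s, y) \<partial>K (Y n \<omega>)) = enn2real (e \<phi> \<omega> s) - enn2real (e ?m \<omega> s)" if w: "\<omega> \<in> space M" for \<omega> s
  proof -
    have "integrable (K (Y n \<omega>)) (\<lambda>y. \<phi> (\<omega>, s, y))"
      by (rule finite_measure.integrable_const_bound[OF kernel_finite[OF Y_in[OF w]], where B=c])
        (use bd[OF w] section_measurable[OF phi w] in auto)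
    then show ?thesis unfolding e_def by (rule real_lebesgue_integral_def)
  qed
  have Ceq: "Cj \<omega> = enn2real (G \<phi> \<omega>) - enn2real (G ?m \<omega>)" if w: "\<omega> \<in> space M" for \<omega>
    unfolding Cj_def using GI[OF g1 w] GI[OF g2 w] phiK[OF w]
    by (simp add: set_integral_diff)
  show "set_integrable lborel (?I \<omega>) (\<lambda>s. \<integral>y. \<phi> (\<omega>, s, y) \<partial>K (Y n \<omega>))" if w: "\<omega> \<in> space M" for \<omega>
    unfolding phiK[OF w] by (rule set_integral_diff(1)[OF GI(1)[OF g1 w] GI(1)[OF g2 w]])
  have Gint: "integrable M (\<lambda>\<omega>. enn2real (G \<psi> \<omega>))" "(\<integral>\<omega>. enn2real (G \<psi> \<omega>) \<partial>M) = enn2real (\<integral>\<^sup>+ \<omega>. G \<psi> \<omega> \<partial>M)"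
    if g: "?good \<psi>" for \<psi>
  proof -
    note [measurable] = Gm[OF g]
    have fin: "G \<psi> \<omega> < top" if "\<omega> \<in> space M" for \<omega>
      by (rule le_less_trans[OF Gb[OF g that] ennreal_less_top])
    have le: "enn2real (G \<psi> \<omega>) \<le> c * q * (t - t0)" if "\<omega> \<in> space M" for \<omega>
      using enn2real_mono[OF Gb[OF g that]] c0 q t by simp
    show "integrable M (\<lambda>\<omega>. enn2real (G \<psi> \<omega>))"
      by (rule integrable_const_bound[where B="c * q * (t - t0)"]) (use le in auto)
    show "(\<integral>\<omega>. enn2real (G \<psi> \<omega>) \<partial>M) = enn2real (\<integral>\<^sup>+ \<omega>. G \<psi> \<omega> \<partial>M)"
      by (subst integral_eq_nn_integral) (use fin in \<open>auto intro!: arg_cong[where f=enn2real] nn_integral_cong\<close>)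
  qed
  have Njm: "Nj \<in> borel_measurable M"
    unfolding Nj_def by measurable
  show Nint: "integrable M Nj"
    by (rule integrable_const_bound[where B=c]) (use bd Njm c0 in \<open>auto simp: Nj_def indicator_def\<close>)
  show "integrable M Cj"
    using Bochner_Integration.integrable_diff[OF Gint(1)[OF g1] Gint(1)[OF g2]] Ceq
    by (simp cong: Bochner_Integration.integrable_cong)
  have "(\<integral>\<omega>. Nj \<omega> \<partial>M) = enn2real (\<integral>\<^sup>+ \<omega>. ennreal (Nj \<omega>) \<partial>M) - enn2real (\<integral>\<^sup>+ \<omega>. ennreal (- Nj \<omega>) \<partial>M)"
    by (rule real_lebesgue_integral_def[OF Nint])
  also have "\<dots> = (\<integral>\<omega>. enn2real (G \<phi> \<omega>) - enn2real (G ?m \<omega>) \<partial>M)"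
    using GN[OF g1] GN[OF g2] Gint[OF g1] Gint[OF g2] by (simp add: Nj_def)
  also have "\<dots> = (\<integral>\<omega>. Cj \<omega> \<partial>M)"
    by (intro Bochner_Integration.integral_cong) (simp_all add: Ceq)
  finally show "(\<integral>\<omega>. Nj \<omega> \<partial>M) = (\<integral>\<omega>. Cj \<omega> \<partial>M)" .
qed

end

section \<open>Compensated sums over the jumps\<close>

text \<open>Jumps in the \<open>i\<close>-th coordinate during the window are weighted by \<open>g\<close>, summed and compensated. The predicate
  \<open>B\<close> selects the holding intervals that count. It depends on the past only, so stopping the sum is a choice
  of \<open>B\<close>. The antiderivative \<open>\<Gamma>\<close> makes the compensator of a holding interval
  explicit, as the state is constant there.\<close>

locale compensated_sum = jump_process M J Y I K x0
  for M :: "'w measure" and J :: "nat \<Rightarrow> 'w \<Rightarrow> ereal" and Y :: "nat \<Rightarrow> 'w \<Rightarrow> real^2"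
    and I :: "(real^2) set" and K :: "real^2 \<Rightarrow> (real^2) measure" and x0 :: "real^2" +
  fixes D :: "(real^2) set" and q c2 :: real and i :: 2 and g \<Gamma> :: "real \<Rightarrow> real" and B :: "nat \<Rightarrow> 'w \<Rightarrow> bool"
    and t0 t :: real
  assumes q_nonneg: "q \<ge> 0" and rate_le: "\<And>x. x \<in> D \<Longrightarrow> x \<in> I \<Longrightarrow> measure (K x) UNIV \<le> q"
    and jump_integrable: "\<And>x. x \<in> D \<Longrightarrow> x \<in> I \<Longrightarrow> integrable (K x) (\<lambda>y. y $ i)"
    and square_integrable: "\<And>x. x \<in> D \<Longrightarrow> x \<in> I \<Longrightarrow> integrable (K x) (\<lambda>y. (y $ i)\<^sup>2)"
    and square_le: "\<And>x. x \<in> D \<Longrightarrow> x \<in> I \<Longrightarrow> (\<integral>y. (y $ i)\<^sup>2 \<partial>K x) \<le> c2"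
    and g_cont: "continuous_on UNIV g" and \<Gamma>_deriv: "\<And>s. (\<Gamma> has_real_derivative g s) (at s)"
    and B_measurable: "\<And>n m. n \<le> m \<Longrightarrow> Measurable.pred (history M J Y m) (B n)"
    and B_imp: "\<And>n \<omega>. \<omega> \<in> space M \<Longrightarrow> B n \<omega> \<Longrightarrow> Y n \<omega> \<in> D"
    and t0_nonneg: "0 \<le> t0" and t0_le: "t0 \<le> t"
begin

abbreviation "c n \<omega> \<equiv> clip t0 t (J n \<omega>)"

definition \<beta> :: "nat \<Rightarrow> 'w \<Rightarrow> real" where
  "\<beta> n \<omega> = (if B n \<omega> then \<integral>y. y $ i \<partial>K (Y n \<omega>) else 0)"

definition incr :: "nat \<Rightarrow> 'w \<Rightarrow> real" where
  "incr n \<omega> = (if B n \<omega> \<and> ereal t0 < J (Suc n) \<omega> \<and> J (Suc n) \<omega> \<le> ereal t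
       then g (real_of_ereal (J (Suc n) \<omega>)) * jump n \<omega> $ i else 0)
     - \<beta> n \<omega> * (\<Gamma> (c (Suc n) \<omega>) - \<Gamma> (c n \<omega>))"

definition psum :: "nat \<Rightarrow> 'w \<Rightarrow> real" where
  "psum m \<omega> = (\<Sum>n<m. incr n \<omega>)"

definition total :: "'w \<Rightarrow> real" where
  "total \<omega> = (\<Sum>n. incr n \<omega>)"

lemma g_measurable [measurable]: "g \<in> borel_measurable borel"
  using g_cont by (rule borel_measurable_continuous_onI)

lemma \<Gamma>_cont: "continuous_on UNIV \<Gamma>"
  using \<Gamma>_deriv DERIV_isCont continuous_at_imp_continuous_on by blast

lemma \<Gamma>_measurable [measurable]: "\<Gamma> \<in> borel_measurable borel"
  using \<Gamma>_cont by (rule borel_measurable_continuous_onI)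

lemma \<beta>_measurable:
  assumes "n \<le> m"
  shows "\<beta> n \<in> borel_measurable (F m)"
proof -
  have YR: "Y n \<in> F m \<rightarrow>\<^sub>M restrict_space borel I"
    by (rule measurable_restrict_space2) (auto intro: Y_in measurable_history assms)
  have m: "(\<lambda>\<omega>. \<integral>\<^sup>+ y. ennreal (r * y $ i) \<partial>K (Y n \<omega>)) \<in> borel_measurable (F m)" for r
    by (rule measurable_nn_integral_finite_kernel[OF kernel YR]) measurable
  have [measurable]: "Measurable.pred (F m) (B n)" by (rule B_measurable[OF assms])
  have m1: "(\<lambda>\<omega>. if B n \<omega> then enn2real (\<integral>\<^sup>+ y. ennreal (1 * y $ i) \<partial>K (Y n \<omega>)) - enn2real (\<integral>\<^sup>+ y. ennreal (- 1 * y $ i) \<partial>K (Y n \<omega>)) else 0)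
      \<in> borel_measurable (F m)"
    using m[of 1] m[of "-1"] by measurable
  have e: "\<beta> n \<omega> = (if B n \<omega> then enn2real (\<integral>\<^sup>+ y. ennreal (1 * y $ i) \<partial>K (Y n \<omega>)) - enn2real (\<integral>\<^sup>+ y. ennreal (- 1 * y $ i) \<partial>K (Y n \<omega>)) else 0)"
    if "\<omega> \<in> space (F m)" for \<omega>
    using that jump_integrable[of "Y n \<omega>"] B_imp[of \<omega> n] Y_in[of \<omega> n] by (simp add: \<beta>_def real_lebesgue_integral_def)
  show ?thesis by (rule iffD2[OF measurable_cong[OF e] m1])
qed

lemma incr_measurable: "n < m \<Longrightarrow> incr n \<in> borel_measurable (F m)"
proof -
  assume "n < m"
  then have [measurable]: "J n \<in> borel_measurable (F m)" "J (Suc n) \<in> borel_measurable (F m)"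
    "Y n \<in> borel_measurable (F m)" "Y (Suc n) \<in> borel_measurable (F m)" "Measurable.pred (F m) (B n)" "\<beta> n \<in> borel_measurable (F m)"
    by (auto intro: measurable_history B_measurable \<beta>_measurable)
  show ?thesis unfolding incr_def[abs_def] by measurable
qed

lemma psum_measurable: "psum m \<in> borel_measurable (F m)"
  unfolding psum_def[abs_def] by (intro borel_measurable_sum incr_measurable) auto

lemma incr_measurable_M [measurable]: "incr n \<in> borel_measurable M"
  by (rule measurable_history_imp[OF incr_measurable[of n "Suc n"]]) simp

lemma total_measurable [measurable]: "total \<in> borel_measurable M"
  unfolding total_def[abs_def] by measurable

lemma eventually_past:
  assumes "\<omega> \<in> space M"
  obtains m where "\<And>n. n \<ge> m \<Longrightarrow> ereal t < J n \<omega>"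
proof -
  have "eventually (\<lambda>n. ereal t < J n \<omega>) sequentially"
    using J_lim[OF assms] by (rule order_tendstoD) simp
  then show ?thesis using that by (auto simp: eventually_sequentially)
qed

lemma incr_past: "ereal t < J n \<omega> \<Longrightarrow> \<omega> \<in> space M \<Longrightarrow> incr n \<omega> = 0"
  using t0_le J_mono[of \<omega> n] by (auto simp: incr_def clip_def not_le dest: order_trans less_le_trans)

lemma psum_eq_total:
  assumes "\<omega> \<in> space M" and "\<And>n. n \<ge> m \<Longrightarrow> ereal t < J n \<omega>"
  shows "psum m \<omega> = total \<omega>"
  unfolding total_def psum_def using assms
  by (intro suminf_finite[symmetric]) (auto intro: incr_past simp: not_less)

lemma psum_tendsto:
  assumes "\<omega> \<in> space M"
  shows "eventually (\<lambda>m. psum m \<omega> = total \<omega> \<and> c m \<omega> = t) sequentially"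
proof -
  obtain m where m: "\<And>n. n \<ge> m \<Longrightarrow> ereal t < J n \<omega>" using eventually_past[OF assms] by blast
  have "psum k \<omega> = total \<omega> \<and> c k \<omega> = t" if "k \<ge> m" for k
  proof
    show "psum k \<omega> = total \<omega>" using m that by (intro psum_eq_total assms) auto
    have "ereal t < J k \<omega>" using m that by auto
    moreover from this have "\<not> J k \<omega> \<le> ereal t0" using t0_le by (cases "J k \<omega>") auto
    ultimately show "c k \<omega> = t" by (simp add: clip_def less_imp_le)
  qed
  then show ?thesis by (auto simp: eventually_sequentially)
qed

text \<open>Between two jumps the compensated sum moves along this deterministic curve.\<close>

definition flow :: "nat \<Rightarrow> 'w \<Rightarrow> real \<Rightarrow> real" where
  "flow n \<omega> s = psum n \<omega> - \<beta> n \<omega> * (\<Gamma> s - \<Gamma> (c n \<omega>))"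

text \<open>Ito's formula for \<open>A s * f (sum)\<close> over one holding interval. The jump at its end is replaced by its
  compensator, the motion along \<open>flow\<close> is integrated by the fundamental theorem of calculus, and the two first-order
  terms cancel because the sum is compensated. What remains is the derivative of \<open>A\<close> and the second-order
  remainder of \<open>f\<close>.\<close>

lemma ito_step:
  fixes f f' A A' :: "real \<Rightarrow> real"
  assumes f_deriv: "\<And>u. (f has_real_derivative f' u) (at u)" and f'_cont: "continuous_on UNIV f'"
    and f_bd: "\<And>u. \<bar>f u\<bar> \<le> cf"
    and A_meas [measurable]: "A \<in> borel_measurable borel"
    and A_deriv: "\<And>s. s \<in> {t0..t} \<Longrightarrow> (A has_real_derivative A' s) (at s within {t0..t})"
    and A'_cont: "continuous_on {t0..t} A'"
    and A_bd: "\<And>s. s \<in> {t0..t} \<Longrightarrow> \<bar>A s\<bar> \<le> cA"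
    and H: "\<And>\<omega> s. \<omega> \<in> space M \<Longrightarrow> t0 < s \<Longrightarrow> s \<le> t \<Longrightarrow> J n \<omega> \<le> ereal s \<Longrightarrow> ereal s < J (Suc n) \<omega> \<Longrightarrow>
       ennreal \<bar>A' s * f (flow n \<omega> s) + (if B n \<omega> then A s *
           (\<integral>y. f (flow n \<omega> s + g s * y $ i) - f (flow n \<omega> s) - f' (flow n \<omega> s) * g s * y $ i \<partial>K (Y n \<omega>)) else 0)\<bar>
       \<le> H \<omega> s"
  shows "ennreal \<bar>(\<integral>\<omega>. A (c (Suc n) \<omega>) * f (psum (Suc n) \<omega>) \<partial>M) - (\<integral>\<omega>. A (c n \<omega>) * f (psum n \<omega>) \<partial>M)\<bar>
     \<le> (\<integral>\<^sup>+ \<omega>. (\<integral>\<^sup>+ s. indicator {s. J n \<omega> \<le> ereal s \<and> ereal s < J (Suc n) \<omega> \<and> t0 < s \<and> s \<le> t} s * H \<omega> s \<partial>lborel) \<partial>M)"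
proof -
  let ?u = "flow n"
  have f_cont: "continuous_on UNIV f" using f_deriv DERIV_isCont continuous_at_imp_continuous_on by blast
  have [measurable]: "f \<in> borel_measurable borel" using f_cont by (rule borel_measurable_continuous_onI)
  have Fn [measurable]: "J n \<in> borel_measurable (F n)" "Y n \<in> borel_measurable (F n)" "psum n \<in> borel_measurable (F n)"
    "Measurable.pred (F n) (B n)" "\<beta> n \<in> borel_measurable (F n)"
    by (auto intro: measurable_history B_measurable \<beta>_measurable psum_measurable)
  have [measurable]: "psum n \<in> borel_measurable M" for n by (rule measurable_history_imp[OF psum_measurable])
  define \<phi> where "\<phi> = (\<lambda>(\<omega>, s, y :: real^2). if B n \<omega> \<and> t0 < s \<and> s \<le> t then A s * (f (?u \<omega> s + g s * y $ i) - f (?u \<omega> s)) else 0)"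
  have phi: "\<phi> \<in> borel_measurable (F n \<Otimes>\<^sub>M (borel \<Otimes>\<^sub>M borel))"
    unfolding \<phi>_def flow_def by measurable
  have cf0: "cf \<ge> 0" using f_bd[of 0] by linarith
  have cA0: "cA \<ge> 0" using A_bd[of t0] t0_le by auto
  have Afb: "\<bar>A s * f v\<bar> \<le> cA * cf" if "s \<in> {t0..t}" for s v
    unfolding abs_mult using A_bd[OF that] f_bd[of v] by (intro mult_mono) auto
  have phi_bd: "\<bar>\<phi> (\<omega>, s, y)\<bar> \<le> 2 * cA * cf" for \<omega> s y
  proof (cases "B n \<omega> \<and> t0 < s \<and> s \<le> t")
    case True
    then have "\<bar>A s * f (?u \<omega> s + g s * y $ i)\<bar> \<le> cA * cf" "\<bar>A s * f (?u \<omega> s)\<bar> \<le> cA * cf" by (auto intro!: Afb)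
    then show ?thesis using True by (simp add: \<phi>_def right_diff_distrib)
  qed (use cA0 cf0 in \<open>auto simp: \<phi>_def\<close>)
  have phi_supp: "t0 < s \<and> s \<le> t \<and> rate n \<omega> \<le> q" if "\<omega> \<in> space M" "\<phi> (\<omega>, s, y) \<noteq> 0" for \<omega> s y
    using that rate_le[of "Y n \<omega>"] B_imp[of \<omega> n] Y_in[of \<omega> n] by (auto simp: \<phi>_def split: if_splits)
  note cmp = compensation_formula_bounded[OF phi t0_le q_nonneg phi_bd phi_supp]
  let ?I = "\<lambda>\<omega>. {c n \<omega>..c (Suc n) \<omega>}"
  define N1 where "N1 = (\<lambda>\<omega>. indicator {\<omega>. J (Suc n) \<omega> < \<infinity>} \<omega> * \<phi> (\<omega>, real_of_ereal (J (Suc n) \<omega>), jump n \<omega>))"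
  define C1 where "C1 = (\<lambda>\<omega>. LINT s:?I \<omega>|lborel. (\<integral>y. \<phi> (\<omega>, s, y) \<partial>K (Y n \<omega>)))"
  define G1 where "G1 = (\<lambda>\<omega>. A (c (Suc n) \<omega>) * f (?u \<omega> (c (Suc n) \<omega>)) - A (c n \<omega>) * f (psum n \<omega>))"
  have N1i: "integrable M N1" and C1i: "integrable M C1" and NC: "(\<integral>\<omega>. N1 \<omega> \<partial>M) = (\<integral>\<omega>. C1 \<omega> \<partial>M)"
    using cmp(1-3) unfolding N1_def C1_def by simp_all
  have cI: "c n \<omega> \<in> {t0..t}" for n \<omega> using clip_bounds[OF t0_le] by auto
  have Z: "integrable M (\<lambda>\<omega>. A (c k \<omega>) * f (v \<omega>))" if [measurable]: "v \<in> borel_measurable M" for v k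
    by (rule integrable_const_bound[where B="cA * cf"]) (use Afb[OF cI] in auto)
  have flow_m [measurable]: "(\<lambda>\<omega>. ?u \<omega> (c (Suc n) \<omega>)) \<in> borel_measurable M"
    using measurable_history_imp[OF Fn(5)] unfolding flow_def by measurable
  have G1i: "integrable M G1"
    unfolding G1_def by (intro Bochner_Integration.integrable_diff Z) measurable
  \<comment> \<open>\<open>N1\<close> is the contribution of the jump and \<open>G1\<close> that of the flow.\<close>
  have path: "A (c (Suc n) \<omega>) * f (psum (Suc n) \<omega>) - A (c n \<omega>) * f (psum n \<omega>) = N1 \<omega> + G1 \<omega>" if w: "\<omega> \<in> space M" for \<omega>
  proof (cases "B n \<omega> \<and> ereal t0 < J (Suc n) \<omega> \<and> J (Suc n) \<omega> \<le> ereal t")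
    case True
    then obtain r where r: "J (Suc n) \<omega> = ereal r" "t0 < r" "r \<le> t" by (cases "J (Suc n) \<omega>") auto
    then have "c (Suc n) \<omega> = r" by (auto simp: clip_def)
    moreover have ps: "psum (Suc n) \<omega> = ?u \<omega> r + g r * jump n \<omega> $ i"
      using True r \<open>c (Suc n) \<omega> = r\<close> by (simp add: psum_def incr_def flow_def)
    moreover have "N1 \<omega> = A r * (f (psum (Suc n) \<omega>) - f (?u \<omega> r))"
      using True r unfolding ps by (simp add: N1_def \<phi>_def)
    ultimately show ?thesis by (simp only: G1_def right_diff_distrib)
  next
    case False
    then have "psum (Suc n) \<omega> = ?u \<omega> (c (Suc n) \<omega>)"
      by (auto simp: psum_def incr_def flow_def)
    moreover have "N1 \<omega> = 0"
      using False J_nonneg[OF w, of "Suc n"] by (cases "J (Suc n) \<omega>") (auto simp: N1_def \<phi>_def)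
    ultimately show ?thesis by (simp add: G1_def)
  qed
  define R where "R = (\<lambda>\<omega> s. A' s * f (?u \<omega> s) + (if B n \<omega> then A s *
           (\<integral>y. f (?u \<omega> s + g s * y $ i) - f (?u \<omega> s) - f' (?u \<omega> s) * g s * y $ i \<partial>K (Y n \<omega>)) else 0))"
  have R_int: "C1 \<omega> + G1 \<omega> = (LINT s:?I \<omega>|lborel. R \<omega> s)" "set_integrable lborel (?I \<omega>) (R \<omega>)" if w: "\<omega> \<in> space M" for \<omega>
  proof -
    let ?h = "\<lambda>s. A' s * f (?u \<omega> s) - A s * f' (?u \<omega> s) * (\<beta> n \<omega> * g s)"
    have sub: "?I \<omega> \<subseteq> {t0..t}" using cI[of n \<omega>] cI[of "Suc n" \<omega>] by auto
    have le: "c n \<omega> \<le> c (Suc n) \<omega>" using clip_mono[OF t0_le J_mono[OF w]] .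
    have A_cont: "continuous_on {t0..t} A" using A_deriv by (intro DERIV_continuous_on) auto
    have u_cont: "continuous_on UNIV (?u \<omega>)" unfolding flow_def using \<Gamma>_cont by (intro continuous_intros)
    have comp: "continuous_on X (\<lambda>s. k (?u \<omega> s))" if "continuous_on UNIV k" for k :: "real \<Rightarrow> real" and X
      using continuous_on_compose2[OF that u_cont] by (auto intro: continuous_on_subset)
    have h_cont: "continuous_on (?I \<omega>) ?h"
      by (intro continuous_intros comp f_cont f'_cont continuous_on_subset[OF A'_cont sub]
          continuous_on_subset[OF A_cont sub] continuous_on_subset[OF g_cont]) auto
    have h_int: "set_integrable lborel (?I \<omega>) ?h" by (rule borel_integrable_atLeastAtMost'[OF h_cont])
    have "(\<integral>s. indicator (?I \<omega>) s *\<^sub>R ?h s \<partial>lborel) = A (c (Suc n) \<omega>) * f (?u \<omega> (c (Suc n) \<omega>)) - A (c n \<omega>) * f (?u \<omega> (c n \<omega>))"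
    proof (rule integral_FTC_atLeastAtMost[OF le _ h_cont])
      fix s assume s: "c n \<omega> \<le> s" "s \<le> c (Suc n) \<omega>"
      have "(?u \<omega> has_real_derivative - \<beta> n \<omega> * g s) (at s within ?I \<omega>)"
        unfolding flow_def using DERIV_subset[OF \<Gamma>_deriv[of s]] by (auto intro!: derivative_eq_intros)
      from DERIV_chain2[OF f_deriv this]
      have fu: "((\<lambda>s. f (?u \<omega> s)) has_real_derivative f' (?u \<omega> s) * (- \<beta> n \<omega> * g s)) (at s within ?I \<omega>)" .
      have "(A has_real_derivative A' s) (at s within ?I \<omega>)"
        using A_deriv[of s] sub s by (intro DERIV_subset[OF _ sub]) auto
      from DERIV_mult[OF this fu]
      show "((\<lambda>s. A s * f (?u \<omega> s)) has_vector_derivative ?h s) (at s within ?I \<omega>)"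
        unfolding has_real_derivative_iff_has_vector_derivative[symmetric] by (simp add: algebra_simps)
    qed
    then have G1: "G1 \<omega> = (LINT s:?I \<omega>|lborel. ?h s)"
      by (simp add: G1_def set_lebesgue_integral_def flow_def)
    have C1s: "set_integrable lborel (?I \<omega>) (\<lambda>s. \<integral>y. \<phi> (\<omega>, s, y) \<partial>K (Y n \<omega>))"
      using cmp(4) w by simp
    have Req: "(\<integral>y. \<phi> (\<omega>, s, y) \<partial>K (Y n \<omega>)) + ?h s = R \<omega> s" if s: "t0 < s" "s \<le> t" for s
    proof (cases "B n \<omega>")
      case True
      let ?k = "K (Y n \<omega>)"
      have YI: "Y n \<omega> \<in> I" "Y n \<omega> \<in> D" using Y_in[OF w] B_imp[OF w True] by auto
      interpret k: finite_measure ?k by (rule kernel_finite[OF YI(1)])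
      have [measurable_cong]: "sets ?k = sets borel" by (rule kernel_sets[OF YI(1)])
      have yi: "integrable ?k (\<lambda>y. y $ i)" by (rule jump_integrable[OF YI(2,1)])
      have fi: "integrable ?k (\<lambda>y. f (?u \<omega> s + g s * y $ i) - f (?u \<omega> s))"
      proof (rule k.integrable_const_bound[where B="2 * cf"])
        have "\<bar>f (?u \<omega> s + g s * y $ i) - f (?u \<omega> s)\<bar> \<le> 2 * cf" for y :: "real^2"
          using f_bd[of "?u \<omega> s + g s * y $ i"] f_bd[of "?u \<omega> s"] by linarith
        then show "AE y in ?k. norm (f (?u \<omega> s + g s * y $ i) - f (?u \<omega> s)) \<le> 2 * cf" by simp
      qed measurable
      have p1: "(\<integral>y. \<phi> (\<omega>, s, y) \<partial>?k) = A s * (\<integral>y. f (?u \<omega> s + g s * y $ i) - f (?u \<omega> s) \<partial>?k)"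
        using True s by (simp add: \<phi>_def)
      have p2: "(\<integral>y. f (?u \<omega> s + g s * y $ i) - f (?u \<omega> s) - f' (?u \<omega> s) * g s * y $ i \<partial>?k)
        = (\<integral>y. f (?u \<omega> s + g s * y $ i) - f (?u \<omega> s) \<partial>?k) - f' (?u \<omega> s) * g s * (\<integral>y. y $ i \<partial>?k)"
        using fi yi by (subst Bochner_Integration.integral_diff) auto
      show ?thesis unfolding p1 R_def p2 using True by (simp add: \<beta>_def algebra_simps)
    next
      case False
      then show ?thesis by (simp add: R_def \<beta>_def \<phi>_def)
    qed
    have AE: "AE s in lborel. indicator (?I \<omega>) s *\<^sub>R ((\<integral>y. \<phi> (\<omega>, s, y) \<partial>K (Y n \<omega>)) + ?h s) = indicator (?I \<omega>) s *\<^sub>R R \<omega> s"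
      using AE_clip_interval[OF t0_le, of "J n \<omega>" "J (Suc n) \<omega>"]
    proof eventually_elim
      case (elim s)
      then show ?case using Req[of s] by (auto split: split_indicator)
    qed
    have both: "set_integrable lborel (?I \<omega>) (\<lambda>s. (\<integral>y. \<phi> (\<omega>, s, y) \<partial>K (Y n \<omega>)) + ?h s)"
      "C1 \<omega> + G1 \<omega> = (LINT s:?I \<omega>|lborel. (\<integral>y. \<phi> (\<omega>, s, y) \<partial>K (Y n \<omega>)) + ?h s)"
      using set_integral_add[OF C1s h_int] by (simp_all add: G1 C1_def)
    have Rm: "(\<lambda>s. indicator (?I \<omega>) s *\<^sub>R R \<omega> s) \<in> borel_measurable lborel"
    proof -
      have e: "indicator (?I \<omega>) s *\<^sub>R R \<omega> s = (if s = t0 then indicator (?I \<omega>) s *\<^sub>R R \<omega> s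
         else indicator (?I \<omega>) s *\<^sub>R ((\<integral>y. \<phi> (\<omega>, s, y) \<partial>K (Y n \<omega>)) + ?h s))" for s
        using Req[of s] sub by (auto split: split_indicator)
      have m: "(\<lambda>s. indicator (?I \<omega>) s *\<^sub>R ((\<integral>y. \<phi> (\<omega>, s, y) \<partial>K (Y n \<omega>)) + ?h s)) \<in> borel_measurable lborel"
        using both(1) unfolding set_integrable_def by (rule borel_measurable_integrable)
      have "(\<lambda>s. if s = t0 then indicator (?I \<omega>) t0 *\<^sub>R R \<omega> t0
         else indicator (?I \<omega>) s *\<^sub>R ((\<integral>y. \<phi> (\<omega>, s, y) \<partial>K (Y n \<omega>)) + ?h s)) \<in> borel_measurable lborel"
        using m by (intro measurable_If) auto
      then show ?thesis by (subst e) (simp cong: if_cong)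
    qed
    show "C1 \<omega> + G1 \<omega> = (LINT s:?I \<omega>|lborel. R \<omega> s)"
      unfolding both(2) set_lebesgue_integral_def
      using both(1) Rm AE unfolding set_integrable_def by (intro integral_cong_AE) (auto dest: borel_measurable_integrable)
    show "set_integrable lborel (?I \<omega>) (R \<omega>)"
      unfolding set_integrable_def
      by (rule integrable_cong_AE_imp[OF both(1)[unfolded set_integrable_def] Rm AE])
  qed
  have "(\<integral>\<omega>. A (c (Suc n) \<omega>) * f (psum (Suc n) \<omega>) \<partial>M) - (\<integral>\<omega>. A (c n \<omega>) * f (psum n \<omega>) \<partial>M)
     = (\<integral>\<omega>. A (c (Suc n) \<omega>) * f (psum (Suc n) \<omega>) - A (c n \<omega>) * f (psum n \<omega>) \<partial>M)"
    by (intro Bochner_Integration.integral_diff[symmetric] Z) measurable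
  also have "\<dots> = (\<integral>\<omega>. N1 \<omega> + G1 \<omega> \<partial>M)"
    by (intro Bochner_Integration.integral_cong path) auto
  also have "\<dots> = (\<integral>\<omega>. C1 \<omega> + G1 \<omega> \<partial>M)"
    using N1i C1i G1i NC by simp
  finally have e: "(\<integral>\<omega>. A (c (Suc n) \<omega>) * f (psum (Suc n) \<omega>) \<partial>M) - (\<integral>\<omega>. A (c n \<omega>) * f (psum n \<omega>) \<partial>M)
     = (\<integral>\<omega>. C1 \<omega> + G1 \<omega> \<partial>M)" .
  have "ennreal \<bar>\<integral>\<omega>. C1 \<omega> + G1 \<omega> \<partial>M\<bar> \<le> (\<integral>\<^sup>+ \<omega>. ennreal \<bar>C1 \<omega> + G1 \<omega>\<bar> \<partial>M)"
    using integral_norm_bound_ennreal[OF Bochner_Integration.integrable_add[OF C1i G1i]] by simp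
  also have "\<dots> \<le> (\<integral>\<^sup>+ \<omega>. (\<integral>\<^sup>+ s. indicator {s. J n \<omega> \<le> ereal s \<and> ereal s < J (Suc n) \<omega> \<and> t0 < s \<and> s \<le> t} s * H \<omega> s \<partial>lborel) \<partial>M)"
  proof (intro nn_integral_mono)
    fix \<omega> assume w: "\<omega> \<in> space M"
    have "ennreal \<bar>C1 \<omega> + G1 \<omega>\<bar> \<le> (\<integral>\<^sup>+ s. ennreal (norm (indicator (?I \<omega>) s *\<^sub>R R \<omega> s)) \<partial>lborel)"
      using integral_norm_bound_ennreal[OF R_int(2)[OF w, unfolded set_integrable_def]] R_int(1)[OF w]
      by (simp add: set_lebesgue_integral_def)
    also have "\<dots> \<le> (\<integral>\<^sup>+ s. indicator {s. J n \<omega> \<le> ereal s \<and> ereal s < J (Suc n) \<omega> \<and> t0 < s \<and> s \<le> t} s * H \<omega> s \<partial>lborel)"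
    proof (rule nn_integral_mono_AE)
      show "AE s in lborel. ennreal (norm (indicator (?I \<omega>) s *\<^sub>R R \<omega> s))
         \<le> indicator {s. J n \<omega> \<le> ereal s \<and> ereal s < J (Suc n) \<omega> \<and> t0 < s \<and> s \<le> t} s * H \<omega> s"
        using AE_clip_interval[OF t0_le, of "J n \<omega>" "J (Suc n) \<omega>"]
      proof eventually_elim
        case (elim s)
        then show ?case using H[OF w, of s] by (auto simp: R_def split: split_indicator)
      qed
    qed
    finally show "ennreal \<bar>C1 \<omega> + G1 \<omega>\<bar> \<le> (\<integral>\<^sup>+ s. indicator {s. J n \<omega> \<le> ereal s \<and> ereal s < J (Suc n) \<omega> \<and> t0 < s \<and> s \<le> t} s * H \<omega> s \<partial>lborel)" .
  qed
  finally show ?thesis by (simp only: e)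
qed

end

section \<open>An Ito inequality for compensated sums\<close>

context jump_process
begin

lemma at_most_one_index:
  assumes "\<omega> \<in> space M" "J n \<omega> \<le> ereal s" "ereal s < J (Suc n) \<omega>" "J m \<omega> \<le> ereal s" "ereal s < J (Suc m) \<omega>"
  shows "n = m"
proof (rule ccontr)
  assume "n \<noteq> m"
  then consider "Suc n \<le> m" | "Suc m \<le> n" by linarith
  then show False
    using J_le[OF assms(1), of "Suc n" m] J_le[OF assms(1), of "Suc m" n] assms by cases auto
qed

lemma suminf_state_le:
  fixes a :: "nat \<Rightarrow> ennreal"
  assumes "\<omega> \<in> space M" and "\<And>n. J n \<omega> \<le> ereal s \<Longrightarrow> ereal s < J (Suc n) \<omega> \<Longrightarrow> a n \<le> b"
  shows "(\<Sum>n. indicator {s. J n \<omega> \<le> ereal s \<and> ereal s < J (Suc n) \<omega>} s * a n) \<le> b"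
proof (cases "\<exists>n. J n \<omega> \<le> ereal s \<and> ereal s < J (Suc n) \<omega>")
  case True
  then obtain n where n: "J n \<omega> \<le> ereal s" "ereal s < J (Suc n) \<omega>" by blast
  have "(\<Sum>n. indicator {s. J n \<omega> \<le> ereal s \<and> ereal s < J (Suc n) \<omega>} s * a n)
      = (\<Sum>k\<in>{n}. indicator {s. J k \<omega> \<le> ereal s \<and> ereal s < J (Suc k) \<omega>} s * a k)"
    using at_most_one_index[OF assms(1) n] by (intro suminf_finite) (auto simp: indicator_def)
  also have "\<dots> = a n" using n by simp
  finally show ?thesis using assms(2)[OF n] by simp
next
  case False
  then have "indicator {s. J n \<omega> \<le> ereal s \<and> ereal s < J (Suc n) \<omega>} s = (0::ennreal)" for n
    by (auto simp: indicator_def)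
  then show ?thesis by simp
qed

lemma exists_index:
  assumes "\<omega> \<in> space M" "s \<ge> 0"
  obtains n where "J n \<omega> \<le> ereal s" "ereal s < J (Suc n) \<omega>"
proof -
  have "eventually (\<lambda>n. ereal s < J n \<omega>) sequentially"
    using J_lim[OF assms(1)] by (rule order_tendstoD) simp
  then have ex: "\<exists>n. ereal s < J n \<omega>" by (auto simp: eventually_sequentially)
  define k where "k = (LEAST n. ereal s < J n \<omega>)"
  have k: "ereal s < J k \<omega>" unfolding k_def by (rule LeastI_ex[OF ex])
  have "k \<noteq> 0" using k assms by (cases k) (auto simp: J_0)
  then obtain n where n: "k = Suc n" by (cases k) auto
  have "\<not> ereal s < J n \<omega>" using not_less_Least[of n "\<lambda>n. ereal s < J n \<omega>"] n unfolding k_def by simp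
  then show ?thesis using that[of n] k n by auto
qed

end

text \<open>The bounded function \<open>u\<^sup>2 / (b\<^sup>2 + u\<^sup>2)\<close> stands in for the square: its remainder is bounded by a square like that of
  \<open>u\<^sup>2\<close>, and being bounded it is within the scope of the Ito inequality.\<close>

lemma truncated_square_remainder:
  fixes u h b :: real
  assumes b: "b > 0"
  shows "\<bar>(u + h)\<^sup>2 / (b\<^sup>2 + (u + h)\<^sup>2) - u\<^sup>2 / (b\<^sup>2 + u\<^sup>2) - (2 * b\<^sup>2 * u / (b\<^sup>2 + u\<^sup>2)\<^sup>2) * h\<bar> \<le> h\<^sup>2 / b\<^sup>2"
proof -
  define p r v where "p = b\<^sup>2 + u\<^sup>2" and "r = b\<^sup>2 + v\<^sup>2" and "v = u + h"
  have b2: "b\<^sup>2 > 0" using b by simp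
  have p: "p > 0" "p \<ge> b\<^sup>2" and r: "r > 0" "r \<ge> b\<^sup>2" unfolding p_def r_def using b2 by (auto intro: add_pos_nonneg)
  have frac: "x / (b\<^sup>2 + x) = 1 - b\<^sup>2 / (b\<^sup>2 + x)" if "b\<^sup>2 + x > 0" for x
    using that by (simp add: eq_diff_eq add_divide_distrib[symmetric] add.commute)
  have "(u + h)\<^sup>2 / (b\<^sup>2 + (u + h)\<^sup>2) = 1 - b\<^sup>2 / r"
    using frac[of "(u + h)\<^sup>2"] r(1) by (simp add: r_def v_def)
  moreover have "u\<^sup>2 / (b\<^sup>2 + u\<^sup>2) = 1 - b\<^sup>2 / p"
    using frac[of "u\<^sup>2"] p(1) by (simp add: p_def)
  ultimately have "(u + h)\<^sup>2 / (b\<^sup>2 + (u + h)\<^sup>2) - u\<^sup>2 / (b\<^sup>2 + u\<^sup>2) - (2 * b\<^sup>2 * u / (b\<^sup>2 + u\<^sup>2)\<^sup>2) * h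
     = b\<^sup>2 / p - b\<^sup>2 / r - (2 * b\<^sup>2 * u / p\<^sup>2) * h"
    by (simp add: p_def)
  also have "\<dots> = b\<^sup>2 * h\<^sup>2 * (b\<^sup>2 - u\<^sup>2 - 2 * u * v) / (p\<^sup>2 * r)"
  proof -
    have "b\<^sup>2 / p - b\<^sup>2 / r - (2 * b\<^sup>2 * u / p\<^sup>2) * h = b\<^sup>2 * (p * r - p\<^sup>2 - 2 * u * h * r) / (p\<^sup>2 * r)"
      using p(1) r(1) by (simp add: divide_simps power2_eq_square) (simp add: algebra_simps)
    also have "p * r - p\<^sup>2 - 2 * u * h * r = h\<^sup>2 * (b\<^sup>2 - u\<^sup>2 - 2 * u * v)"
      unfolding p_def r_def v_def by (simp add: power2_eq_square algebra_simps)
    finally show ?thesis by (simp add: mult.assoc)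
  qed
  finally have e: "(u + h)\<^sup>2 / (b\<^sup>2 + (u + h)\<^sup>2) - u\<^sup>2 / (b\<^sup>2 + u\<^sup>2) - (2 * b\<^sup>2 * u / (b\<^sup>2 + u\<^sup>2)\<^sup>2) * h
     = b\<^sup>2 * h\<^sup>2 * (b\<^sup>2 - u\<^sup>2 - 2 * u * v) / (p\<^sup>2 * r)" .
  have num: "\<bar>b\<^sup>2 - u\<^sup>2 - 2 * u * v\<bar> * b\<^sup>2 * b\<^sup>2 \<le> p\<^sup>2 * r"
  proof -
    have "(u - v)\<^sup>2 \<ge> 0" "(u + v)\<^sup>2 \<ge> 0" by simp_all
    then have uv: "\<bar>2 * u * v\<bar> \<le> u\<^sup>2 + v\<^sup>2" by (auto simp: power2_eq_square algebra_simps abs_le_iff)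
    have "\<bar>b\<^sup>2 - u\<^sup>2 - 2 * u * v\<bar> \<le> b\<^sup>2 + u\<^sup>2 + \<bar>2 * u * v\<bar>" using b2 by (smt (verit) zero_le_power2)
    also have "\<dots> \<le> b\<^sup>2 + 2 * u\<^sup>2 + v\<^sup>2" using uv by linarith
    finally have "\<bar>b\<^sup>2 - u\<^sup>2 - 2 * u * v\<bar> * (b\<^sup>2 * b\<^sup>2) \<le> (b\<^sup>2 + 2 * u\<^sup>2 + v\<^sup>2) * (b\<^sup>2 * b\<^sup>2)"
      by (intro mult_right_mono) auto
    also have "\<dots> \<le> p\<^sup>2 * r"
    proof -
      have "p\<^sup>2 * r - (b\<^sup>2 + 2 * u\<^sup>2 + v\<^sup>2) * (b\<^sup>2 * b\<^sup>2) = b\<^sup>2 * (u\<^sup>2)\<^sup>2 + v\<^sup>2 * (2 * b\<^sup>2 * u\<^sup>2 + (u\<^sup>2)\<^sup>2)"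
        unfolding p_def r_def by (simp add: power2_eq_square algebra_simps)
      also have "\<dots> \<ge> 0" by simp
      finally show ?thesis by simp
    qed
    finally show ?thesis by (simp add: mult.assoc)
  qed
  have "\<bar>b\<^sup>2 * h\<^sup>2 * (b\<^sup>2 - u\<^sup>2 - 2 * u * v) / (p\<^sup>2 * r)\<bar> = (h\<^sup>2 / b\<^sup>2) * ((\<bar>b\<^sup>2 - u\<^sup>2 - 2 * u * v\<bar> * b\<^sup>2 * b\<^sup>2) / (p\<^sup>2 * r))"
    using b2 p(1) r(1) by (simp add: abs_mult)
  also have "\<dots> \<le> (h\<^sup>2 / b\<^sup>2) * 1"
    using num p(1) r(1) b2 by (intro mult_left_mono) (auto simp: divide_le_eq_1)
  finally show ?thesis unfolding e by simp
qed

lemma trig_remainder: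
  fixes u x :: real
  shows "\<bar>cos (u + x) - cos u + x * sin u + x\<^sup>2 / 2 * cos u\<bar> \<le> \<bar>x\<bar> ^ 3 / 6"
    and "\<bar>sin (u + x) - sin u - x * cos u + x\<^sup>2 / 2 * sin u\<bar> \<le> \<bar>x\<bar> ^ 3 / 6"
proof -
  define z where "z = iexp x - (1 + \<i> * x - x\<^sup>2 / 2)"
  have "(\<Sum>k\<le>2. (\<i> * complex_of_real x) ^ k / fact k) = 1 + \<i> * x - x\<^sup>2 / 2"
    by (simp add: numeral_2_eq_2 power2_eq_square) (simp add: complex_eq_iff)
  then have z: "cmod z \<le> \<bar>x\<bar> ^ 3 / 6"
    using iexp_approx1[of x 2] unfolding z_def by (simp add: fact_numeral)
  have w: "cmod (iexp u * z) \<le> \<bar>x\<bar> ^ 3 / 6" using z by (simp add: norm_mult)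
  have re: "Re (iexp u * z) = cos (u + x) - cos u + x * sin u + x\<^sup>2 / 2 * cos u"
    and im: "Im (iexp u * z) = sin (u + x) - sin u - x * cos u + x\<^sup>2 / 2 * sin u"
    unfolding z_def by (simp_all add: Re_exp Im_exp cos_add sin_add algebra_simps)
  show "\<bar>cos (u + x) - cos u + x * sin u + x\<^sup>2 / 2 * cos u\<bar> \<le> \<bar>x\<bar> ^ 3 / 6"
    using abs_Re_le_cmod[of "iexp u * z"] w unfolding re by linarith
  show "\<bar>sin (u + x) - sin u - x * cos u + x\<^sup>2 / 2 * sin u\<bar> \<le> \<bar>x\<bar> ^ 3 / 6"
    using abs_Im_le_cmod[of "iexp u * z"] w unfolding im by linarith
qed

context compensated_sum
begin

text \<open>The steps telescope. Their errors add up to a single integral over the window because at most one holding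
  interval contains a given time, and boundedness of \<open>f\<close> and \<open>A\<close> permits dominated convergence along the
  steps.\<close>

lemma ito_total:
  fixes f f' A A' :: "real \<Rightarrow> real" and H :: "'w \<Rightarrow> real \<Rightarrow> ennreal"
  assumes f_deriv: "\<And>u. (f has_real_derivative f' u) (at u)" and f'_cont: "continuous_on UNIV f'"
    and f_bd: "\<And>u. \<bar>f u\<bar> \<le> cf"
    and A_meas [measurable]: "A \<in> borel_measurable borel"
    and A_deriv: "\<And>s. s \<in> {t0..t} \<Longrightarrow> (A has_real_derivative A' s) (at s within {t0..t})"
    and A'_cont: "continuous_on {t0..t} A'"
    and A_bd: "\<And>s. s \<in> {t0..t} \<Longrightarrow> \<bar>A s\<bar> \<le> cA"
    and H_meas [measurable]: "(\<lambda>(\<omega>, s). H \<omega> s) \<in> borel_measurable (M \<Otimes>\<^sub>M lborel)"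
    and H: "\<And>n \<omega> s. \<omega> \<in> space M \<Longrightarrow> t0 < s \<Longrightarrow> s \<le> t \<Longrightarrow> J n \<omega> \<le> ereal s \<Longrightarrow> ereal s < J (Suc n) \<omega> \<Longrightarrow>
       ennreal \<bar>A' s * f (flow n \<omega> s) + (if B n \<omega> then A s *
           (\<integral>y. f (flow n \<omega> s + g s * y $ i) - f (flow n \<omega> s) - f' (flow n \<omega> s) * g s * y $ i \<partial>K (Y n \<omega>)) else 0)\<bar>
       \<le> H \<omega> s"
    and Bd: "(\<integral>\<^sup>+ \<omega>. (\<integral>\<^sup>+ s. indicator {t0<..t} s * H \<omega> s \<partial>lborel) \<partial>M) \<le> ennreal b" "b \<ge> 0"
  shows "\<bar>A t * (\<integral>\<omega>. f (total \<omega>) \<partial>M) - A t0 * f 0\<bar> \<le> b"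
proof -
  define x where "x = (\<lambda>n. \<integral>\<omega>. A (c n \<omega>) * f (psum n \<omega>) \<partial>M)"
  let ?i = "\<lambda>n \<omega>. indicator {s. J n \<omega> \<le> ereal s \<and> ereal s < J (Suc n) \<omega> \<and> t0 < s \<and> s \<le> t} :: real \<Rightarrow> ennreal"
  have f_cont: "continuous_on UNIV f" using f_deriv DERIV_isCont continuous_at_imp_continuous_on by blast
  have [measurable]: "f \<in> borel_measurable borel" using f_cont by (rule borel_measurable_continuous_onI)
  have [measurable]: "psum n \<in> borel_measurable M" for n by (rule measurable_history_imp[OF psum_measurable])
  have step: "ennreal \<bar>x (Suc n) - x n\<bar> \<le> (\<integral>\<^sup>+ \<omega>. (\<integral>\<^sup>+ s. ?i n \<omega> s * H \<omega> s \<partial>lborel) \<partial>M)" for n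
    unfolding x_def by (rule ito_step[OF f_deriv f'_cont f_bd A_meas A_deriv A'_cont A_bd H])
  have i_meas: "(\<lambda>(\<omega>, s). ?i n \<omega> s * H \<omega> s) \<in> borel_measurable (M \<Otimes>\<^sub>M lborel)" for n
  proof -
    have "(\<lambda>z. indicator {z. J n (fst z) \<le> ereal (snd z) \<and> ereal (snd z) < J (Suc n) (fst z) \<and> t0 < snd z \<and> snd z \<le> t} z * H (fst z) (snd z))
        \<in> borel_measurable (M \<Otimes>\<^sub>M lborel)"
      using H_meas unfolding case_prod_beta by measurable
    then show ?thesis by (simp add: case_prod_beta indicator_def)
  qed
  have bound: "\<bar>x m - x 0\<bar> \<le> b" for m
  proof -
    have "\<bar>x m - x 0\<bar> \<le> (\<Sum>n<m. \<bar>x (Suc n) - x n\<bar>)"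
      using sum_abs[of "\<lambda>n. x (Suc n) - x n" "{..<m}"] by (simp add: sum_lessThan_telescope)
    then have "ennreal \<bar>x m - x 0\<bar> \<le> ennreal (\<Sum>n<m. \<bar>x (Suc n) - x n\<bar>)" by (rule ennreal_leI)
    also have "\<dots> = (\<Sum>n<m. ennreal \<bar>x (Suc n) - x n\<bar>)" by (simp add: sum_ennreal)
    also have "\<dots> \<le> (\<Sum>n<m. \<integral>\<^sup>+ \<omega>. (\<integral>\<^sup>+ s. ?i n \<omega> s * H \<omega> s \<partial>lborel) \<partial>M)"
      by (intro sum_mono step)
    also have "\<dots> = (\<integral>\<^sup>+ \<omega>. (\<Sum>n<m. \<integral>\<^sup>+ s. ?i n \<omega> s * H \<omega> s \<partial>lborel) \<partial>M)"
      by (intro nn_integral_sum[symmetric] lborel.borel_measurable_nn_integral i_meas)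
    also have "\<dots> \<le> (\<integral>\<^sup>+ \<omega>. (\<integral>\<^sup>+ s. indicator {t0<..t} s * H \<omega> s \<partial>lborel) \<partial>M)"
    proof (intro nn_integral_mono)
      fix \<omega> assume w: "\<omega> \<in> space M"
      have m: "(\<lambda>s. ?i n \<omega> s * H \<omega> s) \<in> borel_measurable lborel" for n
        using measurable_Pair2[OF i_meas[of n] w] by (simp only: prod.case)
      have "(\<Sum>n<m. \<integral>\<^sup>+ s. ?i n \<omega> s * H \<omega> s \<partial>lborel) = (\<integral>\<^sup>+ s. (\<Sum>n<m. ?i n \<omega> s * H \<omega> s) \<partial>lborel)"
        by (intro nn_integral_sum[symmetric] m)
      also have "\<dots> \<le> (\<integral>\<^sup>+ s. indicator {t0<..t} s * H \<omega> s \<partial>lborel)"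
      proof (intro nn_integral_mono)
        fix s :: real
        have "(\<Sum>n<m. ?i n \<omega> s * H \<omega> s) \<le> (\<Sum>n. ?i n \<omega> s * H \<omega> s)"
          by (rule sum_le_suminf) auto
        also have "\<dots> = (\<Sum>n. indicator {s. J n \<omega> \<le> ereal s \<and> ereal s < J (Suc n) \<omega>} s * (indicator {t0<..t} s * H \<omega> s))"
          by (intro suminf_cong) (auto split: split_indicator)
        also have "\<dots> \<le> indicator {t0<..t} s * H \<omega> s"
          by (rule suminf_state_le[OF w]) simp
        finally show "(\<Sum>n<m. ?i n \<omega> s * H \<omega> s) \<le> indicator {t0<..t} s * H \<omega> s" .
      qed
      finally show "(\<Sum>n<m. \<integral>\<^sup>+ s. ?i n \<omega> s * H \<omega> s \<partial>lborel) \<le> (\<integral>\<^sup>+ s. indicator {t0<..t} s * H \<omega> s \<partial>lborel)" .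
    qed
    also have "\<dots> \<le> ennreal b" by (rule Bd)
    finally show ?thesis using Bd(2) by simp
  qed
  have cI: "c n \<omega> \<in> {t0..t}" for n \<omega> using clip_bounds[OF t0_le] by auto
  have "x \<longlonglongrightarrow> (\<integral>\<omega>. A t * f (total \<omega>) \<partial>M)"
    unfolding x_def
  proof (rule integral_dominated_convergence[where w="\<lambda>_. cA * cf"])
    show "AE \<omega> in M. (\<lambda>n. A (c n \<omega>) * f (psum n \<omega>)) \<longlonglongrightarrow> A t * f (total \<omega>)"
    proof (rule AE_I2)
      fix \<omega> assume w: "\<omega> \<in> space M"
      show "(\<lambda>n. A (c n \<omega>) * f (psum n \<omega>)) \<longlonglongrightarrow> A t * f (total \<omega>)"
        using psum_tendsto[OF w] by (intro tendsto_eventually) (auto elim!: eventually_mono)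
    qed
    show "AE \<omega> in M. norm (A (c n \<omega>) * f (psum n \<omega>)) \<le> cA * cf" for n
    proof (rule AE_I2)
      fix \<omega>
      have "\<bar>A (c n \<omega>)\<bar> \<le> cA" by (rule A_bd[OF cI])
      then show "norm (A (c n \<omega>) * f (psum n \<omega>)) \<le> cA * cf"
        unfolding real_norm_def abs_mult by (intro mult_mono f_bd) auto
    qed
  qed auto
  then have "(\<lambda>m. \<bar>x m - x 0\<bar>) \<longlonglongrightarrow> \<bar>(\<integral>\<omega>. A t * f (total \<omega>) \<partial>M) - x 0\<bar>"
    by (intro tendsto_intros)
  then have "\<bar>(\<integral>\<omega>. A t * f (total \<omega>) \<partial>M) - x 0\<bar> \<le> b"
    by (rule LIMSEQ_le_const2) (use bound in auto)
  moreover have "x 0 = A t0 * f 0"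
  proof -
    have "x 0 = (\<integral>\<omega>. A t0 * f 0 \<partial>M)"
      unfolding x_def using t0_nonneg by (intro Bochner_Integration.integral_cong) (auto simp: psum_def J_0 clip_def zero_ereal_def)
    then show ?thesis by (simp add: prob_space)
  qed
  ultimately show ?thesis by simp
qed

lemma chebyshev_total:
  assumes b: "b > 0" and v: "(\<integral>\<^sup>+ s. indicator {t0<..t} s * ennreal ((g s)\<^sup>2) \<partial>lborel) \<le> ennreal v" "v \<ge> 0"
    and c2: "c2 \<ge> 0"
  shows "measure M {\<omega>\<in>space M. b \<le> \<bar>total \<omega>\<bar>} \<le> 2 * c2 * v / b\<^sup>2"
proof -
  define f where "f = (\<lambda>u::real. u\<^sup>2 / (b\<^sup>2 + u\<^sup>2))"
  define f' where "f' = (\<lambda>u::real. 2 * b\<^sup>2 * u / (b\<^sup>2 + u\<^sup>2)\<^sup>2)"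
  have pos: "b\<^sup>2 + u\<^sup>2 > 0" for u using b by (intro add_pos_nonneg) auto
  have nz: "b\<^sup>2 + u\<^sup>2 \<noteq> 0" for u using less_imp_neq[OF pos[of u]] by (rule not_sym)
  have fd: "(f has_real_derivative f' u) (at u)" for u
  proof -
    have "(f has_real_derivative (2 * u * (b\<^sup>2 + u\<^sup>2) - u\<^sup>2 * (2 * u)) / ((b\<^sup>2 + u\<^sup>2) * (b\<^sup>2 + u\<^sup>2))) (at u)"
      unfolding f_def using nz[of u] by (auto intro!: derivative_eq_intros)
    also have "(2 * u * (b\<^sup>2 + u\<^sup>2) - u\<^sup>2 * (2 * u)) / ((b\<^sup>2 + u\<^sup>2) * (b\<^sup>2 + u\<^sup>2)) = f' u"
      unfolding f'_def by (simp add: power2_eq_square algebra_simps)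
    finally show ?thesis .
  qed
  have f'c: "continuous_on UNIV f'" unfolding f'_def using nz by (intro continuous_intros) auto
  have f01: "0 \<le> f u" "f u \<le> 1" for u using pos[of u] by (auto simp: f_def)
  then have fb: "\<bar>f u\<bar> \<le> 1" for u by simp
  have "\<bar>1 * (\<integral>\<omega>. f (total \<omega>) \<partial>M) - 1 * f 0\<bar> \<le> c2 * v / b\<^sup>2"
  proof (rule ito_total[where A="\<lambda>_. 1" and A'="\<lambda>_. 0" and cA=1 and H="\<lambda>_ s. ennreal (c2 / b\<^sup>2) * ennreal ((g s)\<^sup>2)", OF fd f'c fb])
    fix n \<omega> s assume w: "\<omega> \<in> space M"
    have "\<bar>if B n \<omega> then 1 * (\<integral>y. f (flow n \<omega> s + g s * y $ i) - f (flow n \<omega> s) - f' (flow n \<omega> s) * g s * y $ i \<partial>K (Y n \<omega>)) else 0\<bar>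
       \<le> c2 / b\<^sup>2 * (g s)\<^sup>2"
    proof (cases "B n \<omega>")
      case True
      let ?k = "K (Y n \<omega>)"
      have YI: "Y n \<omega> \<in> D" "Y n \<omega> \<in> I" using Y_in[OF w] B_imp[OF w True] by auto
      have rem: "norm (f (flow n \<omega> s + g s * y $ i) - f (flow n \<omega> s) - f' (flow n \<omega> s) * g s * y $ i) \<le> (g s)\<^sup>2 / b\<^sup>2 * (y $ i)\<^sup>2" for y :: "real^2"
        using truncated_square_remainder[OF b, of "flow n \<omega> s" "g s * y $ i"]
        by (simp add: f_def f'_def power_mult_distrib mult.assoc)
      have "\<bar>\<integral>y. f (flow n \<omega> s + g s * y $ i) - f (flow n \<omega> s) - f' (flow n \<omega> s) * g s * y $ i \<partial>?k\<bar>
         \<le> (\<integral>y. (g s)\<^sup>2 / b\<^sup>2 * (y $ i)\<^sup>2 \<partial>?k)"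
      proof (cases "integrable ?k (\<lambda>y. f (flow n \<omega> s + g s * y $ i) - f (flow n \<omega> s) - f' (flow n \<omega> s) * g s * y $ i)")
        case True
        have "norm (\<integral>y. f (flow n \<omega> s + g s * y $ i) - f (flow n \<omega> s) - f' (flow n \<omega> s) * g s * y $ i \<partial>?k)
           \<le> (\<integral>y. (g s)\<^sup>2 / b\<^sup>2 * (y $ i)\<^sup>2 \<partial>?k)"
          by (rule Bochner_Integration.integral_norm_bound_integral[OF True integrable_mult_right[OF square_integrable[OF YI]] rem])
        then show ?thesis by simp
      next
        case False
        then show ?thesis by (simp add: not_integrable_integral_eq)
      qed
      also have "\<dots> \<le> (g s)\<^sup>2 / b\<^sup>2 * c2"
        using square_le[OF YI] by (simp add: divide_right_mono mult_left_mono)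
      finally show ?thesis using True by (simp add: mult.commute)
    qed (use c2 in auto)
    then show "ennreal \<bar>0 * f (flow n \<omega> s) + (if B n \<omega> then 1 *
           (\<integral>y. f (flow n \<omega> s + g s * y $ i) - f (flow n \<omega> s) - f' (flow n \<omega> s) * g s * y $ i \<partial>K (Y n \<omega>)) else 0)\<bar>
       \<le> ennreal (c2 / b\<^sup>2) * ennreal ((g s)\<^sup>2)"
      using c2 by (simp add: ennreal_mult[symmetric] ennreal_leI del: ennreal_mult)
  next
    have "(\<integral>\<^sup>+ s. indicator {t0<..t} s * (ennreal (c2 / b\<^sup>2) * ennreal ((g s)\<^sup>2)) \<partial>lborel)
       = ennreal (c2 / b\<^sup>2) * (\<integral>\<^sup>+ s. indicator {t0<..t} s * ennreal ((g s)\<^sup>2) \<partial>lborel)"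
      by (subst nn_integral_cmult[symmetric]) (auto simp: ac_simps)
    also have "\<dots> \<le> ennreal (c2 / b\<^sup>2) * ennreal v" by (intro mult_left_mono v) auto
    also have "\<dots> = ennreal (c2 * v / b\<^sup>2)" using c2 v by (subst ennreal_mult[symmetric]) auto
    finally show "(\<integral>\<^sup>+ \<omega>. (\<integral>\<^sup>+ s. indicator {t0<..t} s * (ennreal (c2 / b\<^sup>2) * ennreal ((g s)\<^sup>2)) \<partial>lborel) \<partial>M) \<le> ennreal (c2 * v / b\<^sup>2)"
      by (simp add: emeasure_space_1)
    show "0 \<le> c2 * v / b\<^sup>2" using c2 v by simp
  qed auto
  then have E: "(\<integral>\<omega>. f (total \<omega>) \<partial>M) \<le> c2 * v / b\<^sup>2" by (simp add: f_def)
  have [measurable]: "f \<in> borel_measurable borel" unfolding f_def by measurable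
  have fi: "integrable M (\<lambda>\<omega>. f (total \<omega>))"
    by (rule integrable_const_bound[where B=1]) (use fb in auto)
  \<comment> \<open>This lower bound costs the factor \<open>2\<close> in comparison with the usual inequality.\<close>
  have half: "1 / 2 \<le> f u" if "b \<le> \<bar>u\<bar>" for u
  proof -
    have "b\<^sup>2 \<le> u\<^sup>2" using that b abs_le_square_iff[of b u] by simp
    then show ?thesis using pos[of u] by (simp add: f_def field_simps)
  qed
  have "measure M {\<omega>\<in>space M. b \<le> \<bar>total \<omega>\<bar>} \<le> measure M {\<omega>\<in>space M. 1 / 2 \<le> f (total \<omega>)}"
  proof (rule finite_measure_mono)
    show "{\<omega>\<in>space M. b \<le> \<bar>total \<omega>\<bar>} \<subseteq> {\<omega>\<in>space M. 1 / 2 \<le> f (total \<omega>)}" using half by blast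
  qed measurable
  also have "\<dots> \<le> (\<integral>\<omega>. f (total \<omega>) \<partial>M) / (1 / 2)"
    by (rule integral_Markov_inequality_measure[where A="{}"]) (use fi f01 in auto)
  finally show ?thesis using E by (simp add: mult.assoc)
qed

definition sq :: "nat \<Rightarrow> 'w \<Rightarrow> real" where
  "sq n \<omega> = (if B n \<omega> then \<integral>y. (y $ i)\<^sup>2 \<partial>K (Y n \<omega>) else 0)"

lemma sq_measurable [measurable]: "sq n \<in> borel_measurable M"
proof -
  have YR: "Y n \<in> F n \<rightarrow>\<^sub>M restrict_space borel I"
    by (rule measurable_restrict_space2) (auto intro: Y_in measurable_history)
  have m: "(\<lambda>\<omega>. \<integral>\<^sup>+ y. ennreal ((y $ i)\<^sup>2) \<partial>K (Y n \<omega>)) \<in> borel_measurable (F n)"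
    by (rule measurable_nn_integral_finite_kernel[OF kernel YR]) measurable
  have [measurable]: "Measurable.pred (F n) (B n)" by (rule B_measurable) simp
  have m1: "(\<lambda>\<omega>. if B n \<omega> then enn2real (\<integral>\<^sup>+ y. ennreal ((y $ i)\<^sup>2) \<partial>K (Y n \<omega>)) else 0) \<in> borel_measurable (F n)"
    using m by measurable
  have e: "sq n \<omega> = (if B n \<omega> then enn2real (\<integral>\<^sup>+ y. ennreal ((y $ i)\<^sup>2) \<partial>K (Y n \<omega>)) else 0)"
    if "\<omega> \<in> space (F n)" for \<omega>
  proof -
    have "integrable (K (Y n \<omega>)) (\<lambda>y. (y $ i)\<^sup>2)" if "B n \<omega>"
      using square_integrable B_imp Y_in that \<open>\<omega> \<in> space (F n)\<close> by simp
    then show ?thesis by (auto simp: sq_def intro!: integral_eq_nn_integral borel_measurable_integrable)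
  qed
  show ?thesis by (rule measurable_history_imp[OF iffD2[OF measurable_cong[OF e] m1]])
qed

text \<open>Let \<open>A s = exp (\<kappa>\<^sup>2 / 2 * V s)\<close> in the Ito inequality, and let \<open>f\<close> behave like a solution of \<open>f'' = - \<kappa>\<^sup>2 * f\<close>. Then
  the derivative of \<open>A\<close> contributes \<open>\<kappa>\<^sup>2 / 2 * w s\<close>, the second-order term of \<open>f\<close> contributes
  \<open>- \<kappa>\<^sup>2 / 2\<close> times the actual rate of variance, and only their difference and the third moments of the jumps
  remain.\<close>

lemma clt_estimate_real:
  fixes f f' V w E :: "real \<Rightarrow> real"
  assumes t0: "t0 = 0"
    and f_deriv: "\<And>u. (f has_real_derivative f' u) (at u)" and f'_cont: "continuous_on UNIV f'"
    and f_bd: "\<And>u. \<bar>f u\<bar> \<le> 1"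
    and f_rem: "\<And>u h. \<bar>f (u + h) - f u - f' u * h + (\<kappa> * h)\<^sup>2 / 2 * f u\<bar> \<le> \<bar>\<kappa> * h\<bar> ^ 3 / 6"
    and V_meas [measurable]: "V \<in> borel_measurable borel" and V0: "V 0 = 0"
    and V_deriv: "\<And>s. s \<in> {0..t} \<Longrightarrow> (V has_real_derivative w s) (at s within {0..t})"
    and w_cont: "continuous_on {0..t} w" and w_meas [measurable]: "w \<in> borel_measurable borel"
    and V_bd: "\<And>s. s \<in> {0..t} \<Longrightarrow> V s \<le> Vm"
    and cube_integrable: "\<And>x. x \<in> D \<Longrightarrow> x \<in> I \<Longrightarrow> integrable (K x) (\<lambda>y. \<bar>y $ i\<bar> ^ 3)"
    and cube_le: "\<And>x. x \<in> D \<Longrightarrow> x \<in> I \<Longrightarrow> (\<integral>y. \<bar>y $ i\<bar> ^ 3 \<partial>K x) \<le> c3"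
    and E_meas [measurable]: "E \<in> borel_measurable borel"
    and E: "\<And>s. 0 < s \<Longrightarrow> s \<le> t \<Longrightarrow> (\<integral>\<^sup>+ \<omega>. (\<Sum>n. indicator {s. J n \<omega> \<le> ereal s \<and> ereal s < J (Suc n) \<omega>} s * ennreal \<bar>w s - (g s)\<^sup>2 * sq n \<omega>\<bar>) \<partial>M) \<le> ennreal (E s)"
    and e1: "(\<integral>\<^sup>+ s. indicator {0<..t} s * ennreal (E s) \<partial>lborel) \<le> ennreal e1" "e1 \<ge> 0"
    and e3: "(\<integral>\<^sup>+ s. indicator {0<..t} s * ennreal (\<bar>g s\<bar> ^ 3) \<partial>lborel) \<le> ennreal e3" "e3 \<ge> 0" and c3: "c3 \<ge> 0"
  shows "\<bar>exp (\<kappa>\<^sup>2 / 2 * V t) * (\<integral>\<omega>. f (total \<omega>) \<partial>M) - f 0\<bar>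
     \<le> exp (\<kappa>\<^sup>2 / 2 * Vm) * (\<kappa>\<^sup>2 / 2 * e1 + \<bar>\<kappa>\<bar> ^ 3 * c3 / 6 * e3)"
proof -
  let ?A = "\<lambda>s. exp (\<kappa>\<^sup>2 / 2 * V s)" let ?cA = "exp (\<kappa>\<^sup>2 / 2 * Vm)"
  let ?A' = "\<lambda>s. ?A s * (\<kappa>\<^sup>2 / 2 * w s)"
  define es where "es = (\<lambda>\<omega> s. \<Sum>n. indicator {s. J n \<omega> \<le> ereal s \<and> ereal s < J (Suc n) \<omega>} s * ennreal \<bar>w s - (g s)\<^sup>2 * sq n \<omega>\<bar>)"
  define H where "H = (\<lambda>\<omega> s. ennreal ?cA * (ennreal (\<kappa>\<^sup>2 / 2) * es \<omega> s + ennreal (\<bar>\<kappa>\<bar> ^ 3 * c3 / 6) * ennreal (\<bar>g s\<bar> ^ 3)))"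
  let ?b = "?cA * (\<kappa>\<^sup>2 / 2 * e1 + \<bar>\<kappa>\<bar> ^ 3 * c3 / 6 * e3)"
  have es_meas: "(\<lambda>z. es (fst z) (snd z)) \<in> borel_measurable (M \<Otimes>\<^sub>M lborel)"
  proof -
    have "(\<lambda>z. indicator {z. J n (fst z) \<le> ereal (snd z) \<and> ereal (snd z) < J (Suc n) (fst z)} z * ennreal \<bar>w (snd z) - (g (snd z))\<^sup>2 * sq n (fst z)\<bar>)
       \<in> borel_measurable (M \<Otimes>\<^sub>M lborel)" for n
      by measurable
    then have "(\<lambda>z. \<Sum>n. indicator {z. J n (fst z) \<le> ereal (snd z) \<and> ereal (snd z) < J (Suc n) (fst z)} z * ennreal \<bar>w (snd z) - (g (snd z))\<^sup>2 * sq n (fst z)\<bar>)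
       \<in> borel_measurable (M \<Otimes>\<^sub>M lborel)"
      by (rule borel_measurable_suminf_order)
    then show ?thesis by (simp add: es_def indicator_def)
  qed
  have H_meas: "(\<lambda>(\<omega>, s). H \<omega> s) \<in> borel_measurable (M \<Otimes>\<^sub>M lborel)"
    unfolding H_def case_prod_beta using es_meas by measurable
  have "\<bar>?A t * (\<integral>\<omega>. f (total \<omega>) \<partial>M) - ?A t0 * f 0\<bar> \<le> ?b"
  proof (rule ito_total[where A="?A" and A'="?A'" and cA="?cA" and H=H, OF f_deriv f'_cont f_bd])
    show "?A \<in> borel_measurable borel" by measurable
    show "((\<lambda>s. ?A s) has_real_derivative ?A' s) (at s within {t0..t})" if "s \<in> {t0..t}" for s
      using V_deriv[of s] that t0 by (auto intro!: derivative_eq_intros)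
    have "continuous_on {0..t} V" using V_deriv by (intro DERIV_continuous_on) auto
    then show "continuous_on {t0..t} ?A'"
      using w_cont t0 by (auto intro!: continuous_intros)
    show "\<bar>?A s\<bar> \<le> ?cA" if "s \<in> {t0..t}" for s
      using V_bd[of s] that t0 by (auto intro!: mult_left_mono)
    show "(\<lambda>(\<omega>, s). H \<omega> s) \<in> borel_measurable (M \<Otimes>\<^sub>M lborel)" by (rule H_meas)
    show "0 \<le> ?b" using e1 e3 c3 by (intro mult_nonneg_nonneg add_nonneg_nonneg) auto
  next
    fix n \<omega> s
    assume w: "\<omega> \<in> space M" and s: "t0 < s" "s \<le> t" and Js: "J n \<omega> \<le> ereal s" "ereal s < J (Suc n) \<omega>"
    let ?k = "K (Y n \<omega>)" let ?u = "flow n \<omega> s"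
    let ?X = "\<integral>y. f (?u + g s * y $ i) - f ?u - f' ?u * g s * y $ i \<partial>?k"
    have As: "?A s \<le> ?cA" using V_bd[of s] s t0 by (auto intro!: mult_left_mono)
    have key: "\<bar>(if B n \<omega> then ?X else 0) + \<kappa>\<^sup>2 / 2 * ((g s)\<^sup>2 * sq n \<omega>) * f ?u\<bar> \<le> \<bar>\<kappa>\<bar> ^ 3 * c3 / 6 * \<bar>g s\<bar> ^ 3"
    proof (cases "B n \<omega>")
      case True
      have YI: "Y n \<omega> \<in> D" "Y n \<omega> \<in> I" using Y_in[OF w] B_imp[OF w True] by auto
      interpret k: finite_measure ?k by (rule kernel_finite[OF YI(2)])
      have [measurable_cong]: "sets ?k = sets borel" by (rule kernel_sets[OF YI(2)])
      have f_cont: "continuous_on UNIV f" using f_deriv DERIV_isCont continuous_at_imp_continuous_on by blast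
      have [measurable]: "f \<in> borel_measurable borel" using f_cont by (rule borel_measurable_continuous_onI)
      have f1: "integrable ?k (\<lambda>y. f (?u + g s * y $ i) - f ?u)"
      proof (rule k.integrable_const_bound[where B="2"])
        have "\<bar>f (?u + g s * y $ i) - f ?u\<bar> \<le> 2" for y :: "real^2"
          using f_bd[of "?u + g s * y $ i"] f_bd[of ?u] by linarith
        then show "AE y in ?k. norm (f (?u + g s * y $ i) - f ?u) \<le> 2" by simp
      qed measurable
      have f2: "integrable ?k (\<lambda>y. f' ?u * g s * y $ i)" using jump_integrable[OF YI] by simp
      have f3: "integrable ?k (\<lambda>y. \<kappa>\<^sup>2 / 2 * (g s)\<^sup>2 * f ?u * (y $ i)\<^sup>2)" using square_integrable[OF YI] by simp
      have f4: "integrable ?k (\<lambda>y. f (?u + g s * y $ i) - f ?u - f' ?u * g s * y $ i)"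
        by (rule Bochner_Integration.integrable_diff[OF f1 f2])
      let ?I = "\<integral>y. f (?u + g s * y $ i) - f ?u - f' ?u * g s * y $ i + \<kappa>\<^sup>2 / 2 * (g s)\<^sup>2 * f ?u * (y $ i)\<^sup>2 \<partial>?k"
      have "?X + \<kappa>\<^sup>2 / 2 * ((g s)\<^sup>2 * sq n \<omega>) * f ?u
         = ?X + (\<integral>y. \<kappa>\<^sup>2 / 2 * (g s)\<^sup>2 * f ?u * (y $ i)\<^sup>2 \<partial>?k)"
        using True by (simp add: sq_def)
      also have "\<dots> = ?I"
        by (rule Bochner_Integration.integral_add[OF f4 f3, symmetric])
      finally have XI: "?X + \<kappa>\<^sup>2 / 2 * ((g s)\<^sup>2 * sq n \<omega>) * f ?u = ?I" .
      have "\<bar>?I\<bar> \<le> (\<integral>y. \<bar>\<kappa>\<bar> ^ 3 / 6 * \<bar>g s\<bar> ^ 3 * \<bar>y $ i\<bar> ^ 3 \<partial>?k)"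
      proof -
        have rem: "norm (f (?u + g s * y $ i) - f ?u - f' ?u * g s * y $ i + \<kappa>\<^sup>2 / 2 * (g s)\<^sup>2 * f ?u * (y $ i)\<^sup>2)
          \<le> \<bar>\<kappa>\<bar> ^ 3 / 6 * \<bar>g s\<bar> ^ 3 * \<bar>y $ i\<bar> ^ 3" for y :: "real^2"
          using f_rem[of ?u "g s * y $ i"] by (simp add: power_mult_distrib abs_mult algebra_simps)
        have ci: "integrable ?k (\<lambda>y. \<bar>\<kappa>\<bar> ^ 3 / 6 * \<bar>g s\<bar> ^ 3 * \<bar>y $ i\<bar> ^ 3)"
          using cube_integrable[OF YI] by simp
        show ?thesis
          using Bochner_Integration.integral_norm_bound_integral[OF Bochner_Integration.integrable_add[OF f4 f3] ci rem]
          unfolding real_norm_def .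
      qed
      also have "\<dots> \<le> \<bar>\<kappa>\<bar> ^ 3 / 6 * \<bar>g s\<bar> ^ 3 * c3"
        unfolding integral_mult_right_zero using cube_le[OF YI] by (intro mult_left_mono) auto
      finally have "\<bar>?I\<bar> \<le> \<bar>\<kappa>\<bar> ^ 3 / 6 * \<bar>g s\<bar> ^ 3 * c3" .
      then have "\<bar>?X + \<kappa>\<^sup>2 / 2 * ((g s)\<^sup>2 * sq n \<omega>) * f ?u\<bar> \<le> \<bar>\<kappa>\<bar> ^ 3 / 6 * \<bar>g s\<bar> ^ 3 * c3"
        by (simp only: XI)
      also have "\<dots> = \<bar>\<kappa>\<bar> ^ 3 * c3 / 6 * \<bar>g s\<bar> ^ 3" by simp
      finally show ?thesis using True by (simp only: if_True)
    next
      case False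
      then show ?thesis using c3 by (simp add: sq_def)
    qed
    let ?d = "\<bar>w s - (g s)\<^sup>2 * sq n \<omega>\<bar>"
    let ?Z = "(if B n \<omega> then ?X else 0) + \<kappa>\<^sup>2 / 2 * ((g s)\<^sup>2 * sq n \<omega>) * f ?u"
    have "?A' s * f ?u + (if B n \<omega> then ?A s * ?X else 0)
       = ?A s * (\<kappa>\<^sup>2 / 2 * (w s - (g s)\<^sup>2 * sq n \<omega>) * f ?u + ?Z)"
      by (simp add: algebra_simps)
    then have "\<bar>?A' s * f ?u + (if B n \<omega> then ?A s * ?X else 0)\<bar>
       = ?A s * \<bar>\<kappa>\<^sup>2 / 2 * (w s - (g s)\<^sup>2 * sq n \<omega>) * f ?u + ?Z\<bar>"
      by (simp only: abs_mult abs_exp_cancel)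
    also have "\<dots> \<le> ?cA * (\<kappa>\<^sup>2 / 2 * ?d + \<bar>\<kappa>\<bar> ^ 3 * c3 / 6 * \<bar>g s\<bar> ^ 3)"
    proof (intro mult_mono As)
      have "\<bar>\<kappa>\<^sup>2 / 2 * (w s - (g s)\<^sup>2 * sq n \<omega>) * f ?u\<bar> = \<kappa>\<^sup>2 / 2 * ?d * \<bar>f ?u\<bar>"
        by (simp add: abs_mult)
      also have "\<dots> \<le> \<kappa>\<^sup>2 / 2 * ?d * 1" by (intro mult_left_mono f_bd) auto
      finally have "\<bar>\<kappa>\<^sup>2 / 2 * (w s - (g s)\<^sup>2 * sq n \<omega>) * f ?u\<bar> \<le> \<kappa>\<^sup>2 / 2 * ?d" by simp
      with key show "\<bar>\<kappa>\<^sup>2 / 2 * (w s - (g s)\<^sup>2 * sq n \<omega>) * f ?u + ?Z\<bar> \<le> \<kappa>\<^sup>2 / 2 * ?d + \<bar>\<kappa>\<bar> ^ 3 * c3 / 6 * \<bar>g s\<bar> ^ 3"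
        using abs_triangle_ineq[of "\<kappa>\<^sup>2 / 2 * (w s - (g s)\<^sup>2 * sq n \<omega>) * f ?u" ?Z] by linarith
    qed auto
    finally have "ennreal \<bar>?A' s * f ?u + (if B n \<omega> then ?A s * ?X else 0)\<bar>
       \<le> ennreal (?cA * (\<kappa>\<^sup>2 / 2 * ?d + \<bar>\<kappa>\<bar> ^ 3 * c3 / 6 * \<bar>g s\<bar> ^ 3))"
      by (rule ennreal_leI)
    also have "\<dots> = ennreal ?cA * (ennreal (\<kappa>\<^sup>2 / 2) * ennreal ?d + ennreal (\<bar>\<kappa>\<bar> ^ 3 * c3 / 6) * ennreal (\<bar>g s\<bar> ^ 3))"
      using c3 by (simp only: ennreal_mult ennreal_plus mult_nonneg_nonneg add_nonneg_nonneg exp_ge_zero abs_ge_zero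
          zero_le_power zero_le_power2 divide_nonneg_nonneg zero_le_numeral)
    also have "\<dots> \<le> H \<omega> s"
      unfolding H_def
    proof (intro mult_left_mono add_right_mono)
      have "ennreal ?d = (\<Sum>k\<in>{n}. indicator {s. J k \<omega> \<le> ereal s \<and> ereal s < J (Suc k) \<omega>} s * ennreal \<bar>w s - (g s)\<^sup>2 * sq k \<omega>\<bar>)"
        using Js by simp
      also have "\<dots> \<le> es \<omega> s" unfolding es_def by (rule sum_le_suminf) auto
      finally show "ennreal ?d \<le> es \<omega> s" .
    qed auto
    finally show "ennreal \<bar>?A' s * f ?u + (if B n \<omega> then ?A s * ?X else 0)\<bar> \<le> H \<omega> s" .
  next
    interpret L: pair_sigma_finite M lborel by unfold_locales
    have Hm: "(\<lambda>(\<omega>, s). indicator {t0<..t} s * H \<omega> s) \<in> borel_measurable (M \<Otimes>\<^sub>M lborel)"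
      using H_meas unfolding case_prod_beta by measurable
    have "(\<integral>\<^sup>+ \<omega>. (\<integral>\<^sup>+ s. indicator {t0<..t} s * H \<omega> s \<partial>lborel) \<partial>M)
       = (\<integral>\<^sup>+ s. (\<integral>\<^sup>+ \<omega>. indicator {t0<..t} s * H \<omega> s \<partial>M) \<partial>lborel)"
      by (rule L.Fubini'[OF Hm, symmetric])
    also have "\<dots> \<le> (\<integral>\<^sup>+ s. ennreal ?cA * (ennreal (\<kappa>\<^sup>2 / 2) * (indicator {0<..t} s * ennreal (E s))
         + ennreal (\<bar>\<kappa>\<bar> ^ 3 * c3 / 6) * (indicator {0<..t} s * ennreal (\<bar>g s\<bar> ^ 3))) \<partial>lborel)"
    proof (intro nn_integral_mono)
      fix s :: real
      have em: "(\<lambda>\<omega>. es \<omega> s) \<in> borel_measurable M"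
        using measurable_compose[OF measurable_Pair2'[of s lborel M] es_meas] by simp
      have "(\<integral>\<^sup>+ \<omega>. H \<omega> s \<partial>M) = ennreal ?cA * (ennreal (\<kappa>\<^sup>2 / 2) * (\<integral>\<^sup>+ \<omega>. es \<omega> s \<partial>M) + ennreal (\<bar>\<kappa>\<bar> ^ 3 * c3 / 6) * ennreal (\<bar>g s\<bar> ^ 3))"
        unfolding H_def using em by (simp add: nn_integral_cmult nn_integral_add emeasure_space_1)
      moreover have "(\<integral>\<^sup>+ \<omega>. es \<omega> s \<partial>M) \<le> ennreal (E s)" if "0 < s" "s \<le> t"
        unfolding es_def by (rule E[OF that])
      ultimately show "(\<integral>\<^sup>+ \<omega>. indicator {t0<..t} s * H \<omega> s \<partial>M) \<le> ennreal ?cA * (ennreal (\<kappa>\<^sup>2 / 2) * (indicator {0<..t} s * ennreal (E s))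
         + ennreal (\<bar>\<kappa>\<bar> ^ 3 * c3 / 6) * (indicator {0<..t} s * ennreal (\<bar>g s\<bar> ^ 3)))"
        using t0 by (cases "0 < s \<and> s \<le> t") (auto intro!: mult_left_mono add_right_mono)
    qed
    also have "\<dots> = ennreal ?cA * (ennreal (\<kappa>\<^sup>2 / 2) * (\<integral>\<^sup>+ s. indicator {0<..t} s * ennreal (E s) \<partial>lborel)
         + ennreal (\<bar>\<kappa>\<bar> ^ 3 * c3 / 6) * (\<integral>\<^sup>+ s. indicator {0<..t} s * ennreal (\<bar>g s\<bar> ^ 3) \<partial>lborel))"
      by (simp add: nn_integral_cmult nn_integral_add)
    also have "\<dots> \<le> ennreal ?cA * (ennreal (\<kappa>\<^sup>2 / 2) * ennreal e1 + ennreal (\<bar>\<kappa>\<bar> ^ 3 * c3 / 6) * ennreal e3)"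
      by (intro mult_left_mono add_mono e1 e3) auto
    also have "\<dots> = ennreal ?b"
      using e1 e3 c3 by (simp only: ennreal_mult ennreal_plus mult_nonneg_nonneg add_nonneg_nonneg exp_ge_zero abs_ge_zero
          zero_le_power zero_le_power2 divide_nonneg_nonneg zero_le_numeral)
    finally show "(\<integral>\<^sup>+ \<omega>. (\<integral>\<^sup>+ s. indicator {t0<..t} s * H \<omega> s \<partial>lborel) \<partial>M) \<le> ennreal ?b" .
  qed
  then show ?thesis using V0 t0 by simp
qed

lemma monotone_antiderivative:
  assumes "\<And>s. g s \<ge> 0" "a \<le> b"
  shows "\<Gamma> a \<le> \<Gamma> b"
  by (rule DERIV_nonneg_imp_nondecreasing[OF assms(2)]) (use \<Gamma>_deriv assms(1) in blast)

text \<open>Variation of constants along one path. Multiplication by \<open>exp (- \<gamma> * s)\<close> removes the linear drift: at jumps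
  the product changes by \<open>g\<close> times the jump, and between jumps by what the compensator subtracts, up to the
  drift error \<open>d\<close>. The path is followed up to the time \<open>r\<close>, which is \<open>t\<close> or the first time at which \<open>Qp\<close> fails;
  afterwards \<open>B\<close> is false and \<open>total\<close> does not change any more.\<close>

lemma stopped_decomposition:
  assumes t0: "t0 = 0" and BQ: "\<And>n. B n \<omega> \<longleftrightarrow> (\<forall>k\<le>n. Qp (Y k \<omega>))"
    and g: "\<And>s. g s = w * exp (- \<gamma> * s)" and \<Gamma>: "\<And>s. \<Gamma> s = - (w / \<gamma>) * exp (- \<gamma> * s)"
    and w: "w \<ge> 0" and \<gamma>: "\<gamma> \<noteq> 0" and d: "d \<ge> 0"
    and drift: "\<And>x. x \<in> D \<Longrightarrow> x \<in> I \<Longrightarrow> \<bar>(\<integral>y. y $ i \<partial>K x) - \<gamma> * x $ i\<bar> \<le> d"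
    and \<omega>: "\<omega> \<in> space M"
    and r: "J m \<omega> \<le> ereal r" "r \<le> t" and Qm: "\<And>k. k < m \<Longrightarrow> Qp (Y k \<omega>)"
    and alt: "(r = t \<and> ereal r < J (Suc m) \<omega> \<and> Qp (Y m \<omega>)) \<or> (J m \<omega> = ereal r \<and> \<not> Qp (Y m \<omega>))"
  shows "\<bar>w * exp (- \<gamma> * r) * Y m \<omega> $ i - w * x0 $ i - total \<omega>\<bar> \<le> d * (\<Gamma> t - \<Gamma> 0)"
proof -
  have mono: "\<Gamma> a \<le> \<Gamma> b" if "a \<le> b" for a b
    using that w by (intro monotone_antiderivative) (auto simp: g)
  have gG: "w * exp (- \<gamma> * b) - w * exp (- \<gamma> * a) = - \<gamma> * (\<Gamma> b - \<Gamma> a)" for a b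
    unfolding \<Gamma> using \<gamma> by (simp add: field_simps)
  define v where "v = (\<lambda>n. w * exp (- \<gamma> * c n \<omega>) * Y n \<omega> $ i)"
  have r0: "0 \<le> r" using order_trans[OF J_nonneg[OF \<omega>, of m] r(1)] by simp
  have Jfin: "J n \<omega> = ereal (c n \<omega>) \<and> 0 \<le> c n \<omega> \<and> c n \<omega> \<le> r" if "n \<le> m" for n
  proof -
    have "0 \<le> J n \<omega>" "J n \<omega> \<le> ereal r" using J_nonneg[OF \<omega>] order_trans[OF J_le[OF \<omega> that] r(1)] by auto
    then obtain a where "J n \<omega> = ereal a" "0 \<le> a" "a \<le> r" by (cases "J n \<omega>") auto
    then show ?thesis using r(2) t0 by (auto simp: clip_def)
  qed
  have beta: "\<bar>\<beta> n \<omega> - \<gamma> * Y n \<omega> $ i\<bar> \<le> d" if "B n \<omega>" for n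
    using drift[OF B_imp[OF \<omega> that] Y_in[OF \<omega>]] that by (simp add: \<beta>_def)
  have err: "\<bar>(\<beta> n \<omega> - \<gamma> * Y n \<omega> $ i) * (\<Gamma> b - \<Gamma> a)\<bar> \<le> d * (\<Gamma> b - \<Gamma> a)" if "B n \<omega>" "a \<le> b" for n a b
    unfolding abs_mult using beta[OF that(1)] mono[OF that(2)] d by (intro mult_mono) auto
  have main: "n \<le> m \<Longrightarrow> \<bar>v n - w * x0 $ i - psum n \<omega>\<bar> \<le> d * (\<Gamma> (c n \<omega>) - \<Gamma> 0)" for n
  proof (induction n)
    case 0
    have "c 0 \<omega> = 0" using J_0[OF \<omega>] t0 by (simp add: clip_def zero_ereal_def)
    then show ?case using Y_0[OF \<omega>] by (simp add: v_def psum_def)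
  next
    case (Suc n)
    then have IH: "\<bar>v n - w * x0 $ i - psum n \<omega>\<bar> \<le> d * (\<Gamma> (c n \<omega>) - \<Gamma> 0)" by simp
    have Bn: "B n \<omega>" using Suc.prems Qm by (auto simp: BQ)
    obtain x where x: "J n \<omega> = ereal x" "c n \<omega> = x" "0 \<le> x" using Jfin[of n] Suc.prems by auto
    obtain y where y: "J (Suc n) \<omega> = ereal y" "c (Suc n) \<omega> = y" "y \<le> r" using Jfin[of "Suc n"] Suc.prems by auto
    have lt: "x < y" using J_strict[OF \<omega>, of n] unfolding x(1) y(1) by simp
    have inc: "incr n \<omega> = g y * jump n \<omega> $ i - \<beta> n \<omega> * (\<Gamma> y - \<Gamma> x)"
      unfolding incr_def x(2) y(2) unfolding y(1) using Bn lt t0 r(2) x(3) y(3) by simp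
    have "v (Suc n) - v n = g y * jump n \<omega> $ i + (w * exp (- \<gamma> * y) - w * exp (- \<gamma> * x)) * Y n \<omega> $ i"
      unfolding v_def g x(2) y(2) by (simp add: algebra_simps)
    then have "v (Suc n) - v n - incr n \<omega> = (\<beta> n \<omega> - \<gamma> * Y n \<omega> $ i) * (\<Gamma> y - \<Gamma> x)"
      unfolding gG inc by (simp add: algebra_simps)
    then have "\<bar>v (Suc n) - v n - incr n \<omega>\<bar> \<le> d * (\<Gamma> y - \<Gamma> x)" using err[OF Bn, of x y] lt by simp
    moreover have "d * (\<Gamma> y - \<Gamma> x) + d * (\<Gamma> x - \<Gamma> 0) = d * (\<Gamma> y - \<Gamma> 0)" by (simp add: algebra_simps)
    moreover have "psum (Suc n) \<omega> = psum n \<omega> + incr n \<omega>" by (simp add: psum_def)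
    ultimately show ?case using IH unfolding x(2) y(2) by linarith
  qed
  from alt show ?thesis
  proof
    assume a: "r = t \<and> ereal r < J (Suc m) \<omega> \<and> Qp (Y m \<omega>)"
    have Bm: "B m \<omega>" using a Qm by (auto simp: BQ le_less)
    have past: "ereal t < J n \<omega>" if "n \<ge> Suc m" for n
      using a J_le[OF \<omega> that] by (auto intro: less_le_trans)
    have cS: "c (Suc m) \<omega> = t" using a r0 t0 by (cases "J (Suc m) \<omega>") (auto simp: clip_def)
    have inc: "incr m \<omega> = - \<beta> m \<omega> * (\<Gamma> t - \<Gamma> (c m \<omega>))"
      unfolding incr_def cS using a by auto
    have mart: "total \<omega> = psum m \<omega> + incr m \<omega>"
      using psum_eq_total[OF \<omega>, of "Suc m"] past by (simp add: psum_def)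
    have "w * exp (- \<gamma> * r) * Y m \<omega> $ i - v m = (w * exp (- \<gamma> * t) - w * exp (- \<gamma> * c m \<omega>)) * Y m \<omega> $ i"
      using a by (simp add: v_def algebra_simps)
    then have "w * exp (- \<gamma> * r) * Y m \<omega> $ i - v m - incr m \<omega> = (\<beta> m \<omega> - \<gamma> * Y m \<omega> $ i) * (\<Gamma> t - \<Gamma> (c m \<omega>))"
      unfolding gG inc by (simp add: algebra_simps)
    then have "\<bar>w * exp (- \<gamma> * r) * Y m \<omega> $ i - v m - incr m \<omega>\<bar> \<le> d * (\<Gamma> t - \<Gamma> (c m \<omega>))"
      using err[OF Bm, of "c m \<omega>" t] Jfin[of m] r(2) by simp
    moreover have "d * (\<Gamma> t - \<Gamma> (c m \<omega>)) + d * (\<Gamma> (c m \<omega>) - \<Gamma> 0) = d * (\<Gamma> t - \<Gamma> 0)" by (simp add: algebra_simps)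
    ultimately show ?thesis using main[of m] unfolding mart by linarith
  next
    assume a: "J m \<omega> = ereal r \<and> \<not> Qp (Y m \<omega>)"
    have cm: "c m \<omega> = r" using a Jfin[of m] by simp
    have "incr n \<omega> = 0" if "n \<ge> m" for n
    proof -
      have "\<not> B n \<omega>" using a that by (auto simp: BQ)
      then show ?thesis by (simp add: incr_def \<beta>_def)
    qed
    then have mart: "total \<omega> = psum m \<omega>"
      unfolding total_def psum_def by (intro suminf_finite) auto
    have "d * (\<Gamma> r - \<Gamma> 0) \<le> d * (\<Gamma> t - \<Gamma> 0)" using mono[OF r(2)] d by (intro mult_left_mono) auto
    then show ?thesis using main[of m] unfolding mart v_def cm by simp
  qed
qed

end

section \<open>Stopped paths and hitting times\<close>

lemma abs_slope_measurable [measurable]: "abs_slope \<in> borel_measurable borel"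
  unfolding abs_slope_def[abs_def] by measurable

locale jump_paths = jump_process M J Y I K x0
  for M :: "'w measure" and J :: "nat \<Rightarrow> 'w \<Rightarrow> ereal" and Y :: "nat \<Rightarrow> 'w \<Rightarrow> real^2"
    and I :: "(real^2) set" and K :: "real^2 \<Rightarrow> (real^2) measure" and x0 :: "real^2" +
  fixes X :: "real \<Rightarrow> 'w \<Rightarrow> real^2"
  assumes X_eq: "\<And>\<omega> t n. \<omega> \<in> space M \<Longrightarrow> t \<ge> 0 \<Longrightarrow> J n \<omega> \<le> ereal t \<Longrightarrow> ereal t < J (Suc n) \<omega> \<Longrightarrow> X t \<omega> = Y n \<omega>"

lemma pure_jump_markovE:
  assumes "pure_jump_markov M X I K x0"
  obtains J Y where "jump_paths M J Y I K x0 X"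
proof -
  from assms have pr: "prob_space M" and lk: "levy_kernel I K"
    unfolding pure_jump_markov_def by auto
  from assms obtain J Y where
    1: "\<forall>n. J n \<in> borel_measurable M \<and> Y n \<in> borel_measurable M" and
    2: "\<forall>\<omega>\<in>space M.
           J 0 \<omega> = 0 \<and> Y 0 \<omega> = x0 \<and>
           (\<forall>n. Y n \<omega> \<in> I) \<and>
           (\<forall>n. J n \<omega> \<le> J (Suc n) \<omega>) \<and>
           (\<forall>n. J n \<omega> < \<infinity> \<longrightarrow> J n \<omega> < J (Suc n) \<omega>) \<and>
           (\<lambda>n. J n \<omega>) \<longlonglongrightarrow> \<infinity> \<and>
           (\<forall>n. \<forall>t\<ge>0. J n \<omega> \<le> ereal t \<and> ereal t < J (Suc n) \<omega> \<longrightarrow> X t \<omega> = Y n \<omega>)" and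
    3: "\<forall>n. \<forall>E\<in>sets (history M J Y n). \<forall>A\<in>sets borel. \<forall>t\<ge>0.
           measure M {\<omega>\<in>E. J n \<omega> + ereal t < J (Suc n) \<omega> \<and> J (Suc n) \<omega> < \<infinity> \<and>
                            Y (Suc n) \<omega> - Y n \<omega> \<in> A} =
           (LINT \<omega>:{\<omega>\<in>E. J n \<omega> < \<infinity>}|M.
              exp (- measure (K (Y n \<omega>)) UNIV * t) *
                (measure (K (Y n \<omega>)) A / measure (K (Y n \<omega>)) UNIV))"
    unfolding pure_jump_markov_def by blast
  interpret prob_space M by (rule pr)
  have "jump_process M J Y I K x0"
    by unfold_locales (use 1 2 3 lk in \<open>auto simp: levy_kernel_def\<close>)
  then have "jump_paths M J Y I K x0 X"
    unfolding jump_paths_def jump_paths_axioms_def using 2 by auto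
  then show ?thesis using that by blast
qed

context jump_process
begin

text \<open>\<open>Y m\<close> is the state at time \<open>r\<close>, where \<open>r\<close> is the minimum of \<open>t\<close> and the first time at which \<open>Qp\<close> fails. The state
  that violates \<open>Qp\<close> is included, as for a process that is stopped on leaving a set.\<close>

definition stops_at :: "'w \<Rightarrow> (real^2 \<Rightarrow> bool) \<Rightarrow> real \<Rightarrow> nat \<Rightarrow> real \<Rightarrow> bool" where
  "stops_at \<omega> Qp t m r \<longleftrightarrow> J m \<omega> \<le> ereal r \<and> 0 \<le> r \<and> r \<le> t \<and> (\<forall>k<m. Qp (Y k \<omega>)) \<and>
     ((r = t \<and> ereal r < J (Suc m) \<omega> \<and> Qp (Y m \<omega>)) \<or> (J m \<omega> = ereal r \<and> \<not> Qp (Y m \<omega>)))"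

lemma exists_stops_at:
  assumes w: "\<omega> \<in> space M" and "t \<ge> 0"
  obtains m r where "stops_at \<omega> Qp t m r"
proof -
  obtain n where n: "J n \<omega> \<le> ereal t" "ereal t < J (Suc n) \<omega>" using exists_index[OF assms] by blast
  show ?thesis
  proof (cases "\<forall>k\<le>n. Qp (Y k \<omega>)")
    case True
    then have "stops_at \<omega> Qp t n t" using n assms(2) by (simp add: stops_at_def)
    then show ?thesis by (rule that)
  next
    case False
    define m where "m = (LEAST k. \<not> Qp (Y k \<omega>))"
    from False obtain k where k: "k \<le> n" "\<not> Qp (Y k \<omega>)" by blast
    have m: "\<not> Qp (Y m \<omega>)" "m \<le> n"
      using LeastI[where P="\<lambda>k. \<not> Qp (Y k \<omega>)", OF k(2)] Least_le[where P="\<lambda>k. \<not> Qp (Y k \<omega>)", OF k(2)] k(1)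
      unfolding m_def by auto
    have less: "Qp (Y j \<omega>)" if "j < m" for j using not_less_Least[OF that[unfolded m_def]] by simp
    have "0 \<le> J m \<omega>" "J m \<omega> \<le> ereal t" using J_nonneg[OF w] order_trans[OF J_le[OF w m(2)] n(1)] by auto
    then obtain r where "J m \<omega> = ereal r" "0 \<le> r" "r \<le> t" by (cases "J m \<omega>") auto
    then have "stops_at \<omega> Qp t m r" using m less by (simp add: stops_at_def)
    then show ?thesis by (rule that)
  qed
qed

end

context jump_paths
begin

lemma stopped_eq:
  assumes w: "\<omega> \<in> space M" and st: "stops_at \<omega> (\<lambda>y. y \<in> S) t m r"
  shows "stopped S (\<lambda>t. X t \<omega>) t = Y m \<omega>"
proof -
  let ?x = "\<lambda>t. X t \<omega>"
  from st have r: "J m \<omega> \<le> ereal r" "0 \<le> r" "r \<le> t" and inS: "\<And>k. k < m \<Longrightarrow> Y k \<omega> \<in> S"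
    by (auto simp: stops_at_def)
  have before: "k < m" if "0 \<le> s" "J k \<omega> \<le> ereal s" "ereal s < J (Suc k) \<omega>" "ereal s < J m \<omega>" for k s
  proof (rule ccontr)
    assume "\<not> k < m"
    then have "J m \<omega> \<le> J k \<omega>" by (intro J_le[OF w]) simp
    then show False using that by auto
  qed
  from st consider (no) "r = t" "ereal r < J (Suc m) \<omega>" "Y m \<omega> \<in> S" | (ex) "J m \<omega> = ereal r" "Y m \<omega> \<notin> S"
    by (auto simp: stops_at_def)
  then show ?thesis
  proof cases
    case no
    have "ereal t \<le> exit_time S ?x"
      unfolding exit_time_def
    proof (rule INF_greatest)
      fix s assume s: "s \<in> {s. 0 \<le> s \<and> ?x s \<notin> S}"
      show "ereal t \<le> ereal s"
      proof (rule ccontr)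
        assume "\<not> ereal t \<le> ereal s"
        then have st: "s < t" by simp
        obtain k where k: "J k \<omega> \<le> ereal s" "ereal s < J (Suc k) \<omega>" using exists_index[OF w, of s] s by blast
        have "k \<le> m"
        proof (rule ccontr)
          assume "\<not> k \<le> m"
          then have "J (Suc m) \<omega> \<le> J k \<omega>" by (intro J_le[OF w]) simp
          then have "ereal t < J k \<omega>" using no by (auto intro: less_le_trans)
          from less_le_trans[OF this k(1)] have "ereal t < ereal s" .
          then show False using st by simp
        qed
        then have "Y k \<omega> \<in> S" using inS no by (cases "k = m") auto
        then show False using X_eq[OF w _ k] s by auto
      qed
    qed
    then have "min (ereal t) (exit_time S ?x) = ereal t" by (simp add: min_def)
    then show ?thesis unfolding stopped_def using X_eq[OF w, of t m] no r by simp
  next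
    case ex
    have lt: "ereal r < J (Suc m) \<omega>" using J_strict[OF w, of m] ex by simp
    have xr: "?x r = Y m \<omega>" using X_eq[OF w r(2) _ lt] ex by simp
    have "exit_time S ?x = ereal r"
      unfolding exit_time_def
    proof (rule antisym)
      show "(INF s\<in>{s. 0 \<le> s \<and> ?x s \<notin> S}. ereal s) \<le> ereal r"
        by (rule INF_lower) (use r xr ex in auto)
      show "ereal r \<le> (INF s\<in>{s. 0 \<le> s \<and> ?x s \<notin> S}. ereal s)"
      proof (rule INF_greatest)
        fix s assume s: "s \<in> {s. 0 \<le> s \<and> ?x s \<notin> S}"
        show "ereal r \<le> ereal s"
        proof (rule ccontr)
          assume "\<not> ereal r \<le> ereal s"
          then have sr: "ereal s < J m \<omega>" using ex by simp
          obtain k where k: "J k \<omega> \<le> ereal s" "ereal s < J (Suc k) \<omega>" using exists_index[OF w, of s] s by blast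
          then have "k < m" using before[of s k] s sr by auto
          then have "Y k \<omega> \<in> S" by (rule inS)
          then show False using X_eq[OF w _ k] s by auto
        qed
      qed
    qed
    then have "min (ereal t) (exit_time S ?x) = ereal r" using r by (simp add: min_def)
    then show ?thesis unfolding stopped_def using xr by simp
  qed
qed

text \<open>The steep state \<open>Y n\<close> itself may lie outside \<open>S\<close>: a jump may leave \<open>S\<close> and cross the lines at once, and
  the stopped process then stays at that state.\<close>

definition hits :: "(real^2) set \<Rightarrow> real \<Rightarrow> nat \<Rightarrow> 'w \<Rightarrow> bool" where
  "hits S a n \<omega> \<longleftrightarrow> ereal a \<le> abs_slope (Y n \<omega>) \<and> (\<forall>k<n. Y k \<omega> \<in> S \<and> abs_slope (Y k \<omega>) < ereal a)"

lemma hits_unique: "hits S a n \<omega> \<Longrightarrow> hits S a m \<omega> \<Longrightarrow> n = m"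
  by (metis hits_def not_le nat_neq_iff)

lemma hits_measurable [measurable]:
  assumes [measurable]: "S \<in> sets borel"
  shows "Measurable.pred M (hits S a n)"
  unfolding hits_def[abs_def] by measurable

lemma stopped_at_hit:
  assumes w: "\<omega> \<in> space M" and h: "hits S a n \<omega>" and Jn: "J n \<omega> = ereal s"
  shows "stopped S (\<lambda>t. X t \<omega>) s = Y n \<omega>"
proof (rule stopped_eq[OF w])
  have "ereal s < J (Suc n) \<omega>" using J_strict[OF w, of n] Jn by simp
  moreover have "0 \<le> s" using J_nonneg[OF w, of n] Jn by simp
  ultimately show "stops_at \<omega> (\<lambda>y. y \<in> S) s n s"
    using h Jn by (cases "Y n \<omega> \<in> S") (auto simp: stops_at_def hits_def)
qed

text \<open>The stopped path is a step function whose left limit at a jump time is the preceding state, so the infimum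
  over all times is the infimum over the jump times into a first steep state. The initial state is flat, hence a crossing has a preceding state.\<close>

lemma hit_time_eq:
  assumes w: "\<omega> \<in> space M" and a: "a = \<bar>tan \<theta>\<bar>" and start: "abs_slope x0 < ereal a"
  shows "hit_time \<theta> (stopped S (\<lambda>t. X t \<omega>)) = (INF n\<in>{n. hits S a n \<omega>}. J n \<omega>)"
proof -
  let ?x = "stopped S (\<lambda>t. X t \<omega>)"
  let ?H = "{t. 0 \<le> t \<and> abs_slope (left_limit ?x t) \<le> ereal a \<and> ereal a \<le> abs_slope (?x t)}"
  have "(INF t\<in>?H. ereal t) = (INF n\<in>{n. hits S a n \<omega>}. J n \<omega>)"
  proof (rule antisym)
    show "(INF t\<in>?H. ereal t) \<le> (INF n\<in>{n. hits S a n \<omega>}. J n \<omega>)"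
    proof (rule INF_greatest)
      fix n assume "n \<in> {n. hits S a n \<omega>}"
      then have h: "hits S a n \<omega>" by simp
      show "(INF t\<in>?H. ereal t) \<le> J n \<omega>"
      proof (cases "J n \<omega> = \<infinity>")
        case False
        then obtain s where s: "J n \<omega> = ereal s" "0 \<le> s" using J_nonneg[OF w, of n] by (cases "J n \<omega>") auto
        have "n \<noteq> 0"
        proof
          assume "n = 0"
          then have "ereal a \<le> abs_slope x0" using h Y_0[OF w] by (simp add: hits_def)
          then show False using start by simp
        qed
        then obtain k where k: "n = Suc k" by (cases n) auto
        have Yk: "Y k \<omega> \<in> S" "abs_slope (Y k \<omega>) < ereal a" "\<And>j. j < k \<Longrightarrow> Y j \<omega> \<in> S" using h k by (auto simp: hits_def)
        have "J k \<omega> < \<infinity>" using J_mono[OF w, of k] s k by auto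
        then have "J k \<omega> < ereal s" using J_strict[OF w, of k] s k by simp
        then obtain p where p: "J k \<omega> = ereal p" "0 \<le> p" "p < s" using J_nonneg[OF w, of k] by (cases "J k \<omega>") auto
        have const: "?x u = Y k \<omega>" if "p \<le> u" "u < s" for u
        proof (rule stopped_eq[OF w])
          show "stops_at \<omega> (\<lambda>y. y \<in> S) u k u"
            using that Yk p s k by (auto simp: stops_at_def)
        qed
        have ev: "eventually (\<lambda>u. ?x u = Y k \<omega>) (at_left s)"
          unfolding eventually_at_left_field using p(3) by (intro exI[of _ p]) (auto intro: const)
        have "(?x \<longlongrightarrow> Y k \<omega>) (at_left s)" by (rule tendsto_eventually[OF ev])
        then have "left_limit ?x s = Y k \<omega>"
          unfolding left_limit_def using p by (simp add: tendsto_Lim)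
        moreover have "?x s = Y n \<omega>" by (rule stopped_at_hit[OF w h s(1)])
        ultimately have "s \<in> ?H" using s(2) Yk h by (simp add: hits_def)
        then have "(INF t\<in>?H. ereal t) \<le> ereal s" by (rule INF_lower)
        then show ?thesis using s by simp
      qed simp
    qed
    show "(INF n\<in>{n. hits S a n \<omega>}. J n \<omega>) \<le> (INF t\<in>?H. ereal t)"
    proof (rule INF_greatest)
      fix s assume "s \<in> ?H"
      then have s: "0 \<le> s" "ereal a \<le> abs_slope (?x s)" by auto
      obtain m r where st: "stops_at \<omega> (\<lambda>y. y \<in> S) s m r" using exists_stops_at[OF w s(1)] by blast
      have xm: "ereal a \<le> abs_slope (Y m \<omega>)" using stopped_eq[OF w st] s by simp
      define n where "n = (LEAST n. ereal a \<le> abs_slope (Y n \<omega>))"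
      have n: "ereal a \<le> abs_slope (Y n \<omega>)" "n \<le> m" unfolding n_def using xm by (auto intro: LeastI Least_le)
      have "abs_slope (Y k \<omega>) < ereal a" if "k < n" for k using not_less_Least[OF that[unfolded n_def]] by simp
      moreover have "Y k \<omega> \<in> S" if "k < n" for k using st that n by (auto simp: stops_at_def)
      ultimately have "hits S a n \<omega>" using n by (simp add: hits_def)
      then have "(INF n\<in>{n. hits S a n \<omega>}. J n \<omega>) \<le> J n \<omega>" by (intro INF_lower) simp
      also have "\<dots> \<le> J m \<omega>" by (rule J_le[OF w n(2)])
      also have "\<dots> \<le> ereal s" using st by (auto simp: stops_at_def intro: order_trans)
      finally show "(INF n\<in>{n. hits S a n \<omega>}. J n \<omega>) \<le> ereal s" .
    qed
  qed
  then show ?thesis unfolding hit_time_def a .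
qed

lemma hit_time_hits:
  assumes w: "\<omega> \<in> space M" and a: "a = \<bar>tan \<theta>\<bar>" and start: "abs_slope x0 < ereal a" and h: "hits S a n \<omega>"
  shows "hit_time \<theta> (stopped S (\<lambda>t. X t \<omega>)) = J n \<omega>"
proof -
  have "{n. hits S a n \<omega>} = {n}" using h hits_unique by blast
  then show ?thesis unfolding hit_time_eq[OF w a start] by simp
qed

lemma hit_time_measurable:
  assumes [measurable]: "S \<in> sets borel" and a: "a = \<bar>tan \<theta>\<bar>" and start: "abs_slope x0 < ereal a"
  shows "(\<lambda>\<omega>. hit_time \<theta> (stopped S (\<lambda>t. X t \<omega>))) \<in> borel_measurable M"
proof -
  have "(INF n\<in>{n. hits S a n \<omega>}. J n \<omega>) = (INF n. if hits S a n \<omega> then J n \<omega> else \<infinity>)" for \<omega>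
  proof (rule antisym)
    show "(INF n\<in>{n. hits S a n \<omega>}. J n \<omega>) \<le> (INF n. if hits S a n \<omega> then J n \<omega> else \<infinity>)"
    proof (rule INF_greatest)
      show "(INF n\<in>{n. hits S a n \<omega>}. J n \<omega>) \<le> (if hits S a n \<omega> then J n \<omega> else \<infinity>)" for n
        by (cases "hits S a n \<omega>") (auto intro!: INF_lower)
    qed
    show "(INF n. if hits S a n \<omega> then J n \<omega> else \<infinity>) \<le> (INF n\<in>{n. hits S a n \<omega>}. J n \<omega>)"
    proof (rule INF_greatest)
      fix n assume n: "n \<in> {n. hits S a n \<omega>}"
      have "(INF n. if hits S a n \<omega> then J n \<omega> else \<infinity>) \<le> (if hits S a n \<omega> then J n \<omega> else \<infinity>)"
        by (rule INF_lower) simp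
      then show "(INF n. if hits S a n \<omega> then J n \<omega> else \<infinity>) \<le> J n \<omega>" using n by simp
    qed
  qed
  then have e: "hit_time \<theta> (stopped S (\<lambda>t. X t \<omega>)) = (INF n. if hits S a n \<omega> then J n \<omega> else \<infinity>)" if "\<omega> \<in> space M" for \<omega>
    using hit_time_eq[OF that a start] by simp
  have m: "(\<lambda>\<omega>. INF n. if hits S a n \<omega> then J n \<omega> else \<infinity>) \<in> borel_measurable M" by measurable
  show ?thesis by (rule iffD2[OF measurable_cong[OF e] m])
qed

text \<open>At most one index hits, so the value at the hitting time is a countable sum over the indices.\<close>

lemma norm_value_at_hit_measurable:
  assumes [measurable]: "S \<in> sets borel" and a: "a = \<bar>tan \<theta>\<bar>" and start: "abs_slope x0 < ereal a"
  shows "(\<lambda>\<omega>. norm (value_at (stopped S (\<lambda>t. X t \<omega>)) (hit_time \<theta> (stopped S (\<lambda>t. X t \<omega>))))) \<in> borel_measurable M"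
proof -
  let ?f = "\<lambda>n \<omega>. if hits S a n \<omega> \<and> J n \<omega> < \<infinity> then norm (Y n \<omega>) else 0"
  have e: "norm (value_at (stopped S (\<lambda>t. X t \<omega>)) (hit_time \<theta> (stopped S (\<lambda>t. X t \<omega>)))) = (\<Sum>n. ?f n \<omega>)" if w: "\<omega> \<in> space M" for \<omega>
  proof (cases "\<exists>n. hits S a n \<omega> \<and> J n \<omega> < \<infinity>")
    case True
    then obtain n where n: "hits S a n \<omega>" "J n \<omega> < \<infinity>" by blast
    then obtain s where s: "J n \<omega> = ereal s" using J_nonneg[OF w, of n] by (cases "J n \<omega>") auto
    have "(\<Sum>n. ?f n \<omega>) = (\<Sum>k\<in>{n}. ?f k \<omega>)"
      using hits_unique[OF n(1)] by (intro suminf_finite) auto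
    then show ?thesis
      using n s stopped_at_hit[OF w n(1) s] by (simp add: value_at_def hit_time_hits[OF w a start n(1)])
  next
    case False
    then have "hit_time \<theta> (stopped S (\<lambda>t. X t \<omega>)) = \<infinity>"
      unfolding hit_time_eq[OF w a start] by (intro INF_eqI) (auto simp: top_ereal_def)
    moreover have "(\<lambda>n. ?f n \<omega>) = (\<lambda>_. 0)" by (rule ext) (use False in auto)
    ultimately show ?thesis by (simp add: value_at_def)
  qed
  have m: "(\<lambda>\<omega>. \<Sum>n. ?f n \<omega>) \<in> borel_measurable M" by measurable
  show ?thesis by (rule iffD2[OF measurable_cong[OF e] m])
qed

end

section \<open>The process in the frame that removes the drift\<close>

lemma nn_integral_exp_window:
  assumes "t0 \<le> t" "k \<noteq> 0"
  shows "(\<integral>\<^sup>+ s. indicator {t0<..t} s * ennreal (exp (k * s)) \<partial>lborel) \<le> ennreal ((exp (k * t) - exp (k * t0)) / k)"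
proof -
  have "(\<integral>\<^sup>+ s. indicator {t0<..t} s * ennreal (exp (k * s)) \<partial>lborel) \<le> (\<integral>\<^sup>+ s. ennreal (exp (k * s)) * indicator {t0..t} s \<partial>lborel)"
    by (intro nn_integral_mono) (auto split: split_indicator)
  also have "\<dots> = ennreal (exp (k * t) / k - exp (k * t0) / k)"
    by (rule nn_integral_FTC_Icc) (use assms in \<open>auto intro!: derivative_eq_intros\<close>)
  finally show ?thesis by (simp add: diff_divide_distrib)
qed

text \<open>The hypotheses for one fixed \<open>N\<close>, with all errors explicit: \<open>d\<close> and \<open>da\<close> are the errors of the drift and of the
  variance, \<open>eta\<close> and \<open>b\<close> the tolerances for the compensated sums of the first and the second coordinate, \<open>ts\<close> the
  time horizon, and \<open>rho\<close> the radius of a tube around the limiting path inside \<open>S\<close>. The assumptions \<open>small1\<close> and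
  \<open>small2\<close> say that these tolerances keep the process inside the tube.\<close>

locale scaled_process = jump_paths M J Y I K x0 X
  for M :: "'w measure" and J :: "nat \<Rightarrow> 'w \<Rightarrow> ereal" and Y :: "nat \<Rightarrow> 'w \<Rightarrow> real^2"
    and I :: "(real^2) set" and K :: "real^2 \<Rightarrow> (real^2) measure" and x0 :: "real^2"
    and X :: "real \<Rightarrow> 'w \<Rightarrow> real^2" +
  fixes S :: "(real^2) set" and a :: "real^2 \<Rightarrow> real" and N lam mu Q C2 C3 d da L eta b ts rho :: real
  assumes N: "N \<ge> 1" and pos: "lam > 0" "mu > 0" and S_open: "open S"
    and nonneg: "Q \<ge> 0" "C2 \<ge> 0" "C3 \<ge> 0" "d \<ge> 0" "da \<ge> 0" "L \<ge> 0" "eta > 0" "b > 0" "ts \<ge> 0"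
    and total_rate: "\<And>x. x \<in> S \<Longrightarrow> x \<in> I \<Longrightarrow> measure (K x) UNIV \<le> Q"
    and int1: "\<And>x i. x \<in> S \<Longrightarrow> x \<in> I \<Longrightarrow> integrable (K x) (\<lambda>y. y $ i)"
    and int2: "\<And>x i. x \<in> S \<Longrightarrow> x \<in> I \<Longrightarrow> integrable (K x) (\<lambda>y. (y $ i)\<^sup>2)"
    and le2: "\<And>x i. x \<in> S \<Longrightarrow> x \<in> I \<Longrightarrow> (\<integral>y. (y $ i)\<^sup>2 \<partial>K x) \<le> C2 / N"
    and int3: "\<And>x i. x \<in> S \<Longrightarrow> x \<in> I \<Longrightarrow> integrable (K x) (\<lambda>y. \<bar>y $ i\<bar> ^ 3)"
    and le3: "\<And>x i. x \<in> S \<Longrightarrow> x \<in> I \<Longrightarrow> (\<integral>y. \<bar>y $ i\<bar> ^ 3 \<partial>K x) \<le> C3 / N\<^sup>2"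
    and drift1: "\<And>x. x \<in> S \<Longrightarrow> x \<in> I \<Longrightarrow> \<bar>(\<integral>y. y $ 1 \<partial>K x) - (- mu) * x $ 1\<bar> \<le> d / sqrt N"
    and drift2: "\<And>x. x \<in> S \<Longrightarrow> x \<in> I \<Longrightarrow> \<bar>(\<integral>y. y $ 2 \<partial>K x) - lam * x $ 2\<bar> \<le> d / sqrt N"
    and a_conv: "\<And>x. x \<in> S \<Longrightarrow> x \<in> I \<Longrightarrow> \<bar>N * (\<integral>y. (y $ 2)\<^sup>2 \<partial>K x) - a x\<bar> \<le> da"
    and a_lip: "\<And>x y. x \<in> S \<Longrightarrow> y \<in> S \<Longrightarrow> \<bar>a x - a y\<bar> \<le> L * norm (x - y)"
    and a_bd: "\<And>x. x \<in> S \<Longrightarrow> 0 \<le> a x \<and> a x \<le> C2"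
    and x02: "x0 $ 2 = 0"
    and near_path: "\<And>r. r \<ge> 0 \<Longrightarrow> ball (exp (- mu * r) *\<^sub>R x0) rho \<subseteq> S"
    and small1: "d * exp (mu * ts) / (mu * sqrt N) \<le> eta"
    and small2: "2 * eta + (b + d / lam) * exp (lam * ts) / sqrt N < rho"
begin

text \<open>In the frame that removes the linear drift the \<open>i\<close>-th coordinate \<open>x $ i\<close> becomes \<open>gf i s * x $ i\<close>; \<open>Gf i\<close> is an
  antiderivative of \<open>gf i\<close>.\<close>

definition wt :: "2 \<Rightarrow> real" where "wt i = (if i = 1 then 1 else sqrt N)"

definition gam :: "2 \<Rightarrow> real" where "gam i = (if i = 1 then - mu else lam)"

definition gf :: "2 \<Rightarrow> real \<Rightarrow> real" where "gf i s = wt i * exp (- gam i * s)"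

definition Gf :: "2 \<Rightarrow> real \<Rightarrow> real" where "Gf i s = - (wt i / gam i) * exp (- gam i * s)"

definition all_past :: "(real^2 \<Rightarrow> bool) \<Rightarrow> nat \<Rightarrow> 'w \<Rightarrow> bool" where
  "all_past Qp n \<omega> \<longleftrightarrow> (\<forall>k\<le>n. Qp (Y k \<omega>))"

definition mart :: "2 \<Rightarrow> (nat \<Rightarrow> 'w \<Rightarrow> bool) \<Rightarrow> real \<Rightarrow> real \<Rightarrow> 'w \<Rightarrow> real" where
  "mart i B t0 t = compensated_sum.total J Y K i (gf i) (Gf i) B t0 t"

definition admissible :: "(nat \<Rightarrow> 'w \<Rightarrow> bool) \<Rightarrow> bool" where
  "admissible B \<longleftrightarrow> (\<forall>n m. n \<le> m \<longrightarrow> Measurable.pred (F m) (B n)) \<and> (\<forall>n \<omega>. \<omega> \<in> space M \<longrightarrow> B n \<omega> \<longrightarrow> Y n \<omega> \<in> S)"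

lemma gam_nz: "gam i \<noteq> 0" using pos by (simp add: gam_def)

lemma wt_nonneg: "wt i \<ge> 0" using N by (simp add: wt_def)

lemma sqrtN: "sqrt N > 0" "sqrt N \<ge> 1" "sqrt N * sqrt N = N" using N by auto

lemma S_sets [measurable]: "S \<in> sets borel" using S_open by simp

lemma two_cases: "(i::2) = 1 \<or> i = 2" using exhaust_2 by blast

lemma compensated_sum_mart:
  assumes "admissible B" "0 \<le> t0" "t0 \<le> t"
  shows "compensated_sum M J Y I K x0 S Q (C2 / N) i (gf i) (Gf i) B t0 t"
proof -
  have "jump_process M J Y I K x0" by (rule jump_process_axioms)
  moreover have "compensated_sum_axioms M J Y I K S Q (C2 / N) i (gf i) (Gf i) B t0 t"
  proof (rule compensated_sum_axioms.intro)
    show "continuous_on UNIV (gf i)" unfolding gf_def by (intro continuous_intros)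
    show "(Gf i has_real_derivative gf i s) (at s)" for s
      unfolding Gf_def gf_def using gam_nz[of i] by (auto intro!: derivative_eq_intros)
  qed (use nonneg total_rate int1 int2 le2 assms in \<open>auto simp: admissible_def\<close>)
  ultimately show ?thesis by (simp add: compensated_sum_def)
qed

lemma admissible_all_past:
  assumes Qp [measurable]: "Measurable.pred borel Qp" and QS: "\<And>y. Qp y \<Longrightarrow> y \<in> S"
  shows "admissible (all_past Qp)"
proof -
  have "Measurable.pred (F m) (all_past Qp n)" if "n \<le> m" for n m
  proof -
    have "Measurable.pred (F m) (\<lambda>\<omega>. Qp (Y k \<omega>))" if "k \<le> n" for k
      using measurable_compose[OF measurable_history(2)[of k m] Qp] that \<open>n \<le> m\<close> by simp
    then have "Measurable.pred (F m) (\<lambda>\<omega>. \<forall>k\<in>{..n}. Qp (Y k \<omega>))"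
      by (intro pred_intros_finite) auto
    moreover have "(\<lambda>\<omega>. \<forall>k\<in>{..n}. Qp (Y k \<omega>)) = all_past Qp n" by (rule ext) (auto simp: all_past_def)
    ultimately show ?thesis by simp
  qed
  then show ?thesis using QS by (auto simp: admissible_def all_past_def)
qed

lemma admissible_diff:
  assumes "admissible B" "admissible B'"
  shows "admissible (\<lambda>n \<omega>. B n \<omega> \<and> \<not> B' n \<omega>)"
  using assms by (auto simp: admissible_def intro!: pred_intros_logic)

lemma mart_measurable [measurable]:
  assumes "admissible B" "0 \<le> t0" "t0 \<le> t"
  shows "mart i B t0 t \<in> borel_measurable M"
  unfolding mart_def by (rule compensated_sum.total_measurable[OF compensated_sum_mart[OF assms]])

lemma mart_eq_sum:
  assumes B: "admissible B" and t: "0 \<le> t0" "t0 \<le> t" "t \<le> t'" and w: "\<omega> \<in> space M"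
    and m: "\<forall>n\<ge>m. ereal t' < J n \<omega>"
  shows "mart i B t0 t \<omega> = (\<Sum>n<m. (if B n \<omega> then
      (if ereal t0 < J (Suc n) \<omega> \<and> J (Suc n) \<omega> \<le> ereal t then gf i (real_of_ereal (J (Suc n) \<omega>)) * jump n \<omega> $ i else 0)
      - (\<integral>y. y $ i \<partial>K (Y n \<omega>)) * (Gf i (clip t0 t (J (Suc n) \<omega>)) - Gf i (clip t0 t (J n \<omega>))) else 0))"
proof -
  interpret c: compensated_sum M J Y I K x0 S Q "C2 / N" i "gf i" "Gf i" B t0 t by (rule compensated_sum_mart[OF B t(1,2)])
  have "ereal t < J n \<omega>" if "n \<ge> m" for n
    using le_less_trans[of "ereal t" "ereal t'" "J n \<omega>"] m that t(3) by simp
  then have P: "c.psum m \<omega> = c.total \<omega>" by (rule c.psum_eq_total[OF w])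
  show ?thesis
    unfolding mart_def P[symmetric] c.psum_def
    by (intro sum.cong refl) (simp add: c.incr_def c.\<beta>_def)
qed

lemma past_index:
  assumes "\<omega> \<in> space M"
  obtains m where "\<forall>n\<ge>m. ereal t < J n \<omega>"
proof -
  have "eventually (\<lambda>n. ereal t < J n \<omega>) sequentially"
    using J_lim[OF assms] by (rule order_tendstoD) simp
  then show ?thesis using that by (auto simp: eventually_sequentially)
qed

lemma mart_split_time:
  assumes B: "admissible B" and t: "0 \<le> t0" "t0 \<le> t" and w: "\<omega> \<in> space M"
  shows "mart i B 0 t \<omega> = mart i B 0 t0 \<omega> + mart i B t0 t \<omega>"
proof -
  obtain m where m: "\<forall>n\<ge>m. ereal t < J n \<omega>" using past_index[OF w] by blast
  have clip: "Gf i (clip 0 t x) = Gf i (clip 0 t0 x) + Gf i (clip t0 t x) - Gf i t0" for x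
    using t by (cases x) (auto simp: clip_def)
  show ?thesis
    unfolding mart_eq_sum[OF B order_refl order_trans[OF t] order_refl w m]
      mart_eq_sum[OF B order_refl t(1) t(2) w m] mart_eq_sum[OF B t order_refl w m] sum.distrib[symmetric]
  proof (intro sum.cong refl)
    fix n
    have j: "(if ereal 0 < J (Suc n) \<omega> \<and> J (Suc n) \<omega> \<le> ereal t then z else 0)
       = (if ereal 0 < J (Suc n) \<omega> \<and> J (Suc n) \<omega> \<le> ereal t0 then z else 0)
       + (if ereal t0 < J (Suc n) \<omega> \<and> J (Suc n) \<omega> \<le> ereal t then z else 0)" for z :: real
      using t by (cases "J (Suc n) \<omega>") auto
    show "(if B n \<omega> then
      (if ereal 0 < J (Suc n) \<omega> \<and> J (Suc n) \<omega> \<le> ereal t then gf i (real_of_ereal (J (Suc n) \<omega>)) * jump n \<omega> $ i else 0)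
      - (\<integral>y. y $ i \<partial>K (Y n \<omega>)) * (Gf i (clip 0 t (J (Suc n) \<omega>)) - Gf i (clip 0 t (J n \<omega>))) else 0)
     = (if B n \<omega> then
      (if ereal 0 < J (Suc n) \<omega> \<and> J (Suc n) \<omega> \<le> ereal t0 then gf i (real_of_ereal (J (Suc n) \<omega>)) * jump n \<omega> $ i else 0)
      - (\<integral>y. y $ i \<partial>K (Y n \<omega>)) * (Gf i (clip 0 t0 (J (Suc n) \<omega>)) - Gf i (clip 0 t0 (J n \<omega>))) else 0)
     + (if B n \<omega> then
      (if ereal t0 < J (Suc n) \<omega> \<and> J (Suc n) \<omega> \<le> ereal t then gf i (real_of_ereal (J (Suc n) \<omega>)) * jump n \<omega> $ i else 0)
      - (\<integral>y. y $ i \<partial>K (Y n \<omega>)) * (Gf i (clip t0 t (J (Suc n) \<omega>)) - Gf i (clip t0 t (J n \<omega>))) else 0)"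
      unfolding clip j by (simp only: if_distrib) (simp add: right_diff_distrib distrib_left)
  qed
qed

text \<open>This is how the sum stopped at the crossing is compared with the sum stopped on leaving \<open>S\<close>.\<close>

lemma mart_split_pred:
  assumes B: "admissible B" and B': "admissible B'" and t: "0 \<le> t0" "t0 \<le> t" and w: "\<omega> \<in> space M"
    and sub: "\<And>n. B' n \<omega> \<Longrightarrow> B n \<omega>"
  shows "mart i B t0 t \<omega> = mart i B' t0 t \<omega> + mart i (\<lambda>n \<omega>. B n \<omega> \<and> \<not> B' n \<omega>) t0 t \<omega>"
proof -
  obtain m where m: "\<forall>n\<ge>m. ereal t < J n \<omega>" using past_index[OF w] by blast
  show ?thesis
    unfolding mart_eq_sum[OF B t order_refl w m] mart_eq_sum[OF B' t order_refl w m]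
      mart_eq_sum[OF admissible_diff[OF B B'] t order_refl w m] sum.distrib[symmetric]
    by (intro sum.cong refl) (use sub in auto)
qed

lemma mart_zero:
  assumes B: "admissible B" and t: "0 \<le> t" and w: "\<omega> \<in> space M" and late: "\<And>n. B n \<omega> \<Longrightarrow> ereal t \<le> J n \<omega>"
  shows "mart i B 0 t \<omega> = 0"
proof -
  obtain m where m: "\<forall>n\<ge>m. ereal t < J n \<omega>" using past_index[OF w] by blast
  show ?thesis
    unfolding mart_eq_sum[OF B order_refl t order_refl w m]
  proof (intro sum.neutral ballI)
    fix n
    show "(if B n \<omega> then
      (if ereal 0 < J (Suc n) \<omega> \<and> J (Suc n) \<omega> \<le> ereal t then gf i (real_of_ereal (J (Suc n) \<omega>)) * jump n \<omega> $ i else 0)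
      - (\<integral>y. y $ i \<partial>K (Y n \<omega>)) * (Gf i (clip 0 t (J (Suc n) \<omega>)) - Gf i (clip 0 t (J n \<omega>))) else 0) = 0"
    proof (cases "B n \<omega>")
      case True
      then have a: "ereal t \<le> J n \<omega>" by (rule late)
      have c: "clip 0 t x = t" if "ereal t \<le> x" for x using that t by (cases x) (auto simp: clip_def)
      have "\<not> J (Suc n) \<omega> \<le> ereal t"
      proof
        assume le: "J (Suc n) \<omega> \<le> ereal t"
        then have "J n \<omega> < \<infinity>" using J_mono[OF w, of n] by auto
        then have "J n \<omega> < J (Suc n) \<omega>" by (rule J_strict[OF w])
        then show False using a le by auto
      qed
      then show ?thesis using c[OF a] c[OF order_trans[OF a J_mono[OF w]]] by simp
    qed simp
  qed
qed

lemma mart_1_tail: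
  assumes B: "admissible B" and t: "0 \<le> t" and z: "z > 0"
  shows "measure M {\<omega>\<in>space M. z \<le> \<bar>mart 1 B 0 t \<omega>\<bar>} \<le> C2 * exp (2 * mu * t) / (mu * N * z\<^sup>2)"
proof -
  interpret c: compensated_sum M J Y I K x0 S Q "C2 / N" 1 "gf 1" "Gf 1" B 0 t by (rule compensated_sum_mart[OF B order_refl t])
  have "(gf 1 s)\<^sup>2 = exp (2 * mu * s)" for s
    by (simp add: gf_def wt_def gam_def power2_eq_square exp_add[symmetric])
  then have "(\<integral>\<^sup>+ s. indicator {0<..t} s * ennreal ((gf 1 s)\<^sup>2) \<partial>lborel) \<le> ennreal ((exp (2 * mu * t) - exp (2 * mu * 0)) / (2 * mu))"
    using nn_integral_exp_window[of 0 t "2 * mu"] t pos by simp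
  also have "\<dots> \<le> ennreal (exp (2 * mu * t) / (2 * mu))"
    using pos by (intro ennreal_leI divide_right_mono) auto
  finally have "measure M {\<omega>\<in>space M. z \<le> \<bar>c.total \<omega>\<bar>} \<le> 2 * (C2 / N) * (exp (2 * mu * t) / (2 * mu)) / z\<^sup>2"
    by (rule c.chebyshev_total[OF z]) (use nonneg N pos in auto)
  then show ?thesis unfolding mart_def by (simp add: ac_simps)
qed

text \<open>The bound decays with the beginning \<open>t0\<close> of the window: late jumps hardly change the second coordinate in the moving frame.\<close>

lemma mart_2_tail:
  assumes B: "admissible B" and t: "0 \<le> t0" "t0 \<le> t" and z: "z > 0"
  shows "measure M {\<omega>\<in>space M. z \<le> \<bar>mart 2 B t0 t \<omega>\<bar>} \<le> C2 * exp (- 2 * lam * t0) / (lam * z\<^sup>2)"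
proof -
  interpret c: compensated_sum M J Y I K x0 S Q "C2 / N" 2 "gf 2" "Gf 2" B t0 t by (rule compensated_sum_mart[OF B t])
  have "(gf 2 s)\<^sup>2 = N * exp (- 2 * lam * s)" for s
    using N by (simp add: gf_def wt_def gam_def power_mult_distrib) (simp add: power2_eq_square exp_add[symmetric])
  then have "(\<integral>\<^sup>+ s. indicator {t0<..t} s * ennreal ((gf 2 s)\<^sup>2) \<partial>lborel)
      = (\<integral>\<^sup>+ s. ennreal N * (indicator {t0<..t} s * ennreal (exp (- 2 * lam * s))) \<partial>lborel)"
    using N by (intro nn_integral_cong) (auto simp: ennreal_mult split: split_indicator)
  also have "\<dots> = ennreal N * (\<integral>\<^sup>+ s. indicator {t0<..t} s * ennreal (exp (- 2 * lam * s)) \<partial>lborel)"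
    by (rule nn_integral_cmult) measurable
  also have "\<dots> \<le> ennreal N * ennreal ((exp (- 2 * lam * t) - exp (- 2 * lam * t0)) / (- 2 * lam))"
    using nn_integral_exp_window[of t0 t "- 2 * lam"] t pos by (intro mult_left_mono) auto
  also have "\<dots> \<le> ennreal N * ennreal (exp (- 2 * lam * t0) / (2 * lam))"
  proof (intro mult_left_mono ennreal_leI)
    have "(exp (- 2 * lam * t) - exp (- 2 * lam * t0)) / (- 2 * lam) = (exp (- 2 * lam * t0) - exp (- 2 * lam * t)) / (2 * lam)"
      using pos by (simp add: field_simps)
    also have "\<dots> \<le> exp (- 2 * lam * t0) / (2 * lam)" using pos by (intro divide_right_mono) auto
    finally show "(exp (- 2 * lam * t) - exp (- 2 * lam * t0)) / (- 2 * lam) \<le> exp (- 2 * lam * t0) / (2 * lam)" .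
  qed auto
  also have "\<dots> = ennreal (N * (exp (- 2 * lam * t0) / (2 * lam)))"
    using N pos by (intro ennreal_mult[symmetric]) auto
  finally have "measure M {\<omega>\<in>space M. z \<le> \<bar>c.total \<omega>\<bar>} \<le> 2 * (C2 / N) * (N * (exp (- 2 * lam * t0) / (2 * lam))) / z\<^sup>2"
    by (rule c.chebyshev_total[OF z]) (use nonneg N pos in auto)
  also have "\<dots> = C2 * exp (- 2 * lam * t0) / (lam * z\<^sup>2)" using N by simp
  finally show ?thesis unfolding mart_def .
qed

definition bad :: "(real^2 \<Rightarrow> bool) \<Rightarrow> real \<Rightarrow> 'w set" where
  "bad Qp t = {\<omega>\<in>space M. eta \<le> \<bar>mart 1 (all_past Qp) 0 t \<omega>\<bar>} \<union> {\<omega>\<in>space M. b \<le> \<bar>mart 2 (all_past Qp) 0 t \<omega>\<bar>}"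

definition bad_bound :: real where
  "bad_bound = C2 * exp (2 * mu * ts) / (mu * N * eta\<^sup>2) + C2 / (lam * b\<^sup>2)"

lemma bad_bound_nonneg: "bad_bound \<ge> 0"
  using nonneg pos N by (auto simp: bad_bound_def intro!: add_nonneg_nonneg divide_nonneg_nonneg mult_nonneg_nonneg)

lemma bad_measurable:
  assumes "admissible (all_past Qp)" "0 \<le> t"
  shows "bad Qp t \<in> sets M"
  using mart_measurable[OF assms(1) order_refl assms(2)] unfolding bad_def by measurable

lemma bad_prob:
  assumes B: "admissible (all_past Qp)" and t: "0 \<le> t" "t \<le> ts"
  shows "measure M (bad Qp t) \<le> bad_bound"
proof -
  note [measurable] = mart_measurable[OF B order_refl t(1)]
  have "measure M (bad Qp t) \<le> measure M {\<omega>\<in>space M. eta \<le> \<bar>mart 1 (all_past Qp) 0 t \<omega>\<bar>} + measure M {\<omega>\<in>space M. b \<le> \<bar>mart 2 (all_past Qp) 0 t \<omega>\<bar>}"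
    unfolding bad_def by (rule measure_Un_le) measurable
  also have "measure M {\<omega>\<in>space M. eta \<le> \<bar>mart 1 (all_past Qp) 0 t \<omega>\<bar>} \<le> C2 * exp (2 * mu * t) / (mu * N * eta\<^sup>2)"
    by (rule mart_1_tail[OF B t(1)]) (use nonneg in auto)
  also have "\<dots> \<le> C2 * exp (2 * mu * ts) / (mu * N * eta\<^sup>2)"
    using t nonneg pos N by (intro divide_right_mono mult_left_mono) auto
  also have "measure M {\<omega>\<in>space M. b \<le> \<bar>mart 2 (all_past Qp) 0 t \<omega>\<bar>} \<le> C2 * exp (- 2 * lam * 0) / (lam * b\<^sup>2)"
    by (rule mart_2_tail[OF B order_refl t(1)]) (use nonneg in auto)
  finally show ?thesis by (simp add: bad_bound_def)
qed

text \<open>A bootstrap over the jumps. While the past states satisfy \<open>Qp\<close>, and thus lie in \<open>S\<close>, the decomposition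
  bounds the current state, even if that state is the first to violate \<open>Qp\<close>. The bound puts it into the tube, hence into
  \<open>S\<close>.\<close>

lemma good_state:
  assumes w: "\<omega> \<in> space M" and t: "0 \<le> t" "t \<le> ts" and Q: "Measurable.pred borel Qp" "\<And>y. Qp y \<Longrightarrow> y \<in> S"
    and good: "\<omega> \<notin> bad Qp t" and st: "stops_at \<omega> Qp t m r"
  shows "\<bar>exp (mu * r) * Y m \<omega> $ 1 - x0 $ 1\<bar> \<le> 2 * eta"
    and "\<bar>sqrt N * exp (- lam * r) * Y m \<omega> $ 2 - mart 2 (all_past Qp) 0 t \<omega>\<bar> \<le> d / lam"
    and "norm (Y m \<omega> - exp (- mu * r) *\<^sub>R x0) < rho" and "Y m \<omega> \<in> S"
proof -
  have B: "admissible (all_past Qp)" by (rule admissible_all_past[OF Q])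
  from st have r: "J m \<omega> \<le> ereal r" "0 \<le> r" "r \<le> t" and Qm: "\<And>k. k < m \<Longrightarrow> Qp (Y k \<omega>)"
    and alt: "(r = t \<and> ereal r < J (Suc m) \<omega> \<and> Qp (Y m \<omega>)) \<or> (J m \<omega> = ereal r \<and> \<not> Qp (Y m \<omega>))"
    by (auto simp: stops_at_def)
  have good1: "\<bar>mart 1 (all_past Qp) 0 t \<omega>\<bar> < eta" and good2: "\<bar>mart 2 (all_past Qp) 0 t \<omega>\<bar> < b"
    using good w by (auto simp: bad_def)
  have dec: "\<bar>wt i * exp (- gam i * r) * Y m \<omega> $ i - wt i * x0 $ i - mart i (all_past Qp) 0 t \<omega>\<bar> \<le> d / sqrt N * (Gf i t - Gf i 0)" for i
  proof -
    interpret c: compensated_sum M J Y I K x0 S Q "C2 / N" i "gf i" "Gf i" "all_past Qp" 0 t by (rule compensated_sum_mart[OF B order_refl t(1)])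
    have dr: "\<bar>(\<integral>y. y $ i \<partial>K x) - gam i * x $ i\<bar> \<le> d / sqrt N" if "x \<in> S" "x \<in> I" for x
      using two_cases[of i] drift1[OF that] drift2[OF that] by (auto simp: gam_def)
    show ?thesis unfolding mart_def
      by (rule c.stopped_decomposition[OF refl all_past_def gf_def Gf_def wt_nonneg gam_nz _ dr w r(1,3) Qm alt])
        (use nonneg sqrtN in auto)
  qed
  have G1: "d / sqrt N * (Gf 1 t - Gf 1 0) \<le> eta"
  proof -
    have "Gf 1 t - Gf 1 0 = (exp (mu * t) - 1) / mu"
      using pos by (simp add: Gf_def wt_def gam_def diff_divide_distrib)
    also have "\<dots> \<le> exp (mu * ts) / mu"
    proof (rule divide_right_mono)
      have "exp (mu * t) \<le> exp (mu * ts)" using pos t by simp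
      then show "exp (mu * t) - 1 \<le> exp (mu * ts)" by linarith
    qed (use pos in simp)
    finally have "d / sqrt N * (Gf 1 t - Gf 1 0) \<le> d / sqrt N * (exp (mu * ts) / mu)"
      using nonneg sqrtN by (intro mult_left_mono) auto
    also have "\<dots> = d * exp (mu * ts) / (mu * sqrt N)" by simp
    finally show ?thesis using small1 by linarith
  qed
  have G2: "d / sqrt N * (Gf 2 t - Gf 2 0) \<le> d / lam"
  proof -
    have "Gf 2 t - Gf 2 0 = sqrt N / lam * (1 - exp (- lam * t))"
      by (simp add: Gf_def wt_def gam_def algebra_simps)
    also have "\<dots> \<le> sqrt N / lam * 1" using pos sqrtN by (intro mult_left_mono) auto
    finally have "d / sqrt N * (Gf 2 t - Gf 2 0) \<le> d / sqrt N * (sqrt N / lam * 1)"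
      using nonneg sqrtN by (intro mult_left_mono) auto
    then show ?thesis using sqrtN by simp
  qed
  show 1: "\<bar>exp (mu * r) * Y m \<omega> $ 1 - x0 $ 1\<bar> \<le> 2 * eta"
    using dec[of 1] G1 good1 by (simp add: wt_def gam_def)
  show 2: "\<bar>sqrt N * exp (- lam * r) * Y m \<omega> $ 2 - mart 2 (all_past Qp) 0 t \<omega>\<bar> \<le> d / lam"
    using dec[of 2] G2 x02 by (simp add: wt_def gam_def)
  let ?v = "Y m \<omega> - exp (- mu * r) *\<^sub>R x0"
  have v1: "\<bar>?v $ 1\<bar> \<le> 2 * eta"
  proof -
    have "?v $ 1 = exp (- mu * r) * (exp (mu * r) * Y m \<omega> $ 1 - x0 $ 1)"
      by (simp add: right_diff_distrib mult.assoc[symmetric] exp_add[symmetric])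
    then have "\<bar>?v $ 1\<bar> = exp (- mu * r) * \<bar>exp (mu * r) * Y m \<omega> $ 1 - x0 $ 1\<bar>" by (simp add: abs_mult)
    also have "\<dots> \<le> 1 * (2 * eta)" using 1 pos r(2) by (intro mult_mono) auto
    finally show ?thesis by simp
  qed
  have v2: "\<bar>?v $ 2\<bar> \<le> (b + d / lam) * exp (lam * ts) / sqrt N"
  proof -
    have "\<bar>sqrt N * exp (- lam * r) * Y m \<omega> $ 2\<bar> \<le> b + d / lam" using 2 good2 by linarith
    then have "exp (lam * r) / sqrt N * \<bar>sqrt N * exp (- lam * r) * Y m \<omega> $ 2\<bar> \<le> exp (lam * r) / sqrt N * (b + d / lam)"
      using sqrtN by (intro mult_left_mono) auto
    also have "exp (lam * r) / sqrt N * \<bar>sqrt N * exp (- lam * r) * Y m \<omega> $ 2\<bar> = \<bar>Y m \<omega> $ 2\<bar>"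
      using sqrtN(1) by (simp add: abs_mult exp_minus field_simps)
    also have "exp (lam * r) / sqrt N * (b + d / lam) \<le> exp (lam * ts) / sqrt N * (b + d / lam)"
      using r t pos nonneg sqrtN by (intro mult_right_mono divide_right_mono) auto
    finally show ?thesis using x02 by (simp add: mult.commute)
  qed
  have "norm ?v \<le> \<bar>?v $ 1\<bar> + \<bar>?v $ 2\<bar>" using norm_le_l1_cart[of ?v] by (simp add: sum_2)
  then show 3: "norm ?v < rho" using v1 v2 small2 by linarith
  then have "Y m \<omega> \<in> ball (exp (- mu * r) *\<^sub>R x0) rho" by (simp add: dist_norm norm_minus_commute)
  then show "Y m \<omega> \<in> S" using near_path[OF r(2)] by blast
qed

text \<open>The state at which the path would be stopped lies in \<open>S\<close> by the bootstrap, so the path has not been stopped.\<close>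

lemma good_running:
  assumes w: "\<omega> \<in> space M" and t: "0 \<le> t" "t \<le> ts" and good: "\<omega> \<notin> bad (\<lambda>y. y \<in> S) t"
    and st: "stops_at \<omega> (\<lambda>y. y \<in> S) t m r"
  shows "r = t" "J m \<omega> \<le> ereal t" "ereal t < J (Suc m) \<omega>" "all_past (\<lambda>y. y \<in> S) m \<omega>"
proof -
  have "Y m \<omega> \<in> S" by (rule good_state(4)[OF w t _ _ good st]) auto
  then show "r = t" "J m \<omega> \<le> ereal t" "ereal t < J (Suc m) \<omega>" "all_past (\<lambda>y. y \<in> S) m \<omega>"
    using st by (auto simp: stops_at_def all_past_def le_less)
qed

abbreviation "BS \<equiv> all_past (\<lambda>y. y \<in> S)"

lemma admissible_in_S: "admissible BS" by (rule admissible_all_past) auto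

definition variance_tol :: real where "variance_tol = da + L * rho + 2 * C2 * bad_bound"

lemma rho_pos: "rho > 0"
proof -
  have "0 \<le> (b + d / lam) * exp (lam * ts) / sqrt N" using nonneg pos sqrtN by auto
  then show ?thesis using small2 nonneg by linarith
qed

lemma variance_tol_nonneg: "variance_tol \<ge> 0"
  using nonneg bad_bound_nonneg rho_pos by (auto simp: variance_tol_def intro!: add_nonneg_nonneg mult_nonneg_nonneg)

text \<open>Outside the exceptional event the current state is within \<open>rho\<close> of the limiting path, where Lipschitz continuity
  of \<open>a\<close> applies; on the event both rates of variance are at most \<open>C2\<close>.\<close>

lemma variance_error:
  assumes s: "0 < s" "s \<le> ts"
  shows "(\<integral>\<^sup>+ \<omega>. (\<Sum>n. indicator {s. J n \<omega> \<le> ereal s \<and> ereal s < J (Suc n) \<omega>} s *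
      ennreal \<bar>exp (- 2 * lam * s) * a (exp (- mu * s) *\<^sub>R x0) - (gf 2 s)\<^sup>2 * compensated_sum.sq Y K 2 BS n \<omega>\<bar>) \<partial>M)
    \<le> ennreal (exp (- 2 * lam * s) * variance_tol)"
proof -
  interpret c: compensated_sum M J Y I K x0 S Q "C2 / N" 2 "gf 2" "Gf 2" BS 0 s by (rule compensated_sum_mart[OF admissible_in_S]) (use s in auto)
  let ?e = "exp (- 2 * lam * s)" let ?xs = "exp (- mu * s) *\<^sub>R x0"
  have g2: "(gf 2 s)\<^sup>2 = N * ?e"
    using N by (simp add: gf_def wt_def gam_def power_mult_distrib) (simp add: power2_eq_square exp_add[symmetric])
  have xS: "?xs \<in> S" using near_path[of s] s rho_pos by auto
  have sq: "0 \<le> N * c.sq n \<omega> \<and> N * c.sq n \<omega> \<le> C2" if "\<omega> \<in> space M" for n \<omega>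
  proof (cases "BS n \<omega>")
    case True
    then have YS: "Y n \<omega> \<in> S" "Y n \<omega> \<in> I" using Y_in[OF that] by (auto simp: all_past_def)
    have "0 \<le> (\<integral>y. (y $ 2)\<^sup>2 \<partial>K (Y n \<omega>))" by simp
    moreover have "N * (\<integral>y. (y $ 2)\<^sup>2 \<partial>K (Y n \<omega>)) \<le> N * (C2 / N)" using le2[OF YS, of 2] N by (intro mult_left_mono) auto
    ultimately show ?thesis using True N by (simp add: c.sq_def)
  qed (use nonneg in \<open>auto simp: c.sq_def\<close>)
  have path: "(\<Sum>n. indicator {s. J n \<omega> \<le> ereal s \<and> ereal s < J (Suc n) \<omega>} s *
      ennreal \<bar>?e * a ?xs - (gf 2 s)\<^sup>2 * c.sq n \<omega>\<bar>) \<le> ennreal (?e * (da + L * rho)) + ennreal (?e * (2 * C2)) * indicator (bad (\<lambda>y. y \<in> S) s) \<omega>"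
    if w: "\<omega> \<in> space M" for \<omega>
  proof (rule suminf_state_le[OF w])
    fix n assume n: "J n \<omega> \<le> ereal s" "ereal s < J (Suc n) \<omega>"
    have e: "\<bar>?e * a ?xs - (gf 2 s)\<^sup>2 * c.sq n \<omega>\<bar> = ?e * \<bar>a ?xs - N * c.sq n \<omega>\<bar>"
    proof -
      have "?e * a ?xs - (gf 2 s)\<^sup>2 * c.sq n \<omega> = ?e * (a ?xs - N * c.sq n \<omega>)" unfolding g2 by (simp add: algebra_simps)
      then show ?thesis by (simp only: abs_mult abs_exp_cancel)
    qed
    show "ennreal \<bar>?e * a ?xs - (gf 2 s)\<^sup>2 * c.sq n \<omega>\<bar> \<le> ennreal (?e * (da + L * rho)) + ennreal (?e * (2 * C2)) * indicator (bad (\<lambda>y. y \<in> S) s) \<omega>"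
    proof (cases "\<omega> \<in> bad (\<lambda>y. y \<in> S) s")
      case True
      have "\<bar>a ?xs - N * c.sq n \<omega>\<bar> \<le> 2 * C2" using sq[OF w, of n] a_bd[OF xS] by linarith
      then have "ennreal (?e * \<bar>a ?xs - N * c.sq n \<omega>\<bar>) \<le> ennreal (?e * (2 * C2))"
        by (intro ennreal_leI mult_left_mono) auto
      then show ?thesis unfolding e using True by (simp add: add_increasing)
    next
      case False
      obtain m r where st: "stops_at \<omega> (\<lambda>y. y \<in> S) s m r" using exists_stops_at[OF w, of s] s by auto
      note run = good_running[OF w less_imp_le[OF s(1)] s(2) False st]
      have mn: "m = n" by (rule at_most_one_index[OF w run(2,3) n])
      have near: "norm (Y n \<omega> - ?xs) < rho" and YS: "Y n \<omega> \<in> S"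
        using good_state(3,4)[OF w less_imp_le[OF s(1)] s(2) _ _ False st] run(1) mn by auto
      have YI: "Y n \<omega> \<in> I" by (rule Y_in[OF w])
      have sqn: "c.sq n \<omega> = (\<integral>y. (y $ 2)\<^sup>2 \<partial>K (Y n \<omega>))" using run(4) mn by (simp add: c.sq_def)
      have "\<bar>a (Y n \<omega>) - a ?xs\<bar> \<le> L * rho"
        using a_lip[OF YS xS] mult_left_mono[OF less_imp_le[OF near], of L] nonneg by linarith
      then have "\<bar>a ?xs - N * c.sq n \<omega>\<bar> \<le> da + L * rho" using a_conv[OF YS YI] unfolding sqn by linarith
      then have "ennreal (?e * \<bar>a ?xs - N * c.sq n \<omega>\<bar>) \<le> ennreal (?e * (da + L * rho))"
        by (intro ennreal_leI mult_left_mono) auto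
      then show ?thesis unfolding e using False by simp
    qed
  qed
  have bm [measurable]: "bad (\<lambda>y. y \<in> S) s \<in> sets M" by (rule bad_measurable[OF admissible_in_S]) (use s in auto)
  have "(\<integral>\<^sup>+ \<omega>. (\<Sum>n. indicator {s. J n \<omega> \<le> ereal s \<and> ereal s < J (Suc n) \<omega>} s *
      ennreal \<bar>?e * a ?xs - (gf 2 s)\<^sup>2 * c.sq n \<omega>\<bar>) \<partial>M)
     \<le> (\<integral>\<^sup>+ \<omega>. ennreal (?e * (da + L * rho)) + ennreal (?e * (2 * C2)) * indicator (bad (\<lambda>y. y \<in> S) s) \<omega> \<partial>M)"
    by (intro nn_integral_mono path)
  also have "\<dots> = ennreal (?e * (da + L * rho)) + ennreal (?e * (2 * C2)) * emeasure M (bad (\<lambda>y. y \<in> S) s)"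
    by (simp add: nn_integral_add nn_integral_cmult emeasure_space_1)
  also have "\<dots> \<le> ennreal (?e * (da + L * rho)) + ennreal (?e * (2 * C2)) * ennreal bad_bound"
    using bad_prob[OF admissible_in_S, of s] s by (intro add_left_mono mult_left_mono) (auto simp: emeasure_eq_measure intro!: ennreal_leI)
  also have "\<dots> = ennreal (?e * (da + L * rho) + ?e * (2 * C2) * bad_bound)"
    using nonneg bad_bound_nonneg rho_pos by (subst ennreal_mult[symmetric]) (auto simp: ennreal_plus[symmetric] simp del: ennreal_plus)
  also have "?e * (da + L * rho) + ?e * (2 * C2) * bad_bound = ?e * variance_tol" by (simp add: variance_tol_def algebra_simps)
  finally show ?thesis .
qed

section \<open>Characteristic function of the unstable coordinate\<close>

lemma characteristic_estimate_real:
  fixes f f' V w :: "real \<Rightarrow> real"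
  assumes t: "0 \<le> t" "t \<le> ts"
    and f_deriv: "\<And>u. (f has_real_derivative f' u) (at u)" and f'_cont: "continuous_on UNIV f'"
    and f_bd: "\<And>u. \<bar>f u\<bar> \<le> 1"
    and f_rem: "\<And>u h. \<bar>f (u + h) - f u - f' u * h + (\<kappa> * h)\<^sup>2 / 2 * f u\<bar> \<le> \<bar>\<kappa> * h\<bar> ^ 3 / 6"
    and V: "V \<in> borel_measurable borel" "V 0 = 0" "\<And>s. s \<in> {0..t} \<Longrightarrow> (V has_real_derivative w s) (at s within {0..t})"
      "\<And>s. s \<in> {0..t} \<Longrightarrow> V s \<le> Vm"
    and w: "continuous_on {0..t} w" "w \<in> borel_measurable borel"
      "\<And>s. 0 < s \<Longrightarrow> s \<le> t \<Longrightarrow> w s = exp (- 2 * lam * s) * a (exp (- mu * s) *\<^sub>R x0)"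
  shows "\<bar>exp (\<kappa>\<^sup>2 / 2 * V t) * (\<integral>\<omega>. f (mart 2 BS 0 t \<omega>) \<partial>M) - f 0\<bar>
     \<le> exp (\<kappa>\<^sup>2 / 2 * Vm) * (\<kappa>\<^sup>2 / 2 * (variance_tol / (2 * lam)) + \<bar>\<kappa>\<bar> ^ 3 * C3 / (18 * lam * sqrt N))"
proof -
  interpret c: compensated_sum M J Y I K x0 S Q "C2 / N" 2 "gf 2" "Gf 2" BS 0 t by (rule compensated_sum_mart[OF admissible_in_S order_refl t(1)])
  have e1: "(\<integral>\<^sup>+ s. indicator {0<..t} s * ennreal (exp (- 2 * lam * s) * variance_tol) \<partial>lborel) \<le> ennreal (variance_tol / (2 * lam))"
  proof -
    have "(\<integral>\<^sup>+ s. indicator {0<..t} s * ennreal (exp (- 2 * lam * s) * variance_tol) \<partial>lborel)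
       = (\<integral>\<^sup>+ s. ennreal variance_tol * (indicator {0<..t} s * ennreal (exp (- 2 * lam * s))) \<partial>lborel)"
      using variance_tol_nonneg by (intro nn_integral_cong) (auto simp: ennreal_mult mult.commute split: split_indicator)
    also have "\<dots> = ennreal variance_tol * (\<integral>\<^sup>+ s. indicator {0<..t} s * ennreal (exp (- 2 * lam * s)) \<partial>lborel)"
      by (rule nn_integral_cmult) measurable
    also have "\<dots> \<le> ennreal variance_tol * ennreal ((exp (- 2 * lam * t) - exp (- 2 * lam * 0)) / (- 2 * lam))"
      using nn_integral_exp_window[of 0 t "- 2 * lam"] t pos by (intro mult_left_mono) auto
    also have "\<dots> \<le> ennreal variance_tol * ennreal (1 / (2 * lam))"
    proof (intro mult_left_mono ennreal_leI)
      have "(exp (- 2 * lam * t) - exp (- 2 * lam * 0)) / (- 2 * lam) = (1 - exp (- 2 * lam * t)) / (2 * lam)"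
        using pos by (simp add: field_simps)
      also have "\<dots> \<le> 1 / (2 * lam)" using pos by (intro divide_right_mono) auto
      finally show "(exp (- 2 * lam * t) - exp (- 2 * lam * 0)) / (- 2 * lam) \<le> 1 / (2 * lam)" .
    qed auto
    also have "\<dots> = ennreal (variance_tol / (2 * lam))" using variance_tol_nonneg pos by (subst ennreal_mult[symmetric]) auto
    finally show ?thesis .
  qed
  have e3: "(\<integral>\<^sup>+ s. indicator {0<..t} s * ennreal (\<bar>gf 2 s\<bar> ^ 3) \<partial>lborel) \<le> ennreal (N * sqrt N / (3 * lam))"
  proof -
    have g3: "\<bar>gf 2 s\<bar> ^ 3 = N * sqrt N * exp (- 3 * lam * s)" for s
    proof -
      have "\<bar>gf 2 s\<bar> = sqrt N * exp (- lam * s)" using sqrtN by (simp add: gf_def wt_def gam_def abs_mult)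
      moreover have "sqrt N ^ 3 = N * sqrt N" using sqrtN(3) by (simp add: power3_eq_cube)
      moreover have "exp (- lam * s) ^ 3 = exp (- 3 * lam * s)" by (simp add: power3_eq_cube exp_add[symmetric])
      ultimately show ?thesis by (simp only: power_mult_distrib)
    qed
    have NN: "N * sqrt N \<ge> 0" using N by simp
    have "(\<integral>\<^sup>+ s. indicator {0<..t} s * ennreal (\<bar>gf 2 s\<bar> ^ 3) \<partial>lborel)
       = (\<integral>\<^sup>+ s. ennreal (N * sqrt N) * (indicator {0<..t} s * ennreal (exp (- 3 * lam * s))) \<partial>lborel)"
      unfolding g3 using NN by (intro nn_integral_cong) (auto simp: ennreal_mult split: split_indicator)
    also have "\<dots> = ennreal (N * sqrt N) * (\<integral>\<^sup>+ s. indicator {0<..t} s * ennreal (exp (- 3 * lam * s)) \<partial>lborel)"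
      by (rule nn_integral_cmult) measurable
    also have "\<dots> \<le> ennreal (N * sqrt N) * ennreal ((exp (- 3 * lam * t) - exp (- 3 * lam * 0)) / (- 3 * lam))"
      using nn_integral_exp_window[of 0 t "- 3 * lam"] t pos by (intro mult_left_mono) auto
    also have "\<dots> \<le> ennreal (N * sqrt N) * ennreal (1 / (3 * lam))"
    proof (intro mult_left_mono ennreal_leI)
      have "(exp (- 3 * lam * t) - exp (- 3 * lam * 0)) / (- 3 * lam) = (1 - exp (- 3 * lam * t)) / (3 * lam)"
        using pos by (simp add: field_simps)
      also have "\<dots> \<le> 1 / (3 * lam)" using pos by (intro divide_right_mono) auto
      finally show "(exp (- 3 * lam * t) - exp (- 3 * lam * 0)) / (- 3 * lam) \<le> 1 / (3 * lam)" .
    qed auto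
    also have "\<dots> = ennreal (N * sqrt N / (3 * lam))" using NN pos by (subst ennreal_mult[symmetric]) auto
    finally show ?thesis .
  qed
  have "\<bar>exp (\<kappa>\<^sup>2 / 2 * V t) * (\<integral>\<omega>. f (c.total \<omega>) \<partial>M) - f 0\<bar>
     \<le> exp (\<kappa>\<^sup>2 / 2 * Vm) * (\<kappa>\<^sup>2 / 2 * (variance_tol / (2 * lam)) + \<bar>\<kappa>\<bar> ^ 3 * (C3 / N\<^sup>2) / 6 * (N * sqrt N / (3 * lam)))"
  proof (rule c.clt_estimate_real[where E="\<lambda>s. exp (- 2 * lam * s) * variance_tol", OF refl f_deriv f'_cont f_bd f_rem V(1-3) w(1,2) V(4)])
    show "integrable (K x) (\<lambda>y. \<bar>y $ 2\<bar> ^ 3)" if "x \<in> S" "x \<in> I" for x by (rule int3[OF that])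
    show "(\<integral>y. \<bar>y $ 2\<bar> ^ 3 \<partial>K x) \<le> C3 / N\<^sup>2" if "x \<in> S" "x \<in> I" for x by (rule le3[OF that])
    show "(\<integral>\<^sup>+ \<omega>. (\<Sum>n. indicator {s. J n \<omega> \<le> ereal s \<and> ereal s < J (Suc n) \<omega>} s * ennreal \<bar>w s - (gf 2 s)\<^sup>2 * c.sq n \<omega>\<bar>) \<partial>M)
      \<le> ennreal (exp (- 2 * lam * s) * variance_tol)" if "0 < s" "s \<le> t" for s
      using variance_error[of s] that t unfolding w(3)[OF that] by simp
  qed (use e1 e3 variance_tol_nonneg pos nonneg N in auto)
  also have "\<bar>\<kappa>\<bar> ^ 3 * (C3 / N\<^sup>2) / 6 * (N * sqrt N / (3 * lam)) = \<bar>\<kappa>\<bar> ^ 3 * C3 / (18 * lam * sqrt N)"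
  proof -
    have "N * sqrt N / N\<^sup>2 = 1 / sqrt N"
      using sqrtN N by (simp add: power2_eq_square field_simps)
    have "\<bar>\<kappa>\<bar> ^ 3 * (C3 / N\<^sup>2) / 6 * (N * sqrt N / (3 * lam)) = \<bar>\<kappa>\<bar> ^ 3 * C3 / (18 * lam) * (N * sqrt N / N\<^sup>2)"
      by simp
    then show ?thesis unfolding \<open>N * sqrt N / N\<^sup>2 = 1 / sqrt N\<close> by simp
  qed
  finally show ?thesis unfolding mart_def .
qed

text \<open>Cosine and sine both satisfy \<open>f'' = - \<kappa>\<^sup>2 * f\<close>; they give the real and the imaginary part.\<close>

lemma characteristic_estimate:
  fixes V w :: "real \<Rightarrow> real"
  assumes t: "0 \<le> t" "t \<le> ts"
    and V: "V \<in> borel_measurable borel" "V 0 = 0" "\<And>s. s \<in> {0..t} \<Longrightarrow> (V has_real_derivative w s) (at s within {0..t})"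
      "\<And>s. s \<in> {0..t} \<Longrightarrow> V s \<le> Vm"
    and w: "continuous_on {0..t} w" "w \<in> borel_measurable borel"
      "\<And>s. 0 < s \<Longrightarrow> s \<le> t \<Longrightarrow> w s = exp (- 2 * lam * s) * a (exp (- mu * s) *\<^sub>R x0)"
  shows "cmod (exp (\<kappa>\<^sup>2 / 2 * V t) * char (distr M borel (mart 2 BS 0 t)) \<kappa> - 1)
     \<le> 2 * (exp (\<kappa>\<^sup>2 / 2 * Vm) * (\<kappa>\<^sup>2 / 2 * (variance_tol / (2 * lam)) + \<bar>\<kappa>\<bar> ^ 3 * C3 / (18 * lam * sqrt N)))"
proof -
  let ?U = "mart 2 BS 0 t" let ?b = "exp (\<kappa>\<^sup>2 / 2 * Vm) * (\<kappa>\<^sup>2 / 2 * (variance_tol / (2 * lam)) + \<bar>\<kappa>\<bar> ^ 3 * C3 / (18 * lam * sqrt N))"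
  let ?E = "exp (\<kappa>\<^sup>2 / 2 * V t)"
  note [measurable] = mart_measurable[OF admissible_in_S order_refl t(1), of 2]
  have c: "\<bar>?E * (\<integral>\<omega>. cos (\<kappa> * ?U \<omega>) \<partial>M) - cos (\<kappa> * 0)\<bar> \<le> ?b"
  proof (rule characteristic_estimate_real[OF t _ _ _ _ V w])
    show "((\<lambda>u. cos (\<kappa> * u)) has_real_derivative - \<kappa> * sin (\<kappa> * u)) (at u)" for u
      by (auto intro!: derivative_eq_intros)
    show "continuous_on UNIV (\<lambda>u. - \<kappa> * sin (\<kappa> * u))" by (intro continuous_intros)
    show "\<bar>cos (\<kappa> * (u + h)) - cos (\<kappa> * u) - - \<kappa> * sin (\<kappa> * u) * h + (\<kappa> * h)\<^sup>2 / 2 * cos (\<kappa> * u)\<bar> \<le> \<bar>\<kappa> * h\<bar> ^ 3 / 6" for u h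
      using trig_remainder(1)[of "\<kappa> * u" "\<kappa> * h"] by (simp add: distrib_left ac_simps)
  qed auto
  have s: "\<bar>?E * (\<integral>\<omega>. sin (\<kappa> * ?U \<omega>) \<partial>M) - sin (\<kappa> * 0)\<bar> \<le> ?b"
  proof (rule characteristic_estimate_real[OF t _ _ _ _ V w])
    show "((\<lambda>u. sin (\<kappa> * u)) has_real_derivative \<kappa> * cos (\<kappa> * u)) (at u)" for u
      by (auto intro!: derivative_eq_intros)
    show "continuous_on UNIV (\<lambda>u. \<kappa> * cos (\<kappa> * u))" by (intro continuous_intros)
    show "\<bar>sin (\<kappa> * (u + h)) - sin (\<kappa> * u) - \<kappa> * cos (\<kappa> * u) * h + (\<kappa> * h)\<^sup>2 / 2 * sin (\<kappa> * u)\<bar> \<le> \<bar>\<kappa> * h\<bar> ^ 3 / 6" for u h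
      using trig_remainder(2)[of "\<kappa> * u" "\<kappa> * h"] by (simp add: distrib_left ac_simps)
  qed auto
  have i: "integrable M (\<lambda>\<omega>. iexp (\<kappa> * ?U \<omega>))"
    by (rule integrable_const_bound[where B=1]) auto
  have ch: "char (distr M borel ?U) \<kappa> = (\<integral>\<omega>. iexp (\<kappa> * ?U \<omega>) \<partial>M)"
    unfolding char_def by (rule integral_distr) measurable
  define z where "z = (\<integral>\<omega>. iexp (\<kappa> * ?U \<omega>) \<partial>M)"
  have re: "Re z = (\<integral>\<omega>. cos (\<kappa> * ?U \<omega>) \<partial>M)"
    using integral_Re[OF i] by (simp add: z_def Re_exp)
  have im: "Im z = (\<integral>\<omega>. sin (\<kappa> * ?U \<omega>) \<partial>M)"
    using integral_Im[OF i] by (simp add: z_def Im_exp)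
  have "cmod (of_real ?E * z - 1) \<le> \<bar>Re (of_real ?E * z - 1)\<bar> + \<bar>Im (of_real ?E * z - 1)\<bar>"
    by (rule cmod_le)
  also have "Re (of_real ?E * z - 1) = ?E * (\<integral>\<omega>. cos (\<kappa> * ?U \<omega>) \<partial>M) - cos (\<kappa> * 0)" by (simp add: re)
  also have "Im (of_real ?E * z - 1) = ?E * (\<integral>\<omega>. sin (\<kappa> * ?U \<omega>) \<partial>M) - sin (\<kappa> * 0)" by (simp add: im)
  also have "\<bar>?E * (\<integral>\<omega>. cos (\<kappa> * ?U \<omega>) \<partial>M) - cos (\<kappa> * 0)\<bar> + \<bar>?E * (\<integral>\<omega>. sin (\<kappa> * ?U \<omega>) \<partial>M) - sin (\<kappa> * 0)\<bar> \<le> ?b + ?b"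
    using c s by (rule add_mono)
  also have "\<dots> = 2 * ?b" by simp
  finally show ?thesis unfolding ch z_def .
qed

section \<open>The crossing of the two lines\<close>

abbreviation "XS \<omega> \<equiv> stopped S (\<lambda>t. X t \<omega>)"

definition below :: "real \<Rightarrow> real^2 \<Rightarrow> bool" where
  "below al y \<longleftrightarrow> y \<in> S \<and> abs_slope y < ereal al"

lemma below_measurable: "Measurable.pred borel (below al)"
  unfolding below_def[abs_def] by measurable

lemma admissible_below: "admissible (all_past (below al))"
  by (rule admissible_all_past[OF below_measurable]) (simp add: below_def)

lemma slope_ge_iff:
  assumes "al \<ge> 0"
  shows "al * \<bar>y $ 1\<bar> \<le> \<bar>y $ 2\<bar> \<Longrightarrow> ereal al \<le> abs_slope y"
    and "y $ 1 \<noteq> 0 \<Longrightarrow> ereal al \<le> abs_slope y \<Longrightarrow> al * \<bar>y $ 1\<bar> \<le> \<bar>y $ 2\<bar>"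
  by (auto simp: abs_slope_def field_simps)

text \<open>The path has not left \<open>S\<close> by time \<open>t\<close>, and the large compensated sum makes the state at time \<open>t\<close> steep. So the first
  steep state occurs at or before \<open>t\<close>.\<close>

lemma hit_before:
  assumes w: "\<omega> \<in> space M" and t: "0 \<le> t" "t \<le> ts" and good: "\<omega> \<notin> bad (\<lambda>y. y \<in> S) t"
    and al: "al = \<bar>tan \<theta>\<bar>" and start: "abs_slope x0 < ereal al"
    and large: "al * (\<bar>x0 $ 1\<bar> + 2 * eta) * (sqrt N * exp (- (lam + mu) * t)) \<le> \<bar>mart 2 BS 0 t \<omega>\<bar> - d / lam"
  shows "hit_time \<theta> (XS \<omega>) \<le> ereal t"
proof -
  obtain m r where st: "stops_at \<omega> (\<lambda>y. y \<in> S) t m r" using exists_stops_at[OF w t(1)] by blast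
  note run = good_running[OF w t good st]
  have g1: "\<bar>exp (mu * t) * Y m \<omega> $ 1 - x0 $ 1\<bar> \<le> 2 * eta"
    and g2: "\<bar>sqrt N * exp (- lam * t) * Y m \<omega> $ 2 - mart 2 BS 0 t \<omega>\<bar> \<le> d / lam"
    using good_state(1,2)[OF w t _ _ good st] run(1) by auto
  let ?e = "sqrt N * exp (- lam * t)"
  have e: "?e > 0" using sqrtN by simp
  have "\<bar>exp (mu * t) * Y m \<omega> $ 1\<bar> \<le> \<bar>x0 $ 1\<bar> + 2 * eta" using g1 by linarith
  then have y1: "exp (mu * t) * \<bar>Y m \<omega> $ 1\<bar> \<le> \<bar>x0 $ 1\<bar> + 2 * eta" by (simp add: abs_mult)
  have "\<bar>?e * Y m \<omega> $ 2\<bar> \<ge> \<bar>mart 2 BS 0 t \<omega>\<bar> - d / lam" using g2 by linarith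
  then have y2: "?e * \<bar>Y m \<omega> $ 2\<bar> \<ge> \<bar>mart 2 BS 0 t \<omega>\<bar> - d / lam" using e by (simp add: abs_mult abs_of_pos[OF sqrtN(1)])
  have ee: "sqrt N * exp (- (lam + mu) * t) * exp (mu * t) = ?e"
    by (simp add: mult.assoc exp_add[symmetric] algebra_simps)
  have "al * (exp (mu * t) * \<bar>Y m \<omega> $ 1\<bar>) * (sqrt N * exp (- (lam + mu) * t)) \<le> al * (\<bar>x0 $ 1\<bar> + 2 * eta) * (sqrt N * exp (- (lam + mu) * t))"
    using y1 sqrtN al by (intro mult_right_mono mult_left_mono) auto
  then have "al * (exp (mu * t) * \<bar>Y m \<omega> $ 1\<bar>) * (sqrt N * exp (- (lam + mu) * t)) \<le> ?e * \<bar>Y m \<omega> $ 2\<bar>"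
    using large y2 by linarith
  moreover have "al * (exp (mu * t) * \<bar>Y m \<omega> $ 1\<bar>) * (sqrt N * exp (- (lam + mu) * t)) = ?e * (al * \<bar>Y m \<omega> $ 1\<bar>)"
    unfolding ee[symmetric] by (simp add: ac_simps)
  ultimately have "al * \<bar>Y m \<omega> $ 1\<bar> \<le> \<bar>Y m \<omega> $ 2\<bar>"
    using e by (metis mult_le_cancel_left_pos)
  then have sl: "ereal al \<le> abs_slope (Y m \<omega>)" using slope_ge_iff(1)[of al] al by auto
  define n where "n = (LEAST n. ereal al \<le> abs_slope (Y n \<omega>))"
  have n: "ereal al \<le> abs_slope (Y n \<omega>)" "n \<le> m" unfolding n_def using sl by (auto intro: LeastI Least_le)
  have "abs_slope (Y k \<omega>) < ereal al" if "k < n" for k using not_less_Least[OF that[unfolded n_def]] by simp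
  moreover have "Y k \<omega> \<in> S" if "k < n" for k using run(4) that n by (auto simp: all_past_def)
  ultimately have h: "hits S al n \<omega>" using n by (simp add: hits_def)
  have "hit_time \<theta> (XS \<omega>) = J n \<omega>" by (rule hit_time_hits[OF w al start h])
  also have "\<dots> \<le> J m \<omega>" by (rule J_le[OF w n(2)])
  also have "\<dots> \<le> ereal t" by (rule run(2))
  finally show ?thesis .
qed

text \<open>The crossing ends the flat part of the path inside \<open>S\<close>. The sum restricted to this part no longer changes after the
  hitting time \<open>T\<close>, hence its value at the deterministic time \<open>ts\<close> describes the state at \<open>T\<close>. The sum over the whole
  stay in \<open>S\<close> differs from it only by jumps after \<open>T\<close>. By \<open>late\<close> no crossing occurs before \<open>sn\<close>, so this
  difference is a compensated sum over the window from \<open>sn\<close> to \<open>ts\<close>.\<close>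

lemma at_hit:
  assumes w: "\<omega> \<in> space M" and good: "\<omega> \<notin> bad (below al) ts"
    and al: "al = \<bar>tan \<theta>\<bar>" and start: "abs_slope x0 < ereal al"
    and T: "hit_time \<theta> (XS \<omega>) = ereal T" "T \<le> ts"
    and eta_small: "2 * eta < \<bar>x0 $ 1\<bar>"
    and late: "0 \<le> sn" "sn \<le> ts" "b + d / lam < al * (\<bar>x0 $ 1\<bar> - 2 * eta) * (sqrt N * exp (- (lam + mu) * sn))"
    and window: "\<bar>mart 2 (\<lambda>n \<omega>. BS n \<omega> \<and> \<not> all_past (below al) n \<omega>) sn ts \<omega>\<bar> \<le> z"
  obtains p u where "\<bar>p - x0 $ 1\<bar> \<le> 2 * eta" "\<bar>u - mart 2 BS 0 ts \<omega>\<bar> \<le> z + d / lam"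
    "al * \<bar>p\<bar> * (sqrt N * exp (- (lam + mu) * T)) \<le> \<bar>u\<bar>"
    "value_at (XS \<omega>) (hit_time \<theta> (XS \<omega>)) $ 1 = exp (- mu * T) * p"
    "value_at (XS \<omega>) (hit_time \<theta> (XS \<omega>)) $ 2 = exp (lam * T) * u / sqrt N"
proof -
  have "\<exists>n. hits S al n \<omega>"
  proof (rule ccontr)
    assume "\<nexists>n. hits S al n \<omega>"
    then have "hit_time \<theta> (XS \<omega>) = \<infinity>" unfolding hit_time_eq[OF w al start] by (simp add: top_ereal_def)
    then show False using T by simp
  qed
  then obtain n where h: "hits S al n \<omega>" by blast
  have Jn: "J n \<omega> = ereal T" using hit_time_hits[OF w al start h] T by simp
  have T0: "0 \<le> T" using J_nonneg[OF w, of n] Jn by simp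
  have val: "value_at (XS \<omega>) (hit_time \<theta> (XS \<omega>)) = Y n \<omega>"
    using stopped_at_hit[OF w h Jn] T by (simp add: value_at_def)
  have st: "stops_at \<omega> (below al) ts n T"
    using h Jn T0 T by (auto simp: stops_at_def hits_def below_def)
  have ts0: "0 \<le> ts" using nonneg by simp
  have below_S: "y \<in> S" if "below al y" for y using that by (simp add: below_def)
  let ?p = "exp (mu * T) * Y n \<omega> $ 1" let ?u = "sqrt N * exp (- lam * T) * Y n \<omega> $ 2"
  have p: "\<bar>?p - x0 $ 1\<bar> \<le> 2 * eta" and u: "\<bar>?u - mart 2 (all_past (below al)) 0 ts \<omega>\<bar> \<le> d / lam"
    using good_state(1,2)[OF w ts0 order_refl below_measurable below_S good st] by auto
  have ub: "\<bar>?u\<bar> \<le> b + d / lam"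
    using good w u by (auto simp: bad_def)
  have pb: "\<bar>?p\<bar> \<ge> \<bar>x0 $ 1\<bar> - 2 * eta" using p by linarith
  then have "Y n \<omega> $ 1 \<noteq> 0" using eta_small by auto
  then have sl: "al * \<bar>Y n \<omega> $ 1\<bar> \<le> \<bar>Y n \<omega> $ 2\<bar>" using h slope_ge_iff(2)[of al] al by (auto simp: hits_def)
  have e: "sqrt N * exp (- lam * T) > 0" using sqrtN by simp
  have ee: "sqrt N * exp (- (lam + mu) * T) * exp (mu * T) = sqrt N * exp (- lam * T)"
    by (simp add: mult.assoc exp_add[symmetric] algebra_simps)
  have crossing: "al * \<bar>?p\<bar> * (sqrt N * exp (- (lam + mu) * T)) \<le> \<bar>?u\<bar>"
  proof -
    have "al * \<bar>?p\<bar> * (sqrt N * exp (- (lam + mu) * T)) = (sqrt N * exp (- (lam + mu) * T) * exp (mu * T)) * (al * \<bar>Y n \<omega> $ 1\<bar>)"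
      by (simp add: abs_mult ac_simps)
    also have "\<dots> \<le> (sqrt N * exp (- (lam + mu) * T) * exp (mu * T)) * \<bar>Y n \<omega> $ 2\<bar>"
      using sl sqrtN by (intro mult_left_mono) auto
    also have "\<dots> = \<bar>?u\<bar>" unfolding ee using sqrtN by (simp add: abs_mult)
    finally show ?thesis .
  qed
  have "sn \<le> T"
  proof (rule ccontr)
    assume "\<not> sn \<le> T"
    then have "exp (- (lam + mu) * sn) \<le> exp (- (lam + mu) * T)" using pos by (auto intro!: mult_left_mono)
    then have "al * (\<bar>x0 $ 1\<bar> - 2 * eta) * (sqrt N * exp (- (lam + mu) * sn)) \<le> al * \<bar>?p\<bar> * (sqrt N * exp (- (lam + mu) * T))"
      using pb sqrtN al eta_small by (intro mult_mono) auto
    then show False using crossing ub late(3) by linarith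
  qed
  let ?R = "\<lambda>n \<omega>. BS n \<omega> \<and> \<not> all_past (below al) n \<omega>"
  have okR: "admissible ?R" by (rule admissible_diff[OF admissible_in_S admissible_below])
  have "mart 2 ?R 0 sn \<omega> = 0"
  proof (rule mart_zero[OF okR late(1) w])
    fix m assume "BS m \<omega> \<and> \<not> all_past (below al) m \<omega>"
    then obtain k where k: "k \<le> m" "\<not> below al (Y k \<omega>)" by (auto simp: all_past_def)
    then have "n \<le> k" using h by (auto simp: hits_def below_def not_le[symmetric])
    then have "J n \<omega> \<le> J m \<omega>" using k by (intro J_le[OF w]) auto
    then show "ereal sn \<le> J m \<omega>" using Jn \<open>sn \<le> T\<close> by (auto intro: order_trans[of _ "ereal T"])
  qed
  then have R: "mart 2 ?R 0 ts \<omega> = mart 2 ?R sn ts \<omega>" using mart_split_time[OF okR late(1,2) w] by simp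
  have "mart 2 BS 0 ts \<omega> = mart 2 (all_past (below al)) 0 ts \<omega> + mart 2 ?R 0 ts \<omega>"
    by (rule mart_split_pred[OF admissible_in_S admissible_below order_refl ts0 w]) (auto simp: all_past_def below_def)
  then have u': "\<bar>?u - mart 2 BS 0 ts \<omega>\<bar> \<le> z + d / lam" using u window unfolding R by linarith
  show ?thesis
  proof (rule that[OF p u' crossing])
    show "value_at (XS \<omega>) (hit_time \<theta> (XS \<omega>)) $ 1 = exp (- mu * T) * ?p"
      unfolding val by (simp add: mult.assoc[symmetric] exp_add[symmetric])
    have "exp (lam * T) * exp (- lam * T) = 1" by (simp add: exp_add[symmetric])
    then have "exp (lam * T) * ?u / sqrt N = Y n \<omega> $ 2"
      using sqrtN(1) by (simp add: field_simps)
    then show "value_at (XS \<omega>) (hit_time \<theta> (XS \<omega>)) $ 2 = exp (lam * T) * ?u / sqrt N" unfolding val by simp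
  qed
qed

text \<open>One exceptional event serves all grid times: it collects the failures of the tube bound, the fluctuations of the
  second sum between each grid time and the reference time \<open>tn\<close>, and the fluctuations after the crossing. The horizon
  \<open>ts\<close> belongs to the grid so that the sum at \<open>ts\<close> can be compared with that at \<open>tn\<close>.\<close>

lemma hit_analysis:
  fixes G :: "real set"
  assumes al: "al = \<bar>tan \<theta>\<bar>" and start: "abs_slope x0 < ereal al"
    and G: "finite G" "G \<subseteq> {0..ts}" "ts \<in> G" and tn: "0 \<le> tn" "tn \<le> ts" and z: "z > 0"
    and eta_small: "2 * eta < \<bar>x0 $ 1\<bar>"
    and late: "0 \<le> sn" "sn \<le> ts" "b + d / lam < al * (\<bar>x0 $ 1\<bar> - 2 * eta) * (sqrt N * exp (- (lam + mu) * sn))"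
  obtains E where "E \<in> sets M"
    "measure M E \<le> (card G + 1) * bad_bound + (\<Sum>t\<in>G. C2 * exp (- 2 * lam * min t tn) / (lam * z\<^sup>2)) + C2 * exp (- 2 * lam * sn) / (lam * z\<^sup>2)"
    "\<And>\<omega> t. \<omega> \<in> space M \<Longrightarrow> \<omega> \<notin> E \<Longrightarrow> t \<in> G \<Longrightarrow>
       al * (\<bar>x0 $ 1\<bar> + 2 * eta) * (sqrt N * exp (- (lam + mu) * t)) \<le> \<bar>mart 2 BS 0 tn \<omega>\<bar> - z - d / lam \<Longrightarrow>
       hit_time \<theta> (XS \<omega>) \<le> ereal t"
    "\<And>\<omega> T. \<omega> \<in> space M \<Longrightarrow> \<omega> \<notin> E \<Longrightarrow> hit_time \<theta> (XS \<omega>) = ereal T \<Longrightarrow> T \<le> ts \<Longrightarrow>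
       \<exists>p u. \<bar>p - x0 $ 1\<bar> \<le> 2 * eta \<and> \<bar>u - mart 2 BS 0 tn \<omega>\<bar> \<le> 2 * z + d / lam \<and>
         al * \<bar>p\<bar> * (sqrt N * exp (- (lam + mu) * T)) \<le> \<bar>u\<bar> \<and>
         value_at (XS \<omega>) (hit_time \<theta> (XS \<omega>)) $ 1 = exp (- mu * T) * p \<and>
         value_at (XS \<omega>) (hit_time \<theta> (XS \<omega>)) $ 2 = exp (lam * T) * u / sqrt N"
proof -
  let ?R = "\<lambda>n \<omega>. BS n \<omega> \<and> \<not> all_past (below al) n \<omega>"
  have okR: "admissible ?R" by (rule admissible_diff[OF admissible_in_S admissible_below])
  let ?W = "\<lambda>t. {\<omega>\<in>space M. z \<le> \<bar>mart 2 BS (min t tn) (max t tn) \<omega>\<bar>}"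
  let ?Z = "{\<omega>\<in>space M. z \<le> \<bar>mart 2 ?R sn ts \<omega>\<bar>}"
  let ?b = "\<lambda>t. bad (\<lambda>y. y \<in> S) t"
  define E where "E = (\<Union>t\<in>G. ?b t \<union> ?W t) \<union> (bad (below al) ts \<union> ?Z)"
  have Gt: "0 \<le> t" "t \<le> ts" "0 \<le> min t tn" "min t tn \<le> max t tn" if "t \<in> G" for t using G(2) that tn by auto
  have ts0: "0 \<le> ts" using nonneg by simp
  have m1: "?b t \<in> sets M" if "t \<in> G" for t by (rule bad_measurable[OF admissible_in_S Gt(1)[OF that]])
  have m2: "?W t \<in> sets M" if "t \<in> G" for t
    using mart_measurable[OF admissible_in_S Gt(3,4)[OF that], of 2] by measurable
  have m3: "bad (below al) ts \<in> sets M" by (rule bad_measurable[OF admissible_below ts0])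
  have m4: "?Z \<in> sets M" using mart_measurable[OF okR late(1,2), of 2] by measurable
  have m12: "(\<Union>t\<in>G. ?b t \<union> ?W t) \<in> sets M" using m1 m2 G(1) by (intro sets.finite_UN sets.Un)
  have EM: "E \<in> sets M" unfolding E_def by (intro sets.Un m12 m3 m4)
  have "measure M E \<le> measure M (\<Union>t\<in>G. ?b t \<union> ?W t) + measure M (bad (below al) ts \<union> ?Z)"
    unfolding E_def by (rule measure_Un_le[OF m12 sets.Un[OF m3 m4]])
  also have "measure M (bad (below al) ts \<union> ?Z) \<le> measure M (bad (below al) ts) + measure M ?Z"
    by (rule measure_Un_le[OF m3 m4])
  also have "measure M (bad (below al) ts) \<le> bad_bound" by (rule bad_prob[OF admissible_below ts0 order_refl])
  also have "measure M ?Z \<le> C2 * exp (- 2 * lam * sn) / (lam * z\<^sup>2)" by (rule mart_2_tail[OF okR late(1,2) z])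
  also have "measure M (\<Union>t\<in>G. ?b t \<union> ?W t) \<le> (\<Sum>t\<in>G. measure M (?b t \<union> ?W t))"
    by (rule measure_UNION_le[OF G(1)]) (intro sets.Un m1 m2)
  also have "(\<Sum>t\<in>G. measure M (?b t \<union> ?W t)) \<le> (\<Sum>t\<in>G. bad_bound + C2 * exp (- 2 * lam * min t tn) / (lam * z\<^sup>2))"
  proof (rule sum_mono)
    fix t assume t: "t \<in> G"
    have "measure M (?b t \<union> ?W t) \<le> measure M (?b t) + measure M (?W t)"
      by (rule measure_Un_le[OF m1[OF t] m2[OF t]])
    then show "measure M (?b t \<union> ?W t) \<le> bad_bound + C2 * exp (- 2 * lam * min t tn) / (lam * z\<^sup>2)"
      using bad_prob[OF admissible_in_S Gt(1,2)[OF t]] mart_2_tail[OF admissible_in_S Gt(3,4)[OF t] z] by linarith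
  qed
  finally have EP: "measure M E \<le> (card G + 1) * bad_bound + (\<Sum>t\<in>G. C2 * exp (- 2 * lam * min t tn) / (lam * z\<^sup>2)) + C2 * exp (- 2 * lam * sn) / (lam * z\<^sup>2)"
    by (simp add: sum.distrib algebra_simps)
  have near: "\<bar>mart 2 BS 0 t \<omega> - mart 2 BS 0 tn \<omega>\<bar> < z" if w: "\<omega> \<in> space M" and nE: "\<omega> \<notin> E" and t: "t \<in> G" for \<omega> t
  proof -
    have "\<bar>mart 2 BS (min t tn) (max t tn) \<omega>\<bar> < z" using nE w t by (auto simp: E_def not_le)
    moreover have "mart 2 BS 0 (max t tn) \<omega> = mart 2 BS 0 (min t tn) \<omega> + mart 2 BS (min t tn) (max t tn) \<omega>"
      by (rule mart_split_time[OF admissible_in_S Gt(3,4)[OF t] w])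
    ultimately show ?thesis by (cases "t \<le> tn") (auto simp: min_def max_def)
  qed
  show ?thesis
  proof (rule that[OF EM EP])
    fix \<omega> t assume w: "\<omega> \<in> space M" and nE: "\<omega> \<notin> E" and t: "t \<in> G"
      and large: "al * (\<bar>x0 $ 1\<bar> + 2 * eta) * (sqrt N * exp (- (lam + mu) * t)) \<le> \<bar>mart 2 BS 0 tn \<omega>\<bar> - z - d / lam"
    have good: "\<omega> \<notin> ?b t" using nE t by (auto simp: E_def)
    show "hit_time \<theta> (XS \<omega>) \<le> ereal t"
      by (rule hit_before[OF w Gt(1,2)[OF t] good al start]) (use large near[OF w nE t] in linarith)
  next
    fix \<omega> T assume w: "\<omega> \<in> space M" and nE: "\<omega> \<notin> E" and T: "hit_time \<theta> (XS \<omega>) = ereal T" "T \<le> ts"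
    have good: "\<omega> \<notin> bad (below al) ts" and win: "\<bar>mart 2 ?R sn ts \<omega>\<bar> \<le> z" using nE w by (auto simp: E_def)
    obtain p u where pu: "\<bar>p - x0 $ 1\<bar> \<le> 2 * eta" "\<bar>u - mart 2 BS 0 ts \<omega>\<bar> \<le> z + d / lam"
      "al * \<bar>p\<bar> * (sqrt N * exp (- (lam + mu) * T)) \<le> \<bar>u\<bar>"
      "value_at (XS \<omega>) (hit_time \<theta> (XS \<omega>)) $ 1 = exp (- mu * T) * p"
      "value_at (XS \<omega>) (hit_time \<theta> (XS \<omega>)) $ 2 = exp (lam * T) * u / sqrt N"
      by (rule at_hit[OF w good al start T eta_small late win])
    have "\<bar>u - mart 2 BS 0 tn \<omega>\<bar> \<le> 2 * z + d / lam" using pu(2) near[OF w nE G(3)] by linarith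
    then show "\<exists>p u. \<bar>p - x0 $ 1\<bar> \<le> 2 * eta \<and> \<bar>u - mart 2 BS 0 tn \<omega>\<bar> \<le> 2 * z + d / lam \<and>
         al * \<bar>p\<bar> * (sqrt N * exp (- (lam + mu) * T)) \<le> \<bar>u\<bar> \<and>
         value_at (XS \<omega>) (hit_time \<theta> (XS \<omega>)) $ 1 = exp (- mu * T) * p \<and>
         value_at (XS \<omega>) (hit_time \<theta> (XS \<omega>)) $ 2 = exp (lam * T) * u / sqrt N"
      using pu by blast
  qed
qed

lemma mart_2_eq: "mart 2 BS 0 t = compensated_sum.total J Y K 2 (\<lambda>s. sqrt N * exp (- lam * s))
    (\<lambda>s. - (sqrt N / lam) * exp (- lam * s)) (\<lambda>n \<omega>. \<forall>k\<le>n. Y k \<omega> \<in> S) 0 t"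
proof -
  have "gf 2 = (\<lambda>s. sqrt N * exp (- lam * s))" "Gf 2 = (\<lambda>s. - (sqrt N / lam) * exp (- lam * s))"
    "BS = (\<lambda>n \<omega>. \<forall>k\<le>n. Y k \<omega> \<in> S)"
    by (intro ext; simp add: gf_def Gf_def wt_def gam_def all_past_def)+
  then show ?thesis by (simp only: mart_def)
qed

end

section \<open>From convergence of the kernels to moment bounds\<close>

lemma tendsto_nat_powr_neg: "e < 0 \<Longrightarrow> (\<lambda>N. real N powr e) \<longlonglongrightarrow> 0"
  by (rule tendsto_neg_powr[OF _ filterlim_real_sequentially])

locale fluid_limit =
  fixes M :: "nat \<Rightarrow> 'w measure" and X :: "nat \<Rightarrow> real \<Rightarrow> 'w \<Rightarrow> real^2"
    and I :: "nat \<Rightarrow> (real^2) set" and KN :: "nat \<Rightarrow> real^2 \<Rightarrow> (real^2) measure"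
    and S :: "(real^2) set" and K :: "real^2 \<Rightarrow> (real^2) measure"
    and x0 :: "real^2" and \<eta>0 lam \<mu> \<epsilon> C L :: real
    and J :: "nat \<Rightarrow> nat \<Rightarrow> 'w \<Rightarrow> ereal" and Y :: "nat \<Rightarrow> nat \<Rightarrow> 'w \<Rightarrow> real^2"
  assumes paths: "\<And>N. jump_paths (M N) (J N) (Y N) (I N) (KN N) x0 (X N)"
    and S: "open S" "x0 \<in> S"
    and limit_kernel: "finite_kernel S K"
    and eta: "\<eta>0 > 0"
    and laplace_bounded: "\<And>y \<theta>'. y \<in> S \<Longrightarrow> norm \<theta>' \<le> \<eta>0 \<Longrightarrow> laplace K y \<theta>' \<le> ennreal C"
    and laplace_conv:
      "(\<lambda>N. SUP y\<in>I N \<inter> S. SUP \<theta>'\<in>cball 0 \<eta>0.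
          \<bar>enn2ereal (laplace (KN N) y (real N *\<^sub>R \<theta>')) / ereal (real N)
             - enn2ereal (laplace K y \<theta>')\<bar>) \<longlonglongrightarrow> 0"
    and drift_conv:
      "(\<lambda>N. SUP y\<in>I N \<inter> S. ereal (sqrt (real N) * norm (drift (KN N) y - drift K y))) \<longlonglongrightarrow> 0"
    and covar_lipschitz: "L-lipschitz_on S (covar K)"
    and pos: "lam > 0" "\<mu> > 0"
    and linear: "\<And>y. y \<in> S \<Longrightarrow> drift K y = vector [vector [-\<mu>, 0], vector [0, lam]] *v y"
    and start: "x0 $ 2 = 0" "x0 $ 1 \<noteq> 0"
    and nbhd: "\<epsilon> > 0" "\<And>t. t \<ge> 0 \<Longrightarrow> ball (exp (- \<mu> * t) *\<^sub>R x0) \<epsilon> \<subseteq> S"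
begin

definition a :: "real^2 \<Rightarrow> real" where "a y = covar K y $ 2 $ 2"

text \<open>The constant may be negative, in which case \<open>ennreal C\<close> is \<open>0\<close>.\<close>

definition C' :: real where "C' = max C 0"

text \<open>The constants of \<open>abs_moment_bound\<close> for radius \<open>\<eta>0 / 2\<close> and mass \<open>4 * (C' + 1)\<close>: second moments give
  \<open>2 * 16 * 4 = 128\<close> and third moments \<open>6 * 64 * 4 = 1536\<close>. The summand \<open>1\<close> leaves room for the difference between the
  Laplace transform of the process and its limit.\<close>

definition C2 :: real where "C2 = 128 * (C' + 1) / \<eta>0\<^sup>2"

definition C3 :: real where "C3 = 1536 * (C' + 1) / \<eta>0 ^ 3"

definition tN :: "nat \<Rightarrow> real" where "tN N = 1 / (2 * (lam + \<mu>)) * ln (real N)"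

text \<open>The tolerances are \<open>N\<close> to the power \<open>- bet\<close> for the first coordinate and \<open>N\<close> to the power \<open>bet\<close> for the second. The
  exponent is small enough for the probability of the exceptional events and the radius \<open>rho\<close> of the tube to tend to \<open>0\<close>.\<close>

definition bet :: real where "bet = min \<mu> lam / (4 * (lam + \<mu>))"

definition rho :: "real \<Rightarrow> nat \<Rightarrow> real" where
  "rho A N = 3 * real N powr (- bet) + (real N powr bet + 1 / lam) * exp (lam * (tN N + A)) / sqrt (real N)"

lemma C'_nonneg: "C' \<ge> 0" by (simp add: C'_def)

lemma C2_nonneg: "C2 \<ge> 0" using C'_nonneg by (simp add: C2_def)

lemma C3_nonneg: "C3 \<ge> 0" using C'_nonneg eta by (simp add: C3_def)

lemma kernelN: "x \<in> I N \<Longrightarrow> sets (KN N x) = sets borel" "x \<in> I N \<Longrightarrow> finite_measure (KN N x)"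
proof -
  interpret p: jump_paths "M N" "J N" "Y N" "I N" "KN N" x0 "X N" by (rule paths)
  show "x \<in> I N \<Longrightarrow> sets (KN N x) = sets borel" by (rule p.kernel_sets)
  show "x \<in> I N \<Longrightarrow> finite_measure (KN N x)" by (rule p.kernel_finite)
qed

lemma moments_limit: "x \<in> S \<Longrightarrow> exp_moments (K x) (\<eta>0 / 2) (4 * C')"
proof (rule exp_moments_of_laplace)
  assume x: "x \<in> S"
  show "sets (K x) = sets borel" "finite_measure (K x)" using limit_kernel x by (auto simp: finite_kernel_def)
  show "\<eta>0 > 0" by (rule eta)
  show "C' \<ge> 0" by (rule C'_nonneg)
  fix \<theta> :: "real^2" assume "norm \<theta> \<le> \<eta>0"
  then have "laplace K x \<theta> \<le> ennreal C" by (rule laplace_bounded[OF x])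
  also have "\<dots> \<le> ennreal C'" by (intro ennreal_leI) (simp add: C'_def)
  finally show "laplace K x \<theta> \<le> ennreal C'" .
qed

lemma a_eq: "x \<in> S \<Longrightarrow> a x = (\<integral>y. (y $ 2)\<^sup>2 \<partial>K x)"
  unfolding a_def covar_cong_kernel[of K] by (rule exp_moments.covar_22_eq[OF moments_limit])

lemma a_bounds: "x \<in> S \<Longrightarrow> 0 \<le> a x \<and> a x \<le> C2"
proof -
  assume x: "x \<in> S"
  interpret m: exp_moments "K x" "\<eta>0 / 2" "4 * C'" by (rule moments_limit[OF x])
  have "a x \<le> fact 2 * (2 / (\<eta>0 / 2)) ^ 2 * (4 * C')"
    unfolding a_eq[OF x] using m.abs_moment_bound(2)[of 2 2] by simp
  also have "\<dots> = 128 * C' / \<eta>0\<^sup>2" by (simp add: power2_eq_square)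
  also have "\<dots> \<le> C2" unfolding C2_def by (intro divide_right_mono) auto
  finally show ?thesis using a_eq[OF x] by simp
qed

lemma a_lipschitz: "x \<in> S \<Longrightarrow> y \<in> S \<Longrightarrow> \<bar>a x - a y\<bar> \<le> L * norm (x - y)"
proof -
  assume xy: "x \<in> S" "y \<in> S"
  have "\<bar>a x - a y\<bar> = \<bar>(covar K x - covar K y) $ 2 $ 2\<bar>" by (simp add: a_def)
  also have "\<dots> \<le> norm ((covar K x - covar K y) $ 2)" by (rule component_le_norm_cart)
  also have "\<dots> \<le> norm (covar K x - covar K y)" by (rule Finite_Cartesian_Product.norm_nth_le)
  also have "\<dots> \<le> L * norm (x - y)" using lipschitz_onD[OF covar_lipschitz xy] by (simp add: dist_norm)
  finally show ?thesis .
qed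

lemma L_nonneg: "L \<ge> 0" by (rule lipschitz_on_nonneg[OF covar_lipschitz])

lemma laplace_close:
  assumes u: "\<bar>enn2ereal u / ereal N - enn2ereal v\<bar> < ereal \<delta>" and v: "v \<le> ennreal c" and N: "N > 0"
  shows "u < top" "\<bar>enn2real u / N - enn2real v\<bar> < \<delta>"
proof -
  have "v < top" using v ennreal_less_top le_less_trans by blast
  then obtain s where s: "v = ennreal s" "s \<ge> 0" by (cases v) auto
  have "u \<noteq> top"
  proof
    assume "u = top"
    then have "enn2ereal u / ereal N - enn2ereal v = \<infinity>" using N s by (simp add: enn2ereal_ennreal)
    then show False using u by simp
  qed
  then obtain r where r: "u = ennreal r" "r \<ge> 0" by (cases u) auto
  show "u < top" using r by simp
  show "\<bar>enn2real u / N - enn2real v\<bar> < \<delta>" using u r s N by (simp add: enn2ereal_ennreal)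
qed

lemma laplace_eventually_close:
  assumes "\<delta> > 0"
  shows "\<forall>\<^sub>F N in sequentially. N \<ge> 1 \<and> (\<forall>x\<in>I N \<inter> S. \<forall>\<theta>. norm \<theta> \<le> \<eta>0 \<longrightarrow>
     laplace (KN N) x (real N *\<^sub>R \<theta>) < top \<and>
     \<bar>enn2real (laplace (KN N) x (real N *\<^sub>R \<theta>)) / real N - enn2real (laplace K x \<theta>)\<bar> < \<delta>)"
proof -
  have "\<forall>\<^sub>F N in sequentially. (SUP y\<in>I N \<inter> S. SUP \<theta>'\<in>cball 0 \<eta>0.
          \<bar>enn2ereal (laplace (KN N) y (real N *\<^sub>R \<theta>')) / ereal (real N)
             - enn2ereal (laplace K y \<theta>')\<bar>) < ereal \<delta>"
    using assms by (intro order_tendstoD(2)[OF laplace_conv]) (simp add: zero_ereal_def)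
  then show ?thesis
    using eventually_ge_at_top[of 1]
  proof eventually_elim
    case (elim N)
    have "laplace (KN N) x (real N *\<^sub>R \<theta>) < top \<and>
     \<bar>enn2real (laplace (KN N) x (real N *\<^sub>R \<theta>)) / real N - enn2real (laplace K x \<theta>)\<bar> < \<delta>"
      if x: "x \<in> I N \<inter> S" and th: "norm \<theta> \<le> \<eta>0" for x \<theta>
    proof -
      let ?f = "\<lambda>y \<theta>'. \<bar>enn2ereal (laplace (KN N) y (real N *\<^sub>R \<theta>')) / ereal (real N) - enn2ereal (laplace K y \<theta>')\<bar>"
      have "?f x \<theta> \<le> (SUP \<theta>'\<in>cball 0 \<eta>0. ?f x \<theta>')" using th by (intro SUP_upper) auto
      also have "\<dots> \<le> (SUP y\<in>I N \<inter> S. SUP \<theta>'\<in>cball 0 \<eta>0. ?f y \<theta>')" by (rule SUP_upper[OF x])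
      also have "\<dots> < ereal \<delta>" by (rule elim(1))
      finally have "?f x \<theta> < ereal \<delta>" .
      from laplace_close[OF this laplace_bounded] x th elim(2) show ?thesis by simp
    qed
    then show ?case using elim(2) by simp
  qed
qed

text \<open>At \<open>N * \<theta>\<close> the Laplace transform of the process is at most \<open>N * (C' + 1)\<close> once it is within \<open>1\<close> of its limit after division by \<open>N\<close>.\<close>

lemma exp_moments_eventually:
  "\<forall>\<^sub>F N in sequentially. N \<ge> 1 \<and> (\<forall>x\<in>I N \<inter> S. exp_moments (KN N x) (real N * \<eta>0 / 2) (4 * (real N * (C' + 1))))"
  using laplace_eventually_close[of 1, simplified]
proof eventually_elim
  case (elim N)
  then have N: "N \<ge> 1" by simp
  have "exp_moments (KN N x) (real N * \<eta>0 / 2) (4 * (real N * (C' + 1)))" if x: "x \<in> I N \<inter> S" for x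
  proof (rule exp_moments_of_laplace)
    show "sets (KN N x) = sets borel" "finite_measure (KN N x)" using kernelN x by auto
    show "real N * \<eta>0 > 0" using N eta by simp
    show "real N * (C' + 1) \<ge> 0" using C'_nonneg by simp
    fix \<theta> :: "real^2" assume th: "norm \<theta> \<le> real N * \<eta>0"
    define \<theta>' where "\<theta>' = \<theta> /\<^sub>R real N"
    have th': "norm \<theta>' \<le> \<eta>0" "real N *\<^sub>R \<theta>' = \<theta>" using th N by (auto simp: \<theta>'_def field_simps)
    have l: "laplace (KN N) x \<theta> < top" "\<bar>enn2real (laplace (KN N) x \<theta>) / real N - enn2real (laplace K x \<theta>')\<bar> < 1"
      using elim x th' by auto
    have "enn2real (laplace K x \<theta>') \<le> C'"
      using enn2real_mono[OF laplace_bounded[of x \<theta>']] x th' by (auto simp: C'_def max_def enn2real_ennreal split: if_splits)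
        (metis dual_order.trans enn2real_nonneg ennreal_neg enn2real_0 linorder_not_le max.cobounded2 nle_le order_le_less)
    then have "enn2real (laplace (KN N) x \<theta>) / real N \<le> C' + 1" using l(2) by linarith
    then have "enn2real (laplace (KN N) x \<theta>) \<le> real N * (C' + 1)" using N by (simp add: divide_le_eq mult.commute)
    then show "laplace (KN N) x \<theta> \<le> ennreal (real N * (C' + 1))"
      using l(1) ennreal_enn2real[OF l(1)] ennreal_leI by metis
  qed
  then show ?case using N by blast
qed

text \<open>Second differences with step \<open>s\<close> determine the second moments up to an error of order \<open>s\<^sup>2\<close>. The step is chosen first, then
  \<open>N\<close> so large that the transforms at the three points agree up to a small multiple of \<open>s\<^sup>2\<close>.\<close>

lemma second_moment_close:
  assumes "\<delta> > 0"
  shows "\<forall>\<^sub>F N in sequentially. \<forall>x\<in>I N \<inter> S. \<bar>real N * (\<integral>y. (y $ 2)\<^sup>2 \<partial>KN N x) - a x\<bar> \<le> \<delta>"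
proof -
  define cc where "cc = 8 * (4 / \<eta>0) ^ 4 * (C' + 1)"
  have cc: "cc > 0" using C'_nonneg eta by (simp add: cc_def)
  define s where "s = min (\<eta>0 / 4) (sqrt (\<delta> / (4 * cc)))"
  have s: "s > 0" "s \<le> \<eta>0 / 4" using eta cc assms by (auto simp: s_def)
  have s2: "cc * s\<^sup>2 \<le> \<delta> / 4"
  proof -
    have "s\<^sup>2 \<le> (sqrt (\<delta> / (4 * cc)))\<^sup>2" using s by (intro power_mono) (auto simp: s_def)
    also have "\<dots> = \<delta> / (4 * cc)" using assms cc by simp
    finally show ?thesis using cc by (simp add: field_simps)
  qed
  define \<delta>' where "\<delta>' = \<delta> * s\<^sup>2 / 8"
  have d': "\<delta>' > 0" using assms s by (simp add: \<delta>'_def)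
  show ?thesis
    using laplace_eventually_close[OF d'] exp_moments_eventually
  proof eventually_elim
    case (elim N)
    then have N: "N \<ge> 1" by simp
    show ?case
    proof
      fix x assume x: "x \<in> I N \<inter> S"
      interpret k: exp_moments "K x" "\<eta>0 / 2" "4 * C'" using moments_limit x by simp
      interpret n: exp_moments "KN N x" "real N * \<eta>0 / 2" "4 * (real N * (C' + 1))" using elim(2) x by simp
      have lapK: "enn2real (laplace K x (axis 2 w)) = (\<integral>y. exp (w * y $ 2) \<partial>K x)" if "\<bar>w\<bar> \<le> \<eta>0 / 4" for w
        using k.laplace_eq_integral[of "axis 2 w" x] that by (simp add: laplace_def inner_axis' norm_eq_sqrt_inner inner_axis_axis)
      have lapN: "enn2real (laplace (KN N) x (real N *\<^sub>R axis 2 w)) = (\<integral>y. exp (real N * w * y $ 2) \<partial>KN N x)" if "\<bar>w\<bar> \<le> \<eta>0 / 4" for w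
      proof -
        have na: "norm (axis 2 w :: real^2) = \<bar>w\<bar>" by (simp add: norm_eq_sqrt_inner inner_axis_axis)
        have "norm (real N *\<^sub>R axis 2 w :: real^2) = real N * \<bar>w\<bar>" by (simp only: norm_scaleR na abs_of_nat)
        also have "\<dots> \<le> real N * (\<eta>0 / 4)" using that by (intro mult_left_mono) auto
        finally have "norm (real N *\<^sub>R axis 2 w :: real^2) \<le> real N * \<eta>0 / 2 / 2" by simp
        from n.laplace_eq_integral[OF this, of x] show ?thesis by (simp add: laplace_def inner_axis' mult.assoc)
      qed
      have close: "\<bar>(\<integral>y. exp (real N * w * y $ 2) \<partial>KN N x) / real N - (\<integral>y. exp (w * y $ 2) \<partial>K x)\<bar> < \<delta>'" if "\<bar>w\<bar> \<le> \<eta>0 / 4" for w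
      proof -
        have "norm (axis 2 w :: real^2) \<le> \<eta>0" using that by (simp add: norm_eq_sqrt_inner inner_axis_axis)
        then show ?thesis using elim(1) x lapK[OF that] lapN[OF that] by (metis (no_types, lifting))
      qed
      define A1 A2 A0 B1 B2 B0 where "A1 = (\<integral>y. exp (s * y $ 2) \<partial>K x)" and "A2 = (\<integral>y. exp (- s * y $ 2) \<partial>K x)"
        and "A0 = (\<integral>y. (1::real) \<partial>K x)" and "B1 = (\<integral>y. exp (real N * s * y $ 2) \<partial>KN N x)"
        and "B2 = (\<integral>y. exp (- (real N * s) * y $ 2) \<partial>KN N x)" and "B0 = (\<integral>y. (1::real) \<partial>KN N x)"
      define m where "m = (\<integral>y. (y $ 2)\<^sup>2 \<partial>KN N x)"
      have c1: "\<bar>B1 / real N - A1\<bar> < \<delta>'" using close[of s] s by (simp add: B1_def A1_def)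
      have c2: "\<bar>B2 / real N - A2\<bar> < \<delta>'" using close[of "- s"] s by (simp add: B2_def A2_def)
      have c0: "\<bar>B0 / real N - A0\<bar> < \<delta>'" using close[of 0] eta by (simp add: B0_def A0_def)
      have dK: "\<bar>A1 + A2 - 2 * A0 - s\<^sup>2 * a x\<bar> \<le> s\<^sup>2 * (cc * s\<^sup>2)"
      proof -
        have "\<bar>A1 + A2 - 2 * A0 - s\<^sup>2 * a x\<bar> \<le> 2 * s ^ 4 * ((2 / (\<eta>0 / 2)) ^ 4 * (4 * C'))"
          using k.second_difference_laplace[of s] s x unfolding A1_def A2_def A0_def by (simp add: a_eq)
        also have "\<dots> = 8 * (4 / \<eta>0) ^ 4 * C' * s ^ 4" by simp
        also have "\<dots> \<le> cc * s ^ 4" unfolding cc_def using eta s by (intro mult_right_mono mult_left_mono) auto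
        finally show ?thesis by (simp add: power4_eq_xxxx power2_eq_square mult.assoc mult.left_commute)
      qed
      have dN: "\<bar>B1 + B2 - 2 * B0 - (real N * s)\<^sup>2 * m\<bar> \<le> real N * (s\<^sup>2 * (cc * s\<^sup>2))"
      proof -
        have "\<bar>real N * s\<bar> \<le> real N * \<eta>0 / 2 / 2" 
          using mult_left_mono[of s "\<eta>0 / 4" "real N"] s by (simp add: abs_mult)
        from n.second_difference_laplace[OF this]
        have "\<bar>B1 + B2 - 2 * B0 - (real N * s)\<^sup>2 * m\<bar> \<le> 2 * (real N * s) ^ 4 * ((2 / (real N * \<eta>0 / 2)) ^ 4 * (4 * (real N * (C' + 1))))"
          unfolding B1_def B2_def B0_def m_def by simp
        also have "\<dots> = real N * (cc * s ^ 4)"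
          unfolding cc_def using N by (simp add: power_divide power_mult_distrib)
        finally show ?thesis by (simp add: power4_eq_xxxx power2_eq_square mult.assoc mult.left_commute)
      qed
      have dN': "\<bar>B1 / real N + B2 / real N - 2 * (B0 / real N) - s\<^sup>2 * (real N * m)\<bar> \<le> s\<^sup>2 * (cc * s\<^sup>2)"
      proof -
        have "B1 / real N + B2 / real N - 2 * (B0 / real N) - s\<^sup>2 * (real N * m) = (B1 + B2 - 2 * B0 - (real N * s)\<^sup>2 * m) / real N"
          using N by (simp add: diff_divide_distrib add_divide_distrib power2_eq_square)
        then have "\<bar>B1 / real N + B2 / real N - 2 * (B0 / real N) - s\<^sup>2 * (real N * m)\<bar> = \<bar>B1 + B2 - 2 * B0 - (real N * s)\<^sup>2 * m\<bar> / real N"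
          by simp
        then show ?thesis using dN N by (simp add: divide_le_eq mult.commute)
      qed
      have "\<bar>s\<^sup>2 * (real N * m) - s\<^sup>2 * a x\<bar> \<le> 2 * (s\<^sup>2 * (cc * s\<^sup>2)) + 4 * \<delta>'"
        using c1 c2 c0 dK dN' by linarith
      also have "\<dots> \<le> 2 * (s\<^sup>2 * (\<delta> / 4)) + 4 * (\<delta> * s\<^sup>2 / 8)"
      proof -
        have "s\<^sup>2 * (cc * s\<^sup>2) \<le> s\<^sup>2 * (\<delta> / 4)" by (rule mult_left_mono[OF s2]) simp
        then show ?thesis unfolding \<delta>'_def by linarith
      qed
      also have "\<dots> = s\<^sup>2 * \<delta>" by simp
      finally have "s\<^sup>2 * \<bar>real N * m - a x\<bar> \<le> s\<^sup>2 * \<delta>"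
        by (simp add: right_diff_distrib[symmetric] abs_mult)
      then show "\<bar>real N * (\<integral>y. (y $ 2)\<^sup>2 \<partial>KN N x) - a x\<bar> \<le> \<delta>" using s by (simp add: m_def)
    qed
  qed
qed

lemma drift_close:
  assumes "\<delta> > 0"
  shows "\<forall>\<^sub>F N in sequentially. \<forall>x\<in>I N \<inter> S. \<bar>(\<integral>y. y $ 1 \<partial>KN N x) - (- \<mu>) * x $ 1\<bar> \<le> \<delta> / sqrt (real N)
     \<and> \<bar>(\<integral>y. y $ 2 \<partial>KN N x) - lam * x $ 2\<bar> \<le> \<delta> / sqrt (real N)"
proof -
  have "\<forall>\<^sub>F N in sequentially. (SUP y\<in>I N \<inter> S. ereal (sqrt (real N) * norm (drift (KN N) y - drift K y))) < ereal \<delta>"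
    using assms by (intro order_tendstoD(2)[OF drift_conv]) (simp add: zero_ereal_def)
  then show ?thesis
    using exp_moments_eventually
  proof eventually_elim
    case (elim N)
    show ?case
    proof
      fix x assume x: "x \<in> I N \<inter> S"
      interpret n: exp_moments "KN N x" "real N * \<eta>0 / 2" "4 * (real N * (C' + 1))" using elim(2) x by simp
      have "ereal (sqrt (real N) * norm (drift (KN N) x - drift K x)) < ereal \<delta>"
        by (rule le_less_trans[OF SUP_upper[OF x] elim(1)])
      then have "norm (drift (KN N) x - drift K x) \<le> \<delta> / sqrt (real N)"
        using elim(2) by (simp add: field_simps)
      then have c: "\<bar>(drift (KN N) x - drift K x) $ i\<bar> \<le> \<delta> / sqrt (real N)" for i
        using component_le_norm_cart[of "drift (KN N) x - drift K x" i] by linarith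
      have dN: "drift (KN N) x $ i = (\<integral>y. y $ i \<partial>KN N x)" for i
        unfolding drift_cong_kernel[of "KN N"] n.drift_eq by (rule n.integral_component)
      have dK: "drift K x $ 1 = - \<mu> * x $ 1" "drift K x $ 2 = lam * x $ 2"
        using linear[of x] x by (simp_all add: matrix_vector_mult_def sum_2 vector_2)
      show "\<bar>(\<integral>y. y $ 1 \<partial>KN N x) - (- \<mu>) * x $ 1\<bar> \<le> \<delta> / sqrt (real N) \<and> \<bar>(\<integral>y. y $ 2 \<partial>KN N x) - lam * x $ 2\<bar> \<le> \<delta> / sqrt (real N)"
        using c[of 1] c[of 2] by (simp add: dN dK)
    qed
  qed
qed

lemma exp_tN: "N \<ge> 1 \<Longrightarrow> exp (z * tN N) = real N powr (z / (2 * (lam + \<mu>)))"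
  by (simp add: tN_def powr_def)

lemma D_pos: "lam + \<mu> > 0" using pos by simp

lemma bet_pos: "bet > 0" using pos by (simp add: bet_def)

lemma bet_le: "bet \<le> \<mu> / (4 * (lam + \<mu>))" "bet \<le> lam / (4 * (lam + \<mu>))" "bet \<le> 1 / 8"
proof -
  show "bet \<le> \<mu> / (4 * (lam + \<mu>))" "bet \<le> lam / (4 * (lam + \<mu>))"
    unfolding bet_def using pos by (auto intro!: divide_right_mono)
  have "2 * min \<mu> lam \<le> lam + \<mu>" by simp
  then show "bet \<le> 1 / 8" unfolding bet_def using pos by (simp add: divide_le_eq)
qed

lemma quarter_less:
  assumes "c > 0"
  shows "c / (4 * (lam + \<mu>)) < c / (2 * (lam + \<mu>))" "2 * (c / (4 * (lam + \<mu>))) < c / (lam + \<mu>)"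
proof -
  define w where "w = c / (lam + \<mu>)"
  have u: "w > 0" using assms D_pos by (simp add: w_def)
  have v: "c / (4 * (lam + \<mu>)) = w / 4" "c / (2 * (lam + \<mu>)) = w / 2"
    unfolding w_def by (simp_all only: divide_divide_eq_left mult.commute)
  show "c / (4 * (lam + \<mu>)) < c / (2 * (lam + \<mu>))" unfolding v using u by linarith
  show "2 * (c / (4 * (lam + \<mu>))) < c / (lam + \<mu>)" unfolding v w_def[symmetric] using u by linarith
qed

lemma powr_minus_half: "N \<ge> 1 \<Longrightarrow> real N powr e / sqrt (real N) = real N powr (e - 1 / 2)"
  by (simp add: powr_diff powr_half_sqrt)

text \<open>At \<open>tN\<close> the quotient \<open>exp (lam * tN N) / sqrt N\<close> is \<open>N\<close> to the power \<open>- \<mu> / (2 * (lam + \<mu>))\<close>, which beats \<open>bet\<close>.\<close>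

lemma rho_tendsto: "rho A \<longlonglongrightarrow> 0"
proof -
  let ?g = "\<lambda>N. 3 * real N powr (- bet) + (exp (lam * A) * real N powr (bet + lam / (2 * (lam + \<mu>)) - 1 / 2)
     + exp (lam * A) / lam * real N powr (lam / (2 * (lam + \<mu>)) - 1 / 2))"
  have k: "lam / (2 * (lam + \<mu>)) - 1 / 2 = - (\<mu> / (2 * (lam + \<mu>)))" using D_pos by (simp add: field_simps)
  have k1: "lam / (2 * (lam + \<mu>)) - 1 / 2 < 0" unfolding k using pos by simp
  have k2: "bet + lam / (2 * (lam + \<mu>)) - 1 / 2 < 0" using bet_le(1) k quarter_less(1)[OF pos(2)] by linarith
  have "?g \<longlonglongrightarrow> 3 * 0 + (exp (lam * A) * 0 + exp (lam * A) / lam * 0)"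
    by (intro tendsto_intros tendsto_nat_powr_neg) (use bet_pos k1 k2 in auto)
  then have "?g \<longlonglongrightarrow> 0" by simp
  moreover have "\<forall>\<^sub>F N in sequentially. ?g N = rho A N"
    using eventually_ge_at_top[of 1]
  proof eventually_elim
    case (elim N)
    let ?e = "lam / (2 * (lam + \<mu>))"
    have "(real N powr bet + 1 / lam) * exp (lam * (tN N + A)) / sqrt (real N)
       = exp (lam * A) * ((real N powr bet * real N powr ?e) / sqrt (real N)) + exp (lam * A) / lam * (real N powr ?e / sqrt (real N))"
    proof -
      have ex: "exp (lam * (tN N + A)) = real N powr ?e * exp (lam * A)"
        using exp_tN[OF elim, of lam] by (simp add: distrib_left exp_add)
      show ?thesis unfolding ex by (simp only: distrib_right add_divide_distrib) (simp add: ac_simps)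
    qed
    also have "real N powr bet * real N powr ?e = real N powr (bet + ?e)" using elim by (simp add: powr_add)
    finally show ?case unfolding rho_def powr_minus_half[OF elim] by simp
  qed
  ultimately show ?thesis by (rule Lim_transform_eventually)
qed

definition bad_bound_at :: "real \<Rightarrow> nat \<Rightarrow> real" where
  "bad_bound_at A N = C2 * exp (2 * \<mu> * (tN N + A)) / (\<mu> * real N * (real N powr (- bet))\<^sup>2) + C2 / (lam * (real N powr bet)\<^sup>2)"

text \<open>At \<open>tN\<close> the quotient \<open>exp (2 * \<mu> * tN N) / N\<close> is \<open>N\<close> to the power \<open>- lam / (lam + \<mu>)\<close>, which beats \<open>2 * bet\<close>.\<close>

lemma bad_bound_at_tendsto: "bad_bound_at A \<longlonglongrightarrow> 0"
proof -
  let ?g = "\<lambda>N. C2 * exp (2 * \<mu> * A) / \<mu> * real N powr (\<mu> / (lam + \<mu>) - 1 + 2 * bet) + C2 / lam * real N powr (- 2 * bet)"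
  have "\<mu> / (lam + \<mu>) - 1 = - (lam / (lam + \<mu>))" using D_pos by (simp add: field_simps)
  moreover have "2 * (lam / (4 * (lam + \<mu>))) < lam / (lam + \<mu>)" by (rule quarter_less(2)[OF pos(1)])
  ultimately have k: "\<mu> / (lam + \<mu>) - 1 + 2 * bet < 0" using bet_le(2) by linarith
  have "?g \<longlonglongrightarrow> C2 * exp (2 * \<mu> * A) / \<mu> * 0 + C2 / lam * 0"
    by (intro tendsto_intros tendsto_nat_powr_neg) (use bet_pos k in auto)
  then have "?g \<longlonglongrightarrow> 0" by simp
  moreover have "\<forall>\<^sub>F N in sequentially. ?g N = bad_bound_at A N"
    using eventually_ge_at_top[of 1]
  proof eventually_elim
    case (elim N)
    have N: "real N > 0" using elim by simp
    have e: "exp (2 * \<mu> * (tN N + A)) = exp (2 * \<mu> * A) * real N powr (\<mu> / (lam + \<mu>))"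
    proof -
      have "2 * \<mu> / (2 * (lam + \<mu>)) = \<mu> / (lam + \<mu>)" by (rule mult_divide_mult_cancel_left) simp
      then have "exp (2 * \<mu> * tN N) = real N powr (\<mu> / (lam + \<mu>))" using exp_tN[OF elim, of "2 * \<mu>"] by simp
      then show ?thesis unfolding distrib_left[of "2 * \<mu>"] exp_add by simp
    qed
    have sq: "(real N powr z)\<^sup>2 = real N powr (2 * z)" for z
      by (simp add: power2_eq_square powr_add[symmetric])
    have "real N * real N powr (2 * (- bet)) = real N powr (1 - 2 * bet)"
      using N powr_add[of "real N" 1 "- 2 * bet"] by simp
    then have "exp (2 * \<mu> * (tN N + A)) / (\<mu> * real N * (real N powr (- bet))\<^sup>2) = exp (2 * \<mu> * A) / \<mu> * (real N powr (\<mu> / (lam + \<mu>)) / real N powr (1 - 2 * bet))"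
      unfolding e sq by (simp add: mult.assoc)
    also have "real N powr (\<mu> / (lam + \<mu>)) / real N powr (1 - 2 * bet) = real N powr (\<mu> / (lam + \<mu>) - 1 + 2 * bet)"
      by (simp add: powr_diff[symmetric] algebra_simps)
    finally have 1: "exp (2 * \<mu> * (tN N + A)) / (\<mu> * real N * (real N powr (- bet))\<^sup>2) = exp (2 * \<mu> * A) / \<mu> * real N powr (\<mu> / (lam + \<mu>) - 1 + 2 * bet)" .
    have 2: "1 / (real N powr bet)\<^sup>2 = real N powr (- 2 * bet)" unfolding sq by (simp add: powr_minus_divide)
    have "bad_bound_at A N = C2 * (exp (2 * \<mu> * (tN N + A)) / (\<mu> * real N * (real N powr (- bet))\<^sup>2)) + C2 / lam * (1 / (real N powr bet)\<^sup>2)"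
      by (simp add: bad_bound_at_def)
    then show ?case unfolding 1 2 by simp
  qed
  ultimately show ?thesis by (rule Lim_transform_eventually)
qed

lemma tN_at_top: "filterlim tN at_top sequentially"
proof -
  have "filterlim (\<lambda>N. ln (real N)) at_top sequentially"
    by (rule filterlim_compose[OF ln_at_top filterlim_real_sequentially])
  then show ?thesis unfolding tN_def using D_pos
    by (intro filterlim_tendsto_pos_mult_at_top[OF tendsto_const]) auto
qed

lemma drift_error_eventually_small: "\<forall>\<^sub>F N in sequentially. exp (\<mu> * (tN N + A)) / (\<mu> * sqrt (real N)) \<le> real N powr (- bet)"
proof -
  have k: "\<mu> / (2 * (lam + \<mu>)) - 1 / 2 = - (lam / (2 * (lam + \<mu>)))" using D_pos by (simp add: field_simps)
  have "lam / (4 * (lam + \<mu>)) < lam / (2 * (lam + \<mu>))" by (rule quarter_less(1)[OF pos(1)])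
  then have "\<mu> / (2 * (lam + \<mu>)) - 1 / 2 + bet < 0" using bet_le(2) k by linarith
  then have "(\<lambda>N. exp (\<mu> * A) / \<mu> * real N powr (\<mu> / (2 * (lam + \<mu>)) - 1 / 2 + bet)) \<longlonglongrightarrow> exp (\<mu> * A) / \<mu> * 0"
    by (intro tendsto_intros tendsto_nat_powr_neg)
  then have "\<forall>\<^sub>F N in sequentially. exp (\<mu> * A) / \<mu> * real N powr (\<mu> / (2 * (lam + \<mu>)) - 1 / 2 + bet) < 1"
    by (rule order_tendstoD(2)) simp
  then show ?thesis
    using eventually_ge_at_top[of 1]
  proof eventually_elim
    case (elim N)
    let ?e = "\<mu> / (2 * (lam + \<mu>))"
    have "exp (\<mu> * (tN N + A)) / (\<mu> * sqrt (real N)) = exp (\<mu> * A) / \<mu> * (real N powr ?e / sqrt (real N))"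
      using exp_tN[OF elim(2), of \<mu>] by (simp add: distrib_left exp_add)
    also have "\<dots> = (exp (\<mu> * A) / \<mu> * real N powr (?e - 1 / 2 + bet)) * real N powr (- bet)"
      unfolding powr_minus_half[OF elim(2)] by (simp add: powr_add[symmetric])
    also have "\<dots> \<le> 1 * real N powr (- bet)" using elim(1) by (intro mult_right_mono) auto
    finally show ?case by simp
  qed
qed

lemma scaled_process_eventually:
  assumes A: "A \<ge> 0" and \<delta>: "0 < \<delta>" "\<delta> \<le> 1"
  shows "\<forall>\<^sub>F N in sequentially. scaled_process (M N) (J N) (Y N) (I N) (KN N) x0 (X N) S a (real N) lam \<mu>
     (4 * (real N * (C' + 1))) C2 C3 \<delta> \<delta> L (real N powr (- bet)) (real N powr bet) (tN N + A) (rho A N)"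
proof -
  have "\<forall>\<^sub>F N in sequentially. rho A N < \<epsilon>" by (rule order_tendstoD(2)[OF rho_tendsto nbhd(1)])
  then show ?thesis
    using exp_moments_eventually second_moment_close[OF \<delta>(1)] drift_close[OF \<delta>(1)] drift_error_eventually_small[of A]
  proof eventually_elim
    case (elim N)
    have N: "N \<ge> 1" using elim(2) by simp
    then have N1: "real N \<ge> 1" by simp
    have n: "exp_moments (KN N x) (real N * \<eta>0 / 2) (4 * (real N * (C' + 1)))" if "x \<in> S" "x \<in> I N" for x
      using elim(2) that by blast
    have tN0: "tN N \<ge> 0" using N D_pos by (simp add: tN_def)
    show ?case
    proof (rule scaled_process.intro[OF paths scaled_process_axioms.intro])
      show "measure (KN N x) UNIV \<le> 4 * (real N * (C' + 1))" if "x \<in> S" "x \<in> I N" for x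
        by (rule exp_moments.mass_le[OF n[OF that]])
      show "integrable (KN N x) (\<lambda>y. y $ i)" if "x \<in> S" "x \<in> I N" for x i
        by (rule exp_moments.integrable_component[OF n[OF that]])
      show "integrable (KN N x) (\<lambda>y. (y $ i)\<^sup>2)" if "x \<in> S" "x \<in> I N" for x i
        using exp_moments.abs_moment_bound(1)[OF n[OF that], of i 2] by simp
      show "integrable (KN N x) (\<lambda>y. \<bar>y $ i\<bar> ^ 3)" if "x \<in> S" "x \<in> I N" for x i
        by (rule exp_moments.abs_moment_bound(1)[OF n[OF that]])
      show "(\<integral>y. (y $ i)\<^sup>2 \<partial>KN N x) \<le> C2 / real N" if "x \<in> S" "x \<in> I N" for x i
      proof -
        have "(\<integral>y. (y $ i)\<^sup>2 \<partial>KN N x) \<le> fact 2 * (2 / (real N * \<eta>0 / 2)) ^ 2 * (4 * (real N * (C' + 1)))"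
          using exp_moments.abs_moment_bound(2)[OF n[OF that], of i 2] by simp
        also have "\<dots> = C2 / real N" using N by (simp add: C2_def power2_eq_square)
        finally show ?thesis .
      qed
      show "(\<integral>y. \<bar>y $ i\<bar> ^ 3 \<partial>KN N x) \<le> C3 / (real N)\<^sup>2" if "x \<in> S" "x \<in> I N" for x i
      proof -
        have "(\<integral>y. \<bar>y $ i\<bar> ^ 3 \<partial>KN N x) \<le> fact 3 * (2 / (real N * \<eta>0 / 2)) ^ 3 * (4 * (real N * (C' + 1)))"
          by (rule exp_moments.abs_moment_bound(2)[OF n[OF that], of i 3])
        also have "\<dots> = C3 / (real N)\<^sup>2" using N by (simp add: C3_def power2_eq_square power3_eq_cube fact_numeral)
        finally show ?thesis .
      qed
      show "ball (exp (- \<mu> * r) *\<^sub>R x0) (rho A N) \<subseteq> S" if "r \<ge> 0" for r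
        using nbhd(2)[OF that] elim(1) by (auto simp: subset_iff)
      show "\<delta> * exp (\<mu> * (tN N + A)) / (\<mu> * sqrt (real N)) \<le> real N powr (- bet)"
      proof -
        have "\<delta> * (exp (\<mu> * (tN N + A)) / (\<mu> * sqrt (real N))) \<le> 1 * (exp (\<mu> * (tN N + A)) / (\<mu> * sqrt (real N)))"
          using \<delta> pos by (intro mult_right_mono) auto
        then show ?thesis using elim(5) by simp
      qed
      show "2 * real N powr (- bet) + (real N powr bet + \<delta> / lam) * exp (lam * (tN N + A)) / sqrt (real N) < rho A N"
      proof -
        have "(real N powr bet + \<delta> / lam) * exp (lam * (tN N + A)) / sqrt (real N) \<le> (real N powr bet + 1 / lam) * exp (lam * (tN N + A)) / sqrt (real N)"
          using \<delta> pos by (intro divide_right_mono mult_right_mono add_left_mono) auto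
        moreover have "real N powr (- bet) > 0" using N by simp
        ultimately show ?thesis unfolding rho_def by linarith
      qed
      show "0 < real N powr (- bet)" "0 < real N powr bet" using N by simp_all
      show "0 \<le> 4 * (real N * (C' + 1))" using C'_nonneg by simp
      show "0 \<le> tN N + A" using tN0 A by simp
      show "\<bar>real N * (\<integral>y. (y $ 2)\<^sup>2 \<partial>KN N x) - a x\<bar> \<le> \<delta>" if "x \<in> S" "x \<in> I N" for x
        using elim(3) that by blast
      show "\<bar>(\<integral>y. y $ 1 \<partial>KN N x) - (- \<mu>) * x $ 1\<bar> \<le> \<delta> / sqrt (real N)" if "x \<in> S" "x \<in> I N" for x
        using elim(4) that by blast
      show "\<bar>(\<integral>y. y $ 2 \<partial>KN N x) - lam * x $ 2\<bar> \<le> \<delta> / sqrt (real N)" if "x \<in> S" "x \<in> I N" for x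
        using elim(4) that by blast
      show "\<bar>a x - a y\<bar> \<le> L * norm (x - y)" if "x \<in> S" "y \<in> S" for x y by (rule a_lipschitz[OF that])
      show "0 \<le> a x \<and> a x \<le> C2" if "x \<in> S" for x by (rule a_bounds[OF that])
    qed (use N1 S pos C2_nonneg C3_nonneg \<delta> L_nonneg start in auto)
  qed
qed

end

section \<open>The deterministic crossing and convergence in law\<close>

text \<open>The curve \<open>(exp (- mu * \<tau>) * p0, exp (lam * \<tau>) * U)\<close> has slope \<open>al\<close> in absolute value at \<open>\<tau> = c U\<close>. For \<open>U\<close> in the annulus,
  some point of a fine finite grid lies just after \<open>c U\<close>, where the slope exceeds \<open>al\<close> with a uniform margin. Conversely the
  perturbed curve is still flat before \<open>c U - \<delta>1\<close>. The distance from the origin is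
  uniformly continuous on a compact box that contains all parameters.\<close>

lemma crossing_geometry:
  fixes p0 :: real
  assumes pos: "lam > 0" "mu > 0" and p0: "p0 \<noteq> 0" and al: "al > 0" and R: "R > 1" and \<delta>: "\<delta> > 0"
  defines "c \<equiv> \<lambda>z. 1 / (lam + mu) * ln (\<bar>p0\<bar> * al / \<bar>z\<bar>)"
  obtains A G \<delta>1 \<eta> \<zeta> where "A > 0" "finite G" "G \<subseteq> {- A..A}" "A \<in> G" "0 < \<eta>" "\<eta> < \<bar>p0\<bar>" "\<zeta> > 0"
    "\<And>U. 1 / R \<le> \<bar>U\<bar> \<Longrightarrow> \<bar>U\<bar> \<le> R \<Longrightarrow>
       \<exists>g\<in>G. g \<le> c U + \<delta>1 \<and> al * (\<bar>p0\<bar> + \<eta>) * exp (- (lam + mu) * g) \<le> \<bar>U\<bar> - \<zeta>"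
    "\<And>U \<tau> p u. 1 / R \<le> \<bar>U\<bar> \<Longrightarrow> \<bar>U\<bar> \<le> R \<Longrightarrow> \<bar>p - p0\<bar> \<le> \<eta> \<Longrightarrow> \<bar>u - U\<bar> \<le> \<zeta> \<Longrightarrow>
       al * \<bar>p\<bar> * exp (- (lam + mu) * \<tau>) \<le> \<bar>u\<bar> \<Longrightarrow> \<tau> \<le> c U + \<delta>1 \<Longrightarrow>
       \<bar>\<tau> - c U\<bar> \<le> \<delta> \<and>
       \<bar>sqrt ((exp (- mu * \<tau>) * p)\<^sup>2 + (exp (lam * \<tau>) * u)\<^sup>2) - sqrt ((exp (- mu * c U) * p0)\<^sup>2 + (exp (lam * c U) * U)\<^sup>2)\<bar> \<le> \<delta>"
proof -
  let ?D = "lam + mu"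
  have D: "?D > 0" using pos by simp
  define Ac where "Ac = (\<bar>ln (\<bar>p0\<bar> * al)\<bar> + ln R) / ?D"
  have k: "\<bar>p0\<bar> * al > 0" using p0 al by simp
  have cb: "\<bar>c U\<bar> \<le> Ac" if "1 / R \<le> \<bar>U\<bar>" "\<bar>U\<bar> \<le> R" for U
  proof -
    have U: "\<bar>U\<bar> > 0" using that R by (smt (verit) divide_pos_pos)
    have "ln (1 / R) \<le> ln \<bar>U\<bar>" "ln \<bar>U\<bar> \<le> ln R" using that U R by simp_all
    then have "\<bar>ln \<bar>U\<bar>\<bar> \<le> ln R" using R by (simp add: ln_div)
    moreover have "ln (\<bar>p0\<bar> * al / \<bar>U\<bar>) = ln (\<bar>p0\<bar> * al) - ln \<bar>U\<bar>" using U k ln_div[of "\<bar>p0\<bar> * al" "\<bar>U\<bar>"] p0 al by simp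
    ultimately have "\<bar>ln (\<bar>p0\<bar> * al / \<bar>U\<bar>)\<bar> \<le> \<bar>ln (\<bar>p0\<bar> * al)\<bar> + ln R" by linarith
    then have "\<bar>ln (\<bar>p0\<bar> * al / \<bar>U\<bar>)\<bar> / ?D \<le> Ac" unfolding Ac_def using D by (intro divide_right_mono) auto
    then show ?thesis using D by (simp add: c_def abs_mult)
  qed
  have Ac0: "Ac \<ge> 0" using R D by (simp add: Ac_def)
  have ec: "exp (- ?D * c U) * (\<bar>p0\<bar> * al) = \<bar>U\<bar>" if "\<bar>U\<bar> > 0" for U
  proof -
    have "?D * c U = ln (\<bar>p0\<bar> * al / \<bar>U\<bar>)" using D by (simp add: c_def)
    then have "- ?D * c U = - ln (\<bar>p0\<bar> * al / \<bar>U\<bar>)" by (simp only: mult_minus_left)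
    then have "exp (- ?D * c U) = inverse (\<bar>p0\<bar> * al / \<bar>U\<bar>)"
      using that k by (simp add: exp_minus)
    then show ?thesis using p0 al by (simp only: inverse_divide nonzero_eq_divide_eq mult_eq_0_iff) simp
  qed
  define F where "F = (\<lambda>(\<tau>, p, u :: real). sqrt ((exp (- mu * \<tau>) * p)\<^sup>2 + (exp (lam * \<tau>) * u)\<^sup>2))"
  define Bx where "Bx = {- Ac - 1..Ac + 1} \<times> ({- \<bar>p0\<bar> - 1..\<bar>p0\<bar> + 1} \<times> {- R - 1..R + 1})"
  have "uniformly_continuous_on Bx F"
    unfolding F_def Bx_def case_prod_beta
    by (intro compact_uniformly_continuous continuous_intros compact_Times compact_Icc)
  then obtain d0 where d0: "d0 > 0" "\<And>x y. x \<in> Bx \<Longrightarrow> y \<in> Bx \<Longrightarrow> dist y x < d0 \<Longrightarrow> dist (F y) (F x) < \<delta>"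
    unfolding uniformly_continuous_on_def using \<delta> by blast
  define \<delta>1 where "\<delta>1 = Min {\<delta>, d0 / 4, 1}"
  have d1: "\<delta>1 > 0" "\<delta>1 \<le> \<delta>" "\<delta>1 \<le> d0 / 4" "\<delta>1 \<le> 1" using \<delta> d0 by (auto simp: \<delta>1_def)
  \<comment> \<open>A delay by \<open>\<delta>1 / 2\<close> changes the ratio of the coordinates by at least the factor \<open>1 + x\<close>. Relative errors \<open>y\<close> in both
    coordinates are outweighed by this factor when \<open>1 + y \<le> (1 - y) * (1 + x)\<close>.\<close>
  define x where "x = ?D * \<delta>1 / 2"
  have x: "x > 0" using D d1 by (simp add: x_def)
  define y where "y = Min {x / (2 + x), 1 / 2, 1 / (\<bar>p0\<bar> + 1), d0 / (4 * (\<bar>p0\<bar> + 1)), d0 / 4}"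
  have y: "y > 0" "y \<le> x / (2 + x)" "y \<le> 1 / 2" "y \<le> 1 / (\<bar>p0\<bar> + 1)" "y \<le> d0 / (4 * (\<bar>p0\<bar> + 1))" "y \<le> d0 / 4"
  proof -
    show "y > 0" unfolding y_def using x d0(1) by (subst Min_gr_iff) (auto intro!: divide_pos_pos mult_pos_pos add_nonneg_pos)
  qed (unfold y_def, (rule Min_le, simp, simp)+)
  define \<eta> where "\<eta> = \<bar>p0\<bar> * y"
  \<comment> \<open>On the annulus this absolute error is a relative error of at most \<open>y\<close>.\<close>
  define \<zeta> where "\<zeta> = y / R"
  have eta: "0 < \<eta>" "\<eta> < \<bar>p0\<bar>" "\<eta> \<le> 1" "\<eta> \<le> d0 / 4"
  proof -
    show "0 < \<eta>" using y p0 by (simp add: \<eta>_def)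
    have "\<eta> \<le> \<bar>p0\<bar> * (1 / 2)" unfolding \<eta>_def using y by (intro mult_left_mono) auto
    then show "\<eta> < \<bar>p0\<bar>" using p0 by simp
    have "\<eta> \<le> (\<bar>p0\<bar> + 1) * y" unfolding \<eta>_def using y by (intro mult_right_mono) auto
    also have "\<dots> \<le> 1" using y(4) by (simp add: field_simps)
    finally show "\<eta> \<le> 1" .
    have "\<eta> \<le> (\<bar>p0\<bar> + 1) * y" unfolding \<eta>_def using y by (intro mult_right_mono) auto
    also have "\<dots> \<le> d0 / 4" using y(5) by (simp add: field_simps)
    finally show "\<eta> \<le> d0 / 4" .
  qed
  have zeta: "\<zeta> > 0" "\<zeta> \<le> y" "\<zeta> * R = y"
    using y R by (auto simp: \<zeta>_def divide_le_eq)
  have xy: "1 + y \<le> (1 - y) * (1 + x)"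
  proof -
    have "y * (2 + x) \<le> x" using y(2) x by (simp add: le_divide_eq)
    then show ?thesis by (simp add: algebra_simps)
  qed
  have zU: "\<zeta> \<le> y * \<bar>U\<bar>" if "1 / R \<le> \<bar>U\<bar>" for U
    using mult_left_mono[OF that, of y] y by (simp add: \<zeta>_def)
  define A where "A = Ac + 2"
  define Kn where "Kn = nat \<lceil>2 * A / (\<delta>1 / 2)\<rceil>"
  define G where "G = insert A ({- A..A} \<inter> (\<lambda>k::nat. - A + real k * (\<delta>1 / 2)) ` {..Kn})"
  have upper: "\<exists>g\<in>G. g \<le> c U + \<delta>1 \<and> al * (\<bar>p0\<bar> + \<eta>) * exp (- ?D * g) \<le> \<bar>U\<bar> - \<zeta>"
    if U1: "1 / R \<le> \<bar>U\<bar>" and U2: "\<bar>U\<bar> \<le> R" for U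
  proof -
    have U: "\<bar>U\<bar> > 0" using U1 R by (smt (verit) divide_pos_pos)
    have cU: "\<bar>c U\<bar> \<le> Ac" by (rule cb[OF U1 U2])
    define k where "k = nat \<lceil>(c U + \<delta>1 / 2 + A) / (\<delta>1 / 2)\<rceil>"
    have nn: "(c U + \<delta>1 / 2 + A) / (\<delta>1 / 2) \<ge> 0" using cU d1 by (auto simp: A_def)
    have k1: "real k \<ge> (c U + \<delta>1 / 2 + A) / (\<delta>1 / 2)" "real k < (c U + \<delta>1 / 2 + A) / (\<delta>1 / 2) + 1"
      unfolding k_def using nn by linarith+
    define g where "g = - A + real k * (\<delta>1 / 2)"
    have g1: "g \<ge> c U + \<delta>1 / 2" using mult_right_mono[OF k1(1), of "\<delta>1 / 2"] d1 by (simp add: g_def)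
    have g2: "g < c U + \<delta>1"
    proof -
      have "real k * (\<delta>1 / 2) < ((c U + \<delta>1 / 2 + A) / (\<delta>1 / 2) + 1) * (\<delta>1 / 2)"
        using k1(2) d1 by (intro mult_strict_right_mono) auto
      also have "\<dots> = c U + \<delta>1 + A" using d1 by (simp add: field_simps)
      finally show ?thesis by (simp add: g_def)
    qed
    have gA: "- A \<le> g" "g \<le> A" using g1 g2 cU d1 by (auto simp: A_def)
    have "(c U + \<delta>1 / 2 + A) / (\<delta>1 / 2) \<le> 2 * A / (\<delta>1 / 2)"
      using cU d1 by (intro divide_right_mono) (auto simp: A_def)
    then have "k \<le> Kn" unfolding k_def Kn_def by (intro nat_mono ceiling_mono)
    then have gG: "g \<in> G" using gA by (auto simp: G_def g_def)
    have "- ?D * g \<le> - ?D * (c U + \<delta>1 / 2)" using g1 D by (intro mult_left_mono_neg) auto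
    then have "exp (- ?D * g) \<le> exp (- ?D * (c U + \<delta>1 / 2))" by simp
    also have "- ?D * (c U + \<delta>1 / 2) = - ?D * c U - x" by (simp add: x_def field_simps)
    also have "exp (- ?D * c U - x) = exp (- ?D * c U) / exp x" by (rule exp_diff)
    also have "\<dots> \<le> exp (- ?D * c U) / (1 + x)" using x exp_ge_add_one_self[of x] by (intro divide_left_mono mult_pos_pos) (auto simp: add_pos_pos)
    finally have e: "exp (- ?D * g) \<le> exp (- ?D * c U) / (1 + x)" .
    have "al * (\<bar>p0\<bar> + \<eta>) * exp (- ?D * g) \<le> al * (\<bar>p0\<bar> + \<eta>) * (exp (- ?D * c U) / (1 + x))"
      using e al eta by (intro mult_left_mono) auto
    also have "\<dots> = (1 + y) / (1 + x) * (exp (- ?D * c U) * (\<bar>p0\<bar> * al))"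
      by (simp add: \<eta>_def algebra_simps)
    also have "\<dots> = (1 + y) / (1 + x) * \<bar>U\<bar>" by (simp only: ec[OF U])
    also have "\<dots> \<le> (1 - y) * \<bar>U\<bar>" using xy x by (intro mult_right_mono) (auto simp: divide_le_eq)
    also have "\<dots> \<le> \<bar>U\<bar> - \<zeta>" using zU[OF U1] by (simp add: algebra_simps)
    finally show ?thesis using gG g2 by (intro bexI[of _ g]) auto
  qed
  have lower: "\<bar>\<tau> - c U\<bar> \<le> \<delta> \<and>
       \<bar>sqrt ((exp (- mu * \<tau>) * p)\<^sup>2 + (exp (lam * \<tau>) * u)\<^sup>2) - sqrt ((exp (- mu * c U) * p0)\<^sup>2 + (exp (lam * c U) * U)\<^sup>2)\<bar> \<le> \<delta>"
    if U1: "1 / R \<le> \<bar>U\<bar>" and U2: "\<bar>U\<bar> \<le> R" and p: "\<bar>p - p0\<bar> \<le> \<eta>" and u: "\<bar>u - U\<bar> \<le> \<zeta>"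
      and cr: "al * \<bar>p\<bar> * exp (- ?D * \<tau>) \<le> \<bar>u\<bar>" and le: "\<tau> \<le> c U + \<delta>1" for U \<tau> p u
  proof -
    have U: "\<bar>U\<bar> > 0" using U1 R by (smt (verit) divide_pos_pos)
    have cU: "\<bar>c U\<bar> \<le> Ac" by (rule cb[OF U1 U2])
    have ge: "\<tau> \<ge> c U - \<delta>1"
    proof (rule ccontr)
      assume "\<not> \<tau> \<ge> c U - \<delta>1"
      then have "- ?D * (c U - \<delta>1) < - ?D * \<tau>" using D by (intro mult_strict_left_mono_neg) auto
      then have e0: "exp (- ?D * (c U - \<delta>1)) < exp (- ?D * \<tau>)" by simp
      have "- ?D * (c U - \<delta>1) = - ?D * c U + 2 * x" by (simp add: x_def algebra_simps)
      then have e1: "exp (- ?D * c U) * exp (2 * x) < exp (- ?D * \<tau>)" using e0 by (simp only: exp_add)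
      have "1 + x < exp (2 * x)" using x exp_ge_add_one_self[of "2 * x"] by linarith
      then have e2: "exp (- ?D * c U) * (1 + x) < exp (- ?D * \<tau>)"
        using e1 by (intro order.strict_trans[OF mult_strict_left_mono[of "1 + x" "exp (2 * x)" "exp (- ?D * c U)"] e1]) auto
      have pp: "\<bar>p\<bar> \<ge> \<bar>p0\<bar> * (1 - y)" using p by (simp add: \<eta>_def algebra_simps)
      have pos_p: "\<bar>p0\<bar> * (1 - y) > 0" using p0 y by simp
      have "(1 + y) * \<bar>U\<bar> \<le> (1 - y) * (1 + x) * \<bar>U\<bar>" using xy by (intro mult_right_mono) auto
      also have "\<dots> = al * (\<bar>p0\<bar> * (1 - y)) * (exp (- ?D * c U) * (1 + x))"
        unfolding ec[OF U, symmetric] by (simp add: ac_simps)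
      also have "\<dots> < al * (\<bar>p0\<bar> * (1 - y)) * exp (- ?D * \<tau>)"
        using e2 by (intro mult_strict_left_mono mult_pos_pos[OF al pos_p])
      also have "\<dots> \<le> al * \<bar>p\<bar> * exp (- ?D * \<tau>)" using pp al by (intro mult_right_mono mult_left_mono) auto
      also have "\<dots> \<le> \<bar>U\<bar> + \<zeta>" using cr u by linarith
      also have "\<dots> \<le> (1 + y) * \<bar>U\<bar>" using zU[OF U1] by (simp add: algebra_simps)
      finally show False by simp
    qed
    have tc: "\<bar>\<tau> - c U\<bar> \<le> \<delta>1" using ge le by linarith
    have in1: "(\<tau>, p, u) \<in> Bx"
      using tc cU d1 p eta u zeta y U2 by (auto simp: Bx_def abs_le_iff)
    have in2: "(c U, p0, U) \<in> Bx" using cU U2 by (auto simp: Bx_def)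
    have "dist (\<tau>, p, u) (c U, p0, U) \<le> \<bar>\<tau> - c U\<bar> + (\<bar>p - p0\<bar> + \<bar>u - U\<bar>)"
    proof -
      have s: "sqrt (a\<^sup>2 + b\<^sup>2) \<le> \<bar>a\<bar> + \<bar>b\<bar>" for a b :: real by (rule sqrt_sum_squares_le_sum_abs)
      have "dist (\<tau>, p, u) (c U, p0, U) \<le> \<bar>dist \<tau> (c U)\<bar> + \<bar>dist (p, u) (p0, U)\<bar>"
        unfolding dist_Pair_Pair[of \<tau>] by (rule s)
      moreover have "dist (p, u) (p0, U) \<le> \<bar>dist p p0\<bar> + \<bar>dist u U\<bar>"
        unfolding dist_Pair_Pair by (rule s)
      ultimately show ?thesis by (simp add: dist_real_def)
    qed
    also have "\<dots> < d0" using tc p u d1 eta zeta y d0 by linarith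
    finally have "dist (F (\<tau>, p, u)) (F (c U, p0, U)) < \<delta>" by (rule d0(2)[OF in2 in1])
    then show ?thesis using tc d1 by (simp add: F_def dist_real_def)
  qed
  show ?thesis
  proof (rule that[of A G \<eta> \<zeta> \<delta>1])
    show "A > 0" using Ac0 by (simp add: A_def)
    then show "G \<subseteq> {- A..A}" by (auto simp: G_def)
  qed (use eta zeta upper lower in \<open>auto simp: G_def\<close>)
qed

text \<open>The values of \<open>g\<close> on the annulus are bounded, and \<open>h\<close> is uniformly continuous on bounded intervals.\<close>

lemma uniform_on_annulus:
  fixes h g :: "real \<Rightarrow> real"
  assumes h: "continuous_on UNIV h" and g: "continuous_on (- {0}) g" and R: "R > 1" and e: "e > 0"
  obtains \<delta> where "\<delta> > 0" "\<And>U v. 1 / R \<le> \<bar>U\<bar> \<Longrightarrow> \<bar>U\<bar> \<le> R \<Longrightarrow> \<bar>v - g U\<bar> \<le> \<delta> \<Longrightarrow> \<bar>h v - h (g U)\<bar> \<le> e"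
proof -
  define A where "A = {U. 1 / R \<le> \<bar>U\<bar> \<and> \<bar>U\<bar> \<le> R}"
  have "A = {- R..R} - {- (1 / R)<..<1 / R}" by (auto simp: A_def)
  then have "compact A" by (simp add: compact_diff)
  moreover have "continuous_on A g" using R by (intro continuous_on_subset[OF g]) (auto simp: A_def)
  ultimately have "bounded (g ` A)" by (intro compact_imp_bounded compact_continuous_image)
  then obtain b where b: "\<And>U. U \<in> A \<Longrightarrow> \<bar>g U\<bar> \<le> b" by (auto simp: bounded_iff)
  have "uniformly_continuous_on {- b - 1..b + 1} h"
    by (intro compact_uniformly_continuous continuous_on_subset[OF h]) auto
  then obtain d where d: "d > 0" "\<And>x y. x \<in> {- b - 1..b + 1} \<Longrightarrow> y \<in> {- b - 1..b + 1} \<Longrightarrow> dist y x < d \<Longrightarrow> dist (h y) (h x) < e"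
    unfolding uniformly_continuous_on_def using e by blast
  show ?thesis
  proof (rule that[of "min (d / 2) 1"])
    show "min (d / 2) 1 > 0" using d by simp
    fix U v assume "1 / R \<le> \<bar>U\<bar>" "\<bar>U\<bar> \<le> R" "\<bar>v - g U\<bar> \<le> min (d / 2) 1"
    then have "U \<in> A" "\<bar>v - g U\<bar> \<le> d / 2" "\<bar>v - g U\<bar> \<le> 1" by (auto simp: A_def)
    then have "dist (h v) (h (g U)) < e" using b[of U] d(1) by (intro d(2)) (auto simp: dist_real_def abs_le_iff)
    then show "\<bar>h v - h (g U)\<bar> \<le> e" by (simp add: dist_real_def)
  qed
qed

text \<open>The function \<open>g\<close> may fail to be continuous at \<open>0\<close>, which has mass \<open>0\<close> under the limit law, so the expectation of
  \<open>g (U N)\<close> converges to that of \<open>g Z\<close>. The approximation of \<open>F\<close> by \<open>g (U N)\<close> is needed on an annulus only: for large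
  \<open>R\<close> the limit law gives little mass to the complement, which is a continuity set as there are no atoms.\<close>

lemma converging_together:
  fixes M :: "nat \<Rightarrow> 'w measure" and P :: "'v measure" and F :: "nat \<Rightarrow> 'w \<Rightarrow> real" and U :: "nat \<Rightarrow> 'w \<Rightarrow> real"
    and g :: "real \<Rightarrow> real" and Z :: "'v \<Rightarrow> real"
  assumes M: "\<And>N. prob_space (M N)" and P: "prob_space P"
    and U [measurable]: "\<And>N. U N \<in> borel_measurable (M N)" and Z [measurable]: "Z \<in> borel_measurable P"
    and weak: "weak_conv_m (\<lambda>N. distr (M N) borel (U N)) (distr P borel Z)"
    and atomless: "\<And>z. emeasure (distr P borel Z) {z} = 0"
    and F [measurable]: "\<And>N. F N \<in> borel_measurable (M N)" and F_bd: "\<And>N \<omega>. \<bar>F N \<omega>\<bar> \<le> b"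
    and g [measurable]: "g \<in> borel_measurable borel" and g_bd: "\<And>z. \<bar>g z\<bar> \<le> b" and g_cont: "\<And>z. z \<noteq> 0 \<Longrightarrow> isCont g z"
    and close: "\<And>R e. R > 1 \<Longrightarrow> e > 0 \<Longrightarrow> \<forall>\<^sub>F N in sequentially. \<exists>E\<in>sets (M N). measure (M N) E \<le> e \<and>
       (\<forall>\<omega>\<in>space (M N) - E. 1 / R \<le> \<bar>U N \<omega>\<bar> \<longrightarrow> \<bar>U N \<omega>\<bar> \<le> R \<longrightarrow> \<bar>F N \<omega> - g (U N \<omega>)\<bar> \<le> e)"
  shows "(\<lambda>N. \<integral>\<omega>. F N \<omega> \<partial>M N) \<longlonglongrightarrow> (\<integral>\<omega>. g (Z \<omega>) \<partial>P)"
proof -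
  let ?Q = "distr P borel Z"
  have rd: "real_distribution (distr (M N) borel (U N))" for N
    using M U by (simp add: real_distribution_def real_distribution_axioms_def prob_space.prob_space_distr)
  have rd': "real_distribution ?Q"
    using P Z by (simp add: real_distribution_def real_distribution_axioms_def prob_space.prob_space_distr)
  interpret Q: real_distribution ?Q by (rule rd')
  have b0: "b \<ge> 0" using g_bd[of 0] by linarith
  have null: "emeasure ?Q A = 0" if "finite A" for A
  proof -
    have "A \<in> null_sets ?Q"
      using that
    proof induction
      case (insert x A)
      have "{x} \<in> null_sets ?Q" using atomless by (auto simp: null_sets_def)
      then show ?case using null_sets.Un[OF _ insert(3), of "{x}"] by simp
    qed simp
    then show ?thesis by auto
  qed
  have 1: "(\<lambda>N. \<integral>\<omega>. g (U N \<omega>) \<partial>M N) \<longlonglongrightarrow> (\<integral>\<omega>. g (Z \<omega>) \<partial>P)"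
  proof -
    have "?Q {x. \<not> isCont g x} = 0"
    proof -
      have "{x. \<not> isCont g x} \<subseteq> {0}" using g_cont by auto
      then show ?thesis using null finite_subset by blast
    qed
    from weak_conv_imp_bdd_ae_continuous_conv[OF rd rd' weak this, of b] g_bd
    show ?thesis by (simp add: integral_distr)
  qed
  have "(\<lambda>N. (\<integral>\<omega>. F N \<omega> \<partial>M N) - (\<integral>\<omega>. g (U N \<omega>) \<partial>M N)) \<longlonglongrightarrow> 0"
  proof (rule LIMSEQ_I)
    fix r :: real assume r: "r > 0"
    \<comment> \<open>The error below is at most \<open>e * (1 + 4 * b)\<close>.\<close>
    define e where "e = r / (2 + 6 * b)"
    have e: "e > 0" using r b0 by (simp add: e_def)
    let ?A = "\<lambda>R. {z. \<bar>z\<bar> < 1 / R \<or> \<bar>z\<bar> > (R::real)}"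
    have "\<exists>R>1. measure ?Q (?A R) < e"
    proof -
      let ?B = "\<lambda>n. ?A (real n + 2)"
      have "(\<lambda>n. measure ?Q (?B n)) \<longlonglongrightarrow> measure ?Q (\<Inter>n. ?B n)"
      proof (rule Q.finite_Lim_measure_decseq)
        have "open (?B n)" for n by (intro open_Collect_disj open_Collect_less continuous_intros)
        then show "range ?B \<subseteq> sets ?Q" by auto
        show "decseq ?B"
        proof (rule decseq_SucI, rule subsetI)
          fix n z assume z: "z \<in> ?B (Suc n)"
          have "1 / (real (Suc n) + 2) \<le> 1 / (real n + 2)" by (intro divide_left_mono) auto
          then show "z \<in> ?B n" using z by auto
        qed
      qed
      moreover have "(\<Inter>n. ?B n) \<subseteq> {0}"
      proof
        fix z assume z: "z \<in> (\<Inter>n. ?B n)"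
        show "z \<in> {0}"
        proof (rule ccontr)
          assume "z \<notin> {0}"
          then have z0: "\<bar>z\<bar> > 0" by simp
          obtain n where n: "real n > max \<bar>z\<bar> (1 / \<bar>z\<bar>)" using reals_Archimedean2 by blast
          then have "1 / \<bar>z\<bar> < real n + 2" by simp
          then have "1 / (real n + 2) < \<bar>z\<bar>" using z0 by (simp add: field_simps)
          moreover have "\<bar>z\<bar> < real n + 2" using n by simp
          moreover have "z \<in> ?B n" using z by blast
          ultimately show False by auto
        qed
      qed
      then have "measure ?Q (\<Inter>n. ?B n) = 0"
        using null[of "\<Inter>n. ?B n"] finite_subset by (auto simp: Q.emeasure_eq_measure)
      ultimately have "(\<lambda>n. measure ?Q (?B n)) \<longlonglongrightarrow> 0" by simp
      then have "\<forall>\<^sub>F n in sequentially. measure ?Q (?B n) < e" by (rule order_tendstoD(2)) (rule e)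
      then obtain n where "measure ?Q (?B n) < e" by (auto simp: eventually_sequentially)
      then show ?thesis by (intro exI[of _ "real n + 2"]) auto
    qed
    then obtain R where R: "R > 1" "measure ?Q (?A R) < e" by blast
    have Aopen: "open (?A R)" by (intro open_Collect_disj open_Collect_less continuous_intros)
    then have Am [measurable]: "?A R \<in> sets borel" by simp
    have fr: "?Q (frontier (?A R)) = 0"
    proof -
      have "closed {z. \<bar>z\<bar> \<le> 1 / R \<or> \<bar>z\<bar> \<ge> R}"
        by (intro closed_Collect_disj closed_Collect_le continuous_intros)
      then have "closure (?A R) \<subseteq> {z. \<bar>z\<bar> \<le> 1 / R \<or> \<bar>z\<bar> \<ge> R}" by (intro closure_minimal) auto
      then have "frontier (?A R) \<subseteq> {z. \<bar>z\<bar> \<le> 1 / R \<or> \<bar>z\<bar> \<ge> R} - ?A R"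
        using Aopen by (auto simp: frontier_def interior_open)
      also have "\<dots> \<subseteq> {1 / R, - (1 / R), R, - R}" by (auto simp: abs_if split: if_splits)
      finally show ?thesis using null finite_subset by blast
    qed
    have "(\<lambda>N. measure (distr (M N) borel (U N)) (?A R)) \<longlonglongrightarrow> measure ?Q (?A R)"
      by (rule weak_conv_imp_continuity_set_conv[OF rd rd' weak Am fr])
    then have "\<forall>\<^sub>F N in sequentially. measure (distr (M N) borel (U N)) (?A R) < e"
      by (rule order_tendstoD(2)) (rule R(2))
    then have "\<forall>\<^sub>F N in sequentially. norm ((\<integral>\<omega>. F N \<omega> \<partial>M N) - (\<integral>\<omega>. g (U N \<omega>) \<partial>M N) - 0) < r"
      using close[OF R(1) e]
    proof eventually_elim
      case (elim N)
      interpret prob_space "M N" by (rule M)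
      from elim(2) obtain E where E [measurable]: "E \<in> sets (M N)" "measure (M N) E \<le> e"
        and cl: "\<And>\<omega>. \<omega> \<in> space (M N) \<Longrightarrow> \<omega> \<notin> E \<Longrightarrow> 1 / R \<le> \<bar>U N \<omega>\<bar> \<Longrightarrow> \<bar>U N \<omega>\<bar> \<le> R \<Longrightarrow> \<bar>F N \<omega> - g (U N \<omega>)\<bar> \<le> e"
        by blast
      let ?V = "{\<omega>\<in>space (M N). U N \<omega> \<in> ?A R}"
      have V [measurable]: "?V \<in> sets (M N)" by measurable
      have Vp: "measure (M N) ?V < e"
      proof -
        have "measure (distr (M N) borel (U N)) (?A R) = measure (M N) (U N -` ?A R \<inter> space (M N))" by (rule measure_distr) auto
        also have "U N -` ?A R \<inter> space (M N) = ?V" by auto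
        finally show ?thesis using elim(1) by simp
      qed
      have iF: "integrable (M N) (F N)" by (rule integrable_const_bound[where B=b]) (use F_bd in auto)
      have iG: "integrable (M N) (\<lambda>\<omega>. g (U N \<omega>))" by (rule integrable_const_bound[where B=b]) (use g_bd in auto)
      have "\<bar>(\<integral>\<omega>. F N \<omega> \<partial>M N) - (\<integral>\<omega>. g (U N \<omega>) \<partial>M N)\<bar> = \<bar>\<integral>\<omega>. F N \<omega> - g (U N \<omega>) \<partial>M N\<bar>"
        using iF iG by simp
      also have "\<dots> \<le> (\<integral>\<omega>. \<bar>F N \<omega> - g (U N \<omega>)\<bar> \<partial>M N)" by (rule integral_abs_bound)
      also have "\<dots> \<le> (\<integral>\<omega>. e + 2 * b * (indicator E \<omega> + indicator ?V \<omega>) \<partial>M N)"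
      proof (rule integral_mono)
        fix \<omega> assume w: "\<omega> \<in> space (M N)"
        have "\<bar>F N \<omega> - g (U N \<omega>)\<bar> \<le> 2 * b" using F_bd[of N \<omega>] g_bd[of "U N \<omega>"] by linarith
        then show "\<bar>F N \<omega> - g (U N \<omega>)\<bar> \<le> e + 2 * b * (indicator E \<omega> + indicator ?V \<omega>)"
          using cl[OF w] w e b0 by (cases "\<omega> \<in> E"; cases "\<omega> \<in> ?V") (auto simp: not_less)
      qed (use iF iG in \<open>auto intro!: Bochner_Integration.integrable_add integrable_real_indicator simp: emeasure_eq_measure\<close>)
      also have "\<dots> = e + 2 * b * (measure (M N) E + measure (M N) ?V)"
        by (subst Bochner_Integration.integral_add) (auto intro!: Bochner_Integration.integrable_add integrable_real_indicator simp: emeasure_eq_measure prob_space)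
      also have "\<dots> \<le> e + 2 * b * (e + e)"
        using E(2) Vp b0 by (intro add_left_mono mult_left_mono) auto
      also have "\<dots> = e * (1 + 4 * b)" by (simp add: algebra_simps)
      also have "\<dots> < e * (2 + 6 * b)" using e b0 by (intro mult_strict_left_mono) auto
      also have "\<dots> = r" using b0 by (simp add: e_def)
      finally show ?case by simp
    qed
    then show "\<exists>no. \<forall>n\<ge>no. norm ((\<integral>\<omega>. F n \<omega> \<partial>M n) - (\<integral>\<omega>. g (U n \<omega>) \<partial>M n) - 0) < r"
      by (simp add: eventually_sequentially)
  qed
  from tendsto_add[OF this 1] show ?thesis by simp
qed

section \<open>The Gaussian limit\<close>

context fluid_limit
begin

definition U0 :: "nat \<Rightarrow> 'w \<Rightarrow> real" where
  "U0 N = compensated_sum.total (J N) (Y N) (KN N) 2 (\<lambda>s. sqrt (real N) * exp (- lam * s))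
    (\<lambda>s. - (sqrt (real N) / lam) * exp (- lam * s)) (\<lambda>n \<omega>. \<forall>k\<le>n. Y N k \<omega> \<in> S) 0 (tN N)"

text \<open>Jumps need not be integrable for small \<open>N\<close>, so measurability of \<open>U0\<close> is available only for large \<open>N\<close>. The convention for
  the other values of \<open>N\<close> does not influence the limit.\<close>

definition U :: "nat \<Rightarrow> 'w \<Rightarrow> real" where
  "U N = (if U0 N \<in> borel_measurable (M N) then U0 N else (\<lambda>_. 0))"

lemma U_measurable [measurable]: "U N \<in> borel_measurable (M N)"
  by (simp add: U_def)

lemma prob_space_M: "prob_space (M N)"
proof -
  interpret p: jump_paths "M N" "J N" "Y N" "I N" "KN N" x0 "X N" by (rule paths)
  show ?thesis by unfold_locales
qed

lemma path_in: "s \<ge> 0 \<Longrightarrow> exp (- \<mu> * s) *\<^sub>R x0 \<in> S"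
  using nbhd(2)[of s] nbhd(1) centre_in_ball by blast

lemma tN_nonneg: "tN N \<ge> 0"
  using D_pos by (cases N) (auto simp: tN_def)

text \<open>The rate of the limiting variance; the maximum extends it continuously to negative times.\<close>

definition w :: "real \<Rightarrow> real" where
  "w s = exp (- 2 * lam * s) * a (exp (- \<mu> * max s 0) *\<^sub>R x0)"

lemma w_bounds: "0 \<le> w s" "w s \<le> C2 * exp (- 2 * lam * s)"
proof -
  have "0 \<le> a (exp (- \<mu> * max s 0) *\<^sub>R x0)" "a (exp (- \<mu> * max s 0) *\<^sub>R x0) \<le> C2"
    using a_bounds[OF path_in[of "max s 0"]] by simp_all
  then show "0 \<le> w s" "w s \<le> C2 * exp (- 2 * lam * s)"
    unfolding w_def by (simp_all add: mult.commute mult_right_mono)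
qed

lemma w_continuous: "continuous_on UNIV w"
proof -
  have "continuous_on S (covar K)" by (rule lipschitz_on_continuous_on[OF covar_lipschitz])
  then have "continuous_on S a" unfolding a_def[abs_def] by (intro continuous_intros)
  then have "continuous_on UNIV (\<lambda>s. a (exp (- \<mu> * max s 0) *\<^sub>R x0))"
  proof (rule continuous_on_compose2)
    show "(\<lambda>s. exp (- \<mu> * max s 0) *\<^sub>R x0) ` UNIV \<subseteq> S" by (intro image_subsetI path_in) simp
  qed (intro continuous_intros)
  then show ?thesis unfolding w_def[abs_def] by (intro continuous_intros)
qed

lemma w_measurable [measurable]: "w \<in> borel_measurable borel"
  by (rule borel_measurable_continuous_onI[OF w_continuous])

lemma exp_decay: "k > 0 \<Longrightarrow> ((\<lambda>s::real. exp (- k * s)) \<longlongrightarrow> 0) at_top"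
  by (rule filterlim_compose[OF exp_at_bot])
    (rule filterlim_tendsto_neg_mult_at_bot[OF tendsto_const _ filterlim_ident], simp)

lemma w_integrable: "set_integrable lborel {0..} w"
  unfolding set_integrable_def
proof (rule integrableI_bounded)
  have "(\<integral>\<^sup>+ s. ennreal (norm (indicat_real {0..} s *\<^sub>R w s)) \<partial>lborel)
     \<le> (\<integral>\<^sup>+ s. ennreal (C2 * exp (- (2 * lam) * s)) * indicator {0..} s \<partial>lborel)"
    using w_bounds by (intro nn_integral_mono) (auto split: split_indicator intro!: ennreal_leI)
  also have "\<dots> = ennreal (0 - (- (C2 / (2 * lam)) * exp (- (2 * lam) * 0)))"
  proof (rule nn_integral_FTC_atLeast)
    show "((\<lambda>s. - (C2 / (2 * lam)) * exp (- (2 * lam) * s)) has_real_derivative C2 * exp (- (2 * lam) * s)) (at s)" for s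
      using pos by (auto intro!: derivative_eq_intros)
    have "((\<lambda>s. - (C2 / (2 * lam)) * exp (- (2 * lam) * s)) \<longlongrightarrow> - (C2 / (2 * lam)) * 0) at_top"
      using pos by (intro tendsto_intros exp_decay) auto
    then show "((\<lambda>s. - (C2 / (2 * lam)) * exp (- (2 * lam) * s)) \<longlongrightarrow> 0) at_top" by simp
  qed (use C2_nonneg in auto)
  also have "\<dots> < \<infinity>" by simp
  finally show "(\<integral>\<^sup>+ s. ennreal (norm (indicat_real {0..} s *\<^sub>R w s)) \<partial>lborel) < \<infinity>" .
qed measurable

definition V :: "real \<Rightarrow> real" where "V s = integral {0..s} w"

definition sig2 :: real where "sig2 = (LINT s:{0..}|lborel. w s)"

lemma V_mono: "s \<le> t \<Longrightarrow> V s \<le> V t"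
  unfolding V_def using w_bounds(1)
  by (intro integral_subset_le integrable_continuous_real continuous_on_subset[OF w_continuous]) auto

lemma V_measurable [measurable]: "V \<in> borel_measurable borel"
  by (rule borel_measurable_mono) (auto intro: monoI V_mono)

lemma V_tendsto: "(V \<longlongrightarrow> sig2) at_top"
proof -
  have "((\<lambda>t. LINT s:{0..t}|lborel. w s) \<longlongrightarrow> sig2) at_top"
    unfolding sig2_def by (rule tendsto_set_lebesgue_integral_at_top[OF _ w_integrable]) simp
  moreover have "(LINT s:{0..t}|lborel. w s) = V t" for t
    unfolding V_def
    by (rule set_borel_integral_eq_integral(2), rule set_integrable_subset[OF w_integrable]) auto
  ultimately show ?thesis by simp
qed

lemma V_le: "V s \<le> sig2"
  by (rule tendsto_lowerbound[OF V_tendsto])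
    (auto intro: eventually_mono[OF eventually_ge_at_top[of s]] V_mono)

lemma sig2_nonneg: "sig2 \<ge> 0"
  using V_le[of 0] by (simp add: V_def)

text \<open>The estimate of the characteristic function tends to a multiple of the tolerance \<open>\<delta>\<close> of drift and variance as \<open>N\<close> grows,
  and \<open>\<delta>\<close> is arbitrary.\<close>

lemma char_U_tendsto: "(\<lambda>N. char (distr (M N) borel (U N)) \<kappa>) \<longlonglongrightarrow> of_real (exp (- (\<kappa>\<^sup>2 / 2 * sig2)))"
proof -
  let ?h = "\<lambda>N. char (distr (M N) borel (U N)) \<kappa>"
  let ?E = "\<lambda>N. exp (\<kappa>\<^sup>2 / 2 * V (tN N))"
  have Vlim: "(\<lambda>N. V (tN N)) \<longlonglongrightarrow> sig2" by (rule filterlim_compose[OF V_tendsto tN_at_top])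
  have "(\<lambda>N. of_real (?E N) * ?h N) \<longlonglongrightarrow> 1"
  proof (rule tendstoI)
    fix e :: real assume e: "e > 0"
    define q where "q = exp (\<kappa>\<^sup>2 / 2 * sig2) * \<kappa>\<^sup>2 / (2 * lam)"
    have q: "q \<ge> 0" using pos by (simp add: q_def)
    \<comment> \<open>The limit of the error bound is \<open>q * \<delta>\<close>.\<close>
    define \<delta> where "\<delta> = min 1 (e / (q + 1))"
    have d: "0 < \<delta>" "\<delta> \<le> 1" using e q by (auto simp: \<delta>_def)
    have "q * \<delta> \<le> q * (e / (q + 1))" using q by (intro mult_left_mono) (auto simp: \<delta>_def)
    also have "\<dots> < e" using q e by (simp add: field_simps)
    finally have qd: "q * \<delta> < e" .
    let ?B = "\<lambda>N. 2 * (exp (\<kappa>\<^sup>2 / 2 * sig2) * (\<kappa>\<^sup>2 / 2 * ((\<delta> + L * rho 0 N + 2 * C2 * bad_bound_at 0 N) / (2 * lam))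
       + \<bar>\<kappa>\<bar> ^ 3 * C3 / (18 * lam) * real N powr (- (1 / 2))))"
    have "?B \<longlonglongrightarrow> 2 * (exp (\<kappa>\<^sup>2 / 2 * sig2) * (\<kappa>\<^sup>2 / 2 * ((\<delta> + L * 0 + 2 * C2 * 0) / (2 * lam))
       + \<bar>\<kappa>\<bar> ^ 3 * C3 / (18 * lam) * 0))"
      using pos by (intro tendsto_intros rho_tendsto bad_bound_at_tendsto tendsto_nat_powr_neg) auto
    also have "2 * (exp (\<kappa>\<^sup>2 / 2 * sig2) * (\<kappa>\<^sup>2 / 2 * ((\<delta> + L * 0 + 2 * C2 * 0) / (2 * lam))
       + \<bar>\<kappa>\<bar> ^ 3 * C3 / (18 * lam) * 0)) = q * \<delta>" by (simp add: q_def)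
    finally have "\<forall>\<^sub>F N in sequentially. ?B N < e" by (rule order_tendstoD(2)[OF _ qd])
    then show "\<forall>\<^sub>F N in sequentially. dist (of_real (?E N) * ?h N) 1 < e"
      using scaled_process_eventually[OF order_refl d]
    proof eventually_elim
      case (elim N)
      interpret s: scaled_process "M N" "J N" "Y N" "I N" "KN N" x0 "X N" S a "real N" lam \<mu>
        "4 * (real N * (C' + 1))" C2 C3 \<delta> \<delta> L "real N powr (- bet)" "real N powr bet" "tN N + 0" "rho 0 N"
        by (rule elim(2))
      have UN: "U N = s.mart 2 s.BS 0 (tN N)"
        using s.mart_measurable[OF s.admissible_in_S order_refl tN_nonneg, of 2] unfolding s.mart_2_eq U_def U0_def by simp
      have variance_tol: "s.variance_tol = \<delta> + L * rho 0 N + 2 * C2 * bad_bound_at 0 N"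
        by (simp only: s.variance_tol_def s.bad_bound_def bad_bound_at_def)
      have "cmod (of_real (?E N) * ?h N - 1)
         \<le> 2 * (exp (\<kappa>\<^sup>2 / 2 * sig2) * (\<kappa>\<^sup>2 / 2 * (s.variance_tol / (2 * lam)) + \<bar>\<kappa>\<bar> ^ 3 * C3 / (18 * lam * sqrt (real N))))"
        unfolding UN
      proof (rule s.characteristic_estimate[where w=w])
        show "(V has_real_derivative w r) (at r within {0..tN N})" if "r \<in> {0..tN N}" for r
          unfolding V_def[abs_def]
          by (rule integral_has_real_derivative[OF continuous_on_subset[OF w_continuous] that]) simp
        show "continuous_on {0..tN N} w" by (rule continuous_on_subset[OF w_continuous]) simp
        show "w r = exp (- 2 * lam * r) * a (exp (- \<mu> * r) *\<^sub>R x0)" if "0 < r" for r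
          using that by (simp add: w_def)
        show "V \<in> borel_measurable borel" by (rule V_measurable)
        show "V 0 = 0" by (simp add: V_def)
      qed (use tN_nonneg V_le in auto)
      also have "\<bar>\<kappa>\<bar> ^ 3 * C3 / (18 * lam * sqrt (real N)) = \<bar>\<kappa>\<bar> ^ 3 * C3 / (18 * lam) * real N powr (- (1 / 2))"
        by (simp add: powr_minus_divide powr_half_sqrt)
      finally show ?case using elim(1) unfolding variance_tol dist_norm by linarith
    qed
  qed
  then have "(\<lambda>N. (of_real (?E N) * ?h N) / of_real (?E N)) \<longlonglongrightarrow> 1 / of_real (exp (\<kappa>\<^sup>2 / 2 * sig2))"
    by (intro tendsto_intros Vlim) auto
  moreover have "1 / of_real (exp (\<kappa>\<^sup>2 / 2 * sig2)) = (of_real (exp (- (\<kappa>\<^sup>2 / 2 * sig2))) :: complex)"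
    by (simp only: exp_minus of_real_inverse inverse_eq_divide of_real_divide of_real_1)
  ultimately show ?thesis by simp
qed

end

lemma char_normal:
  assumes P: "prob_space P" and s: "s > 0"
    and Z: "distributed P lborel Z (\<lambda>z. ennreal (normal_density 0 s z))"
  shows "char (distr P borel Z) \<kappa> = of_real (exp (- (\<kappa>\<^sup>2 / 2 * s\<^sup>2)))"
proof -
  interpret prob_space P by (rule P)
  have Zm [measurable]: "Z \<in> borel_measurable P" using distributed_measurable[OF Z] by simp
  have d: "distributed P lborel (\<lambda>x. (Z x - 0) / s) std_normal_density"
    using Z normal_standard_normal_convert[OF s, of Z 0] by simp
  have "char std_normal_distribution (\<kappa> * s) = (CLINT x|P. iexp ((\<kappa> * s) * ((Z x - 0) / s)))"
    unfolding distributed_distr_eq_density[OF d, symmetric] char_def by (rule integral_distr) measurable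
  also have "\<dots> = (CLINT x|P. iexp (\<kappa> * Z x))" using s by simp
  also have "\<dots> = char (distr P borel Z) \<kappa>"
    unfolding char_def by (rule integral_distr[symmetric]) measurable
  finally show ?thesis unfolding char_std_normal_distribution by (simp add: power_mult_distrib)
qed

lemma distributed_lborel_no_atoms:
  assumes "distributed P lborel Z f"
  shows "emeasure (distr P borel Z) {z} = 0"
proof -
  have [measurable]: "f \<in> borel_measurable lborel" by (rule distributed_borel_measurable[OF assms])
  have "distr P borel Z = distr P lborel Z" by (rule distr_cong) auto
  also have "\<dots> = density lborel f" by (rule distributed_distr_eq_density[OF assms])
  also have "emeasure (density lborel f) {z} = (\<integral>\<^sup>+x\<in>{z}. f x \<partial>lborel)" by (rule emeasure_density) auto
  also have "\<dots> = 0" by (rule nn_integral_null_set) auto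
  finally show ?thesis .
qed

context fluid_limit
begin

lemma weak_conv_U:
  assumes P: "prob_space P" and s: "sig2 \<noteq> 0"
    and Z: "distributed P lborel Z (\<lambda>z. ennreal (normal_density 0 (sqrt sig2) z))"
  shows "weak_conv_m (\<lambda>N. distr (M N) borel (U N)) (distr P borel Z)"
proof (rule levy_continuity)
  have Zm: "Z \<in> borel_measurable P" using distributed_measurable[OF Z] by simp
  show "real_distribution (distr (M N) borel (U N))" for N
    by (simp add: real_distribution_def real_distribution_axioms_def prob_space.prob_space_distr[OF prob_space_M])
  show "real_distribution (distr P borel Z)"
    using Zm by (simp add: real_distribution_def real_distribution_axioms_def prob_space.prob_space_distr[OF P])
  show "(\<lambda>N. char (distr (M N) borel (U N)) \<kappa>) \<longlonglongrightarrow> char (distr P borel Z) \<kappa>" for \<kappa>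
    using char_U_tendsto[of \<kappa>] char_normal[OF P _ Z, of \<kappa>] s sig2_nonneg by simp
qed

section \<open>Asymptotics of the crossing\<close>

lemma sqrt_N_eq: "N \<ge> 1 \<Longrightarrow> sqrt (real N) = exp ((lam + \<mu>) * tN N)"
proof -
  assume N: "N \<ge> 1"
  have "(lam + \<mu>) / (2 * (lam + \<mu>)) = 1 / 2" using D_pos by simp
  then have "exp ((lam + \<mu>) * tN N) = real N powr (1 / 2)" using exp_tN[OF N, of "lam + \<mu>"] by (simp only:)
  then show ?thesis by (simp add: powr_half_sqrt)
qed

lemma exp_tN_tendsto: "k > 0 \<Longrightarrow> (\<lambda>N. exp (- k * (tN N + r))) \<longlonglongrightarrow> 0"
proof -
  assume k: "k > 0"
  have "(\<lambda>N. exp (- k * tN N) * exp (- k * r)) \<longlonglongrightarrow> 0 * exp (- k * r)"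
    by (intro tendsto_intros filterlim_compose[OF exp_decay[OF k] tN_at_top])
  then show ?thesis by (simp add: distrib_left exp_add[symmetric])
qed

text \<open>The delay of the crossing of slope \<open>al\<close> after \<open>tN\<close>, if the rescaled second coordinate is \<open>z\<close>.\<close>

definition crossing_shift :: "real \<Rightarrow> real \<Rightarrow> real" where
  "crossing_shift al z = 1 / (lam + \<mu>) * ln (\<bar>x0 $ 1\<bar> * al / \<bar>z\<bar>)"

text \<open>In the time \<open>\<tau> = t - tN\<close> the crossing condition does not depend on \<open>N\<close>, because
  \<open>sqrt N * exp (- (lam + \<mu>) * t) = exp (- (lam + \<mu>) * \<tau>)\<close>. So the bounds at the grid times and at the hitting time
  feed the deterministic \<open>crossing_geometry\<close>, once the tolerances are below its margins.\<close>

lemma hit_asymptotics: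
  assumes theta: "0 < \<theta>" "\<theta> < pi / 2" and R: "R > 1" and \<delta>: "\<delta> > 0" and e: "e > 0"
  shows "\<forall>\<^sub>F N in sequentially. \<exists>E\<in>sets (M N). measure (M N) E \<le> e \<and>
    (\<forall>\<omega>\<in>space (M N) - E. 1 / R \<le> \<bar>U N \<omega>\<bar> \<longrightarrow> \<bar>U N \<omega>\<bar> \<le> R \<longrightarrow>
      (\<exists>\<tau>. hit_time \<theta> (stopped S (\<lambda>t. X N t \<omega>)) = ereal (tN N + \<tau>) \<and> \<bar>\<tau> - crossing_shift \<bar>tan \<theta>\<bar> (U N \<omega>)\<bar> \<le> \<delta> \<and>
        \<bar>real N powr (\<mu> / (2 * (lam + \<mu>))) * norm (value_at (stopped S (\<lambda>t. X N t \<omega>)) (hit_time \<theta> (stopped S (\<lambda>t. X N t \<omega>))))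
         - sqrt ((exp (- \<mu> * crossing_shift \<bar>tan \<theta>\<bar> (U N \<omega>)) * x0 $ 1)\<^sup>2 + (exp (lam * crossing_shift \<bar>tan \<theta>\<bar> (U N \<omega>)) * U N \<omega>)\<^sup>2)\<bar> \<le> \<delta>))"
proof -
  let ?D = "lam + \<mu>"
  define al where "al = \<bar>tan \<theta>\<bar>"
  have al: "al > 0" using tan_gt_zero[of \<theta>] theta by (simp add: al_def)
  obtain A G \<delta>1 \<eta> \<zeta> where A: "A > 0" and G: "finite G" "G \<subseteq> {- A..A}" "A \<in> G"
    and eta: "0 < \<eta>" "\<eta> < \<bar>x0 $ 1\<bar>" and zeta: "\<zeta> > 0"
    and upper: "\<And>u. 1 / R \<le> \<bar>u\<bar> \<Longrightarrow> \<bar>u\<bar> \<le> R \<Longrightarrow>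
       \<exists>g\<in>G. g \<le> crossing_shift al u + \<delta>1 \<and> al * (\<bar>x0 $ 1\<bar> + \<eta>) * exp (- ?D * g) \<le> \<bar>u\<bar> - \<zeta>"
    and lower: "\<And>v \<tau> p u. 1 / R \<le> \<bar>v\<bar> \<Longrightarrow> \<bar>v\<bar> \<le> R \<Longrightarrow> \<bar>p - x0 $ 1\<bar> \<le> \<eta> \<Longrightarrow> \<bar>u - v\<bar> \<le> \<zeta> \<Longrightarrow>
       al * \<bar>p\<bar> * exp (- ?D * \<tau>) \<le> \<bar>u\<bar> \<Longrightarrow> \<tau> \<le> crossing_shift al v + \<delta>1 \<Longrightarrow>
       \<bar>\<tau> - crossing_shift al v\<bar> \<le> \<delta> \<and>
       \<bar>sqrt ((exp (- \<mu> * \<tau>) * p)\<^sup>2 + (exp (lam * \<tau>) * u)\<^sup>2) - sqrt ((exp (- \<mu> * crossing_shift al v) * x0 $ 1)\<^sup>2 + (exp (lam * crossing_shift al v) * v)\<^sup>2)\<bar> \<le> \<delta>"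
    unfolding crossing_shift_def using crossing_geometry[OF pos start(2) al R \<delta>] by metis
  \<comment> \<open>With \<open>z = \<zeta> / 4\<close>, the fluctuation \<open>2 * z\<close> and the drift error \<open>d / lam\<close> together stay below the margin \<open>\<zeta>\<close>.\<close>
  define d where "d = min 1 (lam * \<zeta> / 4)"
  have d: "0 < d" "d \<le> 1" using pos zeta by (auto simp: d_def)
  have "d \<le> lam * \<zeta> / 4" by (simp add: d_def)
  then have dl: "d / lam \<le> \<zeta> / 4" using pos by (simp add: field_simps)
  define z where "z = \<zeta> / 4"
  have z: "z > 0" using zeta by (simp add: z_def)
  let ?pr = "\<lambda>N. real (card G + 1) * bad_bound_at A N + (\<Sum>g\<in>G. C2 / (lam * z\<^sup>2) * exp (- (2 * lam) * (tN N + min g 0)))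
      + C2 / (lam * z\<^sup>2) * exp (- lam * (tN N + 0))"
  have "?pr \<longlonglongrightarrow> real (card G + 1) * 0 + (\<Sum>g\<in>G. C2 / (lam * z\<^sup>2) * 0) + C2 / (lam * z\<^sup>2) * 0"
    by (intro tendsto_intros bad_bound_at_tendsto exp_tN_tendsto) (use pos in auto)
  then have "?pr \<longlonglongrightarrow> 0" by simp
  then have ev1: "\<forall>\<^sub>F N in sequentially. ?pr N < e" by (rule order_tendstoD(2)) (rule e)
  have "(\<lambda>N. 2 * real N powr (- bet)) \<longlonglongrightarrow> 2 * 0"
    using bet_pos by (intro tendsto_intros tendsto_nat_powr_neg) simp
  then have ev2: "\<forall>\<^sub>F N in sequentially. 2 * real N powr (- bet) < \<eta>"
    by (rule order_tendstoD(2)) (use eta in simp)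
  have "(\<lambda>N. real N powr (bet - 1 / 4) + d / lam * real N powr (- 1 / 4)) \<longlonglongrightarrow> 0 + d / lam * 0"
    using bet_le(3) by (intro tendsto_intros tendsto_nat_powr_neg) auto
  then have ev3: "\<forall>\<^sub>F N in sequentially. real N powr (bet - 1 / 4) + d / lam * real N powr (- 1 / 4) < al * (\<bar>x0 $ 1\<bar> - \<eta>)"
    by (rule order_tendstoD(2)) (use al eta in simp)
  have ev4: "\<forall>\<^sub>F N in sequentially. A \<le> tN N"
    using tN_at_top by (simp add: filterlim_at_top)
  show ?thesis
    using ev1 ev2 ev3 ev4 scaled_process_eventually[OF less_imp_le[OF A] d] eventually_ge_at_top[of "1::nat"]
  proof eventually_elim
    case (elim N)
    interpret s: scaled_process "M N" "J N" "Y N" "I N" "KN N" x0 "X N" S a "real N" lam \<mu>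
      "4 * (real N * (C' + 1))" C2 C3 d d L "real N powr (- bet)" "real N powr bet" "tN N + A" "rho A N"
      by (rule elim(5))
    have N: "N \<ge> 1" by (rule elim(6))
    have UN: "s.mart 2 s.BS 0 (tN N) = U N"
      using s.mart_measurable[OF s.admissible_in_S order_refl tN_nonneg, of 2] unfolding s.mart_2_eq U_def U0_def by simp
    have bad_bound: "s.bad_bound = bad_bound_at A N" by (simp add: s.bad_bound_def bad_bound_at_def)
    have kap: "real N powr (\<mu> / (2 * ?D)) = exp (\<mu> * tN N)" by (rule exp_tN[OF N, symmetric])
    have sD: "sqrt (real N) * exp (- ?D * t) = exp (- ?D * (t - tN N))" for t
      unfolding sqrt_N_eq[OF N] exp_add[symmetric] by (simp add: algebra_simps)
    let ?G = "(\<lambda>g. tN N + g) ` G"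
    have st: "abs_slope x0 < ereal al" using start al by (simp add: abs_slope_def)
    \<comment> \<open>The crossing happens after \<open>tN / 2\<close>: at that time the second coordinate would have to exceed its tolerance by a power of \<open>N\<close>.\<close>
    have late: "real N powr bet + d / lam < al * (\<bar>x0 $ 1\<bar> - 2 * real N powr (- bet)) * (sqrt (real N) * exp (- ?D * (tN N / 2)))"
    proof -
      have "- ?D * (tN N / 2 - tN N) = ?D / 2 * tN N" by (simp add: field_simps)
      then have "sqrt (real N) * exp (- ?D * (tN N / 2)) = exp (?D / 2 * tN N)" by (simp only: sD)
      also have "\<dots> = real N powr (?D / 2 / (2 * ?D))" by (rule exp_tN[OF N])
      also have "?D / 2 / (2 * ?D) = 1 / 4" using D_pos by simp
      finally have q: "sqrt (real N) * exp (- ?D * (tN N / 2)) = real N powr (1 / 4)" .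
      have q0: "real N powr (1 / 4) > 0" using N by simp
      have "(real N powr (bet - 1 / 4) + d / lam * real N powr (- 1 / 4)) * real N powr (1 / 4) < al * (\<bar>x0 $ 1\<bar> - \<eta>) * real N powr (1 / 4)"
        using elim(3) q0 by (rule mult_strict_right_mono)
      also have "(real N powr (bet - 1 / 4) + d / lam * real N powr (- 1 / 4)) * real N powr (1 / 4) = real N powr bet + d / lam"
        using N by (simp add: distrib_right powr_add[symmetric] mult.assoc)
      also have "al * (\<bar>x0 $ 1\<bar> - \<eta>) * real N powr (1 / 4) \<le> al * (\<bar>x0 $ 1\<bar> - 2 * real N powr (- bet)) * real N powr (1 / 4)"
        using elim(2) al by (intro mult_right_mono mult_left_mono) auto
      finally show ?thesis unfolding q .
    qed
    obtain E where E: "E \<in> sets (M N)"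
      "measure (M N) E \<le> real (card ?G + 1) * s.bad_bound + (\<Sum>t\<in>?G. C2 * exp (- 2 * lam * min t (tN N)) / (lam * z\<^sup>2)) + C2 * exp (- 2 * lam * (tN N / 2)) / (lam * z\<^sup>2)"
      and E1: "\<And>\<omega> t. \<omega> \<in> space (M N) \<Longrightarrow> \<omega> \<notin> E \<Longrightarrow> t \<in> ?G \<Longrightarrow>
       al * (\<bar>x0 $ 1\<bar> + 2 * real N powr (- bet)) * (sqrt (real N) * exp (- ?D * t)) \<le> \<bar>s.mart 2 s.BS 0 (tN N) \<omega>\<bar> - z - d / lam \<Longrightarrow>
       hit_time \<theta> (s.XS \<omega>) \<le> ereal t"
      and E2: "\<And>\<omega> T. \<omega> \<in> space (M N) \<Longrightarrow> \<omega> \<notin> E \<Longrightarrow> hit_time \<theta> (s.XS \<omega>) = ereal T \<Longrightarrow> T \<le> tN N + A \<Longrightarrow>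
       \<exists>p u. \<bar>p - x0 $ 1\<bar> \<le> 2 * real N powr (- bet) \<and> \<bar>u - s.mart 2 s.BS 0 (tN N) \<omega>\<bar> \<le> 2 * z + d / lam \<and>
         al * \<bar>p\<bar> * (sqrt (real N) * exp (- ?D * T)) \<le> \<bar>u\<bar> \<and>
         value_at (s.XS \<omega>) (hit_time \<theta> (s.XS \<omega>)) $ 1 = exp (- \<mu> * T) * p \<and>
         value_at (s.XS \<omega>) (hit_time \<theta> (s.XS \<omega>)) $ 2 = exp (lam * T) * u / sqrt (real N)"
    proof (rule s.hit_analysis[of al \<theta> ?G "tN N" z "tN N / 2"])
      show "?G \<subseteq> {0..tN N + A}"
      proof
        fix t assume "t \<in> ?G"
        then obtain g where "g \<in> G" "t = tN N + g" by blast
        then show "t \<in> {0..tN N + A}" using G(2) elim(4) by force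
      qed
    qed (use al_def st G A z tN_nonneg[of N] elim(2) eta(2) late in auto)
    have "measure (M N) E \<le> ?pr N"
    proof -
      have c: "card ?G = card G" by (rule card_image) (simp add: inj_on_def)
      have "(\<Sum>t\<in>?G. C2 * exp (- 2 * lam * min t (tN N)) / (lam * z\<^sup>2)) = (\<Sum>g\<in>G. C2 * exp (- 2 * lam * min (tN N + g) (tN N)) / (lam * z\<^sup>2))"
        by (subst sum.reindex) (auto simp: inj_on_def)
      also have "\<dots> = (\<Sum>g\<in>G. C2 / (lam * z\<^sup>2) * exp (- (2 * lam) * (tN N + min g 0)))"
      proof (rule sum.cong[OF refl])
        fix g
        have "min (tN N + g) (tN N) = tN N + min g 0" by simp
        then show "C2 * exp (- 2 * lam * min (tN N + g) (tN N)) / (lam * z\<^sup>2) = C2 / (lam * z\<^sup>2) * exp (- (2 * lam) * (tN N + min g 0))"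
          by simp
      qed
      finally show ?thesis using E(2) unfolding bad_bound c by simp
    qed
    then have Ee: "measure (M N) E \<le> e" using elim(1) by linarith
    have main: "\<exists>\<tau>. hit_time \<theta> (s.XS \<omega>) = ereal (tN N + \<tau>) \<and> \<bar>\<tau> - crossing_shift al (U N \<omega>)\<bar> \<le> \<delta> \<and>
        \<bar>real N powr (\<mu> / (2 * ?D)) * norm (value_at (s.XS \<omega>) (hit_time \<theta> (s.XS \<omega>)))
         - sqrt ((exp (- \<mu> * crossing_shift al (U N \<omega>)) * x0 $ 1)\<^sup>2 + (exp (lam * crossing_shift al (U N \<omega>)) * U N \<omega>)\<^sup>2)\<bar> \<le> \<delta>"
      if w: "\<omega> \<in> space (M N)" "\<omega> \<notin> E" and U1: "1 / R \<le> \<bar>U N \<omega>\<bar>" and U2: "\<bar>U N \<omega>\<bar> \<le> R" for \<omega>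
    proof -
      obtain g where g: "g \<in> G" "g \<le> crossing_shift al (U N \<omega>) + \<delta>1" "al * (\<bar>x0 $ 1\<bar> + \<eta>) * exp (- ?D * g) \<le> \<bar>U N \<omega>\<bar> - \<zeta>"
        using upper[OF U1 U2] by blast
      have "al * (\<bar>x0 $ 1\<bar> + 2 * real N powr (- bet)) * exp (- ?D * g) \<le> al * (\<bar>x0 $ 1\<bar> + \<eta>) * exp (- ?D * g)"
        using elim(2) al by (intro mult_right_mono mult_left_mono) auto
      also have "\<dots> \<le> \<bar>U N \<omega>\<bar> - z - d / lam" using g(3) dl zeta unfolding z_def by linarith
      finally have "al * (\<bar>x0 $ 1\<bar> + 2 * real N powr (- bet)) * (sqrt (real N) * exp (- ?D * (tN N + g))) \<le> \<bar>U N \<omega>\<bar> - z - d / lam"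
        unfolding sD by simp
      then have hT: "hit_time \<theta> (s.XS \<omega>) \<le> ereal (tN N + g)"
        using g(1) by (intro E1[OF w]) (auto simp: UN)
      have "0 \<le> hit_time \<theta> (s.XS \<omega>)" unfolding hit_time_def by (rule INF_greatest) auto
      then obtain Tt where Tt: "hit_time \<theta> (s.XS \<omega>) = ereal Tt"
        using hT by (cases "hit_time \<theta> (s.XS \<omega>)") auto
      have Tg: "Tt \<le> tN N + g" using hT by (simp add: Tt)
      have "g \<le> A" using g(1) G(2) by auto
      then have TA: "Tt \<le> tN N + A" using Tg by linarith
      obtain p u where p: "\<bar>p - x0 $ 1\<bar> \<le> 2 * real N powr (- bet)" and u: "\<bar>u - U N \<omega>\<bar> \<le> 2 * z + d / lam"
        and cr: "al * \<bar>p\<bar> * (sqrt (real N) * exp (- ?D * Tt)) \<le> \<bar>u\<bar>"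
        and v1: "value_at (s.XS \<omega>) (hit_time \<theta> (s.XS \<omega>)) $ 1 = exp (- \<mu> * Tt) * p"
        and v2: "value_at (s.XS \<omega>) (hit_time \<theta> (s.XS \<omega>)) $ 2 = exp (lam * Tt) * u / sqrt (real N)"
        using E2[OF w Tt TA] unfolding UN by blast
      define \<tau> where "\<tau> = Tt - tN N"
      have low: "\<bar>\<tau> - crossing_shift al (U N \<omega>)\<bar> \<le> \<delta> \<and>
       \<bar>sqrt ((exp (- \<mu> * \<tau>) * p)\<^sup>2 + (exp (lam * \<tau>) * u)\<^sup>2) - sqrt ((exp (- \<mu> * crossing_shift al (U N \<omega>)) * x0 $ 1)\<^sup>2 + (exp (lam * crossing_shift al (U N \<omega>)) * U N \<omega>)\<^sup>2)\<bar> \<le> \<delta>"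
      proof (rule lower[OF U1 U2])
        show "\<bar>p - x0 $ 1\<bar> \<le> \<eta>" using p elim(2) by linarith
        show "\<bar>u - U N \<omega>\<bar> \<le> \<zeta>" using u dl zeta unfolding z_def by linarith
        show "al * \<bar>p\<bar> * exp (- ?D * \<tau>) \<le> \<bar>u\<bar>" using cr unfolding sD \<tau>_def .
        show "\<tau> \<le> crossing_shift al (U N \<omega>) + \<delta>1" using Tg g(2) unfolding \<tau>_def by linarith
      qed
      let ?v = "value_at (s.XS \<omega>) (hit_time \<theta> (s.XS \<omega>))"
      have n: "norm ?v = sqrt ((?v $ 1)\<^sup>2 + (?v $ 2)\<^sup>2)"
        by (simp add: norm_vec_def L2_set_def sum_2)
      have k1: "exp (\<mu> * tN N) * (exp (- \<mu> * Tt) * p) = exp (- \<mu> * \<tau>) * p"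
        by (simp add: \<tau>_def exp_add[symmetric] algebra_simps)
      have k2: "exp (\<mu> * tN N) * (exp (lam * Tt) * u / sqrt (real N)) = exp (lam * \<tau>) * u"
      proof -
        have "exp (\<mu> * tN N) * exp (lam * Tt) / exp (?D * tN N) = exp (lam * \<tau>)"
          unfolding exp_add[symmetric] exp_diff[symmetric] by (simp add: \<tau>_def algebra_simps)
        then show ?thesis unfolding sqrt_N_eq[OF N] by (simp add: field_simps)
      qed
      have "exp (\<mu> * tN N) * norm ?v = sqrt ((exp (\<mu> * tN N) * ?v $ 1)\<^sup>2 + (exp (\<mu> * tN N) * ?v $ 2)\<^sup>2)"
        unfolding n by (simp add: power_mult_distrib distrib_left[symmetric] real_sqrt_mult)
      then have "real N powr (\<mu> / (2 * ?D)) * norm ?v = sqrt ((exp (- \<mu> * \<tau>) * p)\<^sup>2 + (exp (lam * \<tau>) * u)\<^sup>2)"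
        unfolding kap v1 v2 k1 k2 .
      then show ?thesis using low by (intro exI[of _ \<tau>]) (simp add: Tt \<tau>_def)
    qed
    show ?case
      using E(1) Ee main unfolding al_def by (intro bexI[of _ E]) auto
  qed
qed

text \<open>At the crossing the second coordinate is \<open>tan \<theta>\<close> times the first in absolute value, so the radius is the first
  coordinate times \<open>sqrt (1 + (tan \<theta>)\<^sup>2) = 1 / cos \<theta>\<close>.\<close>

lemma limit_radius:
  assumes theta: "0 < \<theta>" "\<theta> < pi / 2" and z: "z \<noteq> 0"
  shows "sqrt ((exp (- \<mu> * crossing_shift \<bar>tan \<theta>\<bar> z) * x0 $ 1)\<^sup>2 + (exp (lam * crossing_shift \<bar>tan \<theta>\<bar> z) * z)\<^sup>2)
    = \<bar>1 / cos \<theta>\<bar> * \<bar>tan \<theta>\<bar> powr (- \<mu> / (lam + \<mu>)) * norm x0 powr (lam / (lam + \<mu>)) * \<bar>z\<bar> powr (\<mu> / (lam + \<mu>))"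
proof -
  let ?D = "lam + \<mu>"
  define al q y where "al = \<bar>tan \<theta>\<bar>" and "q = \<bar>x0 $ 1\<bar>" and "y = \<bar>z\<bar>"
  have p: "al > 0" "q > 0" "y > 0" using tan_gt_zero[of \<theta>] theta start z by (simp_all add: al_def q_def y_def)
  have cos: "cos \<theta> > 0" using theta by (intro cos_gt_zero) auto
  have nx: "norm x0 = q" using start by (simp add: norm_vec_def L2_set_def sum_2 q_def)
  define c where "c = crossing_shift al z"
  have Dc: "exp (?D * c) = q * al / y"
  proof -
    have "?D * c = ln (q * al / y)" using D_pos by (simp add: c_def crossing_shift_def q_def y_def)
    then show ?thesis using p by simp
  qed
  have mc: "exp (- \<mu> * c) = (q * al / y) powr (- \<mu> / ?D)"
    using p by (simp add: powr_def c_def crossing_shift_def q_def y_def)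
  have lc: "exp (lam * c) = exp (- \<mu> * c) * (q * al / y)"
    unfolding Dc[symmetric] exp_add[symmetric] by (simp add: algebra_simps)
  have "(exp (- \<mu> * c) * x0 $ 1)\<^sup>2 + (exp (lam * c) * z)\<^sup>2 = (exp (- \<mu> * c) * q)\<^sup>2 * (1 + al\<^sup>2)"
  proof -
    have "(exp (- \<mu> * c) * x0 $ 1)\<^sup>2 = (exp (- \<mu> * c) * q)\<^sup>2" by (simp add: power_mult_distrib q_def)
    moreover have "(exp (lam * c) * z)\<^sup>2 = (exp (lam * c) * y)\<^sup>2" by (simp add: power_mult_distrib y_def)
    moreover have "exp (lam * c) * y = exp (- \<mu> * c) * q * al" unfolding lc using p by simp
    ultimately show ?thesis by (simp add: power_mult_distrib distrib_left)
  qed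
  also have "1 + al\<^sup>2 = (1 / cos \<theta>)\<^sup>2"
    using tan_sec[of \<theta>] cos by (simp add: al_def inverse_eq_divide)
  also have "sqrt ((exp (- \<mu> * c) * q)\<^sup>2 * (1 / cos \<theta>)\<^sup>2) = exp (- \<mu> * c) * q * \<bar>1 / cos \<theta>\<bar>"
    using p by (simp add: real_sqrt_mult abs_mult)
  also have "exp (- \<mu> * c) * q = al powr (- \<mu> / ?D) * q powr (lam / ?D) * y powr (\<mu> / ?D)"
  proof -
    have m1: "exp (- \<mu> * c) = q powr (- \<mu> / ?D) * al powr (- \<mu> / ?D) / y powr (- \<mu> / ?D)"
      unfolding mc using p by (simp add: powr_mult powr_divide)
    have "1 / y powr (- \<mu> / ?D) = y powr (\<mu> / ?D)" by (simp add: powr_minus_divide)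
    moreover have "q powr (- \<mu> / ?D) * q = q powr (lam / ?D)"
    proof -
      have "q powr (- \<mu> / ?D) * q powr 1 = q powr (- \<mu> / ?D + 1)" by (simp only: powr_add)
      also have "- \<mu> / ?D + 1 = lam / ?D" using D_pos by (simp add: field_simps)
      finally show ?thesis using p by simp
    qed
    moreover have "exp (- \<mu> * c) * q = al powr (- \<mu> / ?D) * (q powr (- \<mu> / ?D) * q) * (1 / y powr (- \<mu> / ?D))"
      unfolding m1 by simp
    ultimately show ?thesis by (simp only:)
  qed
  finally show ?thesis unfolding c_def al_def nx y_def by (simp add: ac_simps)
qed

end

section \<open>Hitting time and hitting place\<close>

theorem theorem2p5:
  fixes M :: "nat \<Rightarrow> 'w measure" and X :: "nat \<Rightarrow> real \<Rightarrow> 'w \<Rightarrow> real^2"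
    and I :: "nat \<Rightarrow> (real^2) set" and KN :: "nat \<Rightarrow> real^2 \<Rightarrow> (real^2) measure"
    and S :: "(real^2) set" and K :: "real^2 \<Rightarrow> (real^2) measure"
    and x0 :: "real^2" and \<eta>0 lam \<mu> \<epsilon> C L \<theta> sigma2 :: real
    and P :: "'v measure" and Z :: "'v \<Rightarrow> real"
    and x :: "real \<Rightarrow> real^2" and XS :: "nat \<Rightarrow> 'w \<Rightarrow> real \<Rightarrow> real^2"
    and T :: "nat \<Rightarrow> 'w \<Rightarrow> ereal" and tN :: "nat \<Rightarrow> real" and c :: "'v \<Rightarrow> real"
  assumes process: "\<And>N. pure_jump_markov (M N) (X N) (I N) (KN N) x0"
    and S: "open S" "x0 \<in> S"
    and limit_kernel: "finite_kernel S K"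
    and eta: "\<eta>0 > 0"
    and laplace_bounded: "\<And>y \<theta>'. y \<in> S \<Longrightarrow> norm \<theta>' \<le> \<eta>0 \<Longrightarrow> laplace K y \<theta>' \<le> ennreal C"
    and laplace_conv:
      "(\<lambda>N. SUP y\<in>I N \<inter> S. SUP \<theta>'\<in>cball 0 \<eta>0.
          \<bar>enn2ereal (laplace (KN N) y (real N *\<^sub>R \<theta>')) / ereal (real N)
             - enn2ereal (laplace K y \<theta>')\<bar>) \<longlonglongrightarrow> 0"
    and drift_conv:
      "(\<lambda>N. SUP y\<in>I N \<inter> S. ereal (sqrt (real N) * norm (drift (KN N) y - drift K y))) \<longlonglongrightarrow> 0"
    and covar_lipschitz: "L-lipschitz_on S (covar K)"
    and pos: "lam > 0" "\<mu> > 0"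
    and linear: "\<And>y. y \<in> S \<Longrightarrow> drift K y = vector [vector [-\<mu>, 0], vector [0, lam]] *v y"
    and start: "x0 $ 2 = 0" "x0 $ 1 \<noteq> 0"
    and path: "\<And>t. x t = exp (- \<mu> * t) *\<^sub>R x0"
    and nbhd: "\<epsilon> > 0" "\<And>t. t \<ge> 0 \<Longrightarrow> ball (x t) \<epsilon> \<subseteq> S"
    and sigma2: "sigma2 = (LINT s:{0..}|lborel. exp (- 2 * lam * s) * covar K (x s) $ 2 $ 2)"
      "sigma2 \<noteq> 0"
    and Z: "prob_space P"
      "distributed P lborel Z (\<lambda>z. ennreal (normal_density 0 (sqrt sigma2) z))"
    and theta: "0 < \<theta>" "\<theta> < pi / 2"
    and XS: "\<And>N \<omega>. XS N \<omega> = stopped S (\<lambda>t. X N t \<omega>)"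
    and T: "\<And>N \<omega>. T N \<omega> = hit_time \<theta> (XS N \<omega>)"
    and tN: "\<And>N. tN N = 1 / (2 * (lam + \<mu>)) * ln (real N)"
    and c: "\<And>\<omega>. c \<omega> = 1 / (lam + \<mu>) * ln \<bar>x0 $ 1 * tan \<theta> / Z \<omega>\<bar>"
  shows "converges_in_distribution M (\<lambda>N \<omega>. T N \<omega> - ereal (tN N)) P (\<lambda>\<omega>. ereal (c \<omega>)) \<and>
         converges_in_distribution M
           (\<lambda>N \<omega>. real N powr (\<mu> / (2 * (lam + \<mu>))) * norm (value_at (XS N \<omega>) (T N \<omega>)))
           P
           (\<lambda>\<omega>. \<bar>1 / cos \<theta>\<bar> * \<bar>tan \<theta>\<bar> powr (- \<mu> / (lam + \<mu>)) *
                norm x0 powr (lam / (lam + \<mu>)) * \<bar>Z \<omega>\<bar> powr (\<mu> / (lam + \<mu>)))"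
proof -
  have "\<forall>N. \<exists>p. jump_paths (M N) (fst p) (snd p) (I N) (KN N) x0 (X N)"
  proof
    fix N
    obtain J Y where "jump_paths (M N) J Y (I N) (KN N) x0 (X N)" by (rule pure_jump_markovE[OF process])
    then show "\<exists>p. jump_paths (M N) (fst p) (snd p) (I N) (KN N) x0 (X N)" by (intro exI[of _ "(J, Y)"]) simp
  qed
  then obtain p where p: "\<And>N. jump_paths (M N) (fst (p N)) (snd (p N)) (I N) (KN N) x0 (X N)" by metis
  interpret fl: fluid_limit M X I KN S K x0 \<eta>0 lam \<mu> \<epsilon> C L "\<lambda>N. fst (p N)" "\<lambda>N. snd (p N)"
  proof (rule fluid_limit.intro)
    show "ball (exp (- \<mu> * t) *\<^sub>R x0) \<epsilon> \<subseteq> S" if "0 \<le> t" for t using nbhd(2)[OF that] by (simp add: path)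
  qed (fact p S limit_kernel eta laplace_bounded laplace_conv drift_conv covar_lipschitz pos linear start nbhd(1))+
  have tN_eq: "fl.tN = tN" by (rule ext) (simp add: fl.tN_def tN)
  have sig: "fl.sig2 = sigma2"
    unfolding fl.sig2_def sigma2(1)
    by (rule set_lebesgue_integral_cong) (auto simp: fl.w_def fl.a_def path max_def)
  have Zm [measurable]: "Z \<in> borel_measurable P" using distributed_measurable[OF Z(2)] by simp
  have weak: "weak_conv_m (\<lambda>N. distr (M N) borel (fl.U N)) (distr P borel Z)"
    by (rule fl.weak_conv_U) (use Z sigma2(2) sig in auto)
  note atomless = distributed_lborel_no_atoms[OF Z(2)]
  have Ss: "S \<in> sets borel" using S(1) by simp
  have al: "tan \<theta> > 0" using tan_gt_zero[of \<theta>] theta by simp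
  have st: "abs_slope x0 < ereal \<bar>tan \<theta>\<bar>" using start al by (simp add: abs_slope_def)
  have Tm [measurable]: "T N \<in> borel_measurable (M N)" for N
    using jump_paths.hit_time_measurable[OF p Ss refl st, of N] unfolding T[abs_def] XS .
  have vm [measurable]: "(\<lambda>\<omega>. norm (value_at (XS N \<omega>) (T N \<omega>))) \<in> borel_measurable (M N)" for N
    using jump_paths.norm_value_at_hit_measurable[OF p Ss refl st, of N] unfolding T XS .
  have D: "lam + \<mu> > 0" using pos by simp
  define cz where "cz z = 1 / (lam + \<mu>) * ln \<bar>x0 $ 1 * tan \<theta> / z\<bar>" for z
  define rz where "rz z = \<bar>1 / cos \<theta>\<bar> * \<bar>tan \<theta>\<bar> powr (- \<mu> / (lam + \<mu>)) *
                norm x0 powr (lam / (lam + \<mu>)) * \<bar>z\<bar> powr (\<mu> / (lam + \<mu>))" for z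
  have cz_m [measurable]: "cz \<in> borel_measurable borel" unfolding cz_def[abs_def] by measurable
  have rz_m [measurable]: "rz \<in> borel_measurable borel" unfolding rz_def[abs_def] by measurable
  have cz_cont: "isCont cz z" if "z \<noteq> 0" for z
    unfolding cz_def[abs_def] using that start al by (intro continuous_intros) auto
  have rz_cont: "isCont rz z" if "z \<noteq> 0" for z
    unfolding rz_def[abs_def] using that by (intro continuous_intros) auto
  have on: "continuous_on (- {0}) cz" "continuous_on (- {0}) rz"
    using cz_cont rz_cont by (auto intro!: continuous_at_imp_continuous_on)
  have crossing_shift: "fl.crossing_shift \<bar>tan \<theta>\<bar> z = cz z" for z
    by (simp add: fl.crossing_shift_def cz_def abs_mult abs_divide)
  have close: "\<forall>\<^sub>F N in sequentially. \<exists>E\<in>sets (M N). measure (M N) E \<le> e \<and>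
    (\<forall>\<omega>\<in>space (M N) - E. 1 / R \<le> \<bar>fl.U N \<omega>\<bar> \<longrightarrow> \<bar>fl.U N \<omega>\<bar> \<le> R \<longrightarrow>
      (\<exists>\<tau>. T N \<omega> - ereal (tN N) = ereal \<tau> \<and> \<bar>\<tau> - cz (fl.U N \<omega>)\<bar> \<le> \<delta>) \<and>
        \<bar>real N powr (\<mu> / (2 * (lam + \<mu>))) * norm (value_at (XS N \<omega>) (T N \<omega>)) - rz (fl.U N \<omega>)\<bar> \<le> \<delta>)"
    if R: "R > 1" and "\<delta> > 0" "e > 0" for R \<delta> e
  proof -
    have nz: "u \<noteq> 0" if "1 / R \<le> \<bar>u\<bar>" for u :: real
    proof
      assume "u = 0"
      then have "1 / R \<le> 0" using that by simp
      moreover have "1 / R > 0" using R by simp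
      ultimately show False by simp
    qed
    show ?thesis
      using fl.hit_asymptotics[OF theta that]
    proof eventually_elim
      case (elim N)
      then obtain E where E: "E \<in> sets (M N)" "measure (M N) E \<le> e"
        and main: "\<And>\<omega>. \<omega> \<in> space (M N) \<Longrightarrow> \<omega> \<notin> E \<Longrightarrow> 1 / R \<le> \<bar>fl.U N \<omega>\<bar> \<Longrightarrow> \<bar>fl.U N \<omega>\<bar> \<le> R \<Longrightarrow>
          \<exists>\<tau>. hit_time \<theta> (stopped S (\<lambda>t. X N t \<omega>)) = ereal (fl.tN N + \<tau>) \<and> \<bar>\<tau> - fl.crossing_shift \<bar>tan \<theta>\<bar> (fl.U N \<omega>)\<bar> \<le> \<delta> \<and>
        \<bar>real N powr (\<mu> / (2 * (lam + \<mu>))) * norm (value_at (stopped S (\<lambda>t. X N t \<omega>)) (hit_time \<theta> (stopped S (\<lambda>t. X N t \<omega>))))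
         - sqrt ((exp (- \<mu> * fl.crossing_shift \<bar>tan \<theta>\<bar> (fl.U N \<omega>)) * x0 $ 1)\<^sup>2 + (exp (lam * fl.crossing_shift \<bar>tan \<theta>\<bar> (fl.U N \<omega>)) * fl.U N \<omega>)\<^sup>2)\<bar> \<le> \<delta>"
        by blast
      show ?case
      proof (intro bexI[OF _ E(1)] conjI ballI impI E(2))
        fix \<omega> assume w: "\<omega> \<in> space (M N) - E" and u: "1 / R \<le> \<bar>fl.U N \<omega>\<bar>" "\<bar>fl.U N \<omega>\<bar> \<le> R"
        have "\<omega> \<in> space (M N)" "\<omega> \<notin> E" using w by auto
        from main[OF this u] obtain \<tau> where t: "T N \<omega> = ereal (tN N + \<tau>)" "\<bar>\<tau> - cz (fl.U N \<omega>)\<bar> \<le> \<delta>"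
          "\<bar>real N powr (\<mu> / (2 * (lam + \<mu>))) * norm (value_at (XS N \<omega>) (T N \<omega>)) - rz (fl.U N \<omega>)\<bar> \<le> \<delta>"
          unfolding fl.limit_radius[OF theta nz[OF u(1)]] unfolding tN_eq crossing_shift T XS rz_def by blast
        then show "\<bar>real N powr (\<mu> / (2 * (lam + \<mu>))) * norm (value_at (XS N \<omega>) (T N \<omega>)) - rz (fl.U N \<omega>)\<bar> \<le> \<delta>" by simp
        show "\<exists>\<tau>. T N \<omega> - ereal (tN N) = ereal \<tau> \<and> \<bar>\<tau> - cz (fl.U N \<omega>)\<bar> \<le> \<delta>"
          using t by (intro exI[of _ \<tau>]) simp
      qed
    qed
  qed
  have first: "(\<lambda>N. \<integral>\<omega>. f (T N \<omega> - ereal (tN N)) \<partial>M N) \<longlonglongrightarrow> (\<integral>\<omega>. f (ereal (c \<omega>)) \<partial>P)"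
    if f: "continuous_on UNIV f" "bounded (range f)" for f :: "ereal \<Rightarrow> real"
  proof -
    obtain b where b: "\<And>y. \<bar>f y\<bar> \<le> b" using f(2) by (auto simp: bounded_iff)
    have fm [measurable]: "f \<in> borel_measurable borel" by (rule borel_measurable_continuous_onI[OF f(1)])
    have fe: "continuous_on UNIV (\<lambda>r. f (ereal r))"
      by (rule continuous_on_compose2[OF f(1)]) (auto intro: continuous_on_ereal)
    have "(\<lambda>N. \<integral>\<omega>. f (T N \<omega> - ereal (tN N)) \<partial>M N) \<longlonglongrightarrow> (\<integral>\<omega>. f (ereal (cz (Z \<omega>))) \<partial>P)"
    proof (rule converging_together[where U="\<lambda>N. fl.U N" and g="\<lambda>z. f (ereal (cz z))" and b=b])
      show "isCont (\<lambda>z. f (ereal (cz z))) z" if "z \<noteq> 0" for z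
      proof -
        have "isCont (\<lambda>r. f (ereal r)) (cz z)" using fe by (simp add: continuous_on_eq_continuous_at)
        then show ?thesis by (rule isCont_o2[OF cz_cont[OF that]])
      qed
      fix R e :: real assume R: "R > 1" and e: "e > 0"
      obtain \<delta> where \<delta>: "\<delta> > 0" "\<And>u v. 1 / R \<le> \<bar>u\<bar> \<Longrightarrow> \<bar>u\<bar> \<le> R \<Longrightarrow> \<bar>v - cz u\<bar> \<le> \<delta> \<Longrightarrow> \<bar>f (ereal v) - f (ereal (cz u))\<bar> \<le> e"
        using uniform_on_annulus[OF fe on(1) R e] by blast
      show "\<forall>\<^sub>F N in sequentially. \<exists>E\<in>sets (M N). measure (M N) E \<le> e \<and>
       (\<forall>\<omega>\<in>space (M N) - E. 1 / R \<le> \<bar>fl.U N \<omega>\<bar> \<longrightarrow> \<bar>fl.U N \<omega>\<bar> \<le> R \<longrightarrow> \<bar>f (T N \<omega> - ereal (tN N)) - f (ereal (cz (fl.U N \<omega>)))\<bar> \<le> e)"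
        using close[OF R \<delta>(1) e]
      proof eventually_elim
        case (elim N)
        then obtain E where "E \<in> sets (M N)" "measure (M N) E \<le> e" and
          m: "\<And>\<omega>. \<omega> \<in> space (M N) - E \<Longrightarrow> 1 / R \<le> \<bar>fl.U N \<omega>\<bar> \<Longrightarrow> \<bar>fl.U N \<omega>\<bar> \<le> R \<Longrightarrow>
            \<exists>\<tau>. T N \<omega> - ereal (tN N) = ereal \<tau> \<and> \<bar>\<tau> - cz (fl.U N \<omega>)\<bar> \<le> \<delta>" by blast
        moreover have "\<bar>f (T N \<omega> - ereal (tN N)) - f (ereal (cz (fl.U N \<omega>)))\<bar> \<le> e"
          if "\<omega> \<in> space (M N) - E" "1 / R \<le> \<bar>fl.U N \<omega>\<bar>" "\<bar>fl.U N \<omega>\<bar> \<le> R" for \<omega>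
        proof -
          from m[OF that] obtain \<tau> where "T N \<omega> - ereal (tN N) = ereal \<tau>" "\<bar>\<tau> - cz (fl.U N \<omega>)\<bar> \<le> \<delta>" by blast
          then show ?thesis using \<delta>(2)[OF that(2,3)] by simp
        qed
        ultimately show ?case by blast
      qed
    qed (use Z fl.prob_space_M weak atomless b in auto)
    then show ?thesis by (simp add: cz_def c)
  qed
  have second: "(\<lambda>N. \<integral>\<omega>. f (real N powr (\<mu> / (2 * (lam + \<mu>))) * norm (value_at (XS N \<omega>) (T N \<omega>))) \<partial>M N) \<longlonglongrightarrow> (\<integral>\<omega>. f (rz (Z \<omega>)) \<partial>P)"
    if f: "continuous_on UNIV f" "bounded (range f)" for f :: "real \<Rightarrow> real"
  proof -
    obtain b where b: "\<And>y. \<bar>f y\<bar> \<le> b" using f(2) by (auto simp: bounded_iff)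
    have fm [measurable]: "f \<in> borel_measurable borel" by (rule borel_measurable_continuous_onI[OF f(1)])
    show ?thesis
    proof (rule converging_together[where U="\<lambda>N. fl.U N" and g="\<lambda>z. f (rz z)" and b=b])
      show "isCont (\<lambda>z. f (rz z)) z" if "z \<noteq> 0" for z
      proof -
        have "isCont f (rz z)" using f(1) by (simp add: continuous_on_eq_continuous_at)
        then show ?thesis by (rule isCont_o2[OF rz_cont[OF that]])
      qed
      fix R e :: real assume R: "R > 1" and e: "e > 0"
      obtain \<delta> where \<delta>: "\<delta> > 0" "\<And>u v. 1 / R \<le> \<bar>u\<bar> \<Longrightarrow> \<bar>u\<bar> \<le> R \<Longrightarrow> \<bar>v - rz u\<bar> \<le> \<delta> \<Longrightarrow> \<bar>f v - f (rz u)\<bar> \<le> e"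
        using uniform_on_annulus[OF f(1) on(2) R e] by blast
      show "\<forall>\<^sub>F N in sequentially. \<exists>E\<in>sets (M N). measure (M N) E \<le> e \<and>
       (\<forall>\<omega>\<in>space (M N) - E. 1 / R \<le> \<bar>fl.U N \<omega>\<bar> \<longrightarrow> \<bar>fl.U N \<omega>\<bar> \<le> R \<longrightarrow>
          \<bar>f (real N powr (\<mu> / (2 * (lam + \<mu>))) * norm (value_at (XS N \<omega>) (T N \<omega>))) - f (rz (fl.U N \<omega>))\<bar> \<le> e)"
        using close[OF R \<delta>(1) e]
      proof eventually_elim
        case (elim N)
        then obtain E where "E \<in> sets (M N)" "measure (M N) E \<le> e" and
          m: "\<And>\<omega>. \<omega> \<in> space (M N) - E \<Longrightarrow> 1 / R \<le> \<bar>fl.U N \<omega>\<bar> \<Longrightarrow> \<bar>fl.U N \<omega>\<bar> \<le> R \<Longrightarrow>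
            \<bar>real N powr (\<mu> / (2 * (lam + \<mu>))) * norm (value_at (XS N \<omega>) (T N \<omega>)) - rz (fl.U N \<omega>)\<bar> \<le> \<delta>" by blast
        then show ?case using \<delta>(2) by (intro bexI[of _ E]) blast+
      qed
    qed (use Z fl.prob_space_M weak atomless b in auto)
  qed
  have cm: "(\<lambda>\<omega>. ereal (c \<omega>)) \<in> borel_measurable P"
    using measurable_compose[OF Zm cz_m] by (simp add: cz_def c)
  show ?thesis
    unfolding converges_in_distribution_def
    using first second[unfolded rz_def] cm by (auto simp: rz_def[symmetric])
qed

end
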